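(* For every $q\in\mathbb{N}=\{1,2,\dots\}$, the process $W_{q,\gamma}$ is continuous in $\gamma\in(0,\infty)$ with respect to the topology of weak convergence. Moreover, for all integers $1\le m\le p$ and all nonnegative $c_m,\dots,c_p$ with $\sum_{q=m}^pc_q^2=1$, $$\Big(\sum_{q=m}^pc_qW_{q,\gamma}(t)\Big)_{t\in[0,1]}\longrightarrow_{\mathcal D}(B(t))_{t\in[0,1]}\quad\text{in }C[0,1]\text{ as }\gamma\to\infty,$$ $$\Big(\sum_{q=m}^pc_qW_{q,\gamma}(t)\Big)_{t\in[0,1]}\longrightarrow_{\mathcal D}\Big(t\sum_{q=m}^pc_q\frac{H_q(Z)}{\sqrt{q!}}\Big)_{t\in[0,1]}\quad\text{in }C[0,1]\text{ as }\gamma\to0,$$ where in the limits $B$ is a standard Brownian motion and $Z\sim\mathcal{N}(0,1)$.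
   Context: $C[0,1]$ carries the supremum norm and $\longrightarrow_{\mathcal D}$ is convergence in distribution. $H_q$ is the (probabilists') Hermite polynomial of order $q$. Tempered Hermite processes: for $\gamma>0$, $q\in\mathbb{N}$ and a two-sided standard Brownian motion $B$ on $\mathbb{R}$ (the same for all $q$), $W_{q,\gamma}$ is the continuous version of the process given by the multiple Wiener–Itô integral off the diagonals $$W_{q,\gamma}(t)=K_q^{(\gamma)}\int_{\mathbb{R}^q}'\Big(\int_0^t\prod_{r=1}^qe^{-\gamma(s-x_r)}\mathbf{1}_{\{x_r\le s\}}\,ds\Big)dB(x_1)\cdots dB(x_q),\quad t\in[0,1],\qquad K_q^{(\gamma)}=\sqrt{\frac{2^{q-1}q^2\gamma^{q+2}}{q!\,(e^{-\gamma q}-1+\gamma q)}} .$$ Continuity in $\gamma$ with respect to weak convergence means that $\gamma_k\to\gamma$ in $(0,\infty)$ implies $W_{q,\gamma_k}\longrightarrow_{\mathcal D}W_{q,\gamma}$ in $C[0,1]$. *)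

theory Defs
  imports "HOL-Probability.Probability"
begin

fun hermite :: "nat \<Rightarrow> real \<Rightarrow> real" where
  "hermite 0 x = 1"
| "hermite (Suc 0) x = x"
| "hermite (Suc (Suc n)) x = x * hermite (Suc n) x - real (Suc n) * hermite n x"

text \<open>
  The index set \<open>T\<close> must contain 0. \<open>T = UNIV\<close> gives the two-sided standard Brownian motion (pinned
  at 0, with independent stationary Gaussian increments over the whole line), \<open>T = {0..1}\<close> the usual
  one on the unit interval. The initial condition holds almost surely, path continuity everywhere.
\<close>
definition standard_brownian_motion ::
  "'a measure \<Rightarrow> real set \<Rightarrow> (real \<Rightarrow> 'a \<Rightarrow> real) \<Rightarrow> bool" where
  "standard_brownian_motion M T B \<longleftrightarrow>
     prob_space M \<and>
     (\<forall>t\<in>T. B t \<in> borel_measurable M) \<and>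
     (AE \<omega> in M. B 0 \<omega> = 0) \<and>
     (\<forall>s\<in>T. \<forall>t\<in>T. s < t \<longrightarrow>
        distributed M lborel (\<lambda>\<omega>. B t \<omega> - B s \<omega>) (normal_density 0 (sqrt (t - s)))) \<and>
     (\<forall>n \<tau>. strict_mono_on {..n} \<tau> \<and> \<tau> ` {..n} \<subseteq> T \<longrightarrow>
        prob_space.indep_vars M (\<lambda>_. borel)
          (\<lambda>i \<omega>. B (\<tau> (Suc i)) \<omega> - B (\<tau> i) \<omega>) {..<n::nat}) \<and>
     (\<forall>\<omega>\<in>space M. continuous_on T (\<lambda>t. B t \<omega>))"

text \<open>
  Multiple Wiener-Ito integrals of order \<open>q\<close>. Points of \<open>\<real>\<^sup>q\<close> are functions on \<open>{..<q}\<close>, with Lebesgue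
  measure \<open>Pi\<^sub>M {..<q} (\<lambda>_. lborel)\<close>. An elementary integrand is a step function on the boxes of a grid
  \<open>\<tau> 0 < \<dots> < \<tau> n\<close> which vanishes on all boxes meeting a diagonal: only multi-indices \<open>i\<close> with
  pairwise different entries occur. These are dense in \<open>L\<^sup>2(\<real>\<^sup>q)\<close>, and the integral is the
  \<open>L\<^sup>2\<close>-continuous extension of its value on them.
\<close>
definition off_diagonal :: "nat \<Rightarrow> nat \<Rightarrow> (nat \<Rightarrow> nat) set" where
  "off_diagonal q n = {i \<in> {..<q} \<rightarrow>\<^sub>E {..<n}. inj_on i {..<q}}"

definition elementary_fun ::
  "nat \<Rightarrow> nat \<Rightarrow> (nat \<Rightarrow> real) \<Rightarrow> ((nat \<Rightarrow> nat) \<Rightarrow> real) \<Rightarrow> (nat \<Rightarrow> real) \<Rightarrow> real" where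
  "elementary_fun q n \<tau> a x =
     (\<Sum>i\<in>off_diagonal q n. a i * (\<Prod>r<q. indicator {\<tau> (i r)<..\<tau> (Suc (i r))} (x r)))"

definition elementary_integral ::
  "(real \<Rightarrow> 'a \<Rightarrow> real) \<Rightarrow> nat \<Rightarrow> nat \<Rightarrow> (nat \<Rightarrow> real) \<Rightarrow> ((nat \<Rightarrow> nat) \<Rightarrow> real) \<Rightarrow> 'a \<Rightarrow> real" where
  "elementary_integral B q n \<tau> a \<omega> =
     (\<Sum>i\<in>off_diagonal q n. a i * (\<Prod>r<q. B (\<tau> (Suc (i r))) \<omega> - B (\<tau> (i r)) \<omega>))"

definition has_multiple_wiener_integral ::
  "'a measure \<Rightarrow> (real \<Rightarrow> 'a \<Rightarrow> real) \<Rightarrow> nat \<Rightarrow> ((nat \<Rightarrow> real) \<Rightarrow> real) \<Rightarrow> ('a \<Rightarrow> real) \<Rightarrow> bool" where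
  "has_multiple_wiener_integral M B q f J \<longleftrightarrow>
     f \<in> borel_measurable (Pi\<^sub>M {..<q} (\<lambda>_. lborel)) \<and>
     J \<in> borel_measurable M \<and>
     (\<exists>n \<tau> a. (\<forall>k. strict_mono_on {..n k} (\<tau> k)) \<and>
        (\<lambda>k. \<integral>\<^sup>+x. ennreal ((elementary_fun q (n k) (\<tau> k) (a k) x - f x)\<^sup>2)
                \<partial>Pi\<^sub>M {..<q} (\<lambda>_. lborel)) \<longlonglongrightarrow> 0 \<and>
        (\<lambda>k. \<integral>\<^sup>+\<omega>. ennreal ((elementary_integral B q (n k) (\<tau> k) (a k) \<omega> - J \<omega>)\<^sup>2)
                \<partial>M) \<longlonglongrightarrow> (0::ennreal))"

definition hermite_kernel :: "nat \<Rightarrow> real \<Rightarrow> real \<Rightarrow> (nat \<Rightarrow> real) \<Rightarrow> real" where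
  "hermite_kernel q \<gamma> t x =
     (LBINT s:{0..t}. (\<Prod>r<q. exp (- \<gamma> * (s - x r)) * indicator {..s} (x r)))"

definition hermite_const :: "nat \<Rightarrow> real \<Rightarrow> real" where
  "hermite_const q \<gamma> =
     sqrt (2 ^ (q - 1) * (real q)\<^sup>2 * \<gamma> ^ (q + 2)
           / (fact q * (exp (- \<gamma> * real q) - 1 + \<gamma> * real q)))"

text \<open>The multiple integral is determined only almost surely for each \<open>t\<close>; \<open>W\<close> is a version with
  continuous paths.\<close>
definition tempered_hermite_process ::
  "'a measure \<Rightarrow> (real \<Rightarrow> 'a \<Rightarrow> real) \<Rightarrow> nat \<Rightarrow> real \<Rightarrow> (real \<Rightarrow> 'a \<Rightarrow> real) \<Rightarrow> bool" where
  "tempered_hermite_process M B q \<gamma> W \<longleftrightarrow>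
     (\<forall>t\<in>{0..1}. W t \<in> borel_measurable M \<and>
        (\<exists>J. has_multiple_wiener_integral M B q (hermite_kernel q \<gamma> t) J \<and>
             (AE \<omega> in M. W t \<omega> = hermite_const q \<gamma> * J \<omega>))) \<and>
     (\<forall>\<omega>\<in>space M. continuous_on {0..1} (\<lambda>t. W t \<omega>))"

definition conv_in_distribution ::
  "'s topology \<Rightarrow> 'a measure \<Rightarrow> ('i \<Rightarrow> 'a \<Rightarrow> 's) \<Rightarrow> 'b measure \<Rightarrow> ('b \<Rightarrow> 's) \<Rightarrow> 'i filter \<Rightarrow> bool" where
  "conv_in_distribution S M X N Y F \<longleftrightarrow>
     (\<forall>\<^sub>F i in F. X i \<in> measurable M (sigma (topspace S) {U. openin S U})) \<and>
     Y \<in> measurable N (sigma (topspace S) {U. openin S U}) \<and>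
     (\<forall>\<phi>. continuous_map S euclideanreal \<phi> \<and> bounded (\<phi> ` topspace S) \<longrightarrow>
        ((\<lambda>i. \<integral>\<omega>. \<phi> (X i \<omega>) \<partial>M) \<longlongrightarrow> (\<integral>\<omega>. \<phi> (Y \<omega>) \<partial>N)) F)"

text \<open>The topology of \<open>C[0,1]\<close> with the supremum metric; its points are the continuous functions on
  \<open>{0..1}\<close>, extended by \<open>undefined\<close>, so paths have to be passed through \<open>restrict\<close>.\<close>
definition C01 :: "(real \<Rightarrow> real) topology" where
  "C01 = mtopology_of (cfunspace (top_of_set {0..1}) euclidean_metric)"

definition process_conv_C01 ::
  "'a measure \<Rightarrow> ('i \<Rightarrow> real \<Rightarrow> 'a \<Rightarrow> real) \<Rightarrow> 'b measure \<Rightarrow> (real \<Rightarrow> 'b \<Rightarrow> real) \<Rightarrow> 'i filter \<Rightarrow> bool" where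
  "process_conv_C01 M X N Y F \<longleftrightarrow>
     conv_in_distribution C01 M (\<lambda>i \<omega>. \<lambda>t\<in>{0..1}. X i t \<omega>) N (\<lambda>\<omega>. \<lambda>t\<in>{0..1}. Y t \<omega>) F"

end

theory Submission
  imports Defs "HOL-Real_Asymp.Real_Asymp" "HOL-Analysis.Bounded_Continuous_Function"
begin

text \<open>
  Almost surely \<open>W(t)\<close> is a constant multiple of \<open>\<integral>\<^sub>0\<^sup>t H\<^sub>q(X\<^sub>s) ds\<close>, where \<open>X\<close> is the stationary
  Ornstein--Uhlenbeck process driven by \<open>B\<close>, built pathwise. Continuity in \<open>\<gamma>\<close> is then pathwise, and as
  \<open>\<gamma> \<rightarrow> 0\<close> the process \<open>X\<close> freezes at a standard normal variable. For \<open>\<gamma> \<rightarrow> \<infinity>\<close>, Mehler's formula gives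
  integral equations for \<open>E[U f(S\<^sub>r - S\<^sub>s) H\<^sub>k(X\<^sub>r)]\<close>, where \<open>S\<close> is the combination of the processes and \<open>U\<close>
  depends only on the past of \<open>s\<close>. With \<open>f\<close> a power they bound the fourth moments of the increments,
  which gives tightness; with \<open>f\<close> a cosine they show that in the limit the increments are Gaussian and
  independent of the past. (Below, \<open>G\<close> stands for \<open>\<gamma>\<close> and \<open>w\<close> for the sample point \<open>\<omega>\<close>.)
\<close>

section \<open>Hermite polynomials\<close>

text \<open>The multiple integral is given only through some approximating sequence, so identifying
  \<open>W\<close> is a uniqueness argument: for every elementary integrand f, the mean square
  distance between its integral and a time integral of Hermite polynomials is at most q! times the
  squared distance between f and the kernel. In this comparison only the square of the elementary
  integral is estimated; the other terms are computed exactly. As gamma tends to infinity the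
  obstacle is that the amplitude grows like sqrt(gamma) and that multiplying by H_q couples all
  Hermite orders, so the integral equations do not close. The relaxation of X rescues them: order k
  >= 1 decays at rate k gamma, a time integral of it gains 1/gamma, and two factors sqrt(gamma)
  against one 1/gamma leave a constant. Only order 0 survives, its coefficient in H_k H_q being k!
  for k = q and 0 otherwise. The constant is \<open>effective_variance\<close>; its limit 1/2 is the
  1/2 in the exponent of the normal characteristic function. A weight U from the past passes through
  these equations unchanged, so the independence of limiting increments comes out of the same
  computation.\<close>

definition abs_moments :: "'a measure => ('a => real) => bool" where
 "abs_moments M V \<longleftrightarrow> V \<in> borel_measurable M \<and> (\<forall>p::nat. integrable M (%w. \<bar>V w\<bar> ^ p))"

lemma abs_moments_measurable[measurable_dest]: "abs_moments M V ==> V \<in> borel_measurable M"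
 by (simp add: abs_moments_def)

lemma abs_moments_integrable:
 assumes "abs_moments M V" shows "integrable M V"
proof -
 have "integrable M (%w. \<bar>V w\<bar> ^ 1)" using assms unfolding abs_moments_def by blast
 then have "integrable M (%w. \<bar>V w\<bar>)" by (simp only: power_one_right)
 then show ?thesis using abs_moments_measurable[OF assms] by (rule integrable_abs_cancel)
qed

lemma abs_moments_mono:
 assumes "abs_moments M V" "W \<in> borel_measurable M" "AE w in M. \<bar>W w\<bar> \<le> \<bar>V w\<bar>"
 shows "abs_moments M W"
 unfolding abs_moments_def
proof (intro conjI allI)
 fix p :: nat
 show "integrable M (%w. \<bar>W w\<bar> ^ p)"
 proof (rule Bochner_Integration.integrable_bound)
  show "integrable M (%w. \<bar>V w\<bar> ^ p)" using assms(1) by (simp add: abs_moments_def)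
  show "AE x in M. norm (\<bar>W x\<bar> ^ p) \<le> norm (\<bar>V x\<bar> ^ p)"
   using assms(3) by eventually_elim (simp add: power_mono)
 qed (use assms in measurable)
qed (use assms in auto)

lemma power_add_le_real:
 fixes a b :: real assumes "0 \<le> a" "0 \<le> b"
 shows "(a + b) ^ p \<le> 2 ^ p * (a ^ p + b ^ p)"
proof -
 have "(a + b) ^ p \<le> (2 * max a b) ^ p" using assms by (intro power_mono) auto
 also have "... = 2 ^ p * max a b ^ p" by (simp add: power_mult_distrib)
 also have "... \<le> 2 ^ p * (a ^ p + b ^ p)"
  using assms by (intro mult_left_mono) (auto simp: max_def)
 finally show ?thesis .
qed

context prob_space
begin

lemma abs_moments_const[simp]: "abs_moments M (%_. c)"
 by (simp add: abs_moments_def)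

lemma abs_moments_bounded:
 assumes "V \<in> borel_measurable M" "\<And>w. w \<in> space M ==> \<bar>V w\<bar> \<le> C"
 shows "abs_moments M V"
 by (rule abs_moments_mono[OF abs_moments_const[of C]]) (use assms in fastforce)+

lemma abs_moments_add:
 assumes "abs_moments M V" "abs_moments M W"
 shows "abs_moments M (%w. V w + W w)"
 unfolding abs_moments_def
proof (intro conjI allI)
 fix p :: nat
 show "integrable M (%w. \<bar>V w + W w\<bar> ^ p)"
 proof (rule Bochner_Integration.integrable_bound)
  show "integrable M (%w. 2 ^ p * (\<bar>V w\<bar> ^ p + \<bar>W w\<bar> ^ p))"
   using assms by (simp add: abs_moments_def)
  show "AE x in M. norm (\<bar>V x + W x\<bar> ^ p) \<le> norm (2 ^ p * (\<bar>V x\<bar> ^ p + \<bar>W x\<bar> ^ p))"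
  proof (rule AE_I2)
   fix x
   have "\<bar>V x + W x\<bar> ^ p \<le> (\<bar>V x\<bar> + \<bar>W x\<bar>) ^ p" by (intro power_mono) auto
   also have "... \<le> 2 ^ p * (\<bar>V x\<bar> ^ p + \<bar>W x\<bar> ^ p)" by (rule power_add_le_real) auto
   finally show "norm (\<bar>V x + W x\<bar> ^ p) \<le> norm (2 ^ p * (\<bar>V x\<bar> ^ p + \<bar>W x\<bar> ^ p))" by simp
  qed
 qed (use assms in measurable)
qed (use assms in measurable)

text \<open>The bound |V W|^p <= |V|^(2p) + |W|^(2p) trades a product for higher moments, which is
  why the class asks for all moments at once.\<close>

lemma abs_moments_mult:
 assumes "abs_moments M V" "abs_moments M W"
 shows "abs_moments M (%w. V w * W w)"
 unfolding abs_moments_def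
proof (intro conjI allI)
 fix p :: nat
 show "integrable M (%w. \<bar>V w * W w\<bar> ^ p)"
 proof (rule Bochner_Integration.integrable_bound)
  show "integrable M (%w. \<bar>V w\<bar> ^ (2 * p) + \<bar>W w\<bar> ^ (2 * p))"
   using assms by (simp add: abs_moments_def)
  show "AE x in M. norm (\<bar>V x * W x\<bar> ^ p) \<le> norm (\<bar>V x\<bar> ^ (2 * p) + \<bar>W x\<bar> ^ (2 * p))"
  proof (rule AE_I2)
   fix x
   define a b where "a = \<bar>V x\<bar> ^ p" "b = \<bar>W x\<bar> ^ p"
   have "0 \<le> (a - b)\<^sup>2" "0 \<le> a * b" by (auto simp: a_b_def)
   then have "a * b \<le> a\<^sup>2 + b\<^sup>2" by (simp add: power2_diff)
   moreover have "\<bar>V x * W x\<bar> ^ p = a * b" by (simp add: abs_mult power_mult_distrib a_b_def)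
   moreover have "\<bar>V x\<bar> ^ (2 * p) = a\<^sup>2" "\<bar>W x\<bar> ^ (2 * p) = b\<^sup>2"
    by (simp_all only: a_b_def power_mult[symmetric] mult.commute)
   ultimately show "norm (\<bar>V x * W x\<bar> ^ p) \<le> norm (\<bar>V x\<bar> ^ (2 * p) + \<bar>W x\<bar> ^ (2 * p))"
    using \<open>0 \<le> a * b\<close> by (simp only: real_norm_def)
  qed
 qed (use assms in measurable)
qed (use assms in measurable)

lemma abs_moments_cmult: "abs_moments M V ==> abs_moments M (%w. c * V w)"
 by (rule abs_moments_mult) simp_all

lemma abs_moments_diff: "abs_moments M V ==> abs_moments M W ==> abs_moments M (%w. V w - W w)"
 using abs_moments_add[of V "%w. (-1) * W w"] abs_moments_cmult[of W "-1"] by simp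

lemma abs_moments_sum:
 "(\<And>i. i \<in> I ==> abs_moments M (V i)) ==> abs_moments M (%w. \<Sum>i\<in>I. V i w)"
 by (induction I rule: infinite_finite_induct) (auto intro!: abs_moments_add)

lemma abs_moments_prod:
 "(\<And>i. i \<in> I ==> abs_moments M (V i)) ==> abs_moments M (%w. \<Prod>i\<in>I. V i w)"
 by (induction I rule: infinite_finite_induct) (auto intro!: abs_moments_mult)

lemma abs_moments_power: "abs_moments M V ==> abs_moments M (%w. V w ^ n)"
 by (induction n) (auto intro!: abs_moments_mult)

lemma abs_moments_poly: "abs_moments M V ==> abs_moments M (%w. poly p (V w))"
 unfolding poly_altdef by (intro abs_moments_sum abs_moments_cmult abs_moments_power)

lemma abs_moments_normal:
 assumes D: "distributed M lborel V (normal_density 0 \<sigma>)" and "0 < \<sigma>"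
 shows "abs_moments M V"
 unfolding abs_moments_def
proof (intro conjI allI)
 show V: "V \<in> borel_measurable M" using distributed_measurable[OF D] by simp
 fix p :: nat
 show "integrable M (%w. \<bar>V w\<bar> ^ p)"
  using distributed_integrable[OF D, of "%x. \<bar>x\<bar> ^ p"] integrable_normal_moment_abs[of \<sigma> 0 p] assms(2)
  by simp
qed

end

section \<open>Hermite polynomials: derivative, addition formula, linearisation of products\<close>

fun hermite_poly :: "nat => real poly" where
 "hermite_poly 0 = 1"
| "hermite_poly (Suc 0) = [:0, 1:]"
| "hermite_poly (Suc (Suc n)) = [:0, 1:] * hermite_poly (Suc n) - smult (real (Suc n)) (hermite_poly n)"

lemma poly_hermite_poly[simp]: "poly (hermite_poly n) x = hermite n x"
 by (induction n x rule: hermite.induct) (auto simp: algebra_simps)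

lemma hermite_Suc: "hermite (Suc n) x = x * hermite n x - real n * hermite (n - 1) x"
 by (cases n) auto

lemma hermite_mult_x: "x * hermite n x = hermite (Suc n) x + real n * hermite (n - 1) x"
 by (simp add: hermite_Suc)

lemma continuous_on_hermite[continuous_intros]:
 "continuous_on S f ==> continuous_on S (%x. hermite n (f x))"
 unfolding poly_hermite_poly[symmetric] by (intro continuous_intros)

lemma borel_measurable_hermite[measurable]: "hermite n \<in> borel_measurable borel"
 by (intro borel_measurable_continuous_onI continuous_intros)

lemma tendsto_hermite[tendsto_intros]: "(f \<longlongrightarrow> l) F ==> ((%x. hermite n (f x)) \<longlongrightarrow> hermite n l) F"
 unfolding poly_hermite_poly[symmetric] by (intro tendsto_intros)

lemma (in prob_space) abs_moments_hermite:
 "abs_moments M V ==> abs_moments M (%w. hermite n (V w))"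
 using abs_moments_poly[of V "hermite_poly n"] by simp

lemma pderiv_hermite_poly: "pderiv (hermite_poly (Suc n)) = smult (real (Suc n)) (hermite_poly n)"
proof (induction n rule: induct_nat_012)
 case 0 show ?case by (simp add: pderiv_pCons)
next
 case 1 show ?case by (simp add: pderiv_pCons pderiv_diff pderiv_smult pderiv_mult pderiv_1)
next
 case (ge2 n)
 have "pderiv (hermite_poly (Suc (Suc (Suc n)))) =
   hermite_poly (Suc (Suc n)) + [:0, 1:] * pderiv (hermite_poly (Suc (Suc n)))
   - smult (real (Suc (Suc n))) (pderiv (hermite_poly (Suc n)))"
  by (simp only: hermite_poly.simps(3)[of "Suc n"] pderiv_diff pderiv_mult pderiv_smult)
    (simp add: pderiv_pCons)
 also have "... = hermite_poly (Suc (Suc n)) + smult (real (Suc (Suc n)))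
   ([:0, 1:] * hermite_poly (Suc n) - smult (real (Suc n)) (hermite_poly n))"
  unfolding ge2 by (simp add: smult_diff_right)
 also have "... = smult (real (Suc (Suc (Suc n)))) (hermite_poly (Suc (Suc n)))"
  unfolding hermite_poly.simps(3)[of n, symmetric]
  by (metis (no_types, lifting) add.commute of_nat_Suc smult_1_left smult_add_left)
 finally show ?case .
qed

text \<open>As functions of n both sides obey the same three-term recursion and agree for n = 0 and
  1. Later x is the Ornstein-Uhlenbeck process at an earlier time and y its normalised
  innovation.\<close>

lemma hermite_add:
 fixes x y \<rho> \<sigma> :: real
 assumes "\<rho>\<^sup>2 + \<sigma>\<^sup>2 = 1"
 shows "hermite n (\<rho> * x + \<sigma> * y) =
  (\<Sum>j\<le>n. real (n choose j) * \<rho> ^ j * \<sigma> ^ (n - j) * hermite j x * hermite (n - j) y)"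
proof -
 define T where "T n = (\<Sum>j\<le>n. real (n choose j) * \<rho> ^ j * \<sigma> ^ (n - j) * hermite j x * hermite (n - j) y)" for n
 have rec: "T (Suc n) = (\<rho> * x + \<sigma> * y) * T n - real n * T (n - 1)" for n
 proof -
  let ?h = "%j. hermite j x" and ?g = "%j. hermite j y"
  \<comment> \<open>Multiplying by x or y raises or lowers a Hermite index. The first two sums are
    the raising parts, the last two the lowering parts.\<close>
  have 1: "(\<rho> * x + \<sigma> * y) * T n =
    (\<Sum>j\<le>n. real (n choose j) * \<rho> ^ Suc j * \<sigma> ^ (n - j) * ?h (Suc j) * ?g (n - j)) +
    (\<Sum>j\<le>n. real (n choose j) * \<rho> ^ j * \<sigma> ^ Suc (n - j) * ?h j * ?g (Suc (n - j))) +
    ((\<Sum>j\<le>n. real (n choose j) * \<rho> ^ Suc j * \<sigma> ^ (n - j) * (real j * ?h (j - 1)) * ?g (n - j)) +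
    (\<Sum>j\<le>n. real (n choose j) * \<rho> ^ j * \<sigma> ^ Suc (n - j) * ?h j * (real (n - j) * ?g (n - j - 1))))"
  proof -
   have "(\<rho> * x + \<sigma> * y) * T n = (\<Sum>j\<le>n.
     real (n choose j) * \<rho> ^ Suc j * \<sigma> ^ (n - j) * ?h (Suc j) * ?g (n - j) +
     real (n choose j) * \<rho> ^ j * \<sigma> ^ Suc (n - j) * ?h j * ?g (Suc (n - j)) +
     (real (n choose j) * \<rho> ^ Suc j * \<sigma> ^ (n - j) * (real j * ?h (j - 1)) * ?g (n - j) +
     real (n choose j) * \<rho> ^ j * \<sigma> ^ Suc (n - j) * ?h j * (real (n - j) * ?g (n - j - 1))))"
    unfolding T_def sum_distrib_left
   proof (intro sum.cong refl)
    fix j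
    have "(\<rho> * x + \<sigma> * y) * (real (n choose j) * \<rho> ^ j * \<sigma> ^ (n - j) * ?h j * ?g (n - j)) =
     real (n choose j) * \<rho> ^ Suc j * \<sigma> ^ (n - j) * (x * ?h j) * ?g (n - j)
     + real (n choose j) * \<rho> ^ j * \<sigma> ^ Suc (n - j) * ?h j * (y * ?g (n - j))"
     by (simp add: algebra_simps)
    then show "(\<rho> * x + \<sigma> * y) * (real (n choose j) * \<rho> ^ j * \<sigma> ^ (n - j) * ?h j * ?g (n - j)) =
     real (n choose j) * \<rho> ^ Suc j * \<sigma> ^ (n - j) * ?h (Suc j) * ?g (n - j) +
     real (n choose j) * \<rho> ^ j * \<sigma> ^ Suc (n - j) * ?h j * ?g (Suc (n - j)) +
     (real (n choose j) * \<rho> ^ Suc j * \<sigma> ^ (n - j) * (real j * ?h (j - 1)) * ?g (n - j) +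
     real (n choose j) * \<rho> ^ j * \<sigma> ^ Suc (n - j) * ?h j * (real (n - j) * ?g (n - j - 1)))"
     unfolding hermite_mult_x by (simp only: distrib_left distrib_right add_ac)
   qed
   then show ?thesis by (simp only: sum.distrib)
  qed
  \<comment> \<open>Pascal's rule reassembles the raising parts.\<close>
  have 2: "T (Suc n) =
    (\<Sum>j\<le>n. real (n choose j) * \<rho> ^ Suc j * \<sigma> ^ (n - j) * ?h (Suc j) * ?g (n - j)) +
    (\<Sum>j\<le>n. real (n choose j) * \<rho> ^ j * \<sigma> ^ Suc (n - j) * ?h j * ?g (Suc (n - j)))"
  proof -
   have a: "(\<Sum>j\<le>n. real (n choose j) * \<rho> ^ j * \<sigma> ^ Suc (n - j) * ?h j * ?g (Suc (n - j))) =
     (\<Sum>j\<le>Suc n. real (n choose j) * \<rho> ^ j * \<sigma> ^ (Suc n - j) * ?h j * ?g (Suc n - j))"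
    by (auto intro!: sum.cong simp: Suc_diff_le binomial_eq_0)
   have "T (Suc n) = \<sigma> ^ Suc n * ?h 0 * ?g (Suc n) +
     (\<Sum>j\<le>n. real (Suc n choose Suc j) * \<rho> ^ Suc j * \<sigma> ^ (n - j) * ?h (Suc j) * ?g (n - j))"
    unfolding T_def by (subst sum.atMost_Suc_shift) simp
   also have "(\<Sum>j\<le>n. real (Suc n choose Suc j) * \<rho> ^ Suc j * \<sigma> ^ (n - j) * ?h (Suc j) * ?g (n - j)) =
     (\<Sum>j\<le>n. real (n choose j) * \<rho> ^ Suc j * \<sigma> ^ (n - j) * ?h (Suc j) * ?g (n - j)) +
     (\<Sum>j\<le>n. real (n choose Suc j) * \<rho> ^ Suc j * \<sigma> ^ (n - j) * ?h (Suc j) * ?g (n - j))"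
    by (simp add: distrib_right sum.distrib del: hermite.simps)
   finally show ?thesis unfolding a by (subst sum.atMost_Suc_shift) (simp del: hermite.simps)
  qed
  \<comment> \<open>The lowering parts give \<open>\<rho>\<^sup>2\<close> and
    \<open>\<sigma>\<^sup>2\<close> times the same term; this is where their sum being 1 enters. For
    n = 0 the truncated index \<open>n - 1\<close> is harmless because the factor n
    vanishes.\<close>
  have 3: "((\<Sum>j\<le>n. real (n choose j) * \<rho> ^ Suc j * \<sigma> ^ (n - j) * (real j * ?h (j - 1)) * ?g (n - j)) +
    (\<Sum>j\<le>n. real (n choose j) * \<rho> ^ j * \<sigma> ^ Suc (n - j) * ?h j * (real (n - j) * ?g (n - j - 1))))
    = real n * T (n - 1)"
  proof (cases n)
   case 0 then show ?thesis by simp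
  next
   case (Suc m)
   have b1: "real (Suc m choose Suc j) * real (Suc j) = real (Suc m) * real (m choose j)" for j
    by (metis Suc_times_binomial_eq of_nat_mult)
   have b2: "real (Suc m choose j) * real (Suc m - j) = real (Suc m) * real (m choose j)" if "j \<le> m" for j
    using that by (metis binomial_absorb_comp of_nat_mult mult.commute diff_Suc_1)
   have s1: "(\<Sum>j\<le>n. real (n choose j) * \<rho> ^ Suc j * \<sigma> ^ (n - j) * (real j * ?h (j - 1)) * ?g (n - j))
     = \<rho>\<^sup>2 * (real n * T m)"
   proof -
    have "(\<Sum>j\<le>n. real (n choose j) * \<rho> ^ Suc j * \<sigma> ^ (n - j) * (real j * ?h (j - 1)) * ?g (n - j))
     = (\<Sum>j\<le>m. (real (Suc m choose Suc j) * real (Suc j)) * \<rho> ^ Suc (Suc j) * \<sigma> ^ (m - j) * ?h j * ?g (m - j))"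
     unfolding Suc by (subst sum.atMost_Suc_shift) (simp add: mult_ac del: binomial_Suc_Suc hermite.simps of_nat_Suc)
    also have "... = \<rho>\<^sup>2 * (real n * T m)"
     unfolding b1 T_def sum_distrib_left Suc by (intro sum.cong) (auto simp: power2_eq_square algebra_simps)
    finally show ?thesis .
   qed
   have s2: "(\<Sum>j\<le>n. real (n choose j) * \<rho> ^ j * \<sigma> ^ Suc (n - j) * ?h j * (real (n - j) * ?g (n - j - 1)))
     = \<sigma>\<^sup>2 * (real n * T m)"
   proof -
    have "(\<Sum>j\<le>n. real (n choose j) * \<rho> ^ j * \<sigma> ^ Suc (n - j) * ?h j * (real (n - j) * ?g (n - j - 1)))
     = (\<Sum>j\<le>m. (real (Suc m choose j) * real (Suc m - j)) * \<rho> ^ j * \<sigma> ^ Suc (Suc m - j) * ?h j * ?g (Suc m - j - 1))"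
     unfolding Suc by (simp add: mult_ac del: hermite.simps of_nat_Suc of_nat_diff)
    also have "... = (\<Sum>j\<le>m. real (Suc m) * real (m choose j) * \<rho> ^ j * \<sigma> ^ Suc (Suc m - j) * ?h j * ?g (Suc m - j - 1))"
     by (intro sum.cong refl) (simp only: b2 atMost_iff)
    also have "... = \<sigma>\<^sup>2 * (real n * T m)"
     unfolding T_def sum_distrib_left Suc by (intro sum.cong) (auto simp: power2_eq_square Suc_diff_le)
    finally show ?thesis .
   qed
   show ?thesis unfolding s1 s2 using assms Suc by (simp flip: distrib_right)
  qed
  show ?thesis using 1 2 3 by linarith
 qed
 have "hermite n (\<rho> * x + \<sigma> * y) = T n" for n
 proof (induction n rule: induct_nat_012)
  case 0 show ?case by (simp add: T_def)
 next
  case 1 show ?case by (simp add: T_def)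
 next
  case (ge2 n)
  then show ?case by (simp add: rec[of "Suc n"])
 qed
 then show ?thesis by (simp add: T_def)
qed

text \<open>The span of the Hermite polynomials is stable under multiplication by x, so the
  recursion in k carries the expansion to the next order. Only existence is claimed; the coefficient
  of H_0, the one whose value matters, is read off later from orthogonality.\<close>

lemma hermite_product_expansion:
 "\<exists>a N. \<forall>x. hermite k x * hermite q x = (\<Sum>l\<le>N. a l * hermite l x)"
proof (induction k rule: induct_nat_012)
 have mx: "\<exists>b N. \<forall>x. x * (\<Sum>l\<le>N'. a l * hermite l x) = (\<Sum>l\<le>N. b l * hermite l x)" for a :: "nat => real" and N'
 proof (intro exI allI)
  fix x
  have "x * (\<Sum>l\<le>N'. a l * hermite l x) = (\<Sum>l\<le>N'. a l * hermite (Suc l) x) + (\<Sum>l\<le>N'. a l * real l * hermite (l - 1) x)"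
   unfolding sum_distrib_left sum.distrib[symmetric]
   by (intro sum.cong refl) (simp add: hermite_Suc algebra_simps)
  also have "(\<Sum>l\<le>N'. a l * hermite (Suc l) x) = (\<Sum>l\<le>Suc N'. (if l = 0 then 0 else a (l - 1)) * hermite l x)"
   by (subst sum.atMost_Suc_shift) simp
  also have "(\<Sum>l\<le>N'. a l * real l * hermite (l - 1) x) = (\<Sum>l\<le>Suc N'. (if l < N' then a (Suc l) * real (Suc l) else 0) * hermite l x)"
  proof (cases N')
   case (Suc m)
   show ?thesis unfolding Suc by (subst sum.atMost_Suc_shift) (auto intro!: sum.cong simp: less_Suc_eq_le)
  qed simp
  finally show "x * (\<Sum>l\<le>N'. a l * hermite l x) = (\<Sum>l\<le>Suc N'. ((if l = 0 then 0 else a (l - 1)) + (if l < N' then a (Suc l) * real (Suc l) else 0)) * hermite l x)"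
   by (simp add: distrib_right sum.distrib del: sum.atMost_Suc)
 qed
 have single: "hermite q x = (\<Sum>l\<le>q. (if l = q then 1 else 0) * hermite l x)" for x
  by (subst sum.mono_neutral_right[of _ "{q}"]) auto
 {
  case 0 show ?case
   using single by auto
 next
  case 1
  show ?case using mx[of "%l. if l = q then 1 else 0" q] single by simp
 next
  case (ge2 n)
  obtain a N where a: "\<And>x. hermite n x * hermite q x = (\<Sum>l\<le>N. a l * hermite l x)" using ge2 by blast
  obtain a' N' where a': "\<And>x. hermite (Suc n) x * hermite q x = (\<Sum>l\<le>N'. a' l * hermite l x)" using ge2 by blast
  obtain b K where b: "\<And>x. x * (\<Sum>l\<le>N'. a' l * hermite l x) = (\<Sum>l\<le>K. b l * hermite l x)" using mx by blast
  \<comment> \<open>Zero coefficients bring the two expansions to a common length.\<close>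
  have pad: "(\<Sum>l\<le>n. a l * hermite l x) = (\<Sum>l\<le>max n m. (if l \<le> n then a l else 0) * hermite l x)" for a :: "nat => real" and n m x
   by (rule sum.mono_neutral_cong_left) auto
  show ?case
  proof (intro exI allI)
   fix x
   have "hermite (Suc (Suc n)) x * hermite q x = x * (hermite (Suc n) x * hermite q x) - real (Suc n) * (hermite n x * hermite q x)"
    by (simp add: algebra_simps)
   also have "... = (\<Sum>l\<le>K. b l * hermite l x) - real (Suc n) * (\<Sum>l\<le>N. a l * hermite l x)" by (simp only: a a' b)
   also have "... = (\<Sum>l\<le>max K N. ((if l \<le> K then b l else 0) - real (Suc n) * (if l \<le> N then a l else 0)) * hermite l x)"
    unfolding pad[of b x K N] pad[of a x N K] max.commute[of N K]
    by (simp add: left_diff_distrib sum_subtractf sum_distrib_left mult.assoc)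
   finally show "hermite (Suc (Suc n)) x * hermite q x = (\<Sum>l\<le>max K N. ((if l \<le> K then b l else 0) - real (Suc n) * (if l \<le> N then a l else 0)) * hermite l x)" .
  qed
 }
qed

section \<open>Gaussian integration by parts and orthogonality\<close>

lemma integrable_std_normal_poly: "integrable lborel (%x. std_normal_density x * poly p x)"
proof -
 have "integrable lborel (%x. \<Sum>i\<le>degree p. coeff p i * (std_normal_density x * x ^ i))"
  by (intro Bochner_Integration.integrable_sum integrable_mult_right integrable_std_normal_moment)
 then show ?thesis by (simp add: poly_altdef sum_distrib_left mult_ac)
qed

text \<open>Stein's identity, verified on monomials by the closed formulas for normal moments and
  extended by linearity.\<close>

lemma std_normal_integral_by_parts:
 "(\<integral>x. std_normal_density x * (x * poly p x) \<partial>lborel) = (\<integral>x. std_normal_density x * poly (pderiv p) x \<partial>lborel)"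
proof -
 \<comment> \<open>For even n both moments are of odd order and vanish; at n = 0 the truncated index
   is covered by the factor 0. For odd n the two factorial formulas differ exactly by the factor
   n.\<close>
 have mono: "(\<integral>x. std_normal_density x * x ^ Suc n \<partial>lborel) = real n * (\<integral>x. std_normal_density x * x ^ (n - 1) \<partial>lborel)" for n
 proof (cases "even n")
  case True
  then obtain k where k: "n = 2 * k" by blast
  show ?thesis
  proof (cases k)
   case 0 then show ?thesis using integral_std_normal_moment_odd[of 0] k by simp
  next
   case (Suc m)
   then show ?thesis using integral_std_normal_moment_odd[of k] integral_std_normal_moment_odd[of m] k by simp
  qed
 next
  case False
  then obtain k where k: "n = 2 * k + 1" using oddE by blast
  have "fact (2 * Suc k) / (2 ^ Suc k * fact (Suc k)) = real n * (fact (2 * k) / (2 ^ k * fact k))"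
  proof -
   have "fact (2 * Suc k) = (2 * real k + 2) * (2 * real k + 1) * fact (2 * k)" by (simp add: algebra_simps)
   then show ?thesis unfolding k by (simp add: divide_simps)
  qed
  then show ?thesis using integral_std_normal_moment_even[of "Suc k"] integral_std_normal_moment_even[of k] k by simp
 qed
 have "(\<integral>x. std_normal_density x * (x * poly p x) \<partial>lborel)
   = (\<integral>x. (\<Sum>i\<le>degree p. coeff p i * (std_normal_density x * x ^ Suc i)) \<partial>lborel)"
  by (simp add: poly_altdef sum_distrib_left mult_ac)
 also have "... = (\<Sum>i\<le>degree p. coeff p i * (\<integral>x. std_normal_density x * x ^ Suc i \<partial>lborel))"
  by (subst Bochner_Integration.integral_sum)
    (auto intro!: integrable_std_normal_moment integrable_mult_right simp del: power_Suc)
 also have "... = (\<Sum>i\<le>degree p. coeff p i * (real i * (\<integral>x. std_normal_density x * x ^ (i - 1) \<partial>lborel)))"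
  unfolding mono ..
 also have "... = (\<integral>x. (\<Sum>i\<le>degree p. (coeff p i * real i) * (std_normal_density x * x ^ (i - 1))) \<partial>lborel)"
  by (subst Bochner_Integration.integral_sum)
    (auto intro!: integrable_std_normal_moment simp: mult.assoc)
 also have "... = (\<integral>x. std_normal_density x * poly (pderiv p) x \<partial>lborel)"
 proof (rule Bochner_Integration.integral_cong[OF refl])
  fix x :: real
  have "poly (pderiv p) x = (\<Sum>i\<le>degree p. coeff p i * real i * x ^ (i - 1))"
  proof -
   have "DERIV (%x. poly p x) x :> poly (pderiv p) x" by (rule poly_DERIV)
   moreover have "DERIV (%x. poly p x) x :> (\<Sum>i\<le>degree p. coeff p i * (real i * x ^ (i - 1)))"
    unfolding poly_altdef by (auto intro!: derivative_eq_intros sum.cong)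
   ultimately show ?thesis by (metis (no_types, lifting) DERIV_unique mult.assoc sum.cong)
  qed
  then show "(\<Sum>i\<le>degree p. (coeff p i * real i) * (std_normal_density x * x ^ (i - 1))) = std_normal_density x * poly (pderiv p) x"
   by (simp add: sum_distrib_left mult_ac)
 qed
 finally show ?thesis .
qed

text \<open>H_(n+1) = x H_n - H_n' is the creation operator applied to H_n, the adjoint of
  differentiation under the normal density. Iterating it gives orthogonality.\<close>

lemma std_normal_hermite_times_poly:
 "(\<integral>x. std_normal_density x * (hermite (Suc n) x * poly p x) \<partial>lborel) =
  (\<integral>x. std_normal_density x * (hermite n x * poly (pderiv p) x) \<partial>lborel)"
proof -
 have d: "poly (pderiv (hermite_poly n)) x = real n * hermite (n - 1) x" for x
  by (cases n) (auto simp: pderiv_hermite_poly)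
 have i1: "integrable lborel (%x. std_normal_density x * (x * poly (hermite_poly n * p) x))"
  using integrable_std_normal_poly[of "[:0,1:] * (hermite_poly n * p)"] by simp
 have i2: "integrable lborel (%x. std_normal_density x * poly (smult (real n) (hermite_poly (n - 1)) * p) x)"
  by (rule integrable_std_normal_poly)
 have i3: "integrable lborel (%x. std_normal_density x * poly (hermite_poly n * pderiv p) x)"
  by (rule integrable_std_normal_poly)
 have "(\<integral>x. std_normal_density x * (hermite (Suc n) x * poly p x) \<partial>lborel)
  = (\<integral>x. std_normal_density x * (x * poly (hermite_poly n * p) x)
     - std_normal_density x * poly (smult (real n) (hermite_poly (n - 1)) * p) x \<partial>lborel)"
  by (intro Bochner_Integration.integral_cong refl) (simp add: hermite_Suc algebra_simps)
 also have "... = (\<integral>x. std_normal_density x * poly (pderiv (hermite_poly n * p)) x \<partial>lborel)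
     - (\<integral>x. std_normal_density x * poly (smult (real n) (hermite_poly (n - 1)) * p) x \<partial>lborel)"
  using i1 i2 by (simp only: Bochner_Integration.integral_diff std_normal_integral_by_parts)
 also have "(\<integral>x. std_normal_density x * poly (pderiv (hermite_poly n * p)) x \<partial>lborel) =
   (\<integral>x. std_normal_density x * poly (hermite_poly n * pderiv p) x
   + std_normal_density x * poly (smult (real n) (hermite_poly (n - 1)) * p) x \<partial>lborel)"
  by (intro Bochner_Integration.integral_cong refl) (simp add: pderiv_mult d algebra_simps)
 finally show ?thesis using i2 i3 by simp
qed

lemma std_normal_hermite_orthogonal:
 "(\<integral>x. std_normal_density x * (hermite n x * hermite m x) \<partial>lborel) = (if n = m then fact n else 0)"
proof (induction n arbitrary: m)
 case 0
 show ?case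
 proof (cases m)
  case (Suc k)
  then show ?thesis using std_normal_hermite_times_poly[of k 1] by simp
 qed simp
next
 case (Suc n)
 show ?case
 proof (cases m)
  case 0
  then show ?thesis using std_normal_hermite_times_poly[of n 1] by simp
 next
  case (Suc k)
  have "(\<integral>x. std_normal_density x * (hermite (Suc n) x * hermite m x) \<partial>lborel)
   = (\<integral>x. real (Suc k) * (std_normal_density x * (hermite n x * hermite k x)) \<partial>lborel)"
   using std_normal_hermite_times_poly[of n "hermite_poly m"] Suc
   by (simp add: pderiv_hermite_poly mult_ac)
  also have "... = real (Suc k) * (if n = k then fact n else 0)" by (simp add: Suc.IH del: of_nat_Suc)
  finally show ?thesis using Suc by simp
 qed
qed

section \<open>Two-sided Brownian motion\<close>

lemma (in pair_sigma_finite) AE_integrable_fst_snd: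
 fixes f :: "_ => _::{banach, second_countable_topology}"
 assumes "integrable (M1 \<Otimes>\<^sub>M M2) f"
 shows "AE y in M2. integrable M1 (%x. f (x, y))"
proof -
 interpret Q: pair_sigma_finite M2 M1 ..
 have "integrable (M2 \<Otimes>\<^sub>M M1) (%(x, y). f (y, x))"
  by (rule integrable_product_swap) fact
 from Q.AE_integrable_fst'[OF this] show ?thesis by simp
qed

text \<open>Rounding the time down to a multiple of 1/(n+1) leaves countably many time values, hence
  a jointly measurable process; continuity of the paths makes these approximations converge.\<close>

lemma measurable_continuous_process:
 fixes Y :: "real => 'a => real"
 assumes meas: "\<And>u. Y u \<in> borel_measurable N"
  and cont: "\<And>w. w \<in> space N ==> continuous_on UNIV (%u. Y u w)"
 shows "(%(u, w). Y u w) \<in> borel_measurable (borel \<Otimes>\<^sub>M N)"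
proof (rule borel_measurable_LIMSEQ_metric)
 define f where "f n p = Y (of_int \<lfloor>fst p * real (Suc n)\<rfloor> / real (Suc n)) (snd p)" for n and p :: "real \<times> 'a"
 fix n
 have "(%p. Y (of_int i / real (Suc n)) (snd p)) \<in> borel_measurable (borel \<Otimes>\<^sub>M N)" for i :: int
  using meas by measurable
 moreover have "(%p. \<lfloor>fst p * real (Suc n)\<rfloor>) \<in> measurable (borel \<Otimes>\<^sub>M N) (count_space UNIV)"
  by measurable
 ultimately show "f n \<in> borel_measurable (borel \<Otimes>\<^sub>M N)"
  unfolding f_def
  by (rule measurable_compose_countable'[where f="%i p. Y (of_int i / real (Suc n)) (snd p)"]) auto
next
 fix p :: "real \<times> 'a" assume p: "p \<in> space (borel \<Otimes>\<^sub>M N)"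
 obtain u w where uw: "p = (u, w)" "w \<in> space N" using p by (auto simp: space_pair_measure)
 have lim: "(%n. of_int \<lfloor>u * real (Suc n)\<rfloor> / real (Suc n)) \<longlonglongrightarrow> u"
 proof (rule tendsto_sandwich)
  show "\<forall>\<^sub>F n in sequentially. u - 1 / real (Suc n) \<le> of_int \<lfloor>u * real (Suc n)\<rfloor> / real (Suc n)"
  proof (rule always_eventually, rule allI)
   fix n
   have "u * real (Suc n) - 1 \<le> of_int \<lfloor>u * real (Suc n)\<rfloor>" by linarith
   then have "(u * real (Suc n) - 1) / real (Suc n) \<le> of_int \<lfloor>u * real (Suc n)\<rfloor> / real (Suc n)"
    by (intro divide_right_mono) auto
   then show "u - 1 / real (Suc n) \<le> of_int \<lfloor>u * real (Suc n)\<rfloor> / real (Suc n)"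
    by (simp add: diff_divide_distrib del: of_nat_Suc)
  qed
  show "\<forall>\<^sub>F n in sequentially. of_int \<lfloor>u * real (Suc n)\<rfloor> / real (Suc n) \<le> u"
   by (simp add: divide_le_eq)
  show "(%n. u - 1 / real (Suc n)) \<longlonglongrightarrow> u"
   using tendsto_diff[OF tendsto_const[of u] LIMSEQ_inverse_real_of_nat] by (simp add: inverse_eq_divide)
 qed auto
 have "isCont (%u. Y u w) u"
  using cont[OF uw(2)] by (simp add: continuous_on_eq_continuous_at)
 from isCont_tendsto_compose[OF this lim]
 show "(%n. Y (of_int \<lfloor>fst p * real (Suc n)\<rfloor> / real (Suc n)) (snd p)) \<longlonglongrightarrow> (case p of (u, w) => Y u w)"
  by (simp add: uw)
qed

text \<open>Generated by increments from the base time u, since increments are what the axioms of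
  Brownian motion make independent; the values are tied to them only through B 0 = 0 almost
  surely.\<close>

definition incr_sigma :: "'a measure => (real => 'a => real) => real => real set => 'a measure" where
 "incr_sigma M B u T =
   vimage_algebra (space M) (%w. \<lambda>v\<in>T. B v w - B u w) (Pi\<^sub>M T (%_. borel))"

lemma space_incr_sigma[simp]: "space (incr_sigma M B u T) = space M"
 by (simp add: incr_sigma_def)

lemma measurable_incr_sigma:
 assumes "v \<in> T"
 shows "(%w. B v w - B u w) \<in> borel_measurable (incr_sigma M B u T)"
proof -
 have "(%w. \<lambda>v\<in>T. B v w - B u w) \<in> measurable (incr_sigma M B u T) (Pi\<^sub>M T (%_. borel))"
  unfolding incr_sigma_def by (rule measurable_vimage_algebra1) (auto simp: space_PiM)
 from measurable_component_singleton[OF assms, THEN measurable_compose[OF this]]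
 show ?thesis using assms by simp
qed

lemma subalgebra_incr_sigma:
 assumes sp: "space N = space M" and "\<And>v. v \<in> T ==> (%w. B v w - B u w) \<in> borel_measurable N"
 shows "subalgebra N (incr_sigma M B u T)"
proof -
 have "(%w. \<lambda>v\<in>T. B v w - B u w) \<in> measurable N (Pi\<^sub>M T (%_. borel))"
  using assms(2) by (rule measurable_restrict)
 from sets_image_in_sets[OF sp this] show ?thesis
  by (simp add: subalgebra_def incr_sigma_def sp)
qed

text \<open>Exhibits a generator made of cylinders over finitely many times, stable under
  intersection, so that independence can be checked on finitely many increments.\<close>

lemma sets_incr_sigma:
 "sets (incr_sigma M B u T) = sigma_sets (space M)
   {(%w. \<lambda>v\<in>T. B v w - B u w) -` A \<inter> space M | A. A \<in> prod_algebra T (%_. borel)}"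
proof -
 have "sets (incr_sigma M B u T) = sets (vimage_algebra (space M) (%w. \<lambda>v\<in>T. B v w - B u w)
   (sigma (\<Pi>\<^sub>E i\<in>T. UNIV) (prod_algebra T (%_. borel))))"
  unfolding incr_sigma_def
  by (rule sets_vimage_algebra_cong)
    (subst sets_measure_of, use prod_algebra_sets_into_space[of T "%_. borel :: real measure"] in \<open>auto simp: sets_PiM\<close>)
 also have "... = sets (sigma (space M) {(%w. \<lambda>v\<in>T. B v w - B u w) -` A \<inter> space M | A. A \<in> prod_algebra T (%_. borel)})"
  by (subst vimage_algebra_sigma)
    (use prod_algebra_sets_into_space[of T "%_. borel :: real measure"] in auto)
 also have "... = sigma_sets (space M)
   {(%w. \<lambda>v\<in>T. B v w - B u w) -` A \<inter> space M | A. A \<in> prod_algebra T (%_. borel)}"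
  by (rule sets_measure_of) auto
 finally show ?thesis .
qed

lemma Int_stable_incr_sigma:
 "Int_stable {(%w. \<lambda>v\<in>T. B v w - B u w) -` A \<inter> space M | A. A \<in> prod_algebra T (%_. borel :: real measure)}"
 (is "Int_stable {?f -` A \<inter> _ | A. _}")
proof (rule Int_stableI)
 fix a b assume "a \<in> {?f -` A \<inter> space M | A. A \<in> prod_algebra T (%_. borel)}"
  "b \<in> {?f -` A \<inter> space M | A. A \<in> prod_algebra T (%_. borel)}"
 then obtain A A' where A: "A \<in> prod_algebra T (%_. borel)" "A' \<in> prod_algebra T (%_. borel)"
  and ab: "a = ?f -` A \<inter> space M" "b = ?f -` A' \<inter> space M" by blast
 have "A \<inter> A' \<in> prod_algebra T (%_. borel)"
  by (rule Int_stableD[OF Int_stable_prod_algebra A])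
 moreover have "a \<inter> b = ?f -` (A \<inter> A') \<inter> space M" unfolding ab by blast
 ultimately show "a \<inter> b \<in> {?f -` A \<inter> space M | A. A \<in> prod_algebra T (%_. borel)}" by blast
qed

text \<open>The total mass of the exponential density, reflected at u by an affine change of
  variables.\<close>

lemma has_bochner_integral_exp_atMost:
 fixes c u :: real
 assumes "0 < c"
 shows "has_bochner_integral lborel (%x. indicator {..u} x * exp (- c * (u - x))) (1 / c)"
proof -
 have "has_bochner_integral lborel (%x. exponential_density c x) 1"
 proof (rule has_bochner_integral_nn_integral)
  show "(\<integral>\<^sup>+ x. ennreal (exponential_density c x) \<partial>lborel) = ennreal 1"
   using prob_space.emeasure_space_1[OF prob_space_exponential_density[OF assms]]
   by (simp add: emeasure_density)
 qed (auto simp: exponential_density_def assms less_imp_le)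
 then have "has_bochner_integral lborel (%x. exponential_density c (u + (-1) * x)) (1 /\<^sub>R \<bar>-1\<bar>)"
  by (subst lborel_has_bochner_integral_real_affine_iff[symmetric]) auto
 then have "has_bochner_integral lborel (%x. (1 / c) * exponential_density c (u - x)) ((1 / c) * 1)"
  by (intro has_bochner_integral_mult_right) auto
 moreover have "(1 / c) * exponential_density c (u - x) = indicator {..u} x * exp (- c * (u - x))" for x
  using assms by (auto simp: exponential_density_def indicator_def algebra_simps)
 ultimately show ?thesis by simp
qed

locale brownian_motion =
 fixes M :: "'a measure" and B :: "real => 'a => real"
 assumes brownian: "standard_brownian_motion M UNIV B"

sublocale brownian_motion \<subseteq> prob_space M
 using brownian by (simp add: standard_brownian_motion_def)

context brownian_motion
begin

lemma B_measurable[measurable]: "B t \<in> borel_measurable M"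
 using brownian by (simp add: standard_brownian_motion_def)

lemma B_continuous: "w \<in> space M ==> continuous_on A (%t. B t w)"
 using brownian continuous_on_subset unfolding standard_brownian_motion_def by blast

lemma B_increment: "s < t ==> distributed M lborel (%w. B t w - B s w) (normal_density 0 (sqrt (t - s)))"
 using brownian by (simp add: standard_brownian_motion_def)

lemma B_indep: "strict_mono_on {..n::nat} \<tau> ==>
  indep_vars (%_. borel) (%i w. B (\<tau> (Suc i)) w - B (\<tau> i) w) {..<n}"
 using brownian by (simp add: standard_brownian_motion_def)

lemma abs_moments_increment: "abs_moments M (%w. B t w - B s w)"
proof -
 consider "s < t" | "s = t" | "t < s" by linarith
 then show ?thesis
 proof cases
  case 1 from abs_moments_normal[OF B_increment[OF this]] 1 show ?thesis by simp
 next
  case 3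
  from abs_moments_normal[OF B_increment[OF this]] 3 have "abs_moments M (%w. B s w - B t w)" by simp
  then show ?thesis by (rule abs_moments_mono) auto
 qed simp
qed

lemma expectation_increment: "expectation (%w. B t w - B s w) = 0"
proof -
 have *: "expectation (%w. B t w - B s w) = 0" if "s < t" for s t
  using normal_distributed_expectation[OF _ B_increment[OF that]] that by simp
 consider "s < t" | "s = t" | "t < s" by linarith
 then show ?thesis
 proof cases
  case 3
  have "expectation (%w. B t w - B s w) = expectation (%w. - (B s w - B t w))" by simp
  also have "... = 0" using *[OF 3] by (subst Bochner_Integration.integral_minus) simp
  finally show ?thesis .
 qed (simp_all add: *)
qed

lemma expectation_increment_sq: "expectation (%w. (B t w - B s w)\<^sup>2) = \<bar>t - s\<bar>"
proof -
 have *: "expectation (%w. (B t w - B s w)\<^sup>2) = t - s" if "s < t" for s t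
  using normal_distributed_variance[OF _ B_increment[OF that]] that expectation_increment[of t s] by simp
 consider "s < t" | "s = t" | "t < s" by linarith
 then show ?thesis
 proof cases
  case 3
  have "(%w. (B t w - B s w)\<^sup>2) = (%w. (B s w - B t w)\<^sup>2)" by (auto simp: power2_commute)
  then show ?thesis using *[OF 3] 3 by simp
 qed (simp_all add: *)
qed

abbreviation "past u \<equiv> incr_sigma M B u {..u}"
abbreviation "future u \<equiv> incr_sigma M B u {u..}"

lemma subalgebra_past: "subalgebra M (past u)" and subalgebra_future: "subalgebra M (future u)"
 by (auto intro!: subalgebra_incr_sigma)

lemmas measurable_past_M = measurable_from_subalg[OF subalgebra_past]
lemmas measurable_future_M = measurable_from_subalg[OF subalgebra_future]

lemma measurable_past_increment:
 assumes "v \<le> u" "x \<le> u"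
 shows "(%w. B v w - B x w) \<in> borel_measurable (past u)"
proof -
 have "(%w. (B v w - B u w) - (B x w - B u w)) \<in> borel_measurable (past u)"
  using assms by (intro borel_measurable_diff measurable_incr_sigma) auto
 then show ?thesis by simp
qed

lemma measurable_future_increment:
 assumes "u \<le> v" "u \<le> x"
 shows "(%w. B v w - B x w) \<in> borel_measurable (future u)"
proof -
 have "(%w. (B v w - B u w) - (B x w - B u w)) \<in> borel_measurable (future u)"
  using assms by (intro borel_measurable_diff measurable_incr_sigma) auto
 then show ?thesis by simp
qed

lemma measurable_past_mono:
 assumes "u \<le> r" "f \<in> measurable (past u) N"
 shows "f \<in> measurable (past r) N"
proof (rule measurable_from_subalg[OF _ assms(2)])
 show "subalgebra (past r) (past u)"
  by (rule subalgebra_incr_sigma) (use assms(1) in \<open>auto intro!: measurable_past_increment\<close>)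
qed

text \<open>The axioms speak of consecutive increments of one grid. Past times, future times and u
  itself are merged into a single sorted grid; every increment from u is then a sum of consecutive
  increments on its own side of u.\<close>

lemma indep_finite_increments:
 assumes J: "finite J" "J \<subseteq> {..u}" and L: "finite L" "L \<subseteq> {u..}"
 shows "indep_var (Pi\<^sub>M J (%_. borel)) (%w. \<lambda>v\<in>J. B v w - B u w)
          (Pi\<^sub>M L (%_. borel)) (%w. \<lambda>v\<in>L. B v w - B u w)"
proof -
 define S where "S = insert u (J \<union> L)"
 define xs where "xs = sorted_list_of_set S"
 define \<tau> where "\<tau> i = xs ! i" for i
 define n where "n = length xs - 1"
 have finS: "finite S" using J L by (simp add: S_def)
 have sxs: "sorted_wrt (<) xs" "set xs = S" unfolding xs_def using finS by auto
 have lenpos: "length xs = Suc n" using sxs(2) by (cases xs) (auto simp: n_def S_def)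
 have smono: "\<tau> i < \<tau> j" if "i < j" "j \<le> n" for i j
  using sorted_wrt_nth_less[OF sxs(1)] that lenpos by (simp add: \<tau>_def)
 then have sm: "strict_mono_on {..n} \<tau>" by (auto simp: strict_mono_on_def)
 have "\<exists>i\<le>n. \<tau> i = v" if "v \<in> S" for v
  using that sxs(2) lenpos unfolding \<tau>_def by (metis in_set_conv_nth less_Suc_eq_le)
 then obtain idx where idx: "\<And>v. v \<in> S ==> idx v \<le> n \<and> \<tau> (idx v) = v" by metis
 define k where "k = idx u"
 have k: "k \<le> n" "\<tau> k = u" using idx[of u] by (auto simp: k_def S_def)
 have idxJ: "idx v \<le> k" if "v \<in> J" for v
 proof (rule ccontr)
  assume "\<not> idx v \<le> k"
  then have "\<tau> k < \<tau> (idx v)" using smono[of k "idx v"] idx[of v] that by (simp add: S_def)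
  then show False using k idx[of v] that J(2) by (auto simp: S_def)
 qed
 have idxL: "k \<le> idx v" if "v \<in> L" for v
 proof (rule ccontr)
  assume "\<not> k \<le> idx v"
  then have "\<tau> (idx v) < \<tau> k" using smono k by auto
  then show False using k idx[of v] that L(2) by (auto simp: S_def)
 qed
 let ?D = "%i w. B (\<tau> (Suc i)) w - B (\<tau> i) w"
 \<comment> \<open>From u back to an earlier v the telescoping sum carries a minus sign.\<close>
 define Y1 where "Y1 x = (\<lambda>v\<in>J. - (\<Sum>i=idx v..<k. x i))" for x :: "nat => real"
 define Y2 where "Y2 x = (\<lambda>v\<in>L. \<Sum>i=k..<idx v. x i)" for x :: "nat => real"
 have ind: "indep_var (Pi\<^sub>M J (%_. borel)) (Y1 \<circ> (%w. restrict (%i. ?D i w) {..<k}))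
         (Pi\<^sub>M L (%_. borel)) (Y2 \<circ> (%w. restrict (%i. ?D i w) {k..<n}))"
 proof (rule indep_var_compose)
  show "indep_var (Pi\<^sub>M {..<k} (%_. borel)) (%w. restrict (%i. ?D i w) {..<k})
    (Pi\<^sub>M {k..<n} (%_. borel)) (%w. restrict (%i. ?D i w) {k..<n})"
   by (rule indep_var_restrict[OF B_indep[OF sm]]) (use k in auto)
  show "Y1 \<in> Pi\<^sub>M {..<k} (%_. borel) \<rightarrow>\<^sub>M Pi\<^sub>M J (%_. borel)"
   unfolding Y1_def
   by (intro measurable_restrict borel_measurable_uminus borel_measurable_sum measurable_component_singleton) auto
  show "Y2 \<in> Pi\<^sub>M {k..<n} (%_. borel) \<rightarrow>\<^sub>M Pi\<^sub>M L (%_. borel)"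
   unfolding Y2_def
  proof (intro measurable_restrict borel_measurable_sum measurable_component_singleton)
   fix v i assume "v \<in> L" "i \<in> {k..<idx v}"
   then show "i \<in> {k..<n}" using idx[of v] by (auto simp: S_def)
  qed
 qed
 have 1: "(Y1 \<circ> (%w. restrict (%i. ?D i w) {..<k})) = (%w. \<lambda>v\<in>J. B v w - B u w)"
 proof (rule ext)
  fix w
  have "- (\<Sum>i=idx v..<k. restrict (%i. ?D i w) {..<k} i) = B v w - B u w" if v: "v \<in> J" for v
  proof -
   have "(\<Sum>i=idx v..<k. restrict (%i. ?D i w) {..<k} i) = (\<Sum>i=idx v..<k. ?D i w)"
    by (intro sum.cong) auto
   also have "... = B (\<tau> k) w - B (\<tau> (idx v)) w"
    using idxJ[OF v] by (rule sum_Suc_diff')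
   finally show ?thesis using idx[of v] v k by (simp add: S_def)
  qed
  then show "(Y1 \<circ> (%w. restrict (%i. ?D i w) {..<k})) w = (\<lambda>v\<in>J. B v w - B u w)"
   by (auto simp: Y1_def)
 qed
 have 2: "(Y2 \<circ> (%w. restrict (%i. ?D i w) {k..<n})) = (%w. \<lambda>v\<in>L. B v w - B u w)"
 proof (rule ext)
  fix w
  have "(\<Sum>i=k..<idx v. restrict (%i. ?D i w) {k..<n} i) = B v w - B u w" if v: "v \<in> L" for v
  proof -
   have "idx v \<le> n" using idx[of v] v by (auto simp: S_def)
   then have "(\<Sum>i=k..<idx v. restrict (%i. ?D i w) {k..<n} i) = (\<Sum>i=k..<idx v. ?D i w)"
    by (intro sum.cong) auto
   also have "... = B (\<tau> (idx v)) w - B (\<tau> k) w"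
    using idxL[OF v] by (rule sum_Suc_diff')
   finally show ?thesis using idx[of v] v k by (simp add: S_def)
  qed
  then show "(Y2 \<circ> (%w. restrict (%i. ?D i w) {k..<n})) w = (\<lambda>v\<in>L. B v w - B u w)"
   by (auto simp: Y2_def)
 qed
 show ?thesis using ind unfolding 1 2 .
qed

text \<open>Both generators are stable under intersection, so it suffices to treat two cylinders,
  which is the finite case above.\<close>

lemma indep_past_future: "indep_set (sets (past u)) (sets (future u))"
 unfolding sets_incr_sigma
proof (rule indep_set_sigma_sets[OF _ Int_stable_incr_sigma Int_stable_incr_sigma], rule indep_setI)
 let ?f = "%T w. \<lambda>v\<in>T. B v w - B u w"
 have sub: "{?f T -` A \<inter> space M | A. A \<in> prod_algebra T (%_. borel)} \<subseteq> events" for T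
 proof -
  have "?f T \<in> measurable M (Pi\<^sub>M T (%_. borel))" by (intro measurable_restrict) simp
  moreover have "prod_algebra T (%_. borel) \<subseteq> sets (Pi\<^sub>M T (%_. borel :: real measure))"
   unfolding sets_PiM by auto
  ultimately show ?thesis using measurable_sets[of "?f T" M "Pi\<^sub>M T (%_. borel)"] by blast
 qed
 show "{?f {..u} -` A \<inter> space M | A. A \<in> prod_algebra {..u} (%_. borel)} \<subseteq> events"
  "{?f {u..} -` A \<inter> space M | A. A \<in> prod_algebra {u..} (%_. borel)} \<subseteq> events"
  by (rule sub)+
 fix a b
 assume "a \<in> {?f {..u} -` A \<inter> space M | A. A \<in> prod_algebra {..u} (%_. borel)}"
  and "b \<in> {?f {u..} -` A \<inter> space M | A. A \<in> prod_algebra {u..} (%_. borel)}"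
 then obtain A A' where A: "a = ?f {..u} -` A \<inter> space M" "A \<in> prod_algebra {..u} (%_. borel)"
  and A': "b = ?f {u..} -` A' \<inter> space M" "A' \<in> prod_algebra {u..} (%_. borel)" by blast
 obtain J E where J: "A = prod_emb {..u} (%_. borel) J (\<Pi>\<^sub>E j\<in>J. E j)" "finite J" "J \<subseteq> {..u}"
   "\<And>i. i \<in> J ==> E i \<in> sets borel"
  using prod_algebraE[OF A(2)] by metis
 obtain L G where L: "A' = prod_emb {u..} (%_. borel) L (\<Pi>\<^sub>E j\<in>L. G j)" "finite L" "L \<subseteq> {u..}"
   "\<And>i. i \<in> L ==> G i \<in> sets borel"
  using prod_algebraE[OF A'(2)] by metis
 have a: "a = ?f J -` (\<Pi>\<^sub>E j\<in>J. E j) \<inter> space M"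
  unfolding A(1) J(1) using J(3) by (auto simp: prod_emb_def PiE_iff extensional_def subset_iff)
 have b: "b = ?f L -` (\<Pi>\<^sub>E j\<in>L. G j) \<inter> space M"
  unfolding A'(1) L(1) using L(3) by (auto simp: prod_emb_def PiE_iff extensional_def subset_iff)
 have "prob ((%x. (?f J x, ?f L x)) -` ((\<Pi>\<^sub>E j\<in>J. E j) \<times> (\<Pi>\<^sub>E j\<in>L. G j)) \<inter> space M) =
   prob (?f J -` (\<Pi>\<^sub>E j\<in>J. E j) \<inter> space M) * prob (?f L -` (\<Pi>\<^sub>E j\<in>L. G j) \<inter> space M)"
  by (rule indep_varD[OF indep_finite_increments[OF J(2,3) L(2,3)]])
    (use J L in \<open>auto intro!: sets_PiM_I_finite\<close>)
 moreover have "(%x. (?f J x, ?f L x)) -` ((\<Pi>\<^sub>E j\<in>J. E j) \<times> (\<Pi>\<^sub>E j\<in>L. G j)) \<inter> space M = a \<inter> b"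
  unfolding a b by auto
 ultimately show "prob (a \<inter> b) = prob a * prob b" unfolding a b by simp
qed

lemma indep_var_past_future:
 fixes V Z :: "'a => real"
 assumes V: "V \<in> borel_measurable (past u)" and Z: "Z \<in> borel_measurable (future u)"
 shows "indep_var borel V borel Z"
 unfolding indep_var_eq
proof (intro conjI)
 show "V \<in> borel_measurable M" "Z \<in> borel_measurable M"
  using V Z by (auto intro: measurable_past_M measurable_future_M)
 have 1: "{V -` A \<inter> space M | A. A \<in> sets borel} \<subseteq> sets (past u)"
  using measurable_sets[OF V] by auto
 have 2: "{Z -` A \<inter> space M | A. A \<in> sets borel} \<subseteq> sets (future u)"
  using measurable_sets[OF Z] by auto
 have 3: "sigma_sets (space M) {V -` A \<inter> space M | A. A \<in> sets borel} \<subseteq> sets (past u)"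
  using sets.sigma_sets_subset[OF 1] by simp
 have 4: "sigma_sets (space M) {Z -` A \<inter> space M | A. A \<in> sets borel} \<subseteq> sets (future u)"
  using sets.sigma_sets_subset[OF 2] by simp
 show "indep_set (sigma_sets (space M) {V -` A \<inter> space M | A. A \<in> sets borel})
   (sigma_sets (space M) {Z -` A \<inter> space M | A. A \<in> sets borel})"
 proof (rule indep_setI)
  fix a b assume "a \<in> sigma_sets (space M) {V -` A \<inter> space M | A. A \<in> sets borel}"
   "b \<in> sigma_sets (space M) {Z -` A \<inter> space M | A. A \<in> sets borel}"
  then show "prob (a \<inter> b) = prob a * prob b"
   using 3 4 by (intro indep_setD[OF indep_past_future[of u]]) auto
 qed (use 3 4 subalgebra_past[of u] subalgebra_future[of u] in \<open>auto simp: subalgebra_def\<close>)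
qed

lemma expectation_past_future:
 fixes V Z :: "'a => real"
 assumes "V \<in> borel_measurable (past u)" "Z \<in> borel_measurable (future u)"
  "integrable M V" "integrable M Z"
 shows "expectation (%w. V w * Z w) = expectation V * expectation Z"
 by (rule indep_var_lebesgue_integral[OF indep_var_past_future[OF assms(1,2)] assms(3,4)])

lemma measurable_B_joint: "(%(x, w). B x w) \<in> borel_measurable (borel \<Otimes>\<^sub>M M)"
 by (rule measurable_continuous_process) (auto intro: B_continuous)

text \<open>Stopping the time at u keeps the whole path inside the past sigma-algebra, jointly in
  time, so that time integrals of the path stay there as well.\<close>

lemma measurable_past_joint:
 "(%(x, w). B (min x u) w - B u w) \<in> borel_measurable (borel \<Otimes>\<^sub>M past u)"
proof (rule measurable_continuous_process)
 fix w assume "w \<in> space (past u)"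
 then have "continuous_on UNIV (%t. B t w)" by (simp add: B_continuous)
 then have "continuous_on UNIV (%x. B (min x u) w)"
  by (rule continuous_on_compose2) (auto intro!: continuous_intros)
 then show "continuous_on UNIV (%x. B (min x u) w - B u w)" by (intro continuous_intros)
qed (auto intro!: measurable_past_increment)

lemma measurable_future_joint:
 "(%(x, w). B (max x u) w - B u w) \<in> borel_measurable (borel \<Otimes>\<^sub>M future u)"
proof (rule measurable_continuous_process)
 fix w assume "w \<in> space (future u)"
 then have "continuous_on UNIV (%t. B t w)" by (simp add: B_continuous)
 then have "continuous_on UNIV (%x. B (max x u) w)"
  by (rule continuous_on_compose2) (auto intro!: continuous_intros)
 then show "continuous_on UNIV (%x. B (max x u) w - B u w)" by (intro continuous_intros)
qed (auto intro!: measurable_future_increment)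

text \<open>One null set must serve all G at once, because the parameter varies for a fixed path
  later. Fubini treats one G; on the negative half-line exp(G x) decreases in G, so the countably
  many parameters 1/(n+1) dominate all others.\<close>

lemma AE_exp_integrable_path:
 "AE w in M. \<forall>G>0. integrable lborel (%x. indicator {..0} x * (exp (G * x) * B x w))"
proof -
 have one: "AE w in M. integrable lborel (%x. indicator {..0} x * (exp (G * x) * B x w))" if g: "0 < G" for G
 proof -
  interpret P: pair_sigma_finite lborel M ..
  define f where "f = (%(x, w). indicator {..0} x * exp (G * x) * (B x w - B 0 w))"
  have [measurable]: "(%(x, w). B x w) \<in> borel_measurable (lborel \<Otimes>\<^sub>M M)"
   using measurable_B_joint by (simp cong: measurable_cong_sets)
  have mf: "f \<in> borel_measurable (lborel \<Otimes>\<^sub>M M)" unfolding f_def by measurable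
  have E1: "expectation (%w. \<bar>B x w - B 0 w\<bar>) \<le> 1 + \<bar>x\<bar>" for x
  proof -
   have "expectation (%w. \<bar>B x w - B 0 w\<bar>) \<le> expectation (%w. 1 + (B x w - B 0 w)\<^sup>2)"
   proof (rule integral_mono)
    fix w
    have "\<bar>z\<bar> \<le> 1 + z\<^sup>2" for z :: real
     by (metis abs_ge_zero add_increasing2 less_eq_real_def linorder_le_cases one_le_power order_trans
       power2_abs power2_eq_square self_le_power zero_le_power2 le_add_same_cancel1 zero_less_numeral
       add_increasing zero_le_one)
    then show "\<bar>B x w - B 0 w\<bar> \<le> 1 + (B x w - B 0 w)\<^sup>2" .
   qed (intro integrable_abs Bochner_Integration.integrable_add integrable_const abs_moments_integrable abs_moments_power abs_moments_increment)+
   also have "... = 1 + \<bar>x\<bar>"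
    using abs_moments_integrable[OF abs_moments_power[OF abs_moments_increment[of x 0], of 2]]
    by (simp add: expectation_increment_sq prob_space)
   finally show ?thesis .
  qed
  have "integrable (lborel \<Otimes>\<^sub>M M) f"
  proof (rule P.Fubini_integrable[OF mf])
   show "AE x in lborel. integrable M (%w. f (x, w))"
    by (simp add: f_def abs_moments_integrable abs_moments_increment)
   have *: "integrable lborel (%x. (1 + 2 / G) * (indicator {..0} x * exp (- (G / 2) * (0 - x))))"
    using has_bochner_integral_exp_atMost[of "G / 2" 0] g
    by (intro integrable_mult_right) (auto simp: has_bochner_integral_iff)
   show "integrable lborel (%x. LINT y|M. norm (f (x, y)))"
   proof (rule Bochner_Integration.integrable_bound[OF *])
    show "(%x. LINT y|M. norm (f (x, y))) \<in> borel_measurable lborel"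
     using mf by measurable
    show "AE x in lborel. norm (LINT y|M. norm (f (x, y))) \<le>
     norm ((1 + 2 / G) * (indicator {..0} x * exp (- (G / 2) * (0 - x))))"
    proof (rule AE_I2)
     fix x :: real
     have "(LINT y|M. norm (f (x, y))) = indicator {..0} x * exp (G * x) * expectation (%w. \<bar>B x w - B 0 w\<bar>)"
      by (simp add: f_def abs_mult)
     also have "... \<le> (1 + 2 / G) * (indicator {..0} x * exp (G / 2 * x))"
     proof (cases "x \<le> 0")
      case True
      \<comment> \<open>Half of the exponent is spent on the linear growth of the first moment; the
        constant 1 + 2/G comes from -x <= (2/G) exp(-G x / 2).\<close>
      have "1 + (- G / 2 * x) \<le> exp (- G / 2 * x)" by (rule exp_ge_add_one_self)
      then have a: "- x \<le> 2 / G * exp (- G / 2 * x)" using g by (simp add: field_simps)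
      have b: "1 \<le> exp (- G / 2 * x)" using True g by (simp add: mult_nonneg_nonpos)
      have c: "1 + \<bar>x\<bar> \<le> (1 + 2 / G) * exp (- G / 2 * x)"
       unfolding distrib_right using a b True by linarith
      have "exp (G * x) * expectation (%w. \<bar>B x w - B 0 w\<bar>) \<le> exp (G * x) * (1 + \<bar>x\<bar>)"
       by (intro mult_left_mono E1) simp
      also have "... \<le> exp (G * x) * ((1 + 2 / G) * exp (- G / 2 * x))"
       by (intro mult_left_mono c) simp
      also have "... = (1 + 2 / G) * (exp (G * x) * exp (- G / 2 * x))" by (simp add: mult_ac)
      also have "exp (G * x) * exp (- G / 2 * x) = exp (G / 2 * x)"
       by (simp flip: exp_add)
      finally show ?thesis using True by simp
     qed simp
     finally have "(LINT y|M. norm (f (x, y))) \<le> (1 + 2 / G) * (indicator {..0} x * exp (G / 2 * x))" .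
     then show "norm (LINT y|M. norm (f (x, y))) \<le>
      norm ((1 + 2 / G) * (indicator {..0} x * exp (- (G / 2) * (0 - x))))"
      using g by (simp add: abs_mult)
    qed
   qed
  qed
  from P.AE_integrable_fst_snd[OF this]
  have "AE w in M. integrable lborel (%x. indicator {..0} x * exp (G * x) * (B x w - B 0 w))"
   by (simp add: f_def)
  then show ?thesis
  proof eventually_elim
   case (elim w)
   have "integrable lborel (%x. B 0 w * (indicator {..0} x * exp (- G * (0 - x))))"
    using has_bochner_integral_exp_atMost[OF g, of 0]
    by (intro integrable_mult_right) (auto simp: has_bochner_integral_iff)
   from Bochner_Integration.integrable_add[OF elim this] show ?case
    by (simp add: algebra_simps)
  qed
 qed
 have "AE w in M. \<forall>n. integrable lborel (%x. indicator {..0} x * (exp (1 / real (Suc n) * x) * B x w))"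
  unfolding AE_all_countable by (intro allI one) simp
 then show ?thesis
  using AE_space
 proof eventually_elim
  case (elim w)
  have [measurable]: "(%x. B x w) \<in> borel_measurable borel"
   using B_continuous[OF elim(2)] by (intro borel_measurable_continuous_onI)
  show ?case
  proof (intro allI impI)
   fix G :: real assume "0 < G"
   then obtain n where n: "1 / real (Suc n) < G" using nat_approx_posE by blast
   show "integrable lborel (%x. indicator {..0} x * (exp (G * x) * B x w))"
   proof (rule Bochner_Integration.integrable_bound[OF elim(1)[rule_format, of n]])
    show "AE x in lborel. norm (indicator {..0} x * (exp (G * x) * B x w))
     \<le> norm (indicator {..0} x * (exp (1 / real (Suc n) * x) * B x w))"
    proof (rule AE_I2)
     fix x :: real
     show "norm (indicator {..0} x * (exp (G * x) * B x w))
     \<le> norm (indicator {..0} x * (exp (1 / real (Suc n) * x) * B x w))"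
     proof (cases "x \<le> 0")
      case True
      then have "G * x \<le> 1 / real (Suc n) * x" using n by (intro mult_right_mono_neg) auto
      then show ?thesis using True by (simp add: abs_mult mult_right_mono)
     qed simp
    qed
   qed measurable
  qed
 qed
qed

end

section \<open>The Ornstein--Uhlenbeck process\<close>

lemma (in prob_space) distributed_std_normal_iff_distr:
 assumes [measurable]: "Z \<in> borel_measurable M"
 shows "distributed M lborel Z std_normal_density \<longleftrightarrow> distr M borel Z = std_normal_distribution"
proof -
 have "distr M lborel Z = distr M borel Z" by (rule distr_cong) auto
 then show ?thesis by (auto simp: distributed_def)
qed

lemma (in prob_space) expectation_iexp_normal:
 assumes D: "distributed M lborel X (normal_density 0 \<sigma>)" and s: "0 < \<sigma>"
 shows "(CLINT w|M. iexp (t * X w)) = complex_of_real (exp (- ((t * \<sigma>)\<^sup>2) / 2))"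
proof -
 have X[measurable]: "X \<in> borel_measurable M" using distributed_measurable[OF D] by simp
 have "distributed M lborel (%x. X x / \<sigma>) std_normal_density"
  using D normal_standard_normal_convert[OF s, of X 0] by simp
 then have e: "distr M borel (%x. X x / \<sigma>) = std_normal_distribution"
  by (subst (asm) distributed_std_normal_iff_distr) auto
 have "(CLINT w|M. iexp (t * X w)) = (CLINT w|M. iexp ((t * \<sigma>) * (X w / \<sigma>)))"
  using s by simp
 also have "... = char (distr M borel (%x. X x / \<sigma>)) (t * \<sigma>)"
  unfolding char_def by (subst integral_distr) auto
 finally show ?thesis unfolding e char_std_normal_distribution .
qed

text \<open>The remainder changes the characteristic function by at most |t| E|R n|, and that of X n
  converges with its standard deviation. Used with R = 0 for Riemann sums and with the boundary term
  of a truncated integral.\<close>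

lemma (in prob_space) normal_limit:
 fixes X R :: "nat => 'a => real"
 assumes D: "\<And>n. distributed M lborel (X n) (normal_density 0 (\<sigma> n))" "\<And>n. 0 < \<sigma> n"
  and lim_sigma: "\<sigma> \<longlonglongrightarrow> s" "0 < s"
  and R: "\<And>n. integrable M (R n)" "(%n. expectation (%w. \<bar>R n w\<bar>)) \<longlonglongrightarrow> 0"
  and Y[measurable]: "Y \<in> borel_measurable M"
  and lim: "AE w in M. (%n. X n w - R n w) \<longlonglongrightarrow> Y w"
 shows "distributed M lborel Y (normal_density 0 s)"
proof -
 have X[measurable]: "X n \<in> borel_measurable M" for n using distributed_measurable[OF D(1)] by simp
 have Rm[measurable]: "R n \<in> borel_measurable M" for n using R by simp
 have ch: "(CLINT w|M. iexp (t * Y w)) = complex_of_real (exp (- ((t * s)\<^sup>2) / 2))" for t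
 proof (rule LIMSEQ_unique)
  show "(%n. CLINT w|M. iexp (t * (X n w - R n w))) \<longlonglongrightarrow> (CLINT w|M. iexp (t * Y w))"
  proof (rule integral_dominated_convergence[where w="%_. 1"])
   show "AE x in M. (%n. iexp (t * (X n x - R n x))) \<longlonglongrightarrow> iexp (t * Y x)"
    using lim by eventually_elim (intro tendsto_intros)
  qed auto
  have "(%n. (CLINT w|M. iexp (t * (X n w - R n w))) - (CLINT w|M. iexp (t * X n w))) \<longlonglongrightarrow> 0"
  proof (rule Lim_null_comparison)
   show "(%n. \<bar>t\<bar> * expectation (%w. \<bar>R n w\<bar>)) \<longlonglongrightarrow> 0"
    using tendsto_mult_right_zero[OF R(2)] by simp
   show "\<forall>\<^sub>F n in sequentially. norm ((CLINT w|M. iexp (t * (X n w - R n w))) - (CLINT w|M. iexp (t * X n w)))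
     \<le> \<bar>t\<bar> * expectation (%w. \<bar>R n w\<bar>)"
   proof (rule always_eventually, rule allI)
    fix n
    have "(CLINT w|M. iexp (t * (X n w - R n w))) - (CLINT w|M. iexp (t * X n w))
     = (CLINT w|M. iexp (t * (X n w - R n w)) - iexp (t * X n w))"
     by (rule Bochner_Integration.integral_diff[symmetric]) (auto intro!: integrable_iexp)
    also have "norm ... \<le> expectation (%w. \<bar>t\<bar> * \<bar>R n w\<bar>)"
    proof (rule order_trans[OF integral_norm_bound integral_mono])
     show "integrable M (%w. norm (iexp (t * (X n w - R n w)) - iexp (t * X n w)))"
      by (intro integrable_norm Bochner_Integration.integrable_diff integrable_iexp) auto
     fix w
     have "iexp (t * (X n w - R n w)) - iexp (t * X n w) = iexp (t * X n w) * (iexp (t * - R n w) - 1)"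
      by (simp add: algebra_simps flip: exp_add)
     also have "norm ... = norm (iexp (t * - R n w) - 1)" by (simp only: norm_mult norm_exp_i_times mult_1)
     also have "... \<le> \<bar>t * - R n w\<bar>" using iexp_approx1[of "t * - R n w" 0] by simp
     finally show "norm (iexp (t * (X n w - R n w)) - iexp (t * X n w)) \<le> \<bar>t\<bar> * \<bar>R n w\<bar>"
      by (simp add: abs_mult)
    qed (use R in auto)
    finally show "norm ((CLINT w|M. iexp (t * (X n w - R n w))) - (CLINT w|M. iexp (t * X n w)))
     \<le> \<bar>t\<bar> * expectation (%w. \<bar>R n w\<bar>)" by simp
   qed
  qed
  moreover have "(%n. CLINT w|M. iexp (t * X n w)) \<longlonglongrightarrow> complex_of_real (exp (- ((t * s)\<^sup>2) / 2))"
   unfolding expectation_iexp_normal[OF D] by (intro tendsto_intros lim_sigma) simp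
  ultimately show "(%n. CLINT w|M. iexp (t * (X n w - R n w))) \<longlonglongrightarrow> complex_of_real (exp (- ((t * s)\<^sup>2) / 2))"
   using Lim_transform by fastforce
 qed
 have "char (distr M borel (%w. Y w / s)) t = char std_normal_distribution t" for t
 proof -
  have "char (distr M borel (%w. Y w / s)) t = (CLINT w|M. iexp ((t / s) * Y w))"
   unfolding char_def by (subst integral_distr) auto
  then show ?thesis using ch[of "t / s"] lim_sigma(2) by (simp add: char_std_normal_distribution)
 qed
 then have "distr M borel (%w. Y w / s) = std_normal_distribution"
  by (intro Levy_uniqueness real_dist_normal_dist) auto
 then have "distributed M lborel (%w. (Y w - 0) / s) std_normal_density"
  by (subst distributed_std_normal_iff_distr) auto
 then show ?thesis using normal_standard_normal_convert[OF lim_sigma(2), of Y 0] by simp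
qed

lemma lborel_integral_Icc_eq_integral:
 fixes f :: "real => real"
 assumes "continuous_on {a..b} f"
 shows "(\<integral>x. indicator {a..b} x * f x \<partial>lborel) = integral {a..b} f"
  "integrable lborel (%x. indicator {a..b} x * f x)"
 using set_borel_integral_eq_integral(2)[OF borel_integrable_atLeastAtMost'[OF assms]]
  borel_integrable_atLeastAtMost'[OF assms]
 by (simp_all add: set_lebesgue_integral_def set_integrable_def)

lemma integral_gexp:
 fixes G :: real
 assumes "u \<le> r"
 shows "integral {u..r} (%x. G * exp (- G * (v - x))) = exp (- G * (v - r)) - exp (- G * (v - u))"
 by (rule integral_unique, rule fundamental_theorem_of_calculus[OF assms])
   (auto intro!: derivative_eq_intros simp: has_real_derivative_iff_has_vector_derivative[symmetric])

text \<open>A primitive of exp(G x) b(x) starting at minus infinity. The Ornstein-Uhlenbeck path is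
  written through it, so that its regularity follows from the fundamental theorem of
  calculus.\<close>

definition exp_primitive :: "real => (real => real) => real => real" where
 "exp_primitive G b u = (\<integral>x. indicator {..u} x * (exp (G * x) * b x) \<partial>lborel)"

lemma exp_primitive_integrable:
 fixes b :: "real => real"
 assumes cont: "continuous_on UNIV b"
  and int: "integrable lborel (%x. indicator {..0} x * (exp (G * x) * b x))"
 shows "integrable lborel (%x. indicator {..u} x * (exp (G * x) * b x))"
proof (rule Bochner_Integration.integrable_bound)
 have b[measurable]: "b \<in> borel_measurable borel" by (rule borel_measurable_continuous_onI[OF cont])
 show "integrable lborel (%x. \<bar>indicator {..0} x * (exp (G * x) * b x)\<bar> + \<bar>indicator {0..u} x * (exp (G * x) * b x)\<bar>)"
  by (intro Bochner_Integration.integrable_add integrable_abs int lborel_integral_Icc_eq_integral(2)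
     continuous_intros continuous_on_subset[OF cont]) auto
 show "AE x in lborel. norm (indicator {..u} x * (exp (G * x) * b x))
   \<le> norm (\<bar>indicator {..0} x * (exp (G * x) * b x)\<bar> + \<bar>indicator {0..u} x * (exp (G * x) * b x)\<bar>)"
  by (intro AE_I2) (auto simp: indicator_def)
qed (use borel_measurable_continuous_onI[OF cont] in measurable)

lemma exp_primitive_diff:
 fixes b :: "real => real"
 assumes cont: "continuous_on UNIV b"
  and int: "integrable lborel (%x. indicator {..0} x * (exp (G * x) * b x))" and "u \<le> r"
 shows "exp_primitive G b r - exp_primitive G b u = integral {u..r} (%x. exp (G * x) * b x)"
proof -
 have c: "continuous_on {u..r} (%x. exp (G * x) * b x)"
  by (intro continuous_intros continuous_on_subset[OF cont]) auto
 have "exp_primitive G b r - exp_primitive G b u =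
   (\<integral>x. indicator {..r} x * (exp (G * x) * b x) - indicator {..u} x * (exp (G * x) * b x) \<partial>lborel)"
  unfolding exp_primitive_def
  by (rule Bochner_Integration.integral_diff[symmetric]) (rule exp_primitive_integrable[OF cont int])+
 also have "... = (\<integral>x. indicator {u..r} x * (exp (G * x) * b x) \<partial>lborel)"
 proof (rule integral_cong_AE)
  show "AE x in lborel. indicator {..r} x * (exp (G * x) * b x) - indicator {..u} x * (exp (G * x) * b x)
   = indicator {u..r} x * (exp (G * x) * b x)"
   using AE_lborel_singleton[of u] by eventually_elim (use \<open>u \<le> r\<close> in \<open>auto simp: indicator_def\<close>)
 qed (use borel_measurable_continuous_onI[OF cont] in measurable)
 also have "... = integral {u..r} (%x. exp (G * x) * b x)"
  by (rule lborel_integral_Icc_eq_integral[OF c])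
 finally show ?thesis .
qed

lemma exp_primitive_derivative:
 fixes b :: "real => real"
 assumes cont: "continuous_on UNIV b"
  and int: "integrable lborel (%x. indicator {..0} x * (exp (G * x) * b x))"
 shows "(exp_primitive G b has_real_derivative exp (G * u) * b u) (at u)"
proof -
 have c: "continuous_on {u - 1..u + 1} (%x. exp (G * x) * b x)"
  by (intro continuous_intros continuous_on_subset[OF cont]) auto
 have "((%x. exp_primitive G b (u - 1) + integral {u - 1..x} (%x. exp (G * x) * b x))
   has_real_derivative 0 + exp (G * u) * b u) (at u within {u - 1..u + 1})"
  by (intro DERIV_add DERIV_const integral_has_real_derivative[OF c]) auto
 then have "(exp_primitive G b has_real_derivative exp (G * u) * b u) (at u within {u - 1..u + 1})"
 proof (rule has_field_derivative_transform_within[where d=1, THEN back_subst[of "%z. (_ has_real_derivative z) _"]])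
  fix x assume "x \<in> {u - 1..u + 1}"
  then show "exp_primitive G b (u - 1) + integral {u - 1..x} (%x. exp (G * x) * b x) = exp_primitive G b x"
   using exp_primitive_diff[OF cont int, of "u - 1" x] by simp
 qed auto
 then show ?thesis by (simp add: at_within_Icc_at)
qed

context brownian_motion
begin

text \<open>One event of probability one that carries the pathwise identities below for all G
  simultaneously.\<close>

definition good_path :: "'a => bool" where
 "good_path w \<longleftrightarrow> w \<in> space M \<and> (\<forall>G>0. integrable lborel (%x. indicator {..0} x * (exp (G * x) * B x w)))"

lemma AE_good_path: "AE w in M. good_path w"
 using AE_exp_integrable_path AE_space unfolding good_path_def by eventually_elim auto

text \<open>Integration by parts of sqrt(2G) times the Wiener integral of exp(-G(u - x)) over x <=
  u. Only increments of the path occur, and sqrt(2G) normalises the variance to 1.\<close>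

definition OU :: "real => real => 'a => real" where
 "OU G u w = sqrt (2 * G) *
   (\<integral>x. indicator {..u} x * (G * exp (- G * (u - x)) * (B u w - B x w)) \<partial>lborel)"

text \<open>The Wiener integral of exp(-G(r - x)) over u <= x <= r in the same integrated form; it
  depends on the future of u alone.\<close>

definition innovation :: "real => real => real => 'a => real" where
 "innovation G u r w = (B r w - B u w) -
   (\<integral>x. indicator {u..r} x * (G * exp (- G * (r - x)) * (B x w - B u w)) \<partial>lborel)"

lemma good_path_integrable:
 "good_path w ==> 0 < G ==> integrable lborel (%x. indicator {..u} x * (exp (G * x) * B x w))"
 by (rule exp_primitive_integrable) (auto simp: good_path_def B_continuous)

lemma OU_eq:
 assumes w: "good_path w" and g: "0 < G"
 shows "OU G u w = sqrt (2 * G) * (B u w - G * exp (- G * u) * exp_primitive G (%x. B x w) u)"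
proof -
 have e: "has_bochner_integral lborel (%x. indicator {..u} x * exp (- G * (u - x))) (1 / G)"
  by (rule has_bochner_integral_exp_atMost[OF g])
 have "(\<integral>x. indicator {..u} x * (G * exp (- G * (u - x)) * (B u w - B x w)) \<partial>lborel) =
  (\<integral>x. (G * B u w) * (indicator {..u} x * exp (- G * (u - x)))
    - (G * exp (- G * u)) * (indicator {..u} x * (exp (G * x) * B x w)) \<partial>lborel)"
  by (intro Bochner_Integration.integral_cong refl) (simp add: algebra_simps flip: exp_add)
 also have "... = (G * B u w) * (1 / G) - (G * exp (- G * u)) * exp_primitive G (%x. B x w) u"
  using e good_path_integrable[OF w g, of u]
  by (subst Bochner_Integration.integral_diff)
    (auto simp: has_bochner_integral_iff exp_primitive_def intro!: integrable_mult_right)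
 finally show ?thesis using g by (simp add: OU_def)
qed

lemma innovation_eq:
 assumes w: "w \<in> space M" and ur: "u \<le> r"
 shows "innovation G u r w = B r w - exp (- G * (r - u)) * B u w
   - integral {u..r} (%x. G * exp (- G * (r - x)) * B x w)"
proof -
 note c = B_continuous[OF w]
 have "(\<integral>x. indicator {u..r} x * (G * exp (- G * (r - x)) * (B x w - B u w)) \<partial>lborel)
  = integral {u..r} (%x. G * exp (- G * (r - x)) * (B x w - B u w))"
  by (intro lborel_integral_Icc_eq_integral continuous_intros c)
 also have "... = integral {u..r} (%x. G * exp (- G * (r - x)) * B x w - G * exp (- G * (r - x)) * B u w)"
  by (intro arg_cong[where f="integral {u..r}"]) (auto simp: algebra_simps)
 also have "... = integral {u..r} (%x. G * exp (- G * (r - x)) * B x w)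
  - integral {u..r} (%x. G * exp (- G * (r - x)) * B u w)"
  by (intro Henstock_Kurzweil_Integration.integral_diff integrable_continuous_interval continuous_intros c)
 also have "integral {u..r} (%x. G * exp (- G * (r - x)) * B u w) = (1 - exp (- G * (r - u))) * B u w"
  using integral_gexp[OF ur, of G r] by (simp del: integral_mult_right)
 finally show ?thesis by (simp add: innovation_def algebra_simps)
qed

text \<open>The autoregressive decomposition into a discounted past value and a contribution from
  the future of u. It is an identity of paths, obtained by splitting the primitive at u, and the
  source of Mehler's formula.\<close>

lemma OU_innovation:
 assumes w: "good_path w" and g: "0 < G" and ur: "u \<le> r"
 shows "OU G r w = exp (- G * (r - u)) * OU G u w + sqrt (2 * G) * innovation G u r w"
proof -
 have w': "w \<in> space M" using w by (simp add: good_path_def)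
 have K: "exp_primitive G (%x. B x w) r = exp_primitive G (%x. B x w) u + integral {u..r} (%x. exp (G * x) * B x w)"
  using exp_primitive_diff[of "%x. B x w" G u r] w g ur B_continuous[OF w'] by (simp add: good_path_def)
 have "integral {u..r} (%x. G * exp (- G * (r - x)) * B x w) =
   integral {u..r} (%x. (G * exp (- G * r)) * (exp (G * x) * B x w))"
  by (intro arg_cong[where f="integral {u..r}"]) (auto simp: algebra_simps simp flip: exp_add)
 then have I: "integral {u..r} (%x. G * exp (- G * (r - x)) * B x w) =
   G * exp (- G * r) * integral {u..r} (%x. exp (G * x) * B x w)" by simp
 have E: "exp (- G * (r - u)) * exp (- G * u) = exp (- G * r)" by (simp add: algebra_simps flip: exp_add)
 have "exp (- G * (r - u)) * OU G u w = sqrt (2 * G) * (exp (- G * (r - u)) * B u w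
   - G * (exp (- G * (r - u)) * exp (- G * u)) * exp_primitive G (%x. B x w) u)"
  unfolding OU_eq[OF w g] by (simp add: algebra_simps)
 then show ?thesis
  unfolding OU_eq[OF w g, of r] innovation_eq[OF w' ur] I E K by (simp add: algebra_simps)
qed

lemma OU_continuous:
 assumes w: "good_path w" and g: "0 < G"
 shows "continuous_on A (%u. OU G u w)"
proof -
 have w': "w \<in> space M" using w by (simp add: good_path_def)
 have "\<forall>u\<in>A. isCont (exp_primitive G (%x. B x w)) u"
  using exp_primitive_derivative[of "%x. B x w" G] w g B_continuous[OF w']
  by (auto simp: good_path_def intro: DERIV_isCont)
 then have "continuous_on A (exp_primitive G (%x. B x w))"
  by (rule continuous_at_imp_continuous_on)
 then show ?thesis unfolding OU_eq[OF w g] by (intro continuous_intros B_continuous[OF w'])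
qed

text \<open>The integrated Langevin equation. The discounted primitive Z solves Z' = B - G Z and the
  process equals sqrt(2G) Z', so its time integral is explicit.\<close>

lemma OU_integral_equation:
 assumes w: "good_path w" and g: "0 < G" and ur: "u \<le> r"
 shows "sqrt (2 * G) * (B r w - B u w) = OU G r w - OU G u w + G * (\<integral>x. indicator {u..r} x * OU G x w \<partial>lborel)"
proof -
 have w': "w \<in> space M" using w by (simp add: good_path_def)
 define Z where "Z x = exp (- G * x) * exp_primitive G (%x. B x w) x" for x
 have OU: "OU G x w = sqrt (2 * G) * (B x w - G * Z x)" for x by (simp add: OU_eq[OF w g] Z_def)
 have "(Z has_real_derivative B x w - G * Z x) (at x)" for x
 proof -
  have "(exp_primitive G (%x. B x w) has_real_derivative exp (G * x) * B x w) (at x)"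
   using exp_primitive_derivative[of "%x. B x w" G] w g B_continuous[OF w'] by (auto simp: good_path_def)
  then have "(Z has_real_derivative exp (- G * x) * - G * exp_primitive G (%x. B x w) x + exp (G * x) * B x w * exp (- G * x)) (at x)"
   unfolding Z_def by (auto intro!: derivative_eq_intros)
  moreover have "exp (G * x) * B x w * exp (- G * x) = B x w" by (simp add: exp_minus field_simps)
  ultimately have "(Z has_real_derivative exp (- G * x) * - G * exp_primitive G (%x. B x w) x + B x w) (at x)" by metis
  then show ?thesis by (simp add: Z_def mult_ac)
 qed
 then have "((%x. B x w - G * Z x) has_integral (Z r - Z u)) {u..r}"
  by (intro fundamental_theorem_of_calculus ur)
    (auto simp: has_real_derivative_iff_has_vector_derivative[symmetric] intro: DERIV_subset)
 then have "((%x. sqrt (2 * G) * (B x w - G * Z x)) has_integral sqrt (2 * G) * (Z r - Z u)) {u..r}"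
  by (rule has_integral_mult_right)
 then have "integral {u..r} (%x. OU G x w) = sqrt (2 * G) * (Z r - Z u)"
  unfolding OU by (rule integral_unique)
 moreover have "(\<integral>x. indicator {u..r} x * OU G x w \<partial>lborel) = integral {u..r} (%x. OU G x w)"
  by (rule lborel_integral_Icc_eq_integral) (rule OU_continuous[OF w g])
 ultimately have I: "(\<integral>x. indicator {u..r} x * OU G x w \<partial>lborel) = sqrt (2 * G) * (Z r - Z u)" by metis
 show ?thesis unfolding I unfolding OU by (simp add: algebra_simps)
qed

section \<open>Measurability of the process with respect to past and future\<close>

lemma measurable_past_joint'[measurable]:
 "(%(x, w). B (min x u) w - B u w) \<in> borel_measurable (lborel \<Otimes>\<^sub>M past u)"
 "(%(x, w). B (min x u) w - B u w) \<in> borel_measurable (borel \<Otimes>\<^sub>M past u)"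
 using measurable_past_joint[of u] by (simp_all cong: measurable_cong_sets)

lemma measurable_future_joint'[measurable]:
 "(%(x, w). B (max x u) w - B u w) \<in> borel_measurable (lborel \<Otimes>\<^sub>M future u)"
 "(%(x, w). B (max x u) w - B u w) \<in> borel_measurable (borel \<Otimes>\<^sub>M future u)"
 using measurable_future_joint[of u] by (simp_all cong: measurable_cong_sets)

lemma measurable_B_joint'[measurable]:
 "(%(x, w). B x w) \<in> borel_measurable (lborel \<Otimes>\<^sub>M M)"
 "(%(x, w). B x w) \<in> borel_measurable (borel \<Otimes>\<^sub>M M)"
 using measurable_B_joint by (simp_all cong: measurable_cong_sets)

text \<open>Time integrals of the process up to u have to be measurable for the past. Stopping at u
  and writing the integrand through differences of the form \<open>B (min t u) w - B u w\<close>
  keeps every ingredient there.\<close>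

lemma OU_past_joint: "(%(t, w). OU G (min t u) w) \<in> borel_measurable (borel \<Otimes>\<^sub>M past u)"
proof -
 have eq: "OU G (min t u) w = sqrt (2 * G) *
   (\<integral>x. (if x \<le> min t u then 1 else 0) * (G * exp (- G * (min t u - x)) *
    ((B (min t u) w - B u w) - (B (min x u) w - B u w))) \<partial>lborel)" for t w
  unfolding OU_def
  by (intro arg_cong[where f="(*) (sqrt (2 * G))"] Bochner_Integration.integral_cong refl)
    (auto simp: indicator_def)
 have m1: "(%q. B (min (fst (fst q)) u) (snd (fst q)) - B u (snd (fst q))) \<in> borel_measurable ((borel \<Otimes>\<^sub>M past u) \<Otimes>\<^sub>M lborel)"
  using measurable_compose[OF measurable_fst measurable_past_joint'(2)[of u]] by (simp add: case_prod_beta)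
 have m2: "(%q. B (min (snd q) u) (snd (fst q)) - B u (snd (fst q))) \<in> borel_measurable ((borel \<Otimes>\<^sub>M past u) \<Otimes>\<^sub>M lborel)"
 proof -
  have "(%q. (snd q, snd (fst q))) \<in> measurable ((borel \<Otimes>\<^sub>M past u) \<Otimes>\<^sub>M lborel) (borel \<Otimes>\<^sub>M past u)"
   by measurable
  from measurable_compose[OF this measurable_past_joint'(2)[of u]] show ?thesis by (simp add: case_prod_beta)
 qed
 have "(%(t, w). \<integral>x. (if x \<le> min t u then 1 else 0) * (G * exp (- G * (min t u - x)) *
    ((B (min t u) w - B u w) - (B (min x u) w - B u w))) \<partial>lborel) \<in> borel_measurable (borel \<Otimes>\<^sub>M past u)"
  unfolding case_prod_beta
 proof (rule lborel.borel_measurable_lebesgue_integral)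
  show "(%(p, x). (if x \<le> min (fst p) u then 1 else 0) * (G * exp (- G * (min (fst p) u - x)) *
    (B (min (fst p) u) (snd p) - B u (snd p) - (B (min x u) (snd p) - B u (snd p)))))
   \<in> borel_measurable ((borel \<Otimes>\<^sub>M past u) \<Otimes>\<^sub>M lborel)"
   unfolding case_prod_beta
   by (intro borel_measurable_times borel_measurable_diff[OF m1 m2]) measurable
 qed
 then show ?thesis unfolding eq case_prod_beta by measurable
qed

lemma OU_past_measurable: "t \<le> u ==> OU G t \<in> borel_measurable (past u)"
 using measurable_compose[OF measurable_Pair1' OU_past_joint[of G u], of t] by (simp add: min_absorb1)

lemma OU_measurable[measurable]: "OU G t \<in> borel_measurable M"
 using OU_past_measurable[of t t] by (intro measurable_past_M) auto

lemma OU_joint[measurable]: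
 "(%(t, w). OU G t w) \<in> borel_measurable (borel \<Otimes>\<^sub>M M)"
 "(%(t, w). OU G t w) \<in> borel_measurable (lborel \<Otimes>\<^sub>M M)"
proof -
 have "(%(t, w). \<integral>x. (if x \<le> t then 1 else 0) * (G * exp (- G * (t - x)) *
    (B t w - B x w)) \<partial>lborel) \<in> borel_measurable (borel \<Otimes>\<^sub>M M)"
  unfolding case_prod_beta
  by (rule lborel.borel_measurable_lebesgue_integral) measurable
 moreover have "OU G t w = sqrt (2 * G) * (\<integral>x. (if x \<le> t then 1 else 0) * (G * exp (- G * (t - x)) *
    (B t w - B x w)) \<partial>lborel)" for t w
  unfolding OU_def by (intro arg_cong[where f="(*) (sqrt (2 * G))"] Bochner_Integration.integral_cong refl)
    (auto simp: indicator_def)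
 ultimately show "(%(t, w). OU G t w) \<in> borel_measurable (borel \<Otimes>\<^sub>M M)"
  unfolding case_prod_beta by simp
 then show "(%(t, w). OU G t w) \<in> borel_measurable (lborel \<Otimes>\<^sub>M M)"
  by (simp cong: measurable_cong_sets)
qed

lemma innovation_future_measurable: "u \<le> r ==> innovation G u r \<in> borel_measurable (future u)"
proof -
 assume ur: "u \<le> r"
 have "(%w. \<integral>x. indicator {u..r} x * (G * exp (- G * (r - x)) * (B (max x u) w - B u w)) \<partial>lborel) \<in> borel_measurable (future u)"
 proof (rule lborel.borel_measurable_lebesgue_integral)
  have "(%q. (snd q, fst q)) \<in> measurable (future u \<Otimes>\<^sub>M lborel) (borel \<Otimes>\<^sub>M future u)" by measurable
  from measurable_compose[OF this measurable_future_joint'(2)[of u]]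
  have "(%q. B (max (snd q) u) (fst q) - B u (fst q)) \<in> borel_measurable (future u \<Otimes>\<^sub>M lborel)"
   by (simp add: case_prod_beta)
  then show "(%(w, x). indicator {u..r} x * (G * exp (- G * (r - x)) * (B (max x u) w - B u w)))
   \<in> borel_measurable (future u \<Otimes>\<^sub>M lborel)"
   unfolding case_prod_beta by (intro borel_measurable_times) measurable
 qed
 moreover have "(\<integral>x. indicator {u..r} x * (G * exp (- G * (r - x)) * (B (max x u) w - B u w)) \<partial>lborel)
   = (\<integral>x. indicator {u..r} x * (G * exp (- G * (r - x)) * (B x w - B u w)) \<partial>lborel)" for w
  by (intro Bochner_Integration.integral_cong refl) (auto simp: indicator_def max_def)
 ultimately have "(%w. \<integral>x. indicator {u..r} x * (G * exp (- G * (r - x)) * (B x w - B u w)) \<partial>lborel) \<in> borel_measurable (future u)"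
  by (simp only:)
 then show ?thesis
  unfolding innovation_def using ur by (intro borel_measurable_diff[OF measurable_future_increment]) auto
qed

lemma innovation_measurable[measurable]: "u \<le> r ==> innovation G u r \<in> borel_measurable M"
 by (rule measurable_future_M[OF innovation_future_measurable])

text \<open>One cell of a Riemann-Stieltjes sum: freezing the exponential at the left end costs the
  integral of G exp(-G(r - x)) (B c - B x), which the oscillation of the path on the cell
  controls.\<close>

lemma innovation_cocycle_bound:
 assumes w: "w \<in> space M" and uv: "a \<le> c" "c \<le> r" and g: "0 < G"
  and osc: "\<And>x. x \<in> {a..c} ==> \<bar>B c w - B x w\<bar> \<le> e"
 shows "\<bar>(exp (- G * (r - c)) * B c w - exp (- G * (r - a)) * B a w - integral {a..c} (%x. G * exp (- G * (r - x)) * B x w))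
   - exp (- G * (r - a)) * (B c w - B a w)\<bar> \<le> G * e * (c - a)"
proof -
 note c = B_continuous[OF w]
 have "integral {a..c} (%x. G * exp (- G * (r - x)) * (B c w - B x w)) =
   integral {a..c} (%x. G * exp (- G * (r - x)) * B c w - G * exp (- G * (r - x)) * B x w)"
  by (intro arg_cong[where f="integral {a..c}"]) (auto simp: algebra_simps)
 also have "... = integral {a..c} (%x. G * exp (- G * (r - x)) * B c w)
  - integral {a..c} (%x. G * exp (- G * (r - x)) * B x w)"
  by (intro Henstock_Kurzweil_Integration.integral_diff integrable_continuous_interval continuous_intros c)
 also have "integral {a..c} (%x. G * exp (- G * (r - x)) * B c w) = (exp (- G * (r - c)) - exp (- G * (r - a))) * B c w"
  using integral_gexp[OF uv(1), of G r] by (simp del: integral_mult_right)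
 finally have "(exp (- G * (r - c)) * B c w - exp (- G * (r - a)) * B a w - integral {a..c} (%x. G * exp (- G * (r - x)) * B x w))
   - exp (- G * (r - a)) * (B c w - B a w) = integral {a..c} (%x. G * exp (- G * (r - x)) * (B c w - B x w))"
  by (simp add: algebra_simps)
 moreover have "norm (integral {a..c} (%x. G * exp (- G * (r - x)) * (B c w - B x w))) \<le> (G * e) * (c - a)"
 proof (rule integral_bound[OF uv(1)])
  show "continuous_on {a..c} (%x. G * exp (- G * (r - x)) * (B c w - B x w))" by (intro continuous_intros c)
  fix x assume x: "x \<in> {a..c}"
  have "\<bar>exp (- G * (r - x)) * (B c w - B x w)\<bar> \<le> 1 * e"
   unfolding abs_mult using x uv g by (intro mult_mono osc) (auto simp: mult_nonneg_nonneg)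
  then show "norm (G * exp (- G * (r - x)) * (B c w - B x w)) \<le> G * e"
   using g by (simp add: abs_mult mult.assoc)
 qed
 ultimately show ?thesis by simp
qed

text \<open>Riemann-Stieltjes sums on uniform grids are sums of independent centred normals and
  converge on every path, so only their variance has to be followed to the limit.\<close>

lemma innovation_distributed:
 assumes g: "0 < G" and ur: "u < r"
 shows "distributed M lborel (innovation G u r)
   (normal_density 0 (sqrt ((1 - exp (- 2 * G * (r - u))) / (2 * G))))"
proof -
 define h where "h n = (r - u) / real (Suc n)" for n
 define \<tau> where "\<tau> n i = u + real i * h n" for n i
 have h: "0 < h n" for n using ur by (simp add: h_def)
 have hN: "real (Suc n) * h n = r - u" for n by (simp add: h_def del: of_nat_Suc)
 have \<tau>S: "\<tau> n (Suc i) = \<tau> n i + h n" for n i by (simp add: \<tau>_def algebra_simps)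
 have \<tau>0: "\<tau> n 0 = u" and \<tau>N: "\<tau> n (Suc n) = r" for n using hN[of n] by (simp_all add: \<tau>_def)
 have \<tau>mono: "\<tau> n i < \<tau> n j" if "i < j" for n i j using h that by (simp add: \<tau>_def)
 have \<tau>r: "\<tau> n i \<le> r" if "i \<le> Suc n" for n i
  using \<tau>mono[of i "Suc n" n] \<tau>N[of n] that by (cases "i = Suc n") auto
 have \<tau>u: "u \<le> \<tau> n i" for n i using h[of n] by (simp add: \<tau>_def)
 define X where "X n w = (\<Sum>i<Suc n. exp (- G * (r - \<tau> n i)) * (B (\<tau> n (Suc i)) w - B (\<tau> n i) w))" for n w
 define \<sigma> where "\<sigma> n = sqrt (\<Sum>i<Suc n. (exp (- G * (r - \<tau> n i)) * sqrt (h n))\<^sup>2)" for n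
 have X: "distributed M lborel (X n) (normal_density 0 (\<sigma> n))" for n
 proof -
  have "indep_vars (%_. borel) (%i w. B (\<tau> n (Suc i)) w - B (\<tau> n i) w) {..<Suc n}"
   by (rule B_indep) (auto simp: strict_mono_on_def intro: \<tau>mono)
  then have ind: "indep_vars (%_. borel) (%i w. exp (- G * (r - \<tau> n i)) * (B (\<tau> n (Suc i)) w - B (\<tau> n i) w)) {..<Suc n}"
   by (rule indep_vars_compose2) measurable
  have "distributed M lborel (%x. \<Sum>i<Suc n. exp (- G * (r - \<tau> n i)) * (B (\<tau> n (Suc i)) x - B (\<tau> n i) x))
    (normal_density (\<Sum>i<Suc n. 0) (sqrt (\<Sum>i<Suc n. (exp (- G * (r - \<tau> n i)) * sqrt (h n))\<^sup>2)))"
  proof (rule sum_indep_normal[OF _ _ ind])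
   fix i
   have "distributed M lborel (%w. B (\<tau> n (Suc i)) w - B (\<tau> n i) w) (normal_density 0 (sqrt (h n)))"
    using B_increment[OF \<tau>mono[of i "Suc i" n]] by (simp add: \<tau>S)
   from normal_density_affine[OF this, of "exp (- G * (r - \<tau> n i))" 0]
   show "distributed M lborel (%w. exp (- G * (r - \<tau> n i)) * (B (\<tau> n (Suc i)) w - B (\<tau> n i) w))
     (normal_density 0 (exp (- G * (r - \<tau> n i)) * sqrt (h n)))" using h[of n] by simp
  qed (use h in auto)
  then show ?thesis by (simp add: X_def[abs_def] \<sigma>_def)
 qed
 \<comment> \<open>On a uniform grid the squared weights form a geometric progression with ratio
   exp(2 G h).\<close>
 have sum: "(\<Sum>i<Suc n. (exp (- G * (r - \<tau> n i)) * sqrt (h n))\<^sup>2) = (1 - exp (- 2 * G * (r - u))) * (h n / (exp (2 * G * h n) - 1))" for n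
 proof -
  have "(exp (- G * (r - \<tau> n i)) * sqrt (h n))\<^sup>2 = (exp (- 2 * G * (r - u)) * h n) * exp (2 * G * h n) ^ i" for i
  proof -
   have "(exp (- G * (r - \<tau> n i)))\<^sup>2 = exp (- 2 * G * (r - u)) * exp (2 * G * h n) ^ i"
    by (simp add: \<tau>_def power2_eq_square algebra_simps flip: exp_add exp_of_nat_mult)
   then show ?thesis using h[of n] by (simp add: power_mult_distrib)
  qed
  then have "(\<Sum>i<Suc n. (exp (- G * (r - \<tau> n i)) * sqrt (h n))\<^sup>2) =
   (exp (- 2 * G * (r - u)) * h n) * (\<Sum>i<Suc n. exp (2 * G * h n) ^ i)" by (simp only: sum_distrib_left)
  also have "exp (2 * G * h n) \<noteq> 1" using g h[of n] by simp
  then have "(\<Sum>i<Suc n. exp (2 * G * h n) ^ i) = (exp (2 * G * h n) ^ Suc n - 1) / (exp (2 * G * h n) - 1)"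
   by (rule geometric_sum)
  also have "exp (2 * G * h n) ^ Suc n = exp (2 * G * (r - u))"
  proof -
   have "exp (2 * G * h n) ^ Suc n = exp (real (Suc n) * (2 * G * h n))" by (simp only: exp_of_nat_mult)
   also have "real (Suc n) * (2 * G * h n) = 2 * G * (r - u)" using hN[of n] by (metis mult.left_commute)
   finally show ?thesis .
  qed
  also have "(exp (- 2 * G * (r - u)) * h n) * ((exp (2 * G * (r - u)) - 1) / (exp (2 * G * h n) - 1))
   = (exp (- 2 * G * (r - u)) * exp (2 * G * (r - u)) - exp (- 2 * G * (r - u))) * (h n / (exp (2 * G * h n) - 1))"
   by (simp add: algebra_simps diff_divide_distrib)
  also have "exp (- 2 * G * (r - u)) * exp (2 * G * (r - u)) = 1" by (simp flip: exp_add)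
  finally show ?thesis .
 qed
 have hlim: "h \<longlonglongrightarrow> 0"
  unfolding h_def using tendsto_mult_right_zero[OF LIMSEQ_inverse_real_of_nat, of "r - u"]
  by (simp add: divide_inverse)
 have hne: "h n \<noteq> 0" for n using h[of n] by simp
 have "((%y. (exp (2 * G * y) - 1) / y) \<longlongrightarrow> 2 * G) (at 0)"
 proof -
  have "((%y. exp (2 * G * y)) has_real_derivative 2 * G) (at 0)"
   by (auto intro!: derivative_eq_intros)
  then show ?thesis by (simp add: has_field_derivative_iff)
 qed
 then have "(%n. (exp (2 * G * h n) - 1) / h n) \<longlonglongrightarrow> 2 * G"
  by (rule filterlim_compose) (use hlim in \<open>auto simp: filterlim_at hne intro!: always_eventually\<close>)
 from tendsto_inverse[OF this] have "(%n. h n / (exp (2 * G * h n) - 1)) \<longlonglongrightarrow> inverse (2 * G)" using g by simp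
 then have lim: "(%n. sqrt ((1 - exp (- 2 * G * (r - u))) * (h n / (exp (2 * G * h n) - 1))))
   \<longlonglongrightarrow> sqrt ((1 - exp (- 2 * G * (r - u))) * inverse (2 * G))"
  by (intro tendsto_intros)
 have "\<sigma> = (%n. sqrt ((1 - exp (- 2 * G * (r - u))) * (h n / (exp (2 * G * h n) - 1))))"
  unfolding \<sigma>_def sum ..
 with lim have \<sigma>lim: "\<sigma> \<longlonglongrightarrow> sqrt ((1 - exp (- 2 * G * (r - u))) / (2 * G))"
  by (simp only: divide_inverse)
 have spos: "0 < sqrt ((1 - exp (- 2 * G * (r - u))) / (2 * G))" using g ur by (simp add: mult_neg_pos)
 have \<sigma>pos: "0 < \<sigma> n" for n unfolding \<sigma>_def using h[of n]
  by (intro real_sqrt_gt_zero sum_pos) auto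
 have pathlim: "(%n. X n w) \<longlonglongrightarrow> innovation G u r w" if w: "w \<in> space M" for w
 proof (rule LIMSEQ_I)
  fix e :: real assume e: "0 < e"
  \<comment> \<open>Chosen so that the cell errors, at most G e' (r - u) in total, add up to
    e/2.\<close>
  define e' where "e' = e / (2 * G * (r - u))"
  have e': "0 < e'" using e g ur by (simp add: e'_def)
  have "uniformly_continuous_on {u..r} (%x. B x w)"
   by (intro compact_uniformly_continuous B_continuous[OF w] compact_Icc)
  then obtain d where d: "0 < d" "\<And>x y. x \<in> {u..r} ==> y \<in> {u..r} ==> dist y x < d ==> dist (B y w) (B x w) < e'"
   unfolding uniformly_continuous_on_def using e' by metis
  from hlim d(1) obtain N where N: "\<And>n. n \<ge> N ==> h n < d"
   using LIMSEQ_D[OF hlim d(1)] h by (auto simp: abs_of_pos)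
  have "norm (X n w - innovation G u r w) < e" if n: "n \<ge> N" for n
  proof -
   \<comment> \<open>The innovation is F r - F u, which telescopes over the grid and can be compared
     with X cell by cell.\<close>
   define F where "F x = exp (- G * (r - x)) * B x w - integral {u..x} (%x. G * exp (- G * (r - x)) * B x w)" for x
   have Fd: "F c - F a = exp (- G * (r - c)) * B c w - exp (- G * (r - a)) * B a w
     - integral {a..c} (%x. G * exp (- G * (r - x)) * B x w)" if "u \<le> a" "a \<le> c" for a c
   proof -
    have "integral {u..a} (%x. G * exp (- G * (r - x)) * B x w) + integral {a..c} (%x. G * exp (- G * (r - x)) * B x w)
     = integral {u..c} (%x. G * exp (- G * (r - x)) * B x w)"
     using that by (intro Henstock_Kurzweil_Integration.integral_combine integrable_continuous_interval continuous_intros B_continuous[OF w])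
    then show ?thesis by (simp add: F_def)
   qed
   have "innovation G u r w = F r - F u"
    using Fd[of u r] ur innovation_eq[OF w, of u r G] by simp
   also have "... = (\<Sum>i<Suc n. F (\<tau> n (Suc i)) - F (\<tau> n i))"
    by (simp only: sum_lessThan_telescope[of "%i. F (\<tau> n i)" "Suc n"] \<tau>0 \<tau>N)
   finally have "X n w - innovation G u r w = - (\<Sum>i<Suc n. (F (\<tau> n (Suc i)) - F (\<tau> n i))
     - exp (- G * (r - \<tau> n i)) * (B (\<tau> n (Suc i)) w - B (\<tau> n i) w))"
    by (simp only: X_def sum_subtractf)
   then have "norm (X n w - innovation G u r w) \<le> (\<Sum>i<Suc n. \<bar>(F (\<tau> n (Suc i)) - F (\<tau> n i))
     - exp (- G * (r - \<tau> n i)) * (B (\<tau> n (Suc i)) w - B (\<tau> n i) w)\<bar>)"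
    by (simp only: real_norm_def abs_minus_cancel sum_abs)
   also have "... \<le> (\<Sum>i<Suc n. G * e' * h n)"
   proof (rule sum_mono)
    fix i assume i: "i \<in> {..<Suc n}"
    have le: "\<tau> n i \<le> \<tau> n (Suc i)" "\<tau> n (Suc i) \<le> r" using i \<tau>mono[of i "Suc i" n] \<tau>r[of "Suc i" n] by auto
    have osc: "\<bar>B (\<tau> n (Suc i)) w - B x w\<bar> \<le> e'" if x: "x \<in> {\<tau> n i..\<tau> n (Suc i)}" for x
    proof -
     have "dist (B (\<tau> n (Suc i)) w) (B x w) < e'"
     proof (rule d(2))
      show "x \<in> {u..r}" "\<tau> n (Suc i) \<in> {u..r}" using x le \<tau>u[of n i] by auto
      show "dist (\<tau> n (Suc i)) x < d" using x N[OF n] \<tau>S[of n i] by (auto simp: dist_real_def)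
     qed
     then show ?thesis by (simp add: dist_real_def)
    qed
    show "\<bar>(F (\<tau> n (Suc i)) - F (\<tau> n i))
     - exp (- G * (r - \<tau> n i)) * (B (\<tau> n (Suc i)) w - B (\<tau> n i) w)\<bar> \<le> G * e' * h n"
     using innovation_cocycle_bound[OF w le g osc] unfolding Fd[OF \<tau>u le(1)] by (simp add: \<tau>S)
   qed
   also have "... = G * e' * (real (Suc n) * h n)" by simp
   also have "G * e' * (real (Suc n) * h n) = e / 2"
   proof -
    have "G * (e / (2 * G * d)) * d = e / 2" if "0 < d" for d :: real using g that by simp
    from this[of "r - u"] show ?thesis unfolding hN e'_def using ur by simp
   qed
   also have "... < e" using e by simp
   finally show ?thesis .
  qed
  then show "\<exists>no. \<forall>n\<ge>no. norm (X n w - innovation G u r w) < e" by blast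
 qed
 show ?thesis
 proof (rule normal_limit[where X=X and R="%_ _. 0", OF X \<sigma>pos \<sigma>lim spos])
  show "AE w in M. (%n. X n w - 0) \<longlonglongrightarrow> innovation G u r w" using pathlim by auto
 qed (use ur in auto)
qed

end

section \<open>Time integrals of processes\<close>

text \<open>A Lebesgue integral with an indicator, so that Fubini applies to processes; for
  continuous integrands it equals the gauge integral, which brings in the fundamental theorem. Its
  value is 0 when b < a.\<close>

definition time_integral :: "real => real => (real => real) => real" where
 "time_integral a b f = (\<integral>s. indicator {a..b} s * f s \<partial>lborel)"

lemma time_integral_cong: "(\<And>s. a \<le> s ==> s \<le> b ==> f s = g s) ==> time_integral a b f = time_integral a b g"
 unfolding time_integral_def by (intro Bochner_Integration.integral_cong refl) (auto simp: indicator_def)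

lemma time_integral_eq_integral: "continuous_on {a..b} f ==> time_integral a b f = integral {a..b} f"
 unfolding time_integral_def by (rule lborel_integral_Icc_eq_integral)

lemma time_integral_const[simp]: "a \<le> b ==> time_integral a b (%_. c) = c * (b - a)"
 by (subst time_integral_eq_integral) auto

lemma time_integral_cmult[simp]: "time_integral a b (%s. c * f s) = c * time_integral a b f"
 unfolding time_integral_def by (simp add: mult.left_commute)

lemma time_integral_refl[simp]: "time_integral a a f = 0"
 unfolding time_integral_def
proof -
 have "(\<integral>s. indicator {a..a} s * f s \<partial>lborel) = (\<integral>s. f a * indicator {a..a} s \<partial>lborel)"
  by (intro Bochner_Integration.integral_cong refl) (auto simp: indicator_def)
 then show "(\<integral>s. indicator {a..a} s * f s \<partial>lborel) = 0" by simp
qed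

lemma time_integrable_bounded:
 fixes f :: "real => real"
 assumes [measurable]: "f \<in> borel_measurable borel" and bd: "\<And>s. a \<le> s ==> s \<le> b ==> \<bar>f s\<bar> \<le> C"
 shows "integrable lborel (%s. indicator {a..b} s * f s)"
proof (rule Bochner_Integration.integrable_bound)
 show "integrable lborel (%s. C * indicator {a..b} s :: real)" by (intro integrable_mult_right integrable_real_indicator) (auto simp: emeasure_lborel_Icc_eq)
 show "AE s in lborel. norm (indicator {a..b} s * f s) \<le> norm (C * indicator {a..b} s)"
 proof (rule AE_I2)
  fix s show "norm (indicator {a..b} s * f s) \<le> norm (C * indicator {a..b} s)"
   using bd[of s] by (auto simp: indicator_def)
 qed
qed measurable

lemma time_integral_mono:
 assumes "integrable lborel (%s. indicator {a..b} s * f s)" "integrable lborel (%s. indicator {a..b} s * g s)"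
  and "\<And>s. a \<le> s ==> s \<le> b ==> f s \<le> g s"
 shows "time_integral a b f \<le> time_integral a b g"
 unfolding time_integral_def
 by (rule integral_mono[OF assms(1,2)]) (auto simp: indicator_def assms(3))

lemma abs_time_integral_le:
 assumes "integrable lborel (%s. indicator {a..b} s * g s)"
  and "\<And>s. a \<le> s ==> s \<le> b ==> \<bar>f s\<bar> \<le> g s"
 shows "\<bar>time_integral a b f\<bar> \<le> time_integral a b g"
proof -
 have "\<bar>time_integral a b f\<bar> \<le> (\<integral>s. norm (indicator {a..b} s * f s) \<partial>lborel)"
  unfolding time_integral_def using integral_norm_bound[of lborel "%s. indicator {a..b} s * f s"] by simp
 also have "... \<le> time_integral a b g"
  unfolding time_integral_def
  by (rule Bochner_Integration.integral_mono'[OF assms(1)]) (use assms(2) order_trans[OF abs_ge_zero assms(2)] in \<open>auto simp: indicator_def abs_mult\<close>)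
 finally show ?thesis .
qed

lemma abs_time_integral_le_const:
 assumes "a \<le> b" "\<And>s. a \<le> s ==> s \<le> b ==> \<bar>f s\<bar> \<le> C"
 shows "\<bar>time_integral a b f\<bar> \<le> C * (b - a)"
 using abs_time_integral_le[of a b "%_. C" f] time_integrable_bounded[of "%_. C" a b "\<bar>C\<bar>"] assms by simp

lemma time_integral_add:
 assumes "integrable lborel (%s. indicator {a..b} s * f s)" "integrable lborel (%s. indicator {a..b} s * g s)"
 shows "time_integral a b (%s. f s + g s) = time_integral a b f + time_integral a b g"
 unfolding time_integral_def using assms by (simp add: distrib_left)

lemma time_integral_diff:
 assumes "integrable lborel (%s. indicator {a..b} s * f s)" "integrable lborel (%s. indicator {a..b} s * g s)"
 shows "time_integral a b (%s. f s - g s) = time_integral a b f - time_integral a b g"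
 unfolding time_integral_def using assms by (simp add: right_diff_distrib)

lemma time_integral_sum:
 assumes "\<And>i. i \<in> I ==> integrable lborel (%s. indicator {a..b} s * f i s)"
 shows "time_integral a b (%s. \<Sum>i\<in>I. f i s) = (\<Sum>i\<in>I. time_integral a b (f i))"
 unfolding time_integral_def sum_distrib_left using assms by (subst Bochner_Integration.integral_sum) auto

lemma time_integrable_subinterval:
 fixes f :: "real => real"
 assumes "integrable lborel (%s. indicator {a..b} s * f s)" "a \<le> c" "d \<le> b"
 shows "integrable lborel (%s. indicator {c..d} s * f s)"
proof -
 have "integrable lborel (%s. indicator {c..d} s *\<^sub>R (indicator {a..b} s * f s))"
  by (rule integrable_mult_indicator[OF _ assms(1)]) simp
 moreover have "indicator {c..d} s *\<^sub>R (indicator {a..b} s * f s) = indicator {c..d} s * f s" for s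
  using assms(2,3) by (auto simp: indicator_def)
 ultimately show ?thesis by (simp only:)
qed

lemma time_integral_combine:
 assumes "a \<le> c" "c \<le> b" "integrable lborel (%s. indicator {a..b} s * f s)"
 shows "time_integral a b f = time_integral a c f + time_integral c b f"
proof -
 have 1: "integrable lborel (%s. indicator {a..c} s * f s)"
  and 2: "integrable lborel (%s. indicator {c..b} s * f s)"
  using assms by (auto intro: time_integrable_subinterval)
 have "time_integral a b f = (\<integral>s. indicator {a..c} s * f s + indicator {c..b} s * f s \<partial>lborel)"
  unfolding time_integral_def
 proof (rule integral_cong_AE)
  show "AE s in lborel. indicator {a..b} s * f s = indicator {a..c} s * f s + indicator {c..b} s * f s"
   using AE_lborel_singleton[of c] by eventually_elim (use assms(1,2) in \<open>auto simp: indicator_def\<close>)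
 qed (use 1 2 assms(3) in \<open>auto intro!: borel_measurable_add\<close>)
 then show ?thesis using 1 2 by (simp add: time_integral_def)
qed

text \<open>Convexity of the power in tangent form, the pointwise input for Jensen's
  inequality.\<close>

lemma power_tangent_le:
 fixes c y :: real assumes "0 \<le> c" "0 \<le> y"
 shows "c ^ p + real p * c ^ (p - 1) * (y - c) \<le> y ^ p"
proof (induction p)
 case (Suc p)
 have "c ^ Suc p + real (Suc p) * c ^ p * (y - c) = c * c ^ p + real p * (c ^ p * (y - c)) + c ^ p * (y - c)"
  by (simp add: algebra_simps)
 also have "real p * (c ^ p * (y - c)) \<le> real p * c ^ (p - 1) * (y - c) * y"
 proof (cases p)
  case (Suc k)
  have "c * (y - c) \<le> y * (y - c)" using zero_le_square[of "y - c"] by (simp add: algebra_simps)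
  then have "c ^ k * (c * (y - c)) \<le> c ^ k * (y * (y - c))" by (intro mult_left_mono) (auto simp: assms)
  then have "real (Suc k) * (c ^ k * (c * (y - c))) \<le> real (Suc k) * (c ^ k * (y * (y - c)))"
   by (rule mult_left_mono) simp
  then show ?thesis unfolding Suc by (simp add: mult_ac del: of_nat_Suc)
 qed simp
 finally have "c ^ Suc p + real (Suc p) * c ^ p * (y - c) \<le> y * (c ^ p + real p * c ^ (p - 1) * (y - c))"
  by (simp add: algebra_simps)
 also have "... \<le> y * y ^ p" by (intro mult_left_mono Suc assms)
 finally show ?case by simp
qed simp

text \<open>Jensen's inequality for normalised Lebesgue measure: the tangent at the mean value c is
  integrated.\<close>

lemma time_integral_power_le:
 assumes ab: "a < b" and p: "0 < p" and nn: "\<And>s. 0 \<le> f s"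
  and i1: "integrable lborel (%s. indicator {a..b} s * f s)" and ip: "integrable lborel (%s. indicator {a..b} s * f s ^ p)"
 shows "time_integral a b f ^ p \<le> (b - a) ^ (p - 1) * time_integral a b (%s. f s ^ p)"
proof -
 define c where "c = time_integral a b f / (b - a)"
 have c: "0 \<le> c" unfolding c_def time_integral_def using ab nn by (intro divide_nonneg_pos Bochner_Integration.integral_nonneg) auto
 have N: "time_integral a b f = c * (b - a)" using ab by (simp add: c_def)
 have ic: "integrable lborel (%s. indicator {a..b} s * d)" for d :: real
  by (rule time_integrable_bounded[where C="\<bar>d\<bar>"]) auto
 have "c ^ p * (b - a) = time_integral a b (%s. (c ^ p - real p * c ^ (p - 1) * c) + real p * c ^ (p - 1) * f s)"
 proof -
  have "integrable lborel (%s. indicator {a..b} s * (real p * c ^ (p - 1) * f s))"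
   using integrable_mult_right[OF i1, of "real p * c ^ (p - 1)"] by (simp add: mult_ac)
  then have "time_integral a b (%s. (c ^ p - real p * c ^ (p - 1) * c) + real p * c ^ (p - 1) * f s)
    = (c ^ p - real p * c ^ (p - 1) * c) * (b - a) + real p * c ^ (p - 1) * (c * (b - a))"
   using ab by (simp only: time_integral_add[OF ic] time_integral_cmult N time_integral_const less_imp_le)
  then show ?thesis by (simp add: algebra_simps)
 qed
 also have "... \<le> time_integral a b (%s. f s ^ p)"
 proof (rule time_integral_mono)
  have "integrable lborel (%s. indicator {a..b} s * (c ^ p - real p * c ^ (p - 1) * c) + (real p * c ^ (p - 1)) * (indicator {a..b} s * f s))"
   by (intro Bochner_Integration.integrable_add integrable_mult_right ic i1)
  then show "integrable lborel (%s. indicator {a..b} s * ((c ^ p - real p * c ^ (p - 1) * c) + real p * c ^ (p - 1) * f s))"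
   by (simp add: algebra_simps)
  fix s show "(c ^ p - real p * c ^ (p - 1) * c) + real p * c ^ (p - 1) * f s \<le> f s ^ p"
   using power_tangent_le[OF c nn[of s], of p] by (simp add: algebra_simps)
 qed (rule ip)
 finally have "(b - a) ^ (p - 1) * (c ^ p * (b - a)) \<le> (b - a) ^ (p - 1) * time_integral a b (%s. f s ^ p)"
  using ab by (intro mult_left_mono) auto
 moreover have "(b - a) ^ (p - 1) * (c ^ p * (b - a)) = time_integral a b f ^ p"
  unfolding N power_mult_distrib using p by (cases p) auto
 ultimately show ?thesis by simp
qed

text \<open>Moments bounded uniformly in time are what Fubini asks for on a compact interval; the
  property passes to sums, products, polynomials and time integrals, so it can be carried through
  the whole moment calculus.\<close>

definition unif_moments :: "'a measure => 'i set => ('i => 'a => real) => bool" where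
 "unif_moments M S Y \<longleftrightarrow> (\<forall>s\<in>S. abs_moments M (Y s)) \<and>
   (\<forall>p::nat. \<exists>C. \<forall>s\<in>S. (\<integral>w. \<bar>Y s w\<bar> ^ p \<partial>M) \<le> C)"

lemma abs_moments_integrable_power: "abs_moments M V ==> integrable M (%w. \<bar>V w\<bar> ^ p)"
 by (simp add: abs_moments_def)

lemma unif_moments_D: "unif_moments M S Y ==> s \<in> S ==> abs_moments M (Y s)"
 by (simp add: unif_moments_def)

lemma unif_moments_const: "abs_moments M V ==> unif_moments M S (%_. V)"
 unfolding unif_moments_def by auto

lemma unif_moments_mono:
 assumes W: "unif_moments M S W" and Y: "\<And>s. s \<in> S ==> Y s \<in> borel_measurable M"
  and le: "\<And>s. s \<in> S ==> AE w in M. \<bar>Y s w\<bar> \<le> \<bar>W s w\<bar>"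
 shows "unif_moments M S Y"
 unfolding unif_moments_def
proof (intro conjI ballI allI)
 fix s assume "s \<in> S" then show "abs_moments M (Y s)"
  using abs_moments_mono[OF unif_moments_D[OF W] Y le] by blast
next
 fix p
 obtain C where C: "\<And>s. s \<in> S ==> (\<integral>w. \<bar>W s w\<bar> ^ p \<partial>M) \<le> C" using W unfolding unif_moments_def by blast
 have "(\<integral>w. \<bar>Y s w\<bar> ^ p \<partial>M) \<le> C" if s: "s \<in> S" for s
 proof -
  have "(\<integral>w. \<bar>Y s w\<bar> ^ p \<partial>M) \<le> (\<integral>w. \<bar>W s w\<bar> ^ p \<partial>M)"
  proof (rule integral_mono_AE)
   show "AE w in M. \<bar>Y s w\<bar> ^ p \<le> \<bar>W s w\<bar> ^ p" using le[OF s] by eventually_elim (simp add: power_mono)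
  qed (use abs_moments_mono[OF unif_moments_D[OF W s] Y[OF s] le[OF s]] unif_moments_D[OF W s]
     in \<open>auto intro: abs_moments_integrable_power\<close>)
  also have "... \<le> C" by (rule C[OF s])
  finally show ?thesis .
 qed
 then show "\<exists>C. \<forall>s\<in>S. (\<integral>w. \<bar>Y s w\<bar> ^ p \<partial>M) \<le> C" by blast
qed

context prob_space
begin

lemma unif_moments_mult:
 assumes "unif_moments M S Y" "unif_moments M S W"
 shows "unif_moments M S (%s w. Y s w * W s w)"
 unfolding unif_moments_def
proof (intro conjI ballI allI)
 fix s assume "s \<in> S" then show "abs_moments M (%w. Y s w * W s w)"
  using assms by (intro abs_moments_mult unif_moments_D[of M S])
next
 fix p
 obtain C where C: "\<And>s. s \<in> S ==> (\<integral>w. \<bar>Y s w\<bar> ^ (2 * p) \<partial>M) \<le> C" using assms(1) unfolding unif_moments_def by blast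
 obtain C' where C': "\<And>s. s \<in> S ==> (\<integral>w. \<bar>W s w\<bar> ^ (2 * p) \<partial>M) \<le> C'" using assms(2) unfolding unif_moments_def by blast
 have "(\<integral>w. \<bar>Y s w * W s w\<bar> ^ p \<partial>M) \<le> C + C'" if s: "s \<in> S" for s
 proof -
  have my: "abs_moments M (Y s)" and mw: "abs_moments M (W s)" using assms s by (auto intro: unif_moments_D)
  have "(\<integral>w. \<bar>Y s w * W s w\<bar> ^ p \<partial>M) \<le> (\<integral>w. \<bar>Y s w\<bar> ^ (2 * p) + \<bar>W s w\<bar> ^ (2 * p) \<partial>M)"
  proof (rule integral_mono)
   fix w
   define a b where "a = \<bar>Y s w\<bar> ^ p" "b = \<bar>W s w\<bar> ^ p"
   have "0 \<le> (a - b)\<^sup>2" "0 \<le> a * b" by (auto simp: a_b_def)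
   then have "a * b \<le> a\<^sup>2 + b\<^sup>2" by (simp add: power2_diff)
   moreover have "\<bar>Y s w * W s w\<bar> ^ p = a * b" by (simp add: abs_mult power_mult_distrib a_b_def)
   moreover have "\<bar>Y s w\<bar> ^ (2 * p) = a\<^sup>2" "\<bar>W s w\<bar> ^ (2 * p) = b\<^sup>2"
    by (simp_all only: a_b_def power_mult[symmetric] mult.commute)
   ultimately show "\<bar>Y s w * W s w\<bar> ^ p \<le> \<bar>Y s w\<bar> ^ (2 * p) + \<bar>W s w\<bar> ^ (2 * p)" by simp
  qed (intro abs_moments_integrable_power abs_moments_mult my mw Bochner_Integration.integrable_add)+
  also have "... = (\<integral>w. \<bar>Y s w\<bar> ^ (2 * p) \<partial>M) + (\<integral>w. \<bar>W s w\<bar> ^ (2 * p) \<partial>M)"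
   by (intro Bochner_Integration.integral_add abs_moments_integrable_power my mw)
  also have "... \<le> C + C'" by (intro add_mono C C' s)
  finally show ?thesis .
 qed
 then show "\<exists>C. \<forall>s\<in>S. (\<integral>w. \<bar>Y s w * W s w\<bar> ^ p \<partial>M) \<le> C" by blast
qed

lemma unif_moments_add:
 assumes "unif_moments M S Y" "unif_moments M S W"
 shows "unif_moments M S (%s w. Y s w + W s w)"
 unfolding unif_moments_def
proof (intro conjI ballI allI)
 fix s assume "s \<in> S" then show "abs_moments M (%w. Y s w + W s w)"
  using assms by (intro abs_moments_add unif_moments_D[of M S])
next
 fix p
 obtain C where C: "\<And>s. s \<in> S ==> (\<integral>w. \<bar>Y s w\<bar> ^ p \<partial>M) \<le> C" using assms(1) unfolding unif_moments_def by blast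
 obtain C' where C': "\<And>s. s \<in> S ==> (\<integral>w. \<bar>W s w\<bar> ^ p \<partial>M) \<le> C'" using assms(2) unfolding unif_moments_def by blast
 have "(\<integral>w. \<bar>Y s w + W s w\<bar> ^ p \<partial>M) \<le> 2 ^ p * (C + C')" if s: "s \<in> S" for s
 proof -
  have my: "abs_moments M (Y s)" and mw: "abs_moments M (W s)" using assms s by (auto intro: unif_moments_D)
  have "(\<integral>w. \<bar>Y s w + W s w\<bar> ^ p \<partial>M) \<le> (\<integral>w. 2 ^ p * (\<bar>Y s w\<bar> ^ p + \<bar>W s w\<bar> ^ p) \<partial>M)"
  proof (rule integral_mono)
   fix w
   have "\<bar>Y s w + W s w\<bar> ^ p \<le> (\<bar>Y s w\<bar> + \<bar>W s w\<bar>) ^ p" by (intro power_mono) auto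
   also have "... \<le> 2 ^ p * (\<bar>Y s w\<bar> ^ p + \<bar>W s w\<bar> ^ p)" by (rule power_add_le_real) auto
   finally show "\<bar>Y s w + W s w\<bar> ^ p \<le> 2 ^ p * (\<bar>Y s w\<bar> ^ p + \<bar>W s w\<bar> ^ p)" .
  qed (intro integrable_mult_right abs_moments_integrable_power abs_moments_add my mw Bochner_Integration.integrable_add)+
  also have "... = 2 ^ p * ((\<integral>w. \<bar>Y s w\<bar> ^ p \<partial>M) + (\<integral>w. \<bar>W s w\<bar> ^ p \<partial>M))"
   by (subst integral_mult_right_zero, subst Bochner_Integration.integral_add)
     (auto intro!: abs_moments_integrable_power my mw)
  also have "... \<le> 2 ^ p * (C + C')" by (intro mult_left_mono add_mono C C' s) auto
  finally show ?thesis .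
 qed
 then show "\<exists>C. \<forall>s\<in>S. (\<integral>w. \<bar>Y s w + W s w\<bar> ^ p \<partial>M) \<le> C" by blast
qed

lemma unif_moments_cmult: "unif_moments M S Y ==> unif_moments M S (%s w. c * Y s w)"
 by (erule unif_moments_mult[OF unif_moments_const[OF abs_moments_const]])

lemma unif_moments_sum:
 "(\<And>i. i \<in> I ==> unif_moments M S (Y i)) ==> unif_moments M S (%s w. \<Sum>i\<in>I. Y i s w)"
 by (induction I rule: infinite_finite_induct)
   (auto intro!: unif_moments_add unif_moments_const)

lemma unif_moments_power: "unif_moments M S Y ==> unif_moments M S (%s w. Y s w ^ n)"
 by (induction n) (auto intro!: unif_moments_mult unif_moments_const)

lemma unif_moments_poly: "unif_moments M S Y ==> unif_moments M S (%s w. poly p (Y s w))"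
 unfolding poly_altdef by (intro unif_moments_sum unif_moments_cmult unif_moments_power)

lemma unif_moments_hermite: "unif_moments M S Y ==> unif_moments M S (%s w. hermite n (Y s w))"
 using unif_moments_poly[of S Y "hermite_poly n"] by simp

lemma time_integral_measurable[measurable (raw)]:
 assumes "(%(s, w). Y s w) \<in> borel_measurable (lborel \<Otimes>\<^sub>M N)"
 shows "(%w. time_integral a b (%s. Y s w)) \<in> borel_measurable N"
 unfolding time_integral_def
proof (rule lborel.borel_measurable_lebesgue_integral)
 have "(%q. (snd q, fst q)) \<in> measurable (N \<Otimes>\<^sub>M lborel) (lborel \<Otimes>\<^sub>M N)" by measurable
 from measurable_compose[OF this assms]
 show "(%(w, s). indicator {a..b} s * Y s w) \<in> borel_measurable (N \<Otimes>\<^sub>M lborel)"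
  unfolding case_prod_beta by (intro borel_measurable_times) auto
qed

lemma time_integral_joint_measurable:
 assumes "(%(s, w). Y s w) \<in> borel_measurable (lborel \<Otimes>\<^sub>M N)"
 shows "(%(u, w). time_integral a u (%s. Y s w)) \<in> borel_measurable (lborel \<Otimes>\<^sub>M N)"
proof -
 have "(%q. (snd q, snd (fst q))) \<in> measurable ((lborel \<Otimes>\<^sub>M N) \<Otimes>\<^sub>M lborel) (lborel \<Otimes>\<^sub>M N)" by measurable
 from measurable_compose[OF this assms]
 have m: "(%q. Y (snd q) (snd (fst q))) \<in> borel_measurable ((lborel \<Otimes>\<^sub>M N) \<Otimes>\<^sub>M lborel)" by (simp add: case_prod_beta)
 have eq: "time_integral a u f = (\<integral>s. (if a \<le> s \<and> s \<le> u then 1 else 0) * f s \<partial>lborel)" for u f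
  unfolding time_integral_def by (intro Bochner_Integration.integral_cong refl) (auto simp: indicator_def)
 show ?thesis
  unfolding eq case_prod_beta
 proof (rule lborel.borel_measurable_lebesgue_integral)
  show "(%(p, s). (if a \<le> s \<and> s \<le> fst p then 1 else 0) * Y s (snd p)) \<in> borel_measurable ((lborel \<Otimes>\<^sub>M N) \<Otimes>\<^sub>M lborel)"
   unfolding case_prod_beta by (intro borel_measurable_times m) measurable
 qed
qed

text \<open>A uniform bound on first absolute moments makes the process integrable for the product
  measure; all four facts are then instances of Fubini's theorem.\<close>

lemma
 assumes Y[measurable]: "(%(s, w). Y s w) \<in> borel_measurable (lborel \<Otimes>\<^sub>M M)"
  and um: "unif_moments M {a..b} Y"
 shows time_integral_AE_integrable: "AE w in M. integrable lborel (%s. indicator {a..b} s * Y s w)"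
  and time_integral_integrable: "integrable M (%w. time_integral a b (%s. Y s w))"
  and expectation_time_integral:
   "expectation (%w. time_integral a b (%s. Y s w)) = time_integral a b (%s. expectation (Y s))"
  and expectation_time_integrable: "integrable lborel (%s. indicator {a..b} s * expectation (Y s))"
proof -
 interpret P: pair_sigma_finite lborel M ..
 let ?f = "%(s, w). indicator {a..b} s * Y s w"
 obtain C where C: "\<And>s. s \<in> {a..b} ==> (\<integral>w. \<bar>Y s w\<bar> ^ 1 \<partial>M) \<le> C" using um unfolding unif_moments_def by blast
 have m: "?f \<in> borel_measurable (lborel \<Otimes>\<^sub>M M)" using Y by (simp add: case_prod_beta)
 have i: "integrable (lborel \<Otimes>\<^sub>M M) ?f"
 proof (rule P.Fubini_integrable[OF m])
  show "AE s in lborel. integrable M (%w. ?f (s, w))"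
  proof (rule AE_I2)
   fix s show "integrable M (%w. ?f (s, w))"
    by (cases "s \<in> {a..b}") (use um in \<open>auto intro!: abs_moments_integrable dest: unif_moments_D\<close>)
  qed
  show "integrable lborel (%s. LINT w|M. norm (?f (s, w)))"
  proof (rule Bochner_Integration.integrable_bound)
   show "integrable lborel (%s. C * indicator {a..b} s :: real)" by (intro integrable_mult_right integrable_real_indicator) (auto simp: emeasure_lborel_Icc_eq)
   show "(%s. LINT w|M. norm (?f (s, w))) \<in> borel_measurable lborel" using m by measurable
   show "AE s in lborel. norm (LINT w|M. norm (?f (s, w))) \<le> norm (C * indicator {a..b} s)"
   proof (rule AE_I2)
    fix s
    have "(LINT w|M. norm (?f (s, w))) = indicator {a..b} s * (\<integral>w. \<bar>Y s w\<bar> \<partial>M)"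
     by (simp add: abs_mult)
    moreover have "0 \<le> (\<integral>w. \<bar>Y s w\<bar> \<partial>M)" by simp
    ultimately show "norm (LINT w|M. norm (?f (s, w))) \<le> norm (C * indicator {a..b} s)"
     using C[of s] by (auto simp: indicator_def)
   qed
  qed
 qed
 show "AE w in M. integrable lborel (%s. indicator {a..b} s * Y s w)"
  using P.AE_integrable_fst_snd[OF i] by simp
 have i': "integrable (lborel \<Otimes>\<^sub>M M) (case_prod (%s w. indicator {a..b} s * Y s w))" using i by simp
 show "integrable M (%w. time_integral a b (%s. Y s w))"
  unfolding time_integral_def by (rule P.integrable_snd[OF i'])
 show "expectation (%w. time_integral a b (%s. Y s w)) = time_integral a b (%s. expectation (Y s))"
  unfolding time_integral_def using P.Fubini_integral[OF i'] by simp
 show "integrable lborel (%s. indicator {a..b} s * expectation (Y s))"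
  using P.integrable_fst'[OF i] by simp
qed

lemma unif_moments_abs: "unif_moments M S Y ==> unif_moments M S (%s w. \<bar>Y s w\<bar>)"
 by (rule unif_moments_mono) (auto intro!: borel_measurable_abs[OF abs_moments_measurable[OF unif_moments_D]])

text \<open>Jensen in time on each path, then Fubini: a power of the time integral is dominated by
  the time integral of that power.\<close>

lemma abs_moments_time_integral_abs:
 assumes Y[measurable]: "(%(s, w). Y s w) \<in> borel_measurable (lborel \<Otimes>\<^sub>M M)"
  and um: "unif_moments M {a..b} Y"
 shows "abs_moments M (%w. time_integral a b (%s. \<bar>Y s w\<bar>))"
proof (cases "a < b")
 case False
 then have "time_integral a b f = 0" for f
  by (cases "a = b") (auto simp: time_integral_def)
 then show ?thesis by simp
next
 case ab: True
 have m: "(%(s, w). \<bar>Y s w\<bar> ^ p) \<in> borel_measurable (lborel \<Otimes>\<^sub>M M)" for p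
  using Y by (simp add: case_prod_beta)
 have m1: "(%(s, w). \<bar>Y s w\<bar>) \<in> borel_measurable (lborel \<Otimes>\<^sub>M M)" using m[of 1] by simp
 have ump: "unif_moments M {a..b} (%s w. \<bar>Y s w\<bar> ^ p)" for p
  by (intro unif_moments_power unif_moments_abs um)
 have meas: "(%w. time_integral a b (%s. \<bar>Y s w\<bar>)) \<in> borel_measurable M"
  by (rule time_integral_measurable[OF m1])
 show ?thesis
  unfolding abs_moments_def
 proof (intro conjI allI meas)
  fix p :: nat
  show "integrable M (%w. \<bar>time_integral a b (%s. \<bar>Y s w\<bar>)\<bar> ^ p)"
  proof (cases "p = 0")
   case False
   show ?thesis
   proof (rule Bochner_Integration.integrable_bound)
    show "integrable M (%w. (b - a) ^ (p - 1) * time_integral a b (%s. \<bar>Y s w\<bar> ^ p))"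
     by (intro integrable_mult_right time_integral_integrable[OF m ump])
    show "AE w in M. norm (\<bar>time_integral a b (%s. \<bar>Y s w\<bar>)\<bar> ^ p)
      \<le> norm ((b - a) ^ (p - 1) * time_integral a b (%s. \<bar>Y s w\<bar> ^ p))"
     using time_integral_AE_integrable[OF m ump, of p] time_integral_AE_integrable[OF m1 unif_moments_abs[OF um]]
    proof eventually_elim
     case (elim w)
     have n: "0 \<le> time_integral a b (%s. \<bar>Y s w\<bar>)" "0 \<le> time_integral a b (%s. \<bar>Y s w\<bar> ^ p)"
      unfolding time_integral_def by (auto intro!: Bochner_Integration.integral_nonneg)
     have "time_integral a b (%s. \<bar>Y s w\<bar>) ^ p \<le> (b - a) ^ (p - 1) * time_integral a b (%s. \<bar>Y s w\<bar> ^ p)"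
      by (rule time_integral_power_le[OF ab]) (use False elim in auto)
     then show ?case using n ab by (simp add: abs_mult)
    qed
   qed (use meas in measurable)
  qed simp
 qed
qed

text \<open>The integral of the absolute value over the whole interval is a single random variable
  dominating every indefinite integral.\<close>

lemma unif_moments_time_integral:
 assumes Y[measurable]: "(%(s, w). Y s w) \<in> borel_measurable (lborel \<Otimes>\<^sub>M M)"
  and um: "unif_moments M {a..b} Y"
 shows "unif_moments M {a..b} (%u w. time_integral a u (%s. Y s w))"
proof (rule unif_moments_mono[OF unif_moments_const[OF abs_moments_time_integral_abs[OF Y um]]])
 fix u assume u: "u \<in> {a..b}"
 show "(%w. time_integral a u (%s. Y s w)) \<in> borel_measurable M" by (rule time_integral_measurable[OF Y])
 show "AE w in M. \<bar>time_integral a u (%s. Y s w)\<bar> \<le> \<bar>time_integral a b (%s. \<bar>Y s w\<bar>)\<bar>"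
  using time_integral_AE_integrable[OF Y um]
 proof eventually_elim
  case (elim w)
  have i: "integrable lborel (%s. indicator {a..b} s * \<bar>Y s w\<bar>)"
   using integrable_abs[OF elim] by (simp add: abs_mult)
  have j: "integrable lborel (%s. indicator {a..u} s * \<bar>Y s w\<bar>)"
   by (rule time_integrable_subinterval[OF i]) (use u in auto)
  have "\<bar>time_integral a u (%s. Y s w)\<bar> \<le> time_integral a u (%s. \<bar>Y s w\<bar>)"
   by (rule abs_time_integral_le[OF j]) simp
  also have "... \<le> time_integral a b (%s. \<bar>Y s w\<bar>)"
   unfolding time_integral_def by (rule integral_mono[OF j i]) (use u in \<open>auto simp: indicator_def\<close>)
  finally show ?case by simp
 qed
qed

end

section \<open>Mehler's formula\<close>

context brownian_motion
begin

lemma OU_integrand_integrable: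
 assumes w: "good_path w" and g: "0 < G"
 shows "integrable lborel (%x. indicator {..u} x * (G * exp (- G * (u - x)) * (B u w - B x w)))"
proof -
 have "integrable lborel (%x. (G * B u w) * (indicator {..u} x * exp (- G * (u - x)))
    - (G * exp (- G * u)) * (indicator {..u} x * (exp (G * x) * B x w)))"
  using has_bochner_integral_exp_atMost[OF g, of u] good_path_integrable[OF w g, of u]
  by (intro Bochner_Integration.integrable_diff integrable_mult_right) (auto simp: has_bochner_integral_iff)
 moreover have "(G * B u w) * (indicator {..u} x * exp (- G * (u - x)))
    - (G * exp (- G * u)) * (indicator {..u} x * (exp (G * x) * B x w))
   = indicator {..u} x * (G * exp (- G * (u - x)) * (B u w - B x w))" for x
  by (simp add: algebra_simps flip: exp_add)
 ultimately show ?thesis by (simp only:)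
qed

lemma expectation_abs_increment_le: "expectation (%w. \<bar>B t w - B s w\<bar>) \<le> 1 + \<bar>t - s\<bar>"
proof -
 have i: "integrable M (%w. (B t w - B s w)\<^sup>2)"
  by (rule abs_moments_integrable[OF abs_moments_power[OF abs_moments_increment]])
 have "expectation (%w. \<bar>B t w - B s w\<bar>) \<le> expectation (%w. 1 + (B t w - B s w)\<^sup>2)"
 proof (rule integral_mono)
  fix w
  show "\<bar>B t w - B s w\<bar> \<le> 1 + (B t w - B s w)\<^sup>2"
  proof (cases "\<bar>B t w - B s w\<bar> \<le> 1")
   case False
   then have "\<bar>B t w - B s w\<bar> * 1 \<le> \<bar>B t w - B s w\<bar> * \<bar>B t w - B s w\<bar>"
    by (intro mult_left_mono) auto
   then show ?thesis by (simp add: power2_eq_square)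
  qed (simp add: add_increasing2)
 qed (intro integrable_abs Bochner_Integration.integrable_add integrable_const i abs_moments_integrable[OF abs_moments_increment])+
 also have "... = 1 + \<bar>t - s\<bar>" using i by (simp add: expectation_increment_sq prob_space)
 finally show ?thesis .
qed

text \<open>Cutting the defining integral at u - (n+1) leaves a Gaussian innovation minus a boundary
  term, an increment damped by exp(-G(n+1)). That term vanishes in mean while the variances tend to
  1.\<close>

lemma OU_distributed:
 assumes g: "0 < G"
 shows "distributed M lborel (OU G u) std_normal_density"
proof -
 define a where "a n = u - real (Suc n)" for n
 have au: "a n < u" for n by (simp add: a_def)
 define X where "X n w = sqrt (2 * G) * innovation G (a n) u w" for n w
 define R where "R n w = sqrt (2 * G) * exp (- G * real (Suc n)) * (B u w - B (a n) w)" for n w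
 define \<sigma> where "\<sigma> n = sqrt (1 - exp (- 2 * G * real (Suc n)))" for n
 have \<sigma>: "0 < \<sigma> n" for n using g by (simp add: \<sigma>_def mult_neg_pos)
 have X: "distributed M lborel (X n) (normal_density 0 (\<sigma> n))" for n
 proof -
  have "0 < sqrt ((1 - exp (- 2 * G * real (Suc n))) / (2 * G))" using g by (simp add: mult_neg_pos)
  from normal_density_affine[OF _ this, of "innovation G (a n) u" 0 "sqrt (2 * G)" 0]
  have "distributed M lborel (%x. 0 + sqrt (2 * G) * innovation G (a n) u x)
    (normal_density (0 + sqrt (2 * G) * 0) (\<bar>sqrt (2 * G)\<bar> * sqrt ((1 - exp (- 2 * G * real (Suc n))) / (2 * G))))"
   using innovation_distributed[OF g au[of n]] g by (simp add: a_def)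
  moreover have "\<bar>sqrt (2 * G)\<bar> * sqrt ((1 - exp (- 2 * G * real (Suc n))) / (2 * G)) = \<sigma> n"
   using g by (simp add: \<sigma>_def real_sqrt_mult[symmetric] del: of_nat_Suc)
  ultimately show ?thesis by (simp add: X_def[abs_def] del: of_nat_Suc)
 qed
 have \<sigma>lim: "\<sigma> \<longlonglongrightarrow> 1"
 proof -
  have "(%n. exp (- 2 * G * real (Suc n))) \<longlonglongrightarrow> 0" using g by real_asymp
  from tendsto_real_sqrt[OF tendsto_diff[OF tendsto_const[of 1] this]] show ?thesis unfolding \<sigma>_def by simp
 qed
 have Ri: "integrable M (R n)" for n
  unfolding R_def by (intro integrable_mult_right abs_moments_integrable abs_moments_increment)
 have Rlim: "(%n. expectation (%w. \<bar>R n w\<bar>)) \<longlonglongrightarrow> 0"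
 proof (rule tendsto_sandwich[where f="%_. 0"])
  show "\<forall>\<^sub>F n in sequentially. expectation (%w. \<bar>R n w\<bar>) \<le> sqrt (2 * G) * (exp (- G * real (Suc n)) * (1 + real (Suc n)))"
  proof (rule always_eventually, rule allI)
   fix n
   have "expectation (%w. \<bar>R n w\<bar>) = (sqrt (2 * G) * exp (- G * real (Suc n))) * expectation (%w. \<bar>B u w - B (a n) w\<bar>)"
    using g by (simp add: R_def abs_mult)
   also have "... \<le> (sqrt (2 * G) * exp (- G * real (Suc n))) * (1 + real (Suc n))"
    using expectation_abs_increment_le[of u "a n"] g by (intro mult_left_mono) (auto simp: a_def)
   finally show "expectation (%w. \<bar>R n w\<bar>) \<le> sqrt (2 * G) * (exp (- G * real (Suc n)) * (1 + real (Suc n)))"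
    by (simp only: mult.assoc)
  qed
  have "(%n. exp (- G * real (Suc n)) * (1 + real (Suc n))) \<longlonglongrightarrow> 0" using g by real_asymp
  then show "(%n. sqrt (2 * G) * (exp (- G * real (Suc n)) * (1 + real (Suc n)))) \<longlonglongrightarrow> 0"
   by (rule tendsto_mult_right_zero)
 qed (auto intro!: always_eventually)
 have lim: "AE w in M. (%n. X n w - R n w) \<longlonglongrightarrow> OU G u w"
  using AE_good_path
 proof eventually_elim
  case (elim w)
  have w: "w \<in> space M" using elim by (simp add: good_path_def)
  let ?f = "%x. G * exp (- G * (u - x)) * (B u w - B x w)"
  have "X n w - R n w = sqrt (2 * G) * (\<integral>x. indicator {a n..u} x * ?f x \<partial>lborel)" for n
  proof -
   note c = B_continuous[OF w]
   have "(\<integral>x. indicator {a n..u} x * ?f x \<partial>lborel) = integral {a n..u} ?f"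
    by (intro lborel_integral_Icc_eq_integral continuous_intros c)
   also have "... = integral {a n..u} (%x. G * exp (- G * (u - x)) * B u w - G * exp (- G * (u - x)) * B x w)"
    by (intro arg_cong[where f="integral {a n..u}"]) (auto simp: algebra_simps)
   also have "... = integral {a n..u} (%x. G * exp (- G * (u - x)) * B u w)
    - integral {a n..u} (%x. G * exp (- G * (u - x)) * B x w)"
    by (intro Henstock_Kurzweil_Integration.integral_diff integrable_continuous_interval continuous_intros c)
   also have "integral {a n..u} (%x. G * exp (- G * (u - x)) * B u w) = (1 - exp (- G * (u - a n))) * B u w"
    using integral_gexp[of "a n" u G u] au[of n] by (simp del: integral_mult_right)
   finally have L: "(\<integral>x. indicator {a n..u} x * ?f x \<partial>lborel) = (1 - exp (- G * (u - a n))) * B u w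
    - integral {a n..u} (%x. G * exp (- G * (u - x)) * B x w)" .
   have "b - e * c - i = ((1 - e) * b - i) + e * (b - c)" for b e c i :: real by (simp add: algebra_simps)
   then have "innovation G (a n) u w = (\<integral>x. indicator {a n..u} x * ?f x \<partial>lborel) + exp (- G * (u - a n)) * (B u w - B (a n) w)"
    unfolding L innovation_eq[OF w less_imp_le[OF au]] .
   moreover have "u - a n = real (Suc n)" by (simp add: a_def)
   ultimately show ?thesis unfolding X_def R_def by (simp only: distrib_left mult.assoc)
  qed
  moreover have "(%n. \<integral>x. indicator {a n..u} x * ?f x \<partial>lborel) \<longlonglongrightarrow> (\<integral>x. indicator {..u} x * ?f x \<partial>lborel)"
  proof (rule integral_dominated_convergence[where w="%x. norm (indicator {..u} x * ?f x)"])
   have fm: "?f \<in> borel_measurable borel"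
    by (intro borel_measurable_continuous_onI continuous_intros B_continuous[OF w])
   then show "(%x. indicator {..u} x * ?f x) \<in> borel_measurable lborel"
    "\<And>n. (%x. indicator {a n..u} x * ?f x) \<in> borel_measurable lborel" by auto
   show "integrable lborel (%x. norm (indicator {..u} x * ?f x))"
    by (rule integrable_norm[OF OU_integrand_integrable[OF elim g]])
   show "AE x in lborel. norm (indicator {a n..u} x * ?f x) \<le> norm (indicator {..u} x * ?f x)" for n
    by (rule AE_I2) (auto simp: indicator_def)
   show "AE x in lborel. (%n. indicator {a n..u} x * ?f x) \<longlonglongrightarrow> indicator {..u} x * ?f x"
   proof (rule AE_I2)
    fix x
    obtain N where N: "u - x < real N" using reals_Archimedean2 by blast
    have "\<forall>\<^sub>F n in sequentially. indicator {a n..u} x * ?f x = indicator {..u} x * ?f x"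
     using eventually_ge_at_top[of N] by eventually_elim (use N in \<open>auto simp: indicator_def a_def\<close>)
    then show "(%n. indicator {a n..u} x * ?f x) \<longlonglongrightarrow> indicator {..u} x * ?f x" by (rule tendsto_eventually)
   qed
  qed
  ultimately show ?case unfolding OU_def by (simp only: tendsto_mult[OF tendsto_const])
 qed
 show ?thesis
  by (rule normal_limit[OF X \<sigma> \<sigma>lim zero_less_one Ri Rlim OU_measurable lim])
qed

lemma abs_moments_OU: "0 < G ==> abs_moments M (OU G u)"
 by (rule abs_moments_normal[where \<sigma>=1]) (auto intro: OU_distributed)

lemma expectation_OU:
 assumes "0 < G" and [measurable]: "f \<in> borel_measurable borel"
 shows "expectation (%w. f (OU G u w)) = (\<integral>x. std_normal_density x * f x \<partial>lborel)"
 by (rule distributed_integral[OF OU_distributed[OF assms(1)], symmetric]) auto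

lemma expectation_hermite_OU:
 assumes g: "0 < G"
 shows "expectation (%w. hermite n (OU G u w) * hermite m (OU G u w)) = (if n = m then fact n else 0)"
 using expectation_OU[OF g, of "%x. hermite n x * hermite m x" u] std_normal_hermite_orthogonal[of n m] by simp

lemma unif_moments_OU:
 assumes g: "0 < G"
 shows "unif_moments M S (OU G)"
 unfolding unif_moments_def
proof (intro conjI ballI allI abs_moments_OU[OF g])
 fix p
 show "\<exists>C. \<forall>s\<in>S. expectation (%w. \<bar>OU G s w\<bar> ^ p) \<le> C"
  using expectation_OU[OF g, of "%x. \<bar>x\<bar> ^ p"] by auto
qed

lemma innovation_std:
 assumes g: "0 < G" and ur: "u < r"
 shows "distributed M lborel (%w. sqrt (2 * G) / sqrt (1 - exp (- 2 * G * (r - u))) * innovation G u r w) std_normal_density"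
proof -
 define v where "v = 1 - exp (- 2 * G * (r - u))"
 have v: "0 < v" unfolding v_def using g ur by (simp add: mult_neg_pos)
 have s: "0 < sqrt (v / (2 * G))" using v g by simp
 have "distributed M lborel (%x. (innovation G u r x - 0) / sqrt (v / (2 * G))) std_normal_density"
  using innovation_distributed[OF g ur] unfolding v_def[symmetric] by (subst normal_standard_normal_convert[OF s, symmetric])
 moreover have "(innovation G u r x - 0) / sqrt (v / (2 * G)) = sqrt (2 * G) / sqrt v * innovation G u r x" for x
  using v g by (simp add: real_sqrt_divide)
 ultimately show ?thesis by (simp add: v_def)
qed

text \<open>Mehler's formula as a statement about conditional expectations, tested against a past
  variable V. In the addition formula the normalised innovation is independent of the past and its
  Hermite polynomials of positive order have mean 0, so only j = k survives.\<close>

lemma expectation_hermite_OU_past: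
 assumes g: "0 < G" and ur: "u \<le> r" and V: "V \<in> borel_measurable (past u)" and mV: "abs_moments M V"
 shows "expectation (%w. V w * hermite k (OU G r w)) =
  exp (- G * (r - u)) ^ k * expectation (%w. V w * hermite k (OU G u w))"
proof (cases "u = r")
 case False
 then have ur': "u < r" using ur by simp
 define \<rho> where "\<rho> = exp (- G * (r - u))"
 define \<sigma> where "\<sigma> = sqrt (1 - exp (- 2 * G * (r - u)))"
 define \<zeta> where "\<zeta> w = sqrt (2 * G) / \<sigma> * innovation G u r w" for w
 have \<rho>2: "\<rho>\<^sup>2 = exp (- 2 * G * (r - u))" by (simp add: \<rho>_def power2_eq_square flip: exp_add)
 have \<sigma>: "0 < \<sigma>" unfolding \<sigma>_def using g ur' by (simp add: mult_neg_pos)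
 have \<sigma>2: "\<sigma>\<^sup>2 = 1 - \<rho>\<^sup>2" unfolding \<rho>2 using \<sigma> unfolding \<sigma>_def by (subst real_sqrt_pow2) auto
 have D: "distributed M lborel \<zeta> std_normal_density"
  using innovation_std[OF g ur'] unfolding \<zeta>_def[abs_def] \<sigma>_def .
 have \<zeta>f: "\<zeta> \<in> borel_measurable (future u)"
  unfolding \<zeta>_def[abs_def] using innovation_future_measurable[OF ur] by measurable
 have mz: "abs_moments M \<zeta>" by (rule abs_moments_normal[where \<sigma>=1]) (use D in auto)
 have Ez: "expectation (%w. hermite n (\<zeta> w)) = (if n = 0 then 1 else 0)" for n
  using distributed_integral[OF D, of "hermite n"] std_normal_hermite_orthogonal[of n 0] by simp
 have eq: "AE w in M. V w * hermite k (OU G r w) =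
   (\<Sum>j\<le>k. (real (k choose j) * \<rho> ^ j * \<sigma> ^ (k - j)) * ((V w * hermite j (OU G u w)) * hermite (k - j) (\<zeta> w)))"
  using AE_good_path
 proof eventually_elim
  case (elim w)
  have "OU G r w = \<rho> * OU G u w + \<sigma> * \<zeta> w"
   using OU_innovation[OF elim g ur] \<sigma> by (simp add: \<rho>_def \<zeta>_def)
  then have "hermite k (OU G r w) = (\<Sum>j\<le>k. real (k choose j) * \<rho> ^ j * \<sigma> ^ (k - j) * hermite j (OU G u w) * hermite (k - j) (\<zeta> w))"
   using hermite_add[of \<rho> \<sigma> k] \<sigma>2 by simp
  then show ?case by (simp add: sum_distrib_left mult_ac)
 qed
 have mVH: "abs_moments M (%w. V w * hermite j (OU G u w))" for j
  by (intro abs_moments_mult mV abs_moments_hermite abs_moments_OU g)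
 have pVH: "(%w. V w * hermite j (OU G u w)) \<in> borel_measurable (past u)" for j
  using V OU_past_measurable[of u u G] by measurable
 have iVHz: "integrable M (%w. (V w * hermite j (OU G u w)) * hermite i (\<zeta> w))" for i j
  by (intro abs_moments_integrable abs_moments_mult mVH abs_moments_hermite mz)
 have "expectation (%w. V w * hermite k (OU G r w)) =
   expectation (%w. \<Sum>j\<le>k. (real (k choose j) * \<rho> ^ j * \<sigma> ^ (k - j)) * ((V w * hermite j (OU G u w)) * hermite (k - j) (\<zeta> w)))"
  by (rule integral_cong_AE)
    (use eq mV mz abs_moments_OU[OF g] abs_moments_measurable[OF mVH] in
     \<open>auto intro!: borel_measurable_sum borel_measurable_times abs_moments_measurable abs_moments_hermite\<close>)
 also have "... = (\<Sum>j\<le>k. (real (k choose j) * \<rho> ^ j * \<sigma> ^ (k - j)) * expectation (%w. (V w * hermite j (OU G u w)) * hermite (k - j) (\<zeta> w)))"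
  by (subst Bochner_Integration.integral_sum) (auto intro!: integrable_mult_right iVHz)
 also have "... = (\<Sum>j\<le>k. if j = k then \<rho> ^ k * expectation (%w. V w * hermite k (OU G u w)) else 0)"
 proof (intro sum.cong refl)
  fix j assume j: "j \<in> {..k}"
  have "expectation (%w. (V w * hermite j (OU G u w)) * hermite (k - j) (\<zeta> w)) =
   expectation (%w. V w * hermite j (OU G u w)) * expectation (%w. hermite (k - j) (\<zeta> w))"
   by (rule expectation_past_future[OF pVH])
     (use \<zeta>f in \<open>auto intro!: abs_moments_integrable mVH abs_moments_hermite mz\<close>)
  then show "(real (k choose j) * \<rho> ^ j * \<sigma> ^ (k - j)) * expectation (%w. (V w * hermite j (OU G u w)) * hermite (k - j) (\<zeta> w))
    = (if j = k then \<rho> ^ k * expectation (%w. V w * hermite k (OU G u w)) else 0)"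
   using j by (simp add: Ez)
 qed
 also have "... = \<rho> ^ k * expectation (%w. V w * hermite k (OU G u w))" by simp
 finally show ?thesis by (simp add: \<rho>_def)
qed simp

lemma OU_joint_hermite[measurable]:
 "(%(s, w). hermite n (OU G s w)) \<in> borel_measurable (lborel \<Otimes>\<^sub>M M)"
 using measurable_compose[OF OU_joint(2)[of G] borel_measurable_hermite[of n]] by (simp add: case_prod_beta)

lemma expectation_hermite_OU_two:
 assumes g: "0 < G"
 shows "expectation (%w. hermite n (OU G u w) * hermite n (OU G r w)) = fact n * exp (- G * \<bar>r - u\<bar>) ^ n"
proof -
 have *: "expectation (%w. hermite n (OU G u w) * hermite n (OU G r w)) = fact n * exp (- G * (r - u)) ^ n" if ur: "u \<le> r" for u r
  using expectation_hermite_OU_past[OF g ur, of "%w. hermite n (OU G u w)" n] OU_past_measurable[of u u G]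
   expectation_hermite_OU[OF g, of n u n] abs_moments_hermite[OF abs_moments_OU[OF g]] by simp
 show ?thesis
 proof (cases "u \<le> r")
  case False then show ?thesis using *[of r u] by (simp add: mult.commute)
 qed (simp add: *)
qed

text \<open>The increment of \<open>B\<close> is read off the integrated Ornstein--Uhlenbeck equation, so that only
 Mehler's formula is needed.\<close>
lemma expectation_increment_hermite_OU:
 assumes g: "0 < G" and ab: "a \<le> b" and V: "V \<in> borel_measurable (past a)" and mV: "abs_moments M V"
 shows "expectation (%w. V w * (B b w - B a w) * hermite n (OU G b w)) =
  real n * exp (- G * (b - a)) ^ (n - 1) * (sqrt (2 * G) * (1 - exp (- G * (b - a))) / G)
   * expectation (%w. V w * hermite (n - 1) (OU G a w))"
proof -
 define \<rho> where "\<rho> = exp (- G * (b - a))"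
 define v where "v k = expectation (%w. V w * hermite k (OU G a w))" for k
 have mH: "abs_moments M (%w. hermite k (OU G s w))" for k s by (intro abs_moments_hermite abs_moments_OU g)
 have mVH: "abs_moments M (%w. V w * hermite k (OU G s w))" for k s by (intro abs_moments_mult mV mH)
 have Vm[measurable]: "V \<in> borel_measurable M" using mV by (rule abs_moments_measurable)
 \<comment> \<open>Mehler from b back to x, then multiplication by the process value raises or
   lowers the order by one, then Mehler from x back to a.\<close>
 have E: "expectation (%w. V w * OU G x w * hermite n (OU G b w)) =
   exp (- G * (b - x)) ^ n * (exp (- G * (x - a)) ^ (n + 1) * v (n + 1) + real n * exp (- G * (x - a)) ^ (n - 1) * v (n - 1))"
  if x: "a \<le> x" "x \<le> b" for x
 proof -
  have "expectation (%w. (V w * OU G x w) * hermite n (OU G b w)) =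
    exp (- G * (b - x)) ^ n * expectation (%w. (V w * OU G x w) * hermite n (OU G x w))"
   by (rule expectation_hermite_OU_past[OF g x(2)])
     (use measurable_past_mono[OF x(1) V] OU_past_measurable[of x x G] in
      \<open>auto intro!: borel_measurable_times abs_moments_mult mV abs_moments_OU g\<close>)
  also have "(%w. (V w * OU G x w) * hermite n (OU G x w)) =
    (%w. V w * hermite (n + 1) (OU G x w) + real n * (V w * hermite (n - 1) (OU G x w)))"
  proof (rule ext)
   fix w show "(V w * OU G x w) * hermite n (OU G x w) =
    V w * hermite (n + 1) (OU G x w) + real n * (V w * hermite (n - 1) (OU G x w))"
    unfolding mult.assoc hermite_mult_x by (simp add: algebra_simps del: hermite.simps)
  qed
  also have "expectation ... = expectation (%w. V w * hermite (n + 1) (OU G x w)) + real n * expectation (%w. V w * hermite (n - 1) (OU G x w))"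
   by (subst Bochner_Integration.integral_add) (auto intro!: abs_moments_integrable mVH integrable_mult_right)
  also have "... = exp (- G * (x - a)) ^ (n + 1) * v (n + 1) + real n * (exp (- G * (x - a)) ^ (n - 1) * v (n - 1))"
   unfolding expectation_hermite_OU_past[OF g x(1) V mV] v_def ..
  finally show ?thesis by (simp add: mult.assoc)
 qed
 have Ei: "expectation (%w. time_integral a b (%x. V w * OU G x w * hermite n (OU G b w))) =
   time_integral a b (%x. expectation (%w. V w * OU G x w * hermite n (OU G b w)))"
  and ii: "integrable M (%w. time_integral a b (%x. V w * OU G x w * hermite n (OU G b w)))"
 proof -
  have m: "(%(x, w). V w * OU G x w * hermite n (OU G b w)) \<in> borel_measurable (lborel \<Otimes>\<^sub>M M)"
   by measurable
  have u: "unif_moments M {a..b} (%x w. V w * OU G x w * hermite n (OU G b w))"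
   by (intro unif_moments_mult unif_moments_OU unif_moments_const mV mH g)
  show "expectation (%w. time_integral a b (%x. V w * OU G x w * hermite n (OU G b w))) =
   time_integral a b (%x. expectation (%w. V w * OU G x w * hermite n (OU G b w)))"
   by (rule expectation_time_integral[OF m u])
  show "integrable M (%w. time_integral a b (%x. V w * OU G x w * hermite n (OU G b w)))"
   by (rule time_integral_integrable[OF m u])
 qed
 have eq: "AE w in M. sqrt (2 * G) * (V w * (B b w - B a w) * hermite n (OU G b w)) =
   V w * OU G b w * hermite n (OU G b w) - V w * OU G a w * hermite n (OU G b w)
   + G * time_integral a b (%x. V w * OU G x w * hermite n (OU G b w))"
  using AE_good_path
 proof eventually_elim
  case (elim w)
  have "time_integral a b (%x. V w * OU G x w * hermite n (OU G b w)) =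
    (V w * hermite n (OU G b w)) * time_integral a b (%x. OU G x w)"
   by (subst time_integral_cmult[symmetric]) (simp add: mult_ac)
  moreover have "sqrt (2 * G) * (V w * (B b w - B a w) * hermite n (OU G b w)) =
   V w * (sqrt (2 * G) * (B b w - B a w)) * hermite n (OU G b w)" by simp
  ultimately show ?case
   unfolding OU_integral_equation[OF elim g ab] by (simp only: time_integral_def) (simp add: algebra_simps)
 qed
 have i1: "integrable M (%w. V w * OU G x w * hermite n (OU G b w))" for x
  by (intro abs_moments_integrable abs_moments_mult mV abs_moments_OU g mH)
 have "sqrt (2 * G) * expectation (%w. V w * (B b w - B a w) * hermite n (OU G b w)) =
  expectation (%w. sqrt (2 * G) * (V w * (B b w - B a w) * hermite n (OU G b w)))" by simp
 also have "... = expectation (%w. V w * OU G b w * hermite n (OU G b w) - V w * OU G a w * hermite n (OU G b w)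
   + G * time_integral a b (%x. V w * OU G x w * hermite n (OU G b w)))"
  by (rule integral_cong_AE) (use eq ii in auto)
 also have "... = expectation (%w. V w * OU G b w * hermite n (OU G b w)) - expectation (%w. V w * OU G a w * hermite n (OU G b w))
   + G * time_integral a b (%x. expectation (%w. V w * OU G x w * hermite n (OU G b w)))"
  unfolding Ei[symmetric] using i1 ii by simp
 \<comment> \<open>Each of the two terms keeps one surplus decay factor, exp(-G(x - a)) or exp(-G(b
   - x)); both have time integral (1 - \<open>\<rho>\<close>)/G.\<close>
 also have "G * time_integral a b (%x. expectation (%w. V w * OU G x w * hermite n (OU G b w))) =
   \<rho> ^ n * (1 - \<rho>) * v (n + 1) + real n * \<rho> ^ (n - 1) * (1 - \<rho>) * v (n - 1)"
 proof -
  have ex: "exp (- G * (b - x)) * exp (- G * (x - a)) = \<rho>" for x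
   by (simp add: \<rho>_def algebra_simps flip: exp_add)
  have "time_integral a b (%x. expectation (%w. V w * OU G x w * hermite n (OU G b w))) =
   time_integral a b (%x. \<rho> ^ n * v (n + 1) * exp (- G * (x - a)) + real n * \<rho> ^ (n - 1) * v (n - 1) * exp (- G * (b - x)))"
  proof (rule time_integral_cong)
   fix x assume x: "a \<le> x" "x \<le> b"
   define p q where "p = exp (- G * (b - x))" and "q = exp (- G * (x - a))"
   have pq: "\<rho> = p * q" using ex[of x] by (simp add: p_def q_def)
   have "p ^ n * (q ^ (n + 1) * v (n + 1) + real n * q ^ (n - 1) * v (n - 1))
    = \<rho> ^ n * v (n + 1) * q + real n * \<rho> ^ (n - 1) * v (n - 1) * p"
    unfolding pq by (cases n) (simp_all add: power_mult_distrib algebra_simps)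
   then show "expectation (%w. V w * OU G x w * hermite n (OU G b w)) =
    \<rho> ^ n * v (n + 1) * exp (- G * (x - a)) + real n * \<rho> ^ (n - 1) * v (n - 1) * exp (- G * (b - x))"
    unfolding E[OF x] p_def q_def .
  qed
  also have "... = \<rho> ^ n * v (n + 1) * time_integral a b (%x. exp (- G * (x - a))) + real n * \<rho> ^ (n - 1) * v (n - 1) * time_integral a b (%x. exp (- G * (b - x)))"
   by (subst time_integral_add) (auto intro!: lborel_integral_Icc_eq_integral(2) continuous_intros)
  also have "time_integral a b (%x. exp (- G * (b - x))) = (1 - \<rho>) / G"
   using integral_gexp[OF ab, of G b] g
   by (subst time_integral_eq_integral) (auto intro!: continuous_intros simp: \<rho>_def field_simps)
  also have "time_integral a b (%x. exp (- G * (x - a))) = (1 - \<rho>) / G"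
  proof -
   have "integral {a..b} (%x. exp (- G * (x - a))) = (- exp (- G * (b - a)) / G) - (- exp (- G * (a - a)) / G)"
    by (rule integral_unique, rule fundamental_theorem_of_calculus[OF ab])
      (use g in \<open>auto intro!: derivative_eq_intros simp: has_real_derivative_iff_has_vector_derivative[symmetric]\<close>)
   then show ?thesis by (subst time_integral_eq_integral) (auto intro!: continuous_intros simp: \<rho>_def diff_divide_distrib)
  qed
  finally have I: "time_integral a b (%x. expectation (%w. V w * OU G x w * hermite n (OU G b w))) =
   \<rho> ^ n * v (n + 1) * ((1 - \<rho>) / G) + real n * \<rho> ^ (n - 1) * v (n - 1) * ((1 - \<rho>) / G)" .
  have "G * (x * (z / G) + y * (z / G)) = x * z + y * z" for x y z using g by (simp add: distrib_left)
  note J = this[of "\<rho> ^ n * v (n + 1)" "1 - \<rho>" "real n * \<rho> ^ (n - 1) * v (n - 1)"]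
  show ?thesis unfolding I J by (simp only: mult.assoc mult.commute[of "1 - \<rho>"])
 qed
 also have "expectation (%w. V w * OU G b w * hermite n (OU G b w)) = \<rho> ^ (n + 1) * v (n + 1) + real n * \<rho> ^ (n - 1) * v (n - 1)"
  using E[of b] ab by (simp add: \<rho>_def)
 also have "expectation (%w. V w * OU G a w * hermite n (OU G b w)) = \<rho> ^ n * (v (n + 1) + real n * v (n - 1))"
  using E[of a] ab by (simp add: \<rho>_def)
 \<comment> \<open>The moments of order n + 1 cancel; those of order n - 1 add up to twice the same
   term.\<close>
 finally have *: "sqrt (2 * G) * expectation (%w. V w * (B b w - B a w) * hermite n (OU G b w)) =
  2 * (real n * \<rho> ^ (n - 1) * (1 - \<rho>) * v (n - 1))"
  by (cases n) (simp_all add: algebra_simps)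
 have sq: "sqrt (2 * G) * sqrt (2 * G) = 2 * G" using g by simp
 have "s * (x * (s * y / G) * z) = (s * s) * (x * (y / G) * z)" for s x y z by simp
 from this[of "sqrt (2 * G)" "real n * \<rho> ^ (n - 1)" "1 - \<rho>" "v (n - 1)", unfolded sq]
 have "sqrt (2 * G) * (real n * \<rho> ^ (n - 1) * (sqrt (2 * G) * (1 - \<rho>) / G) * v (n - 1))
   = (2 * G) * (real n * \<rho> ^ (n - 1) * ((1 - \<rho>) / G) * v (n - 1))" .
 also have "... = 2 * (real n * \<rho> ^ (n - 1) * (1 - \<rho>) * v (n - 1))" using g by simp
 finally have "sqrt (2 * G) * expectation (%w. V w * (B b w - B a w) * hermite n (OU G b w)) =
  sqrt (2 * G) * (real n * \<rho> ^ (n - 1) * (sqrt (2 * G) * (1 - \<rho>) / G) * v (n - 1))" using * by simp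
 moreover have nz: "sqrt (2 * G) \<noteq> 0" using g by simp
 ultimately show ?thesis unfolding mult_left_cancel[OF nz] \<rho>_def v_def by blast
qed

end

section \<open>Elementary multiple integrals\<close>

text \<open>An injective index enters products only through its range, so products over the q
  coordinates become products over a set of cells.\<close>

lemma off_diagonal_D:
 assumes "i \<in> off_diagonal q n"
 shows "i ` {..<q} \<subseteq> {..<n}" "card (i ` {..<q}) = q" "\<And>f. (\<Prod>r<q. f (i r)) = (\<Prod>l\<in>i ` {..<q}. f l)"
proof -
 have i: "i \<in> {..<q} \<rightarrow>\<^sub>E {..<n}" "inj_on i {..<q}" using assms by (auto simp: off_diagonal_def)
 show "i ` {..<q} \<subseteq> {..<n}" using i(1) by auto
 show "card (i ` {..<q}) = q" using i(2) by (simp add: card_image)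
 show "(\<Prod>r<q. f (i r)) = (\<Prod>l\<in>i ` {..<q}. f l)" for f
  using prod.reindex[OF i(2), of f] by simp
qed

lemma finite_off_diagonal: "finite (off_diagonal q n)"
 unfolding off_diagonal_def by (rule finite_subset[of _ "{..<q} \<rightarrow>\<^sub>E {..<n}"]) (auto intro: finite_PiE)

text \<open>Indices with equal range differ by a permutation of q entries; this is the origin of the
  factor q! in the isometry.\<close>

lemma card_off_diagonal_range:
 assumes "i \<in> off_diagonal q n"
 shows "card {j \<in> off_diagonal q n. j ` {..<q} = i ` {..<q}} \<le> fact q"
proof -
 let ?R = "i ` {..<q}"
 have sub: "{j \<in> off_diagonal q n. j ` {..<q} = ?R} \<subseteq> {f \<in> {..<q} \<rightarrow>\<^sub>E ?R. inj_on f {..<q}}"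
  by (auto simp: off_diagonal_def PiE_iff)
 have c: "card {f \<in> {..<q} \<rightarrow>\<^sub>E ?R. inj_on f {..<q}} = fact q"
 proof -
  have "card {f \<in> {..<q} \<rightarrow>\<^sub>E ?R. inj_on f {..<q}} = prod ((-) q) {0..<q}"
   using card_inj_on_subset_funcset[of "{..<q}" ?R "{..<q}"] off_diagonal_D(2)[OF assms] by simp
  also have "... = fact q" by (simp only: fact_prod_rev of_nat_id)
  finally show ?thesis .
 qed
 have fin: "finite {f \<in> {..<q} \<rightarrow>\<^sub>E ?R. inj_on f {..<q}}"
  by (rule finite_subset[of _ "{..<q} \<rightarrow>\<^sub>E ?R"]) (auto intro: finite_PiE)
 show ?thesis using card_mono[OF fin sub] c by simp
qed

context brownian_motion
begin

text \<open>The integral of sqrt(2G) exp(-G(u - x)) over the part of the l-th cell before u, that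
  is, the covariance of the Brownian increment over the cell with the process at time u.\<close>

definition box_weight :: "real => (nat => real) => nat => real => real" where
 "box_weight G \<tau> l u = sqrt (2 * G) / G *
   (exp (- G * (u - min (\<tau> (Suc l)) u)) - exp (- G * (u - min (\<tau> l) u)))"

lemma abs_moments_prod_increments: "abs_moments M (%w. \<Prod>l\<in>R. B (\<tau> (Suc l)) w - B (\<tau> l) w)"
 by (intro abs_moments_prod abs_moments_increment)

lemma measurable_past_prod_increments:
 assumes "\<And>l. l \<in> R ==> \<tau> (Suc l) \<le> u \<and> \<tau> l \<le> u"
 shows "(%w. \<Prod>l\<in>R. B (\<tau> (Suc l)) w - B (\<tau> l) w) \<in> borel_measurable (past u)"
 using assms by (intro borel_measurable_prod measurable_past_increment) auto

text \<open>Induction over the cells from the right. If the last cell is in R, Mehler moves the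
  process to the right end of that cell and the increment formula removes the increment, lowering
  the Hermite order by one. Hence only the order card R survives.\<close>

lemma expectation_grid_hermite_past:
 assumes g: "0 < G"
 shows "[|mono_on {..j} \<tau>; R \<subseteq> {..<j}; \<tau> j \<le> u|] ==>
  expectation (%w. (\<Prod>l\<in>R. B (\<tau> (Suc l)) w - B (\<tau> l) w) * hermite n (OU G u w)) =
  (if n = card R then fact n * (\<Prod>l\<in>R. box_weight G \<tau> l u) else 0)"
proof (induction j arbitrary: R n u)
 case 0
 then have "R = {}" by auto
 then show ?case using expectation_hermite_OU[OF g, of n u 0] by auto
next
 case (Suc j)
 define a b where "a = \<tau> j" and "b = \<tau> (Suc j)"
 have mono: "mono_on {..j} \<tau>" by (rule mono_on_subset[OF Suc.prems(1)]) auto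
 have ab: "a \<le> b" unfolding a_def b_def by (rule mono_onD[OF Suc.prems(1)]) auto
 have bu: "b \<le> u" using Suc.prems(3) by (simp add: b_def)
 show ?case
 proof (cases "j \<in> R")
  case False
  then have "R \<subseteq> {..<j}" using Suc.prems(2) by (auto simp: less_Suc_eq)
  moreover have "\<tau> j \<le> u" using ab bu by (simp add: a_def)
  ultimately show ?thesis by (rule Suc.IH[OF mono])
 next
  case True
  define R' where "R' = R - {j}"
  have R: "R = insert j R'" "j \<notin> R'" "R' \<subseteq> {..<j}" "finite R'"
   using True Suc.prems(2) by (auto simp: R'_def less_Suc_eq intro: finite_subset[OF _ finite_lessThan[of "Suc j"]])
  have ta: "\<tau> l \<le> a \<and> \<tau> (Suc l) \<le> a" if "l \<in> R'" for l
   using that R(3) unfolding a_def by (auto intro!: mono_onD[OF mono])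
  define V where "V w = (\<Prod>l\<in>R'. B (\<tau> (Suc l)) w - B (\<tau> l) w)" for w
  have V: "V \<in> borel_measurable (past a)"
   unfolding V_def by (rule measurable_past_prod_increments) (use ta in auto)
  have mV: "abs_moments M V" unfolding V_def by (rule abs_moments_prod_increments)
  have "expectation (%w. (\<Prod>l\<in>R. B (\<tau> (Suc l)) w - B (\<tau> l) w) * hermite n (OU G u w))
   = expectation (%w. (V w * (B b w - B a w)) * hermite n (OU G u w))"
   using R by (simp add: V_def a_def b_def mult_ac)
  also have "... = exp (- G * (u - b)) ^ n * expectation (%w. (V w * (B b w - B a w)) * hermite n (OU G b w))"
   by (rule expectation_hermite_OU_past[OF g bu])
     (auto intro!: borel_measurable_times measurable_past_mono[OF ab V] measurable_past_increment ab
      abs_moments_mult mV abs_moments_increment)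
  also have "expectation (%w. (V w * (B b w - B a w)) * hermite n (OU G b w)) =
   real n * exp (- G * (b - a)) ^ (n - 1) * (sqrt (2 * G) * (1 - exp (- G * (b - a))) / G)
    * expectation (%w. V w * hermite (n - 1) (OU G a w))"
   by (rule expectation_increment_hermite_OU[OF g ab V mV])
  also have "expectation (%w. V w * hermite (n - 1) (OU G a w)) =
   (if n - 1 = card R' then fact (n - 1) * (\<Prod>l\<in>R'. box_weight G \<tau> l a) else 0)"
   unfolding V_def by (rule Suc.IH[OF mono R(3)]) (simp add: a_def)
  finally have *: "expectation (%w. (\<Prod>l\<in>R. B (\<tau> (Suc l)) w - B (\<tau> l) w) * hermite n (OU G u w)) =
   exp (- G * (u - b)) ^ n * (real n * exp (- G * (b - a)) ^ (n - 1) * (sqrt (2 * G) * (1 - exp (- G * (b - a))) / G)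
    * (if n - 1 = card R' then fact (n - 1) * (\<Prod>l\<in>R'. box_weight G \<tau> l a) else 0))" .
  show ?thesis
  proof (cases n)
   case 0 then show ?thesis unfolding * using R by simp
  next
   case (Suc m)
   have cR: "card R = Suc (card R')" using R by simp
   define p e where "p = exp (- G * (u - b))" and "e = exp (- G * (b - a))"
   have pe: "exp (- G * (u - a)) = p * e" by (simp add: p_def e_def algebra_simps flip: exp_add)
   have wj: "box_weight G \<tau> j u = sqrt (2 * G) / G * (p * (1 - e))"
   proof -
    have "box_weight G \<tau> j u = sqrt (2 * G) / G * (exp (- G * (u - b)) - exp (- G * (u - a)))"
     using ab bu by (simp add: box_weight_def a_def b_def min_absorb1)
    then show ?thesis unfolding pe by (simp add: p_def right_diff_distrib)
   qed
   \<comment> \<open>Moving the reference time from u to a rescales every remaining weight by p e,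
     which accounts for the powers of p and e produced by the recursion.\<close>
   have wl: "box_weight G \<tau> l u = (p * e) * box_weight G \<tau> l a" if "l \<in> R'" for l
   proof -
    have ex: "exp (- G * (u - x)) = (p * e) * exp (- G * (a - x))" for x
     unfolding pe[symmetric] by (simp add: algebra_simps flip: exp_add)
    have "box_weight G \<tau> l u = sqrt (2 * G) / G * (exp (- G * (u - \<tau> (Suc l))) - exp (- G * (u - \<tau> l)))"
     using ta[OF that] ab bu by (simp add: box_weight_def min_absorb1)
    also have "... = (p * e) * (sqrt (2 * G) / G * (exp (- G * (a - \<tau> (Suc l))) - exp (- G * (a - \<tau> l))))"
     unfolding ex by (simp only: right_diff_distrib mult.left_commute mult.assoc)
    also have "... = (p * e) * box_weight G \<tau> l a"
     using ta[OF that] by (simp add: box_weight_def min_absorb1)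
    finally show ?thesis .
   qed
   have pr: "(\<Prod>l\<in>R. box_weight G \<tau> l u) = sqrt (2 * G) / G * (p * (1 - e)) * ((p * e) ^ card R' * (\<Prod>l\<in>R'. box_weight G \<tau> l a))"
    using R by (simp add: wj wl prod.distrib cong: prod.cong)
   show ?thesis
   proof (cases "m = card R'")
    case True
    have 1: "exp (- G * (u - b)) ^ n * (real n * exp (- G * (b - a)) ^ (n - 1) * (sqrt (2 * G) * (1 - exp (- G * (b - a))) / G) * X)
     = real n * (sqrt (2 * G) / G * (p * (1 - e)) * ((p * e) ^ m * X))" for X
     unfolding p_def[symmetric] e_def[symmetric] Suc by (simp add: power_mult_distrib)
    show ?thesis
     unfolding * 1 pr using True Suc cR by (simp add: mult_ac)
   qed (use * Suc cR in simp)
  qed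
 qed
qed

text \<open>The part of an increment after s is centred and independent of all other factors, so it
  drops out. Cells are removed from the right, and the part of the removed cell before s joins
  V.\<close>

lemma expectation_project_past:
 assumes mono: "mono_on {..n} \<tau>" and fin: "finite R"
 shows "[|R \<subseteq> {..<n}; V \<in> borel_measurable (past s); abs_moments M V|] ==>
  expectation (%w. (\<Prod>l\<in>R. B (\<tau> (Suc l)) w - B (\<tau> l) w) * V w) =
  expectation (%w. (\<Prod>l\<in>R. B (min (\<tau> (Suc l)) s) w - B (min (\<tau> l) s) w) * V w)"
 using fin
proof (induction R arbitrary: V rule: finite_linorder_max_induct)
 case (insert b A)
 have A: "A \<subseteq> {..<n}" "b < n" and bA: "b \<notin> A" using insert by auto
 define P where "P w = (\<Prod>l\<in>A. B (\<tau> (Suc l)) w - B (\<tau> l) w)" for w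
 define Y where "Y w = B (min (\<tau> (Suc b)) s) w - B (min (\<tau> b) s) w" for w
 define D where "D w = B (max (\<tau> (Suc b)) s) w - B (max (\<tau> b) s) w" for w
 \<comment> \<open>The dropped part starts here; the remaining cells and V lie in the past of this
   time.\<close>
 define m where "m = max (\<tau> b) s"
 have mP: "abs_moments M P" unfolding P_def by (rule abs_moments_prod_increments)
 have mY: "abs_moments M Y" unfolding Y_def by (rule abs_moments_increment)
 have mD: "abs_moments M D" unfolding D_def by (rule abs_moments_increment)
 have split: "B (\<tau> (Suc b)) w - B (\<tau> b) w = Y w + D w" for w
  by (simp add: Y_def D_def min_def max_def)
 have "\<tau> l \<le> m \<and> \<tau> (Suc l) \<le> m" if "l \<in> A" for l
 proof -
  have "l < b" using insert.hyps that by blast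
  then have "\<tau> l \<le> \<tau> b" "\<tau> (Suc l) \<le> \<tau> b" using A(2) by (auto intro!: mono_onD[OF mono])
  then show ?thesis by (simp add: m_def le_max_iff_disj)
 qed
 then have pP: "P \<in> borel_measurable (past m)"
  unfolding P_def by (intro measurable_past_prod_increments) auto
 have pV: "V \<in> borel_measurable (past m)"
  by (rule measurable_past_mono[OF _ insert.prems(2)]) (simp add: m_def)
 have "\<tau> b \<le> \<tau> (Suc b)" using A(2) by (auto intro!: mono_onD[OF mono])
 then have fD: "D \<in> borel_measurable (future m)"
  unfolding D_def m_def by (intro measurable_future_increment) auto
 have ED: "expectation D = 0" unfolding D_def[abs_def] by (rule expectation_increment)
 have D0: "expectation (%w. (P w * V w) * D w) = 0"
  by (subst expectation_past_future[OF borel_measurable_times[OF pP pV] fD])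
    (auto intro!: abs_moments_integrable abs_moments_mult mP mD insert.prems simp: ED)
 have "expectation (%w. (\<Prod>l\<in>insert b A. B (\<tau> (Suc l)) w - B (\<tau> l) w) * V w) =
  expectation (%w. P w * (Y w * V w) + (P w * V w) * D w)"
  using insert.hyps bA by (simp add: split P_def[symmetric] algebra_simps)
 also have "... = expectation (%w. P w * (Y w * V w))"
  using D0 by (subst Bochner_Integration.integral_add)
    (auto intro!: abs_moments_integrable abs_moments_mult mP mY mD insert.prems)
 also have "... = expectation (%w. (\<Prod>l\<in>A. B (min (\<tau> (Suc l)) s) w - B (min (\<tau> l) s) w) * (Y w * V w))"
  unfolding P_def
 proof (rule insert.IH)
  show "(%w. Y w * V w) \<in> borel_measurable (past s)"
   unfolding Y_def by (intro borel_measurable_times insert.prems measurable_past_increment) auto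
 qed (auto intro!: abs_moments_mult mY insert.prems A)
 also have "... = expectation (%w. (\<Prod>l\<in>insert b A. B (min (\<tau> (Suc l)) s) w - B (min (\<tau> l) s) w) * V w)"
  using insert.hyps bA by (simp add: Y_def mult_ac)
 finally show ?case .
qed simp

text \<open>Stopping the grid at s may produce degenerate cells, which is why the induction over the
  grid assumes \<open>mono_on\<close> only. The weights are unaffected, as \<open>box_weight\<close>
  already truncates at the reference time.\<close>

lemma expectation_grid_hermite:
 assumes g: "0 < G" and mono: "mono_on {..n} \<tau>" and R: "R \<subseteq> {..<n}"
 shows "expectation (%w. (\<Prod>l\<in>R. B (\<tau> (Suc l)) w - B (\<tau> l) w) * hermite k (OU G s w)) =
  (if k = card R then fact k * (\<Prod>l\<in>R. box_weight G \<tau> l s) else 0)"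
proof -
 have "finite R" using R finite_subset by blast
 then have "expectation (%w. (\<Prod>l\<in>R. B (\<tau> (Suc l)) w - B (\<tau> l) w) * hermite k (OU G s w)) =
  expectation (%w. (\<Prod>l\<in>R. B (min (\<tau> (Suc l)) s) w - B (min (\<tau> l) s) w) * hermite k (OU G s w))"
  by (rule expectation_project_past[OF mono _ R])
    (use OU_past_measurable[of s s G] in \<open>auto intro!: abs_moments_hermite abs_moments_OU g\<close>)
 also have "... = (if k = card R then fact k * (\<Prod>l\<in>R. box_weight G (%l. min (\<tau> l) s) l s) else 0)"
  by (rule expectation_grid_hermite_past[OF g _ R])
    (auto intro!: mono_onI min.mono mono_onD[OF mono])
 finally show ?thesis by (simp add: box_weight_def)
qed

text \<open>Each cell occurs with exponent 0, 1 or 2. Two different sets of equal size leave some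
  cell with exponent 1, and its increment has mean zero.\<close>

lemma expectation_increment_products:
 assumes sm: "strict_mono_on {..n} \<tau>" and R: "R \<subseteq> {..<n}" "R' \<subseteq> {..<n}" "card R = card R'"
 shows "expectation (%w. (\<Prod>l\<in>R. B (\<tau> (Suc l)) w - B (\<tau> l) w) * (\<Prod>l\<in>R'. B (\<tau> (Suc l)) w - B (\<tau> l) w)) =
  (if R = R' then \<Prod>l\<in>R. \<tau> (Suc l) - \<tau> l else 0)"
proof -
 let ?D = "%l w. B (\<tau> (Suc l)) w - B (\<tau> l) w"
 define e where "e l = (if l \<in> R then 1 else 0) + (if l \<in> R' then 1 else 0 :: nat)" for l
 have p: "(\<Prod>l\<in>S. ?D l w) = (\<Prod>l<n. ?D l w ^ (if l \<in> S then 1 else 0))" if "S \<subseteq> {..<n}" for S w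
  using that by (intro prod.mono_neutral_cong_left) auto
 have "(\<Prod>l\<in>R. ?D l w) * (\<Prod>l\<in>R'. ?D l w) = (\<Prod>l<n. ?D l w ^ e l)" for w
  unfolding p[OF R(1)] p[OF R(2)] prod.distrib[symmetric] power_add[symmetric] e_def ..
 then have "expectation (%w. (\<Prod>l\<in>R. ?D l w) * (\<Prod>l\<in>R'. ?D l w)) = expectation (%w. \<Prod>l<n. ?D l w ^ e l)" by simp
 also have "... = (\<Prod>l<n. expectation (%w. ?D l w ^ e l))"
 proof (rule indep_vars_lebesgue_integral)
  show "indep_vars (%_. borel) (%l w. ?D l w ^ e l) {..<n}"
   by (rule indep_vars_compose2[OF B_indep[OF sm]]) measurable
 qed (auto intro!: abs_moments_integrable abs_moments_power abs_moments_increment)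
 also have "... = (if R = R' then \<Prod>l\<in>R. \<tau> (Suc l) - \<tau> l else 0)"
 proof (cases "R = R'")
  case True
  have "expectation (%w. ?D l w ^ e l) = (if l \<in> R then \<tau> (Suc l) - \<tau> l else 1)" if "l < n" for l
  proof -
   have "\<tau> l < \<tau> (Suc l)" using that by (intro strict_mono_onD[OF sm]) auto
   then show ?thesis using True by (auto simp: e_def expectation_increment_sq prob_space numeral_2_eq_2[symmetric])
  qed
  then have "(\<Prod>l<n. expectation (%w. ?D l w ^ e l)) = (\<Prod>l<n. if l \<in> R then \<tau> (Suc l) - \<tau> l else 1)" by simp
  also have "... = (\<Prod>l\<in>R. \<tau> (Suc l) - \<tau> l)" using R(1) by (intro prod.mono_neutral_cong_right) auto
  finally show ?thesis using True by simp
 next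
  case False
  have fin: "finite R" "finite R'" using R finite_subset by blast+
  obtain l where l: "l \<in> R" "l \<notin> R'"
   using False card_subset_eq[OF fin(2), of R] R(3) by blast
  then have "expectation (%w. ?D l w ^ e l) = 0" by (simp add: e_def expectation_increment)
  then have "(\<Prod>l<n. expectation (%w. ?D l w ^ e l)) = 0" using l R(1) by (auto intro!: prod_zero)
  then show ?thesis using False by simp
 qed
 finally show ?thesis .
qed

lemma elementary_integral_eq:
 "elementary_integral B q n \<tau> a w = (\<Sum>i\<in>off_diagonal q n. a i * (\<Prod>l\<in>i ` {..<q}. B (\<tau> (Suc l)) w - B (\<tau> l) w))"
 unfolding elementary_integral_def
 by (intro sum.cong refl arg_cong2[where f="(*)"]) (rule off_diagonal_D(3))

lemma abs_moments_elementary_integral: "abs_moments M (elementary_integral B q n \<tau> a)"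
proof -
 have "abs_moments M (%w. elementary_integral B q n \<tau> a w)"
  unfolding elementary_integral_eq by (intro abs_moments_sum abs_moments_cmult abs_moments_prod_increments)
 then show ?thesis by simp
qed

text \<open>The isometry as an inequality. The coefficients are arbitrary, so products for indices
  with a common range are estimated by (a_i^2 + a_j^2)/2, and every range is attained by at most q!
  indices.\<close>

lemma expectation_elementary_integral_sq:
 assumes sm: "strict_mono_on {..n} \<tau>"
 shows "expectation (%w. (elementary_integral B q n \<tau> a w)\<^sup>2) \<le>
  fact q * (\<Sum>i\<in>off_diagonal q n. (a i)\<^sup>2 * (\<Prod>l\<in>i ` {..<q}. \<tau> (Suc l) - \<tau> l))"
proof -
 let ?O = "off_diagonal q n"
 let ?P = "%i w. \<Prod>l\<in>i ` {..<q}. B (\<tau> (Suc l)) w - B (\<tau> l) w"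
 define d where "d i = (\<Prod>l\<in>i ` {..<q}. \<tau> (Suc l) - \<tau> l)" for i :: "nat => nat"
 define S where "S i j = (if i ` {..<q} = j ` {..<q} then 1 else 0 :: real)" for i j :: "nat => nat"
 have d: "0 \<le> d i" if "i \<in> ?O" for i
  unfolding d_def
 proof (rule prod_nonneg)
  fix l assume "l \<in> i ` {..<q}"
  then have "l < n" using off_diagonal_D(1)[OF that] by auto
  then have "\<tau> l < \<tau> (Suc l)" by (intro strict_mono_onD[OF sm]) auto
  then show "0 \<le> \<tau> (Suc l) - \<tau> l" by simp
 qed
 have "expectation (%w. (elementary_integral B q n \<tau> a w)\<^sup>2) =
  expectation (%w. \<Sum>i\<in>?O. \<Sum>j\<in>?O. (a i * a j) * (?P i w * ?P j w))"
  unfolding elementary_integral_eq power2_eq_square sum_product by (simp add: mult_ac)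
 also have "... = (\<Sum>i\<in>?O. \<Sum>j\<in>?O. (a i * a j) * expectation (%w. ?P i w * ?P j w))"
  by (simp add: Bochner_Integration.integral_sum abs_moments_integrable abs_moments_mult abs_moments_prod_increments)
 also have "... = (\<Sum>i\<in>?O. \<Sum>j\<in>?O. (a i * a j) * (S i j * d i))"
 proof (intro sum.cong refl)
  fix i j assume ij: "i \<in> ?O" "j \<in> ?O"
  have "expectation (%w. ?P i w * ?P j w) = S i j * d i"
   by (subst expectation_increment_products[OF sm]) (auto simp: off_diagonal_D[OF ij(1)] off_diagonal_D[OF ij(2)] S_def d_def)
  then show "(a i * a j) * expectation (%w. ?P i w * ?P j w) = (a i * a j) * (S i j * d i)" by simp
 qed
 also have "... \<le> (\<Sum>i\<in>?O. \<Sum>j\<in>?O. ((a i)\<^sup>2 / 2 + (a j)\<^sup>2 / 2) * (S i j * d i))"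
 proof (intro sum_mono mult_right_mono)
  fix i j assume ij: "i \<in> ?O" "j \<in> ?O"
  show "a i * a j \<le> (a i)\<^sup>2 / 2 + (a j)\<^sup>2 / 2" using sum_squares_bound[of "a i" "a j"] by simp
  show "0 \<le> S i j * d i" using d[OF ij(1)] by (simp add: S_def)
 qed
 also have "... = (\<Sum>i\<in>?O. \<Sum>j\<in>?O. (a i)\<^sup>2 / 2 * (S i j * d i)) + (\<Sum>i\<in>?O. \<Sum>j\<in>?O. (a j)\<^sup>2 / 2 * (S i j * d i))"
  by (simp add: distrib_right sum.distrib)
 also have "(\<Sum>i\<in>?O. \<Sum>j\<in>?O. (a j)\<^sup>2 / 2 * (S i j * d i)) = (\<Sum>i\<in>?O. \<Sum>j\<in>?O. (a i)\<^sup>2 / 2 * (S i j * d i))"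
  by (subst sum.swap) (auto intro!: sum.cong simp: S_def d_def)
 also have "(\<Sum>i\<in>?O. \<Sum>j\<in>?O. (a i)\<^sup>2 / 2 * (S i j * d i)) + (\<Sum>i\<in>?O. \<Sum>j\<in>?O. (a i)\<^sup>2 / 2 * (S i j * d i))
   = (\<Sum>i\<in>?O. (a i)\<^sup>2 * d i * (\<Sum>j\<in>?O. S i j))"
 proof -
  have *: "(\<Sum>j\<in>?O. (a i)\<^sup>2 / 2 * (S i j * d i)) = (a i)\<^sup>2 / 2 * d i * (\<Sum>j\<in>?O. S i j)" for i
   unfolding sum_distrib_left by (intro sum.cong) auto
  show ?thesis unfolding * sum.distrib[symmetric] by (intro sum.cong) auto
 qed
 also have "... \<le> (\<Sum>i\<in>?O. (a i)\<^sup>2 * d i * fact q)"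
 proof (intro sum_mono mult_left_mono)
  fix i assume i: "i \<in> ?O"
  have "(\<Sum>j\<in>?O. S i j) = real (card {j \<in> ?O. j ` {..<q} = i ` {..<q}})"
   unfolding S_def using finite_off_diagonal[of q n] by (subst sum.inter_filter[symmetric]) (auto intro!: arg_cong[where f=card])
  also have "... \<le> fact q" using card_off_diagonal_range[OF i] by (metis of_nat_fact of_nat_le_iff)
  finally show "(\<Sum>j\<in>?O. S i j) \<le> fact q" .
  show "0 \<le> (a i)\<^sup>2 * d i" using d[OF i] by simp
 qed
 finally show ?thesis by (simp add: d_def sum_distrib_left mult_ac)
qed

end

section \<open>Representation of the tempered Hermite process\<close>

definition exp_kernel :: "real => real => real => real" where
 "exp_kernel G s x = exp (- G * (s - x)) * indicator {..s} x"

lemma exp_kernel_alt: "exp_kernel G s x = exp (- G * (s - x)) * (if x \<le> s then 1 else 0)"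
 by (simp add: exp_kernel_def indicator_def)

lemma exp_kernel_bounds: "0 < G ==> 0 \<le> exp_kernel G s x \<and> exp_kernel G s x \<le> 1"
 by (auto simp: exp_kernel_def indicator_def)

lemma exp_kernel_nonneg[simp]: "0 \<le> exp_kernel G s x"
 by (auto simp: exp_kernel_def)

lemma exp_kernel_measurable[measurable]: "exp_kernel G s \<in> borel_measurable borel"
 unfolding exp_kernel_def by measurable

lemma exp_kernel_measurable_pair[measurable (raw)]:
 assumes [measurable]: "f \<in> borel_measurable N" "h \<in> borel_measurable N"
 shows "(%p. exp_kernel G (f p) (h p)) \<in> borel_measurable N"
 unfolding exp_kernel_alt by measurable

lemma exp_kernel_box:
 assumes g: "0 < G" and ab: "a \<le> b"
 shows "integrable lborel (%x. indicator {a<..b} x * exp_kernel G s x)"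
  and "(\<integral>x. indicator {a<..b} x * exp_kernel G s x \<partial>lborel) =
   (exp (- G * (s - min b s)) - exp (- G * (s - min a s))) / G"
proof -
 let ?a = "min a s" and ?b = "min b s"
 have c: "continuous_on {?a..?b} (%x. exp (- G * (s - x)))" by (intro continuous_intros)
 have m1: "(%x. indicator {?a..?b} x * exp (- G * (s - x))) \<in> borel_measurable lborel" by measurable
 have m2: "(%x. indicator {a<..b} x * exp_kernel G s x) \<in> borel_measurable lborel" by measurable
 have eq: "AE x in lborel. indicator {?a..?b} x * exp (- G * (s - x)) = indicator {a<..b} x * exp_kernel G s x"
  using AE_lborel_singleton[of a] AE_lborel_singleton[of s]
  by eventually_elim (auto simp: exp_kernel_def indicator_def)
 show "integrable lborel (%x. indicator {a<..b} x * exp_kernel G s x)"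
  using lborel_integral_Icc_eq_integral(2)[OF c] integrable_cong_AE[OF m1 m2 eq] by simp
 have "(\<integral>x. indicator {a<..b} x * exp_kernel G s x \<partial>lborel) = integral {?a..?b} (%x. exp (- G * (s - x)))"
  using integral_cong_AE[OF m1 m2 eq] lborel_integral_Icc_eq_integral(1)[OF c] by simp
 also have "?a \<le> ?b" using ab by auto
 from integral_gexp[OF this, of G s] g
 have "integral {?a..?b} (%x. exp (- G * (s - x))) = (exp (- G * (s - ?b)) - exp (- G * (s - ?a))) / G"
  by (simp add: field_simps)
 finally show "(\<integral>x. indicator {a<..b} x * exp_kernel G s x \<partial>lborel) =
   (exp (- G * (s - ?b)) - exp (- G * (s - ?a))) / G" .
qed

text \<open>The common support is x <= min s u, where the exponentials combine to exp(-G|s - u|)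
  exp(-2G(min s u - x)).\<close>

lemma exp_kernel_product:
 assumes g: "0 < G"
 shows "has_bochner_integral lborel (%x. exp_kernel G u x * exp_kernel G s x) (exp (- G * \<bar>s - u\<bar>) / (2 * G))"
proof -
 have "has_bochner_integral lborel (%x. exp (- G * \<bar>s - u\<bar>) * (indicator {..min s u} x * exp (- (2 * G) * (min s u - x))))
  (exp (- G * \<bar>s - u\<bar>) * (1 / (2 * G)))"
  by (intro has_bochner_integral_mult_right has_bochner_integral_exp_atMost) (use g in simp)
 moreover have "exp (- G * \<bar>s - u\<bar>) * (indicator {..min s u} x * exp (- (2 * G) * (min s u - x)))
   = exp_kernel G u x * exp_kernel G s x" for x
 proof (cases "x \<le> min s u")
  case True
  have "exp (- G * \<bar>s - u\<bar>) * exp (- (2 * G) * (min s u - x)) = exp (- G * (u - x)) * exp (- G * (s - x))"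
   by (cases "s \<le> u") (simp_all add: algebra_simps flip: exp_add)
  then show ?thesis using True by (simp add: exp_kernel_def)
 qed (auto simp: exp_kernel_def)
 ultimately show ?thesis by simp
qed

interpretation lborel_product: product_sigma_finite "%_::nat. lborel :: real measure" ..

abbreviation lborel_power :: "nat => (nat => real) measure" where
 "lborel_power q \<equiv> Pi\<^sub>M {..<q} (%_. lborel)"

definition exp_kernel_power :: "nat => real => real => (nat => real) => real" where
 "exp_kernel_power q G s x = (\<Prod>r<q. exp_kernel G s (x r))"

lemma exp_kernel_power_bounds: "0 < G ==> 0 \<le> exp_kernel_power q G s x \<and> exp_kernel_power q G s x \<le> 1"
 unfolding exp_kernel_power_def using exp_kernel_bounds[of G s] by (auto intro!: prod_nonneg prod_le_1)

lemma lborel_power_component: "r < q ==> (%x. x r) \<in> borel_measurable (lborel_power q)"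
 using measurable_component_singleton[of r "{..<q}" "%_. lborel"] by (simp cong: measurable_cong_sets)

lemma exp_kernel_power_joint:
 "(%(s, x). exp_kernel_power q G s x) \<in> borel_measurable (lborel \<Otimes>\<^sub>M lborel_power q)"
 unfolding exp_kernel_power_def case_prod_beta
 by (intro borel_measurable_prod exp_kernel_measurable_pair)
   (auto intro!: measurable_compose[OF measurable_snd lborel_power_component])

lemma exp_kernel_power_measurable: "exp_kernel_power q G s \<in> borel_measurable (lborel_power q)"
 using measurable_compose[OF measurable_Pair1' exp_kernel_power_joint, of s] by simp

lemma hermite_kernel_eq: "hermite_kernel q G t x = time_integral 0 t (%s. exp_kernel_power q G s x)"
 by (simp add: hermite_kernel_def time_integral_def set_lebesgue_integral_def exp_kernel_power_def exp_kernel_def)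

lemma hermite_kernel_nonneg: "0 < G ==> 0 \<le> hermite_kernel q G t x"
 unfolding hermite_kernel_eq time_integral_def
 by (intro Bochner_Integration.integral_nonneg mult_nonneg_nonneg) (auto simp: exp_kernel_power_bounds)

lemma hermite_kernel_measurable: "hermite_kernel q G t \<in> borel_measurable (lborel_power q)"
proof -
 have "(%x. time_integral 0 t (%s. exp_kernel_power q G s x)) \<in> borel_measurable (lborel_power q)"
  unfolding time_integral_def
 proof (rule lborel.borel_measurable_lebesgue_integral)
  have "(%p. (snd p, fst p)) \<in> measurable (lborel_power q \<Otimes>\<^sub>M lborel) (lborel \<Otimes>\<^sub>M lborel_power q)" by measurable
  from measurable_compose[OF this exp_kernel_power_joint]
  show "(%(x, s). indicator {0..t} s * exp_kernel_power q G s x) \<in> borel_measurable (lborel_power q \<Otimes>\<^sub>M lborel)"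
   unfolding case_prod_beta by (intro borel_measurable_times) auto
 qed
 then show ?thesis by (simp add: hermite_kernel_eq[abs_def])
qed

text \<open>Fubini for \<open>hermite_kernel\<close> as a time integral, with a nonnegative weight
  h. It is applied to box indicators, to \<open>exp_kernel_power\<close> and to
  \<open>hermite_kernel\<close> itself.\<close>

lemma
 assumes g: "0 < G" and h: "h \<in> borel_measurable (lborel_power q)" "\<And>x. 0 \<le> h x"
  and i: "\<And>s. 0 \<le> s ==> s \<le> t ==> integrable (lborel_power q) (%x. h x * exp_kernel_power q G s x)"
  and C: "\<And>s. 0 \<le> s ==> s \<le> t ==> (\<integral>x. h x * exp_kernel_power q G s x \<partial>lborel_power q) \<le> C"
 shows hermite_kernel_times_integrable: "integrable (lborel_power q) (%x. h x * hermite_kernel q G t x)"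
  and hermite_kernel_times_integral:
   "(\<integral>x. h x * hermite_kernel q G t x \<partial>lborel_power q) = time_integral 0 t (%s. \<integral>x. h x * exp_kernel_power q G s x \<partial>lborel_power q)"
proof -
 interpret Q: sigma_finite_measure "lborel_power q" by (rule lborel_product.sigma_finite) simp
 interpret P: pair_sigma_finite lborel "lborel_power q" ..
 let ?f = "%s x. indicator {0..t} s * (h x * exp_kernel_power q G s x)"
 have m: "case_prod ?f \<in> borel_measurable (lborel \<Otimes>\<^sub>M lborel_power q)"
  using exp_kernel_power_joint[of q G] measurable_compose[OF measurable_snd h(1)]
  unfolding case_prod_beta by (intro borel_measurable_times) auto
 have int: "integrable (lborel \<Otimes>\<^sub>M lborel_power q) (case_prod ?f)"
 proof (rule P.Fubini_integrable[OF m])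
  show "AE s in lborel. integrable (lborel_power q) (%x. case_prod ?f (s, x))"
  proof (rule AE_I2)
   fix s show "integrable (lborel_power q) (%x. case_prod ?f (s, x))"
    by (cases "s \<in> {0..t}") (use i in auto)
  qed
  show "integrable lborel (%s. LINT x|lborel_power q. norm (case_prod ?f (s, x)))"
  proof (rule Bochner_Integration.integrable_bound)
   show "integrable lborel (%s. C * indicator {0..t} s :: real)"
    by (intro integrable_mult_right integrable_real_indicator) (auto simp: emeasure_lborel_Icc_eq)
   show "(%s. LINT x|lborel_power q. norm (case_prod ?f (s, x))) \<in> borel_measurable lborel"
    using m by measurable
   show "AE s in lborel. norm (LINT x|lborel_power q. norm (case_prod ?f (s, x))) \<le> norm (C * indicator {0..t} s)"
   proof (rule AE_I2)
    fix s
    have "(LINT x|lborel_power q. norm (case_prod ?f (s, x))) = indicator {0..t} s * (\<integral>x. h x * exp_kernel_power q G s x \<partial>lborel_power q)"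
     using h(2) exp_kernel_power_bounds[OF g] by (simp add: abs_mult)
    moreover have "0 \<le> (\<integral>x. h x * exp_kernel_power q G s x \<partial>lborel_power q)"
     using h(2) exp_kernel_power_bounds[OF g] by (intro Bochner_Integration.integral_nonneg) auto
    ultimately show "norm (LINT x|lborel_power q. norm (case_prod ?f (s, x))) \<le> norm (C * indicator {0..t} s)"
     using C[of s] by (auto simp: indicator_def)
   qed
  qed
 qed
 have eq: "(\<integral>s. ?f s x \<partial>lborel) = h x * hermite_kernel q G t x" for x
 proof -
  have "(\<integral>s. ?f s x \<partial>lborel) = time_integral 0 t (%s. h x * exp_kernel_power q G s x)"
   by (simp only: time_integral_def)
  then show ?thesis by (simp only: hermite_kernel_eq time_integral_cmult)
 qed
 show "integrable (lborel_power q) (%x. h x * hermite_kernel q G t x)"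
  using P.integrable_snd[OF int] by (simp only: eq)
 show "(\<integral>x. h x * hermite_kernel q G t x \<partial>lborel_power q) = time_integral 0 t (%s. \<integral>x. h x * exp_kernel_power q G s x \<partial>lborel_power q)"
  using P.Fubini_integral[OF int] unfolding eq time_integral_def by simp
qed

section \<open>Boxes of a grid paired with the kernel\<close>

definition box_indicator :: "nat => (nat => real) => (nat => nat) => (nat => real) => real" where
 "box_indicator q \<tau> i x = (\<Prod>r<q. indicator {\<tau> (i r)<..\<tau> (Suc (i r))} (x r))"

lemma box_indicator_measurable: "box_indicator q \<tau> i \<in> borel_measurable (lborel_power q)"
 unfolding box_indicator_def by (intro borel_measurable_prod measurable_compose[OF lborel_power_component]) auto

lemma box_indicator_nonneg: "0 \<le> box_indicator q \<tau> i x"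
 unfolding box_indicator_def by (intro prod_nonneg) auto

lemma
 assumes g: "0 < G" and le: "\<And>r. r < q ==> \<tau> (i r) \<le> \<tau> (Suc (i r))"
 shows box_kernel_integrable: "integrable (lborel_power q) (%x. box_indicator q \<tau> i x * hermite_kernel q G t x)"
  and box_kernel_integral: "(\<integral>x. box_indicator q \<tau> i x * hermite_kernel q G t x \<partial>lborel_power q) =
   time_integral 0 t (%s. \<Prod>r<q. (exp (- G * (s - min (\<tau> (Suc (i r))) s)) - exp (- G * (s - min (\<tau> (i r)) s))) / G)"
proof -
 have eq: "box_indicator q \<tau> i x * exp_kernel_power q G s x =
  (\<Prod>r<q. indicator {\<tau> (i r)<..\<tau> (Suc (i r))} (x r) * exp_kernel G s (x r))" for s x
  by (simp add: box_indicator_def exp_kernel_power_def prod.distrib)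
 have int: "integrable (lborel_power q) (%x. box_indicator q \<tau> i x * exp_kernel_power q G s x)" for s
  unfolding eq by (rule lborel_product.product_integrable_prod) (use exp_kernel_box(1)[OF g le] in auto)
 have val: "(\<integral>x. box_indicator q \<tau> i x * exp_kernel_power q G s x \<partial>lborel_power q) =
   (\<Prod>r<q. (exp (- G * (s - min (\<tau> (Suc (i r))) s)) - exp (- G * (s - min (\<tau> (i r)) s))) / G)" for s
  unfolding eq
  by (subst lborel_product.product_integral_prod) (use exp_kernel_box[OF g le] in auto)
 have bd: "(\<Prod>r<q. (exp (- G * (s - min (\<tau> (Suc (i r))) s)) - exp (- G * (s - min (\<tau> (i r)) s))) / G) \<le> (1 / G) ^ q" for s
 proof -
  have "(\<Prod>r<q. (exp (- G * (s - min (\<tau> (Suc (i r))) s)) - exp (- G * (s - min (\<tau> (i r)) s))) / G) \<le> (\<Prod>r<q. 1 / G)"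
  proof (rule prod_mono, rule conjI)
   fix r assume r: "r \<in> {..<q}"
   show "0 \<le> (exp (- G * (s - min (\<tau> (Suc (i r))) s)) - exp (- G * (s - min (\<tau> (i r)) s))) / G"
    using g le[of r] r by (auto intro!: divide_nonneg_pos)
   have "exp (- G * (s - min (\<tau> (Suc (i r))) s)) \<le> 1" using g by simp
   moreover have "0 < exp (- G * (s - min (\<tau> (i r)) s))" by simp
   ultimately have "exp (- G * (s - min (\<tau> (Suc (i r))) s)) - exp (- G * (s - min (\<tau> (i r)) s)) \<le> 1" by linarith
   then show "(exp (- G * (s - min (\<tau> (Suc (i r))) s)) - exp (- G * (s - min (\<tau> (i r)) s))) / G \<le> 1 / G"
    using g by (intro divide_right_mono) auto
  qed
  then show ?thesis by simp
 qed
 show "integrable (lborel_power q) (%x. box_indicator q \<tau> i x * hermite_kernel q G t x)"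
  by (rule hermite_kernel_times_integrable[where C="(1 / G) ^ q", OF g box_indicator_measurable box_indicator_nonneg int]) (simp only: val bd)
 show "(\<integral>x. box_indicator q \<tau> i x * hermite_kernel q G t x \<partial>lborel_power q) =
   time_integral 0 t (%s. \<Prod>r<q. (exp (- G * (s - min (\<tau> (Suc (i r))) s)) - exp (- G * (s - min (\<tau> (i r)) s))) / G)"
  unfolding val[symmetric]
  by (rule hermite_kernel_times_integral[where C="(1 / G) ^ q", OF g box_indicator_measurable box_indicator_nonneg int]) (simp only: val bd)
qed

text \<open>The exchange above used twice, first with \<open>exp_kernel_power\<close> as weight and
  then with \<open>hermite_kernel\<close>.\<close>

lemma
 assumes g: "0 < G"
 shows hermite_kernel_sq_integrable: "integrable (lborel_power q) (%x. (hermite_kernel q G t x)\<^sup>2)"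
  and hermite_kernel_sq_integral: "(\<integral>x. (hermite_kernel q G t x)\<^sup>2 \<partial>lborel_power q) =
   time_integral 0 t (%s. time_integral 0 t (%u. (exp (- G * \<bar>s - u\<bar>) / (2 * G)) ^ q))"
proof -
 have eq: "exp_kernel_power q G s x * exp_kernel_power q G u x = (\<Prod>r<q. exp_kernel G s (x r) * exp_kernel G u (x r))" for s u x
  by (simp add: exp_kernel_power_def prod.distrib)
 have int: "integrable (lborel_power q) (%x. exp_kernel_power q G s x * exp_kernel_power q G u x)" for s u
  unfolding eq by (rule lborel_product.product_integrable_prod)
   (use exp_kernel_product[OF g] in \<open>auto simp: has_bochner_integral_iff\<close>)
 have val: "(\<integral>x. exp_kernel_power q G s x * exp_kernel_power q G u x \<partial>lborel_power q) = (exp (- G * \<bar>s - u\<bar>) / (2 * G)) ^ q" for s u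
  unfolding eq by (subst lborel_product.product_integral_prod)
   (use exp_kernel_product[OF g] in \<open>auto simp: has_bochner_integral_iff abs_minus_commute\<close>)
 have bd: "(exp (- G * \<bar>s - u\<bar>) / (2 * G)) ^ q \<le> (1 / (2 * G)) ^ q" "0 \<le> (exp (- G * \<bar>s - u\<bar>) / (2 * G)) ^ q" for s u
  using g by (auto intro!: power_mono divide_right_mono)
 note 1 = hermite_kernel_times_integrable[OF g exp_kernel_power_measurable _ int, of s t "(1 / (2 * G)) ^ q" for s]
 note 2 = hermite_kernel_times_integral[OF g exp_kernel_power_measurable _ int, of s t "(1 / (2 * G)) ^ q" for s]
 have i1: "integrable (lborel_power q) (%x. exp_kernel_power q G s x * hermite_kernel q G t x)" for s
  by (rule 1) (auto simp only: val bd exp_kernel_power_bounds[OF g])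
 have v1: "(\<integral>x. exp_kernel_power q G s x * hermite_kernel q G t x \<partial>lborel_power q)
   = time_integral 0 t (%u. (exp (- G * \<bar>s - u\<bar>) / (2 * G)) ^ q)" for s
  unfolding val[symmetric] by (rule 2) (auto simp only: val bd exp_kernel_power_bounds[OF g])
 have b1: "time_integral 0 t (%u. (exp (- G * \<bar>s - u\<bar>) / (2 * G)) ^ q) \<le> (1 / (2 * G)) ^ q * \<bar>t\<bar>" for s
 proof (cases "0 \<le> t")
  case True
  have "\<bar>time_integral 0 t (%u. (exp (- G * \<bar>s - u\<bar>) / (2 * G)) ^ q)\<bar> \<le> (1 / (2 * G)) ^ q * (t - 0)"
   by (rule abs_time_integral_le_const[OF True]) (use bd in \<open>simp only: abs_of_nonneg\<close>)
  then show ?thesis using True by simp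
 next
  case False
  then have "time_integral 0 t f = 0" for f by (simp add: time_integral_def)
  then show ?thesis using g by simp
 qed
 have i1': "integrable (lborel_power q) (%x. hermite_kernel q G t x * exp_kernel_power q G s x)" for s
  using i1[of s] by (simp only: mult.commute)
 have v1': "(\<integral>x. hermite_kernel q G t x * exp_kernel_power q G s x \<partial>lborel_power q)
   = time_integral 0 t (%u. (exp (- G * \<bar>s - u\<bar>) / (2 * G)) ^ q)" for s
  unfolding v1[symmetric] by (simp only: mult.commute)
 show "integrable (lborel_power q) (%x. (hermite_kernel q G t x)\<^sup>2)"
  unfolding power2_eq_square
  by (rule hermite_kernel_times_integrable[where C="(1 / (2 * G)) ^ q * \<bar>t\<bar>", OF g hermite_kernel_measurable hermite_kernel_nonneg[OF g] i1']) (simp only: v1' b1)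
 show "(\<integral>x. (hermite_kernel q G t x)\<^sup>2 \<partial>lborel_power q) =
   time_integral 0 t (%s. time_integral 0 t (%u. (exp (- G * \<bar>s - u\<bar>) / (2 * G)) ^ q))"
  unfolding power2_eq_square v1'[symmetric]
  by (rule hermite_kernel_times_integral[where C="(1 / (2 * G)) ^ q * \<bar>t\<bar>", OF g hermite_kernel_measurable hermite_kernel_nonneg[OF g] i1']) (simp only: v1' b1)
qed

lemma elementary_fun_eq: "elementary_fun q n \<tau> a x = (\<Sum>i\<in>off_diagonal q n. a i * box_indicator q \<tau> i x)"
 by (simp add: elementary_fun_def box_indicator_def)

text \<open>Different indices differ in some coordinate, where two different cells of the grid are
  disjoint; boxes thus behave like orthogonal idempotents and squares of elementary functions become
  diagonal.\<close>

lemma box_indicator_mult: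
 assumes sm: "strict_mono_on {..n} \<tau>" and i: "i \<in> off_diagonal q n" and j: "j \<in> off_diagonal q n"
 shows "box_indicator q \<tau> i x * box_indicator q \<tau> j x = (if i = j then box_indicator q \<tau> i x else 0)"
proof (cases "i = j")
 case True
 then show ?thesis by (auto simp: box_indicator_def prod.distrib[symmetric] indicator_def intro!: prod.cong)
next
 case False
 have ij: "i \<in> {..<q} \<rightarrow>\<^sub>E {..<n}" "j \<in> {..<q} \<rightarrow>\<^sub>E {..<n}" using i j by (auto simp: off_diagonal_def)
 obtain r where r: "r < q" "i r \<noteq> j r" using False PiE_ext[OF ij] by auto
 have disj: "\<not> (x \<in> {\<tau> k<..\<tau> (Suc k)} \<and> x \<in> {\<tau> l<..\<tau> (Suc l)})" if "k < l" "l < n" for x k l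
 proof -
  have "\<tau> (Suc k) \<le> \<tau> l" using that strict_mono_onD[OF sm, of "Suc k" l] by (cases "Suc k = l") auto
  then show ?thesis by auto
 qed
 have "i r < n" "j r < n" using ij r(1) by auto
 then have "(indicator {\<tau> (i r)<..\<tau> (Suc (i r))} (x r) * indicator {\<tau> (j r)<..\<tau> (Suc (j r))} (x r) :: real) = 0"
  using disj[of "i r" "j r" "x r"] disj[of "j r" "i r" "x r"] r(2)
  by (cases "i r" "j r" rule: linorder_cases) (auto simp: indicator_def)
 then have "(\<Prod>r<q. indicator {\<tau> (i r)<..\<tau> (Suc (i r))} (x r) * indicator {\<tau> (j r)<..\<tau> (Suc (j r))} (x r) :: real) = 0"
  using r(1) by (auto intro!: prod_zero)
 then show ?thesis using False by (simp add: box_indicator_def prod.distrib)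
qed

lemma
 assumes sm: "strict_mono_on {..n} \<tau>" and i: "i \<in> off_diagonal q n"
 shows box_indicator_integrable: "integrable (lborel_power q) (box_indicator q \<tau> i)"
  and box_indicator_integral: "(\<integral>x. box_indicator q \<tau> i x \<partial>lborel_power q) = (\<Prod>l\<in>i ` {..<q}. \<tau> (Suc l) - \<tau> l)"
proof -
 have le: "\<tau> (i r) \<le> \<tau> (Suc (i r))" if "r < q" for r
 proof -
  have "i r < n" using i that by (auto simp: off_diagonal_def)
  then have "\<tau> (i r) < \<tau> (Suc (i r))" by (intro strict_mono_onD[OF sm]) auto
  then show ?thesis by simp
 qed
 have "integrable (lborel_power q) (%x. \<Prod>r<q. indicator {\<tau> (i r)<..\<tau> (Suc (i r))} (x r) :: real)"
  by (rule lborel_product.product_integrable_prod) (use le in auto)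
 then show "integrable (lborel_power q) (box_indicator q \<tau> i)" unfolding box_indicator_def[abs_def] .
 have "(\<integral>x. box_indicator q \<tau> i x \<partial>lborel_power q) = (\<Prod>r<q. \<tau> (Suc (i r)) - \<tau> (i r))"
  unfolding box_indicator_def by (subst lborel_product.product_integral_prod) (use le in auto)
 also have "... = (\<Prod>l\<in>i ` {..<q}. \<tau> (Suc l) - \<tau> l)" by (rule off_diagonal_D(3)[OF i])
 finally show "(\<integral>x. box_indicator q \<tau> i x \<partial>lborel_power q) = (\<Prod>l\<in>i ` {..<q}. \<tau> (Suc l) - \<tau> l)" .
qed

lemma elementary_fun_sq:
 assumes sm: "strict_mono_on {..n} \<tau>"
 shows "(elementary_fun q n \<tau> a x)\<^sup>2 = (\<Sum>i\<in>off_diagonal q n. (a i)\<^sup>2 * box_indicator q \<tau> i x)"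
proof -
 have "(elementary_fun q n \<tau> a x)\<^sup>2 =
  (\<Sum>i\<in>off_diagonal q n. \<Sum>j\<in>off_diagonal q n. (a i * a j) * (box_indicator q \<tau> i x * box_indicator q \<tau> j x))"
  unfolding elementary_fun_eq power2_eq_square sum_product by (simp add: mult_ac)
 also have "... = (\<Sum>i\<in>off_diagonal q n. \<Sum>j\<in>off_diagonal q n. if i = j then (a i)\<^sup>2 * box_indicator q \<tau> i x else 0)"
  by (intro sum.cong refl) (auto simp: box_indicator_mult[OF sm] power2_eq_square)
 also have "... = (\<Sum>i\<in>off_diagonal q n. (a i)\<^sup>2 * box_indicator q \<tau> i x)"
  by (intro sum.cong refl) (simp add: finite_off_diagonal)
 finally show ?thesis .
qed

text \<open>The power of sqrt(2G) appears because H_q belongs to the q-fold power of the unit-norm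
  kernel, while the process is defined with the bare exponential.\<close>

definition hermite_amplitude :: "nat => real => real" where
 "hermite_amplitude q G = hermite_const q G / sqrt (2 * G) ^ q"

context brownian_motion
begin

text \<open>The candidate for the multiple integral. The integral of the q-fold tensor power of a
  unit kernel is H_q of its Gaussian variable, and \<open>hermite_kernel\<close> is a time integral
  of such powers up to normalisation.\<close>

definition hermite_integral :: "nat => real => real => 'a => real" where
 "hermite_integral q G t w = time_integral 0 t (%s. hermite q (OU G s w)) / sqrt (2 * G) ^ q"

lemma unif_moments_hermite_OU: "0 < G ==> unif_moments M S (%s w. hermite q (OU G s w))"
 by (intro unif_moments_hermite unif_moments_OU)

lemma abs_moments_hermite_time_integral:
 assumes "0 < G" "0 \<le> t" shows "abs_moments M (%w. time_integral 0 t (%s. hermite q (OU G s w)))"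
 using unif_moments_D[OF unif_moments_time_integral[OF OU_joint_hermite[of q G] unif_moments_hermite_OU[OF assms(1)], of 0 t], of t] assms
 by simp

lemma abs_moments_hermite_integral:
 assumes "0 < G" "0 \<le> t" shows "abs_moments M (hermite_integral q G t)"
 using abs_moments_cmult[OF abs_moments_hermite_time_integral[OF assms], of "1 / sqrt (2 * G) ^ q" q]
 by (simp add: hermite_integral_def[abs_def])

lemma expectation_time_integral_mult:
 assumes Y: "(%(s, w). Y s w) \<in> borel_measurable (lborel \<Otimes>\<^sub>M M)" "unif_moments M {a..b} Y"
  and V: "abs_moments M V"
 shows "expectation (%w. V w * time_integral a b (%s. Y s w)) = time_integral a b (%s. expectation (%w. V w * Y s w))"
proof -
 have [measurable]: "V \<in> borel_measurable M" using V by (rule abs_moments_measurable)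
 have m: "(%(s, w). V w * Y s w) \<in> borel_measurable (lborel \<Otimes>\<^sub>M M)" using Y(1) by (simp add: case_prod_beta)
 have u: "unif_moments M {a..b} (%s w. V w * Y s w)" by (intro unif_moments_mult unif_moments_const V Y)
 show ?thesis using expectation_time_integral[OF m u] by simp
qed

text \<open>Mehler gives the covariance q! exp(-G q |s - u|) of the integrand, and the same double
  time integral computes the norm of the kernel.\<close>

lemma expectation_hermite_integral_sq:
 assumes g: "0 < G" and t: "0 \<le> t"
 shows "expectation (%w. (hermite_integral q G t w)\<^sup>2) = fact q * (\<integral>x. (hermite_kernel q G t x)\<^sup>2 \<partial>lborel_power q)"
proof -
 let ?H = "%s w. hermite q (OU G s w)" and ?T = "%w. time_integral 0 t (%s. hermite q (OU G s w))"
 note mT = abs_moments_hermite_time_integral[OF g t, of q]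
 have sq: "(sqrt (2 * G) ^ q)\<^sup>2 = (2 * G) ^ q" using g by (simp add: power_mult[symmetric] mult.commute[of q] power_mult)
 have "expectation (%w. ?T w * ?T w) = time_integral 0 t (%s. expectation (%w. ?T w * ?H s w))"
  by (rule expectation_time_integral_mult[OF OU_joint_hermite unif_moments_hermite_OU[OF g] mT])
 also have "... = time_integral 0 t (%s. time_integral 0 t (%u. fact q * exp (- G * \<bar>s - u\<bar>) ^ q))"
 proof (rule time_integral_cong)
  fix s
  have "expectation (%w. ?T w * ?H s w) = expectation (%w. ?H s w * ?T w)" by (simp only: mult.commute)
  also have "... = time_integral 0 t (%u. expectation (%w. ?H s w * ?H u w))"
   by (rule expectation_time_integral_mult[OF OU_joint_hermite unif_moments_hermite_OU[OF g] abs_moments_hermite[OF abs_moments_OU[OF g]]])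
  finally show "expectation (%w. ?T w * ?H s w) = time_integral 0 t (%u. fact q * exp (- G * \<bar>s - u\<bar>) ^ q)"
   by (simp only: expectation_hermite_OU_two[OF g] abs_minus_commute)
 qed
 also have "... = fact q * (2 * G) ^ q * time_integral 0 t (%s. time_integral 0 t (%u. (exp (- G * \<bar>s - u\<bar>) / (2 * G)) ^ q))"
 proof -
  have "fact q * exp (- G * \<bar>s - u\<bar>) ^ q = (fact q * (2 * G) ^ q) * (exp (- G * \<bar>s - u\<bar>) / (2 * G)) ^ q" for s u
   using g by (simp add: power_divide)
  then show ?thesis by (simp only: time_integral_cmult)
 qed
 finally have "expectation (%w. ?T w * ?T w) = fact q * (2 * G) ^ q * (\<integral>x. (hermite_kernel q G t x)\<^sup>2 \<partial>lborel_power q)"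
  unfolding hermite_kernel_sq_integral[OF g] .
 then show ?thesis using g by (simp add: hermite_integral_def power_divide sq power2_eq_square[of "?T _"])
qed

text \<open>The grid formula on one side and Fubini on the other reduce both to the time integral of
  the same product of cell weights.\<close>

lemma expectation_increments_hermite_integral:
 assumes g: "0 < G" and t: "0 \<le> t" and sm: "strict_mono_on {..n} \<tau>" and i: "i \<in> off_diagonal q n"
 shows "expectation (%w. (\<Prod>l\<in>i ` {..<q}. B (\<tau> (Suc l)) w - B (\<tau> l) w) * hermite_integral q G t w)
  = fact q * (\<integral>x. box_indicator q \<tau> i x * hermite_kernel q G t x \<partial>lborel_power q)"
proof -
 let ?P = "%w. \<Prod>l\<in>i ` {..<q}. B (\<tau> (Suc l)) w - B (\<tau> l) w"
 have mono: "mono_on {..n} \<tau>" by (rule strict_mono_on_imp_mono_on[OF sm])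
 have le: "\<tau> (i r) \<le> \<tau> (Suc (i r))" if "r < q" for r
  using i that by (intro mono_onD[OF mono]) (auto simp: off_diagonal_def Suc_le_eq intro: less_imp_le)
 have "expectation (%w. ?P w * time_integral 0 t (%s. hermite q (OU G s w))) =
  time_integral 0 t (%s. expectation (%w. ?P w * hermite q (OU G s w)))"
  by (rule expectation_time_integral_mult[OF OU_joint_hermite unif_moments_hermite_OU[OF g] abs_moments_prod_increments])
 also have "... = time_integral 0 t (%s. (fact q * sqrt (2 * G) ^ q) *
   (\<Prod>r<q. (exp (- G * (s - min (\<tau> (Suc (i r))) s)) - exp (- G * (s - min (\<tau> (i r)) s))) / G))"
 proof (rule time_integral_cong)
  fix s
  have "expectation (%w. ?P w * hermite q (OU G s w)) = fact q * (\<Prod>l\<in>i ` {..<q}. box_weight G \<tau> l s)"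
   using expectation_grid_hermite[OF g mono off_diagonal_D(1)[OF i], of q s] off_diagonal_D(2)[OF i] by simp
  also have "(\<Prod>l\<in>i ` {..<q}. box_weight G \<tau> l s) = (\<Prod>r<q. box_weight G \<tau> (i r) s)"
   by (rule off_diagonal_D(3)[OF i, symmetric])
  also have "... = (\<Prod>r<q. sqrt (2 * G) * ((exp (- G * (s - min (\<tau> (Suc (i r))) s)) - exp (- G * (s - min (\<tau> (i r)) s))) / G))"
   by (simp add: box_weight_def)
  also have "... = sqrt (2 * G) ^ q * (\<Prod>r<q. (exp (- G * (s - min (\<tau> (Suc (i r))) s)) - exp (- G * (s - min (\<tau> (i r)) s))) / G)"
   unfolding prod.distrib by simp
  finally show "expectation (%w. ?P w * hermite q (OU G s w)) = (fact q * sqrt (2 * G) ^ q) *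
   (\<Prod>r<q. (exp (- G * (s - min (\<tau> (Suc (i r))) s)) - exp (- G * (s - min (\<tau> (i r)) s))) / G)"
   by (simp only: mult.assoc)
 qed
 also have "... = (fact q * sqrt (2 * G) ^ q) * (\<integral>x. box_indicator q \<tau> i x * hermite_kernel q G t x \<partial>lborel_power q)"
 proof -
  have "(\<integral>x. box_indicator q \<tau> i x * hermite_kernel q G t x \<partial>lborel_power q) =
   time_integral 0 t (%s. \<Prod>r<q. (exp (- G * (s - min (\<tau> (Suc (i r))) s)) - exp (- G * (s - min (\<tau> (i r)) s))) / G)"
   by (rule box_kernel_integral[OF g]) (rule le)
  then show ?thesis by (simp only: time_integral_cmult)
 qed
 finally show ?thesis using g by (simp add: hermite_integral_def)
qed

text \<open>After expanding the squares, the mixed moment and the second moment of the candidate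
  equal q! times their counterparts. The square of the elementary integral enters with a plus sign,
  so its upper bound suffices.\<close>

lemma elementary_integral_error:
 assumes g: "0 < G" and t: "0 \<le> t" and sm: "strict_mono_on {..n} \<tau>"
 shows "(\<integral>\<^sup>+w. ennreal ((elementary_integral B q n \<tau> a w - hermite_integral q G t w)\<^sup>2) \<partial>M) \<le>
  fact q * (\<integral>\<^sup>+x. ennreal ((elementary_fun q n \<tau> a x - hermite_kernel q G t x)\<^sup>2) \<partial>lborel_power q)"
proof -
 let ?O = "off_diagonal q n" and ?Q = "lborel_power q"
 let ?I = "elementary_integral B q n \<tau> a" and ?J = "hermite_integral q G t"
 let ?f = "elementary_fun q n \<tau> a" and ?K = "hermite_kernel q G t"
 let ?P = "%i w. \<Prod>l\<in>i ` {..<q}. B (\<tau> (Suc l)) w - B (\<tau> l) w"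
 have mono: "mono_on {..n} \<tau>" by (rule strict_mono_on_imp_mono_on[OF sm])
 have le: "\<tau> (i r) \<le> \<tau> (Suc (i r))" if "i \<in> ?O" "r < q" for i r
  using that by (intro mono_onD[OF mono]) (auto simp: off_diagonal_def Suc_le_eq intro: less_imp_le)
 note mI = abs_moments_elementary_integral[of q n \<tau> a] and mJ = abs_moments_hermite_integral[OF g t, of q]
 have if2: "integrable ?Q (%x. (?f x)\<^sup>2)"
  unfolding elementary_fun_sq[OF sm] by (intro Bochner_Integration.integrable_sum integrable_mult_right box_indicator_integrable[OF sm])
 have vf2: "(\<integral>x. (?f x)\<^sup>2 \<partial>?Q) = (\<Sum>i\<in>?O. (a i)\<^sup>2 * (\<Prod>l\<in>i ` {..<q}. \<tau> (Suc l) - \<tau> l))"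
  unfolding elementary_fun_sq[OF sm]
  by (subst Bochner_Integration.integral_sum)
    (auto intro!: integrable_mult_right box_indicator_integrable[OF sm] simp: box_indicator_integral[OF sm])
 have fK: "?f x * ?K x = (\<Sum>i\<in>?O. a i * (box_indicator q \<tau> i x * ?K x))" for x
  unfolding elementary_fun_eq sum_distrib_right by (simp add: mult.assoc)
 have ibk: "integrable ?Q (%x. box_indicator q \<tau> i x * ?K x)" if "i \<in> ?O" for i
  by (rule box_kernel_integrable[OF g]) (rule le[OF that])
 have ifK: "integrable ?Q (%x. ?f x * ?K x)"
  unfolding fK by (intro Bochner_Integration.integrable_sum integrable_mult_right ibk)
 have vfK: "(\<integral>x. ?f x * ?K x \<partial>?Q) = (\<Sum>i\<in>?O. a i * (\<integral>x. box_indicator q \<tau> i x * ?K x \<partial>?Q))"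
  unfolding fK by (subst Bochner_Integration.integral_sum)
    (auto intro!: integrable_mult_right ibk)
 have EIJ: "expectation (%w. ?I w * ?J w) = fact q * (\<integral>x. ?f x * ?K x \<partial>?Q)"
 proof -
  have "?I w * ?J w = (\<Sum>i\<in>?O. a i * (?P i w * ?J w))" for w
   unfolding elementary_integral_eq sum_distrib_right by (simp add: mult.assoc)
  then have "expectation (%w. ?I w * ?J w) = (\<Sum>i\<in>?O. a i * expectation (%w. ?P i w * ?J w))"
   by (simp add: Bochner_Integration.integral_sum abs_moments_integrable abs_moments_mult abs_moments_prod_increments mJ)
  also have "... = (\<Sum>i\<in>?O. fact q * (a i * (\<integral>x. box_indicator q \<tau> i x * ?K x \<partial>?Q)))"
   by (intro sum.cong refl) (simp add: expectation_increments_hermite_integral[OF g t sm])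
  finally show ?thesis unfolding vfK sum_distrib_left .
 qed
 have expand: "(x - y)\<^sup>2 = x\<^sup>2 - 2 * (x * y) + y\<^sup>2" for x y :: real by (simp add: power2_diff)
 have iL: "integrable M (%w. (?I w - ?J w)\<^sup>2)"
  by (intro abs_moments_integrable abs_moments_power abs_moments_diff mI mJ)
 have iR: "integrable ?Q (%x. (?f x - ?K x)\<^sup>2)"
  unfolding expand by (intro Bochner_Integration.integrable_add Bochner_Integration.integrable_diff integrable_mult_right if2 ifK hermite_kernel_sq_integrable[OF g])
 have "expectation (%w. (?I w - ?J w)\<^sup>2) = expectation (%w. (?I w)\<^sup>2) - 2 * expectation (%w. ?I w * ?J w) + expectation (%w. (?J w)\<^sup>2)"
  unfolding expand by (simp add: abs_moments_integrable abs_moments_power abs_moments_mult mI mJ)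
 also have "... \<le> fact q * (\<integral>x. (?f x)\<^sup>2 \<partial>?Q) - 2 * (fact q * (\<integral>x. ?f x * ?K x \<partial>?Q)) + fact q * (\<integral>x. (?K x)\<^sup>2 \<partial>?Q)"
  using expectation_elementary_integral_sq[OF sm, of q a] unfolding EIJ expectation_hermite_integral_sq[OF g t] vf2 by simp
 also have "... = fact q * (\<integral>x. (?f x - ?K x)\<^sup>2 \<partial>?Q)"
  unfolding expand using if2 ifK hermite_kernel_sq_integrable[OF g, of q t] by (simp add: algebra_simps)
 finally have "ennreal (expectation (%w. (?I w - ?J w)\<^sup>2)) \<le> ennreal (fact q * (\<integral>x. (?f x - ?K x)\<^sup>2 \<partial>?Q))"
  by (rule ennreal_leI)
 then show ?thesis
  using iL iR by (simp add: nn_integral_eq_integral ennreal_mult ennreal_fact)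
qed

text \<open>Uniqueness of limits: by the error estimate, the approximating sequence that comes with
  J also converges in mean square to the candidate.\<close>

lemma multiple_wiener_integral_hermite_kernel:
 assumes g: "0 < G" and t: "0 \<le> t" and J: "has_multiple_wiener_integral M B q (hermite_kernel q G t) J"
 shows "AE w in M. J w = hermite_integral q G t w"
proof -
 have [measurable]: "J \<in> borel_measurable M" using J by (simp add: has_multiple_wiener_integral_def)
 have [measurable]: "hermite_integral q G t \<in> borel_measurable M" by (rule abs_moments_measurable[OF abs_moments_hermite_integral[OF g t]])
 obtain n \<tau> a where sm: "\<And>k. strict_mono_on {..n k} (\<tau> k :: nat => real)"
  and l1: "(%k. \<integral>\<^sup>+x. ennreal ((elementary_fun q (n k) (\<tau> k) (a k) x - hermite_kernel q G t x)\<^sup>2) \<partial>lborel_power q) \<longlonglongrightarrow> 0"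
  and l2: "(%k. \<integral>\<^sup>+w. ennreal ((elementary_integral B q (n k) (\<tau> k) (a k) w - J w)\<^sup>2) \<partial>M) \<longlonglongrightarrow> (0::ennreal)"
  using J unfolding has_multiple_wiener_integral_def by blast
 let ?I = "%k. elementary_integral B q (n k) (\<tau> k) (a k)" and ?H = "hermite_integral q G t"
 have [measurable]: "?I k \<in> borel_measurable M" for k by (rule abs_moments_measurable[OF abs_moments_elementary_integral])
 let ?A = "%k. \<integral>\<^sup>+w. ennreal ((?I k w - J w)\<^sup>2) \<partial>M"
 let ?C = "%k. \<integral>\<^sup>+x. ennreal ((elementary_fun q (n k) (\<tau> k) (a k) x - hermite_kernel q G t x)\<^sup>2) \<partial>lborel_power q"
 have bound: "(\<integral>\<^sup>+w. ennreal ((J w - ?H w)\<^sup>2) \<partial>M) \<le> 2 * ?A k + 2 * (fact q * ?C k)" for k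
 proof -
  have "(\<integral>\<^sup>+w. ennreal ((J w - ?H w)\<^sup>2) \<partial>M) \<le> (\<integral>\<^sup>+w. 2 * ennreal ((?I k w - J w)\<^sup>2) + 2 * ennreal ((?I k w - ?H w)\<^sup>2) \<partial>M)"
  proof (rule nn_integral_mono)
   fix w
   have "(x - y)\<^sup>2 \<le> 2 * (z - x)\<^sup>2 + 2 * (z - y)\<^sup>2" for x y z :: real
    using zero_le_power2[of "x + y - 2 * z"] by (simp add: power2_eq_square algebra_simps)
   then have "ennreal ((J w - ?H w)\<^sup>2) \<le> ennreal (2 * (?I k w - J w)\<^sup>2 + 2 * (?I k w - ?H w)\<^sup>2)" by (intro ennreal_leI)
   then show "ennreal ((J w - ?H w)\<^sup>2) \<le> 2 * ennreal ((?I k w - J w)\<^sup>2) + 2 * ennreal ((?I k w - ?H w)\<^sup>2)"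
    by (simp add: ennreal_mult)
  qed
  also have "... = 2 * ?A k + 2 * (\<integral>\<^sup>+w. ennreal ((?I k w - ?H w)\<^sup>2) \<partial>M)"
   by (subst nn_integral_add) (auto simp: nn_integral_cmult)
  also have "... \<le> 2 * ?A k + 2 * (fact q * ?C k)"
   by (intro add_mono mult_left_mono elementary_integral_error[OF g t sm]) auto
  finally show ?thesis .
 qed
 have "(%k. 2 * ?A k + 2 * (fact q * ?C k)) \<longlonglongrightarrow> 2 * 0 + 2 * (fact q * 0)"
  by (intro tendsto_add ennreal_tendsto_cmult l1 l2) (auto simp flip: ennreal_fact simp: ennreal_mult_less_top)
 then have "(\<integral>\<^sup>+w. ennreal ((J w - ?H w)\<^sup>2) \<partial>M) \<le> 0"
  using bound by (intro LIMSEQ_le_const[where X="%k. 2 * ?A k + 2 * (fact q * ?C k)"]) auto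
 then have "AE w in M. ennreal ((J w - ?H w)\<^sup>2) = 0"
  by (subst nn_integral_0_iff_AE[symmetric]) auto
 then show ?thesis by eventually_elim (simp add: ennreal_eq_0_iff)
qed

lemma time_integral_hermite_continuous:
 assumes w: "good_path w" and g: "0 < G"
 shows "continuous_on {0..b} (%t. time_integral 0 t (%s. hermite q (OU G s w)))"
proof -
 have c: "continuous_on A (%s. hermite q (OU G s w))" for A
  by (intro continuous_on_hermite OU_continuous w g)
 have "continuous_on {0..b} (%t. integral {0..t} (%s. hermite q (OU G s w)))"
  by (intro indefinite_integral_continuous_1 integrable_continuous_interval c)
 then show ?thesis by (simp add: time_integral_eq_integral[OF c])
qed

text \<open>The identity holds almost surely at each fixed time. Countably many fractions and
  continuity of both sides extend it to whole paths outside one null set.\<close>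

lemma tempered_hermite_process_representation:
 assumes g: "0 < G" and W: "tempered_hermite_process M B q G W"
 shows "AE w in M. \<forall>t\<in>{0..1}. W t w = hermite_amplitude q G * time_integral 0 t (%s. hermite q (OU G s w))"
proof -
 let ?V = "%t w. hermite_amplitude q G * time_integral 0 t (%s. hermite q (OU G s w))"
 define D where "D = range (%(i, n). of_int i / real (Suc n)) \<inter> {0..1}"
 have cD: "countable D" unfolding D_def by (intro countable_Int1 countable_image) auto
 have one: "AE w in M. W t w = ?V t w" if t: "t \<in> {0..1}" for t
 proof -
  obtain J where J: "has_multiple_wiener_integral M B q (hermite_kernel q G t) J"
   and WJ: "AE w in M. W t w = hermite_const q G * J w"
   using W t unfolding tempered_hermite_process_def by blast
  have "AE w in M. J w = hermite_integral q G t w"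
   using multiple_wiener_integral_hermite_kernel[OF g _ J] t by simp
  with WJ show ?thesis by eventually_elim (simp add: hermite_integral_def hermite_amplitude_def)
 qed
 have "AE w in M. \<forall>t\<in>D. W t w = ?V t w"
  by (subst AE_ball_countable[OF cD]) (auto simp: D_def intro!: one)
 with AE_good_path show ?thesis
 proof eventually_elim
  case (elim w)
  have w: "w \<in> space M" using elim(1) by (simp add: good_path_def)
  have cW: "continuous_on {0..1} (%t. W t w)" using W w by (simp add: tempered_hermite_process_def)
  have cV: "continuous_on {0..1} (%t. ?V t w)" by (intro continuous_on_mult_left time_integral_hermite_continuous elim(1) g)
  show ?case
  proof
   fix t :: real assume t: "t \<in> {0..1}"
   define r where "r n = of_int \<lfloor>t * real (Suc n)\<rfloor> / real (Suc n)" for n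
   have r01: "r n \<in> {0..1}" for n
   proof -
    have "of_int \<lfloor>t * real (Suc n)\<rfloor> \<le> t * real (Suc n)" by simp
    also have "... \<le> 1 * real (Suc n)" using t by (intro mult_right_mono) auto
    finally show ?thesis using t by (simp add: r_def divide_le_eq)
   qed
   have rD: "r n \<in> D" for n using r01[of n] by (auto simp: D_def r_def)
   have lim: "r \<longlonglongrightarrow> t" unfolding r_def by real_asymp
   have l1: "(%n. W (r n) w) \<longlonglongrightarrow> W t w"
    using cW t r01 lim unfolding continuous_on_sequentially by (auto simp: comp_def)
   have l2: "(%n. ?V (r n) w) \<longlonglongrightarrow> ?V t w"
    using cV t r01 lim unfolding continuous_on_sequentially by (auto simp: comp_def)
   have "W (r n) w = ?V (r n) w" for n using elim(2) rD by blast
   with l1 l2 show "W t w = ?V t w" using LIMSEQ_unique by auto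
  qed
 qed
qed

end

section \<open>Convergence in distribution on C[0,1]\<close>

definition bounded_lipschitz :: "('s::metric_space => real) => bool" where
 "bounded_lipschitz \<phi> \<longleftrightarrow> (\<exists>C. \<forall>x. \<bar>\<phi> x\<bar> \<le> C) \<and> (\<exists>L\<ge>0. \<forall>x y. \<bar>\<phi> x - \<phi> y\<bar> \<le> L * dist x y)"

lemma bounded_lipschitz_continuous: "bounded_lipschitz \<phi> ==> continuous_on UNIV \<phi>"
proof -
 assume "bounded_lipschitz \<phi>"
 then obtain L where L: "0 \<le> L" "\<And>x y. \<bar>\<phi> x - \<phi> y\<bar> \<le> L * dist x y" unfolding bounded_lipschitz_def by blast
 then have "L-lipschitz_on UNIV \<phi>" by (auto simp: lipschitz_on_def dist_real_def)
 then show ?thesis by (rule lipschitz_on_continuous_on)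
qed

text \<open>For bounded \<open>\<phi>\<close> this is the largest k-Lipschitz minorant; it converges
  pointwise to \<open>\<phi>\<close> when that is continuous.\<close>

definition inf_conv :: "('s::metric_space => real) => nat => 's => real" where
 "inf_conv \<phi> k x = (INF y. \<phi> y + real k * dist x y)"

context
 fixes \<phi> :: "'s::metric_space => real" and C :: real
 assumes bd: "\<And>x. \<bar>\<phi> x\<bar> \<le> C"
begin

lemma inf_conv_bdd_below: "bdd_below (range (%y. \<phi> y + real k * dist x y))"
proof (rule bdd_belowI)
 fix z assume "z \<in> range (%y. \<phi> y + real k * dist x y)"
 then obtain y where "z = \<phi> y + real k * dist x y" by blast
 moreover have "- C \<le> \<phi> y" using bd[of y] by linarith
 moreover have "0 \<le> real k * dist x y" by simp
 ultimately show "- C \<le> z" by linarith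
qed

lemma inf_conv_le: "inf_conv \<phi> k x \<le> \<phi> x"
 using cINF_lower[OF inf_conv_bdd_below, of x k x] by (simp add: inf_conv_def)

lemma inf_conv_ge: "(\<And>y. c \<le> \<phi> y + real k * dist x y) ==> c \<le> inf_conv \<phi> k x"
 unfolding inf_conv_def by (rule cINF_greatest) auto

lemma inf_conv_bounded_lipschitz: "bounded_lipschitz (inf_conv \<phi> k)"
 unfolding bounded_lipschitz_def
proof (intro conjI exI allI)
 fix x
 have "- C \<le> inf_conv \<phi> k x"
 proof (rule inf_conv_ge)
  fix y show "- C \<le> \<phi> y + real k * dist x y" using bd[of y] mult_nonneg_nonneg[OF of_nat_0_le_iff[of k] zero_le_dist[of x y]] by linarith
 qed
 then show "\<bar>inf_conv \<phi> k x\<bar> \<le> C" using inf_conv_le[of k x] bd[of x] by linarith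
next
 have *: "inf_conv \<phi> k x - real k * dist x y \<le> inf_conv \<phi> k y" for x y
 proof (rule inf_conv_ge)
  fix z
  have "inf_conv \<phi> k x \<le> \<phi> z + real k * dist x z"
   unfolding inf_conv_def by (rule cINF_lower[OF inf_conv_bdd_below]) simp
  also have "real k * dist x z \<le> real k * (dist x y + dist y z)" by (intro mult_left_mono dist_triangle) simp
  finally show "inf_conv \<phi> k x - real k * dist x y \<le> \<phi> z + real k * dist y z" by (simp add: algebra_simps)
 qed
 fix x y
 show "\<bar>inf_conv \<phi> k x - inf_conv \<phi> k y\<bar> \<le> real k * dist x y"
  using *[of x y] *[of y x] by (simp add: dist_commute abs_le_iff)
qed simp

lemma inf_conv_tendsto:
 assumes cont: "continuous_on UNIV \<phi>"
 shows "(%k. inf_conv \<phi> k x) \<longlonglongrightarrow> \<phi> x"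
proof (rule LIMSEQ_I)
 fix e :: real assume e: "0 < e"
 have "isCont \<phi> x" using cont by (simp add: continuous_on_eq_continuous_at)
 then have "(\<phi> \<longlongrightarrow> \<phi> x) (nhds x)" by (simp add: isCont_def tendsto_at_iff_tendsto_nhds)
 from tendstoD[OF this half_gt_zero[OF e]]
 obtain d where d: "0 < d" "\<And>y. dist y x < d ==> dist (\<phi> y) (\<phi> x) < e / 2"
  unfolding eventually_nhds_metric by blast
 \<comment> \<open>Beyond distance d the penalty k d exceeds 2C, the largest possible gain in
   \<open>\<phi>\<close>, so only points near x compete in the infimum.\<close>
 obtain N where N: "2 * C / d < real N" using reals_Archimedean2 by blast
 have "norm (inf_conv \<phi> k x - \<phi> x) < e" if k: "k \<ge> N" for k
 proof -
  have "\<phi> x - e / 2 \<le> inf_conv \<phi> k x"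
  proof (rule inf_conv_ge)
   fix y
   show "\<phi> x - e / 2 \<le> \<phi> y + real k * dist x y"
   proof (cases "dist y x < d")
    case True
    have "0 \<le> real k * dist x y" by simp
    moreover have "\<bar>\<phi> y - \<phi> x\<bar> < e / 2" using d(2)[OF True] by (simp only: dist_real_def)
    ultimately show ?thesis by linarith
   next
    case False
    have "2 * C < real N * d" using N d(1) by (simp add: divide_less_eq)
    also have "... \<le> real k * dist x y" using k False d(1) by (intro mult_mono) (auto simp: dist_commute)
    finally show ?thesis using bd[of x] bd[of y] e by linarith
   qed
  qed
  then show ?thesis using inf_conv_le[of k x] e by simp
 qed
 then show "\<exists>N. \<forall>k\<ge>N. norm (inf_conv \<phi> k x - \<phi> x) < e" by blast
qed

end

text \<open>Lipschitz minorants bound the expectations from below in the limit; the same bound for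
  the negative of the test function gives the other half.\<close>

lemma weak_conv_from_lipschitz:
 fixes X :: "'i => 'a => 's::metric_space" and Y :: "'b => 's" and C :: real
 assumes M: "prob_space M" and N: "prob_space N"
  and X: "\<forall>\<^sub>F i in F. X i \<in> borel_measurable M" and Y: "Y \<in> borel_measurable N"
  and lip: "\<And>\<phi>. bounded_lipschitz \<phi> ==> ((%i. \<integral>w. \<phi> (X i w) \<partial>M) \<longlongrightarrow> (\<integral>w. \<phi> (Y w) \<partial>N)) F"
  and cont: "continuous_on UNIV \<phi>" and bd: "\<And>x. \<bar>\<phi> x\<bar> \<le> C"
 shows "((%i. \<integral>w. \<phi> (X i w) \<partial>M) \<longlongrightarrow> (\<integral>w. \<phi> (Y w) \<partial>N)) F"
proof -
 interpret M: prob_space M by fact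
 interpret N: prob_space N by fact
 have low: "\<forall>\<^sub>F i in F. (\<integral>w. \<psi> (Y w) \<partial>N) - e < (\<integral>w. \<psi> (X i w) \<partial>M)"
  if cont: "continuous_on UNIV \<psi>" and bd: "\<And>x. \<bar>\<psi> x\<bar> \<le> C" and e: "0 < e" for \<psi> :: "'s => real" and e
 proof -
  have mp: "\<psi> \<in> borel_measurable borel" by (rule borel_measurable_continuous_onI[OF cont])
  have mk: "inf_conv \<psi> k \<in> borel_measurable borel" for k
   by (rule borel_measurable_continuous_onI[OF bounded_lipschitz_continuous[OF inf_conv_bounded_lipschitz[where \<phi>=\<psi>, OF bd]]])
  have kb: "\<bar>inf_conv \<psi> k x\<bar> \<le> C" for k x
  proof -
   have "- C \<le> inf_conv \<psi> k x"
   proof (rule inf_conv_ge[where \<phi>=\<psi>, OF bd])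
    fix y show "- C \<le> \<psi> y + real k * dist x y" using bd[of y] mult_nonneg_nonneg[OF of_nat_0_le_iff[of k] zero_le_dist[of x y]] by linarith
   qed
   then show ?thesis using inf_conv_le[where \<phi>=\<psi>, OF bd, where k=k and x=x] bd[of x] by linarith
  qed
  have "(%k. \<integral>w. inf_conv \<psi> k (Y w) \<partial>N) \<longlonglongrightarrow> (\<integral>w. \<psi> (Y w) \<partial>N)"
   by (rule integral_dominated_convergence[where w="%_. C"])
     (use kb inf_conv_tendsto[where \<phi>=\<psi>, OF bd cont] measurable_compose[OF Y mp] measurable_compose[OF Y mk] in auto)
  from order_tendstoD(1)[OF this, of "(\<integral>w. \<psi> (Y w) \<partial>N) - e / 2"] e
  obtain k where k: "(\<integral>w. \<psi> (Y w) \<partial>N) - e / 2 < (\<integral>w. inf_conv \<psi> k (Y w) \<partial>N)"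
   by (auto simp: eventually_sequentially)
  have "\<forall>\<^sub>F i in F. (\<integral>w. inf_conv \<psi> k (Y w) \<partial>N) - e / 2 < (\<integral>w. inf_conv \<psi> k (X i w) \<partial>M)"
   by (rule order_tendstoD(1)[OF lip[OF inf_conv_bounded_lipschitz[where \<phi>=\<psi>, OF bd]]]) (use e in simp)
  then show ?thesis using X
  proof eventually_elim
   case (elim i)
   have "(\<integral>w. inf_conv \<psi> k (X i w) \<partial>M) \<le> (\<integral>w. \<psi> (X i w) \<partial>M)"
    by (rule integral_mono)
      (use kb bd inf_conv_le[where \<phi>=\<psi>, OF bd] measurable_compose[OF elim(2) mp] measurable_compose[OF elim(2) mk] in
       \<open>auto intro!: M.integrable_const_bound[where B=C]\<close>)
   then show ?case using elim(1) k by linarith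
  qed
 qed
 show ?thesis
 proof (rule tendstoI)
  fix e :: real assume e: "0 < e"
  have "continuous_on UNIV (%x. - \<phi> x)" "\<And>x. \<bar>- \<phi> x\<bar> \<le> C" using cont bd by (auto intro: continuous_intros)
  from low[OF cont bd e] low[OF this e] show "\<forall>\<^sub>F i in F. dist (\<integral>w. \<phi> (X i w) \<partial>M) (\<integral>w. \<phi> (Y w) \<partial>N) < e"
   by eventually_elim (auto simp: dist_real_def)
 qed
qed

section \<open>Paths as bounded continuous functions on the line\<close>

abbreviation clamp01 :: "real => real" where "clamp01 t \<equiv> max 0 (min 1 t)"

text \<open>Constant extension beyond the unit interval turns paths into points of a normed type,
  where continuity, distances and Borel sets come from type classes.\<close>

definition path_bc :: "(real => real) => (real \<Rightarrow>\<^sub>C real)" where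
 "path_bc f = Bcontfun (%t. f (clamp01 t))"

lemma apply_path_bc:
 assumes "continuous_on {0..1} f"
 shows "apply_bcontfun (path_bc f) t = f (clamp01 t)"
proof -
 have c: "continuous_on UNIV (%t. f (clamp01 t))"
  by (rule continuous_on_compose2[OF assms]) (auto intro!: continuous_intros)
 have "compact (f ` {0..1})" by (rule compact_continuous_image[OF assms compact_Icc])
 then have "bounded (range (%t. f (clamp01 t)))"
  by (rule bounded_subset[OF compact_imp_bounded]) auto
 with c have "(%t. f (clamp01 t)) \<in> bcontfun" by (simp add: bcontfun_def)
 then show ?thesis by (simp add: path_bc_def Bcontfun_inverse)
qed

lemma dist_path_bc_le:
 assumes "continuous_on {0..1} f" "continuous_on {0..1} g" "\<And>t. 0 \<le> t ==> t \<le> 1 ==> \<bar>f t - g t\<bar> \<le> e"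
 shows "dist (path_bc f) (path_bc g) \<le> e"
 by (rule dist_bound) (use assms(3) in \<open>auto simp: apply_path_bc[OF assms(1)] apply_path_bc[OF assms(2)] dist_real_def\<close>)

lemma path_bc_cong: "(\<And>t. 0 \<le> t ==> t \<le> 1 ==> f t = g t) ==> path_bc f = path_bc g"
 unfolding path_bc_def by (intro arg_cong[where f=Bcontfun] ext) auto

lemma topspace_C01: "topspace C01 = {f. f \<in> extensional {0..1} \<and> continuous_on {0..1} f}"
 unfolding C01_def topspace_mtopology_of
 by (subst compactin_mspace_cfunspace) (auto simp: compactin_subtopology)

text \<open>The way back to \<open>C01\<close>. It does not increase distances, so test functionals
  can be pulled back along it.\<close>

definition restrict01 :: "(real \<Rightarrow>\<^sub>C real) => real => real" where
 "restrict01 g = restrict (apply_bcontfun g) {0..1}"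

lemma restrict01_in_C01: "restrict01 g \<in> topspace C01"
 by (auto simp: topspace_C01 restrict01_def intro: continuous_on_eq[OF continuous_on_apply_bcontfun])

lemma continuous_map_restrict01: "continuous_map euclidean C01 restrict01"
proof -
 let ?m = "cfunspace (top_of_set {0..1::real}) (euclidean_metric :: real metric)"
 interpret S: Metric_space "mspace ?m" "mdist ?m" by (rule Metric_space_mspace_mdist)
 have in_m: "restrict01 g \<in> mspace ?m" for g
  using restrict01_in_C01[of g] by (simp only: C01_def topspace_mtopology_of)
 show ?thesis
  unfolding C01_def mtopology_of_def S.continuous_map_to_metric
 proof (intro ballI allI impI)
  fix x :: "real \<Rightarrow>\<^sub>C real" and e :: real assume e: "0 < e"
  have "restrict01 y \<in> S.mball (restrict01 x) e" if "y \<in> ball x e" for y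
  proof -
   have "mdist ?m (restrict01 x) (restrict01 y) \<le> dist x y"
    by (rule mdist_cfunspace_le) (use dist_bounded[of x _ y] in \<open>auto simp: restrict01_def\<close>)
   then show ?thesis using that in_m by (auto simp del: mspace_cfunspace)
  qed
  then show "\<exists>U. openin euclidean U \<and> x \<in> U \<and> (\<forall>y\<in>U. restrict01 y \<in> S.mball (restrict01 x) e)"
   using e by (intro exI[of _ "ball x e"]) auto
 qed
qed

lemma restrict_eq_restrict01:
 "continuous_on {0..1} f ==> restrict f {0..1} = restrict01 (path_bc f)"
 by (auto simp: restrict01_def apply_path_bc intro!: restrict_ext)

section \<open>Polygonal interpolation\<close>

definition hat :: "nat => nat => real => real" where
 "hat n k t = max 0 (1 - \<bar>real n * t - real k\<bar>)"

lemma hat_continuous: "continuous_on A (hat n k)"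
 unfolding hat_def by (intro continuous_intros)

lemma hat_nonneg: "0 \<le> hat n k t" by (simp add: hat_def)

text \<open>At time t only the nodes j and j + 1 around n t contribute, and for t = 1 the last node
  alone.\<close>

lemma hat_partition:
 assumes n: "0 < n" and t: "0 \<le> t" "t \<le> 1"
 shows "(\<Sum>k\<le>n. hat n k t) = 1"
proof -
 define j where "j = nat \<lfloor>real n * t\<rfloor>"
 have nt: "0 \<le> real n * t" "real n * t \<le> real n" using n t by (auto intro: mult_left_le)
 have j: "real j \<le> real n * t" "real n * t < real j + 1" using nt(1) unfolding j_def by linarith+
 have jn: "j \<le> n" using j(1) nt(2) by linarith
 have zero: "hat n k t = 0" if "k \<noteq> j" "k \<noteq> Suc j" for k
 proof -
  have "real k \<le> real j - 1 \<or> real j + 2 \<le> real k" using that by linarith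
  then show ?thesis using j by (auto simp: hat_def)
 qed
 show ?thesis
 proof (cases "j = n")
  case True
  have "(\<Sum>k\<le>n. hat n k t) = (\<Sum>k\<in>{n}. hat n k t)"
   by (rule sum.mono_neutral_right) (use zero True in auto)
  moreover have e: "real n * t = real n" using j(1) nt True by linarith
  have "hat n n t = 1" unfolding hat_def e by simp
  ultimately show ?thesis by simp
 next
  case False
  then have "(\<Sum>k\<le>n. hat n k t) = (\<Sum>k\<in>{j, Suc j}. hat n k t)"
   by (intro sum.mono_neutral_right) (use zero jn in auto)
  then show ?thesis using j by (simp add: hat_def)
 qed
qed

definition polygon :: "nat => (nat => real) => (real \<Rightarrow>\<^sub>C real)" where
 "polygon n x = (\<Sum>k\<le>n. x k *\<^sub>R path_bc (hat n k))"

lemma apply_polygon: "apply_bcontfun (polygon n x) t = (\<Sum>k\<le>n. x k * hat n k (clamp01 t))"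
proof -
 have "apply_bcontfun (\<Sum>k\<in>I. x k *\<^sub>R path_bc (hat n k)) t = (\<Sum>k\<in>I. x k * hat n k (clamp01 t))" if "finite I" for I
  using that by (induction I) (auto simp: apply_path_bc[OF hat_continuous])
 then show ?thesis by (simp add: polygon_def)
qed

lemma dist_polygon_le:
 assumes n: "0 < n" and le: "\<And>k. k \<le> n ==> \<bar>x k - y k\<bar> \<le> e"
 shows "dist (polygon n x) (polygon n y) \<le> e"
proof (rule dist_bound)
 fix t
 have c: "0 \<le> clamp01 t" "clamp01 t \<le> 1" by auto
 have "dist (polygon n x t) (polygon n y t) = \<bar>\<Sum>k\<le>n. (x k - y k) * hat n k (clamp01 t)\<bar>"
  by (simp add: apply_polygon dist_real_def sum_subtractf left_diff_distrib)
 also have "... \<le> (\<Sum>k\<le>n. e * hat n k (clamp01 t))"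
  by (rule order_trans[OF sum_abs]) (auto intro!: sum_mono mult_right_mono le simp: abs_mult hat_nonneg)
 also have "... = e" using hat_partition[OF n c] by (simp flip: sum_distrib_left)
 finally show "dist (polygon n x t) (polygon n y t) \<le> e" .
qed

lemma continuous_on_polygon: "continuous_on UNIV (polygon n)"
 unfolding polygon_def[abs_def] by (intro continuous_intros) auto

text \<open>The polygon averages nodal values with total weight one, and only nodes at distance less
  than 1/n from t carry weight.\<close>

lemma dist_polygon_path_le:
 assumes n: "0 < n" and f: "continuous_on {0..1} f"
  and le: "\<And>t k. 0 \<le> t ==> t \<le> 1 ==> k \<le> n ==> \<bar>real n * t - real k\<bar> < 1 ==> \<bar>f (real k / real n) - f t\<bar> \<le> e"
 shows "dist (polygon n (%k. f (real k / real n))) (path_bc f) \<le> e"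
proof (rule dist_bound)
 fix t
 define s where "s = clamp01 t"
 have s: "0 \<le> s" "s \<le> 1" by (auto simp: s_def)
 have "(\<Sum>k\<le>n. f (real k / real n) * hat n k s) - f s * (\<Sum>k\<le>n. hat n k s) = (\<Sum>k\<le>n. (f (real k / real n) - f s) * hat n k s)"
  by (simp add: sum_distrib_left sum_subtractf left_diff_distrib)
 then have "dist (polygon n (%k. f (real k / real n)) t) (path_bc f t) = \<bar>\<Sum>k\<le>n. (f (real k / real n) - f s) * hat n k s\<bar>"
  by (simp add: apply_polygon apply_path_bc[OF f] dist_real_def hat_partition[OF n s] s_def[symmetric])
 also have "... \<le> (\<Sum>k\<le>n. e * hat n k s)"
 proof (rule order_trans[OF sum_abs], rule sum_mono)
  fix k assume k: "k \<in> {..n}"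
  show "\<bar>(f (real k / real n) - f s) * hat n k s\<bar> \<le> e * hat n k s"
  proof (cases "\<bar>real n * s - real k\<bar> < 1")
   case True
   then show ?thesis using le[OF s _ True] k by (auto simp: abs_mult hat_nonneg intro!: mult_right_mono)
  qed (simp add: hat_def)
 qed
 also have "... = e" using hat_partition[OF n s] by (simp flip: sum_distrib_left)
 finally show "dist (polygon n (%k. f (real k / real n)) t) (path_bc f t) \<le> e" .
qed

lemma polygon_tendsto:
 assumes f: "continuous_on {0..1} f"
 shows "(%n. polygon (Suc n) (%k. f (real k / real (Suc n)))) \<longlonglongrightarrow> path_bc f"
proof (rule tendstoI)
 fix e :: real assume e: "0 < e"
 have "uniformly_continuous_on {0..1} f" by (rule compact_uniformly_continuous[OF f compact_Icc])
 then obtain d where d: "0 < d" "\<And>x y. x \<in> {0..1} ==> y \<in> {0..1} ==> dist y x < d ==> dist (f y) (f x) < e / 2"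
  unfolding uniformly_continuous_on_def using half_gt_zero[OF e] by blast
 obtain N where N: "1 / d < real N" using reals_Archimedean2 by blast
 have "dist (polygon (Suc n) (%k. f (real k / real (Suc n)))) (path_bc f) < e" if n: "N \<le> n" for n
 proof -
  have "dist (polygon (Suc n) (%k. f (real k / real (Suc n)))) (path_bc f) \<le> e / 2"
  proof (rule dist_polygon_path_le[OF _ f])
   fix t k assume t: "0 \<le> t" "t \<le> 1" and k: "k \<le> Suc n" "\<bar>real (Suc n) * t - real k\<bar> < 1"
   have "1 < real N * d" using N d(1) by (simp add: divide_less_eq)
   also have "... \<le> real (Suc n) * d" using n d(1) by (intro mult_right_mono) auto
   finally have nd: "1 < real (Suc n) * d" .
   have eq: "real (Suc n) * (real k / real (Suc n) - t) = real k - real (Suc n) * t" by (simp add: right_diff_distrib)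
   have "real (Suc n) * \<bar>real k / real (Suc n) - t\<bar> = \<bar>real k - real (Suc n) * t\<bar>"
    unfolding eq[symmetric] abs_mult by simp
   then have "real (Suc n) * \<bar>real k / real (Suc n) - t\<bar> < real (Suc n) * d"
    using k(2) nd by linarith
   then have "\<bar>real k / real (Suc n) - t\<bar> < d" by (simp only: mult_less_cancel_left_pos of_nat_0_less_iff zero_less_Suc)
   moreover have "real k / real (Suc n) \<in> {0..1}" using k(1) by (simp add: divide_le_eq)
   ultimately show "\<bar>f (real k / real (Suc n)) - f t\<bar> \<le> e / 2"
    using d(2)[of t "real k / real (Suc n)"] t by (simp add: dist_real_def)
  qed simp
  then show ?thesis using e by linarith
 qed
 then show "\<forall>\<^sub>F n in sequentially. dist (polygon (Suc n) (%k. f (real k / real (Suc n)))) (path_bc f) < e"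
  by (auto simp: eventually_sequentially)
qed

text \<open>A path is the limit of its polygons, and each polygon depends continuously on finitely
  many coordinates.\<close>

lemma path_bc_measurable:
 assumes m: "\<And>t. 0 \<le> t ==> t \<le> 1 ==> X t \<in> borel_measurable M"
  and c: "\<And>w. w \<in> space M ==> continuous_on {0..1} (%t. X t w)"
 shows "(%w. path_bc (%t. X t w)) \<in> borel_measurable M"
proof (rule borel_measurable_LIMSEQ_metric)
 fix n
 \<comment> \<open>\<open>polygon\<close> takes a whole sequence while X is measurable only at times
   in the unit interval, so coordinates beyond the last node are set to 0.\<close>
 have "(%w k. if k \<le> Suc n then X (real k / real (Suc n)) w else 0) \<in> borel_measurable M"
 proof (rule measurable_coordinatewise_then_product)
  fix k show "(%w. if k \<le> Suc n then X (real k / real (Suc n)) w else 0) \<in> borel_measurable M"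
   using m[of "real k / real (Suc n)"] by (cases "k \<le> Suc n") (auto simp: divide_le_eq)
 qed
 from measurable_compose[OF this borel_measurable_continuous_onI[OF continuous_on_polygon[of "Suc n"]]]
 have "(%w. polygon (Suc n) (%k. if k \<le> Suc n then X (real k / real (Suc n)) w else 0)) \<in> borel_measurable M" .
 moreover have "polygon (Suc n) (%k. if k \<le> Suc n then x k else 0) = polygon (Suc n) x" for x
  unfolding polygon_def by (intro sum.cong) auto
 ultimately show "(%w. polygon (Suc n) (%k. X (real k / real (Suc n)) w)) \<in> borel_measurable M" by simp
next
 fix w assume "w \<in> space M"
 then show "(%n. polygon (Suc n) (%k. X (real k / real (Suc n)) w)) \<longlonglongrightarrow> path_bc (%t. X t w)"
  by (intro polygon_tendsto c)
qed

lemma restrict_path_measurable: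
 assumes m: "\<And>t. 0 \<le> t ==> t \<le> 1 ==> X t \<in> borel_measurable M"
  and c: "\<And>w. w \<in> space M ==> continuous_on {0..1} (%t. X t w)"
 shows "(%w. \<lambda>t\<in>{0..1}. X t w) \<in> measurable M (sigma (topspace C01) {U. openin C01 U})"
proof (rule measurable_measure_of)
 show "{U. openin C01 U} \<subseteq> Pow (topspace C01)" by (auto dest: openin_subset)
 have eq: "(\<lambda>t\<in>{0..1}. X t w) = restrict01 (path_bc (%t. X t w))" if "w \<in> space M" for w
  by (rule restrict_eq_restrict01[OF c[OF that]])
 show "(%w. \<lambda>t\<in>{0..1}. X t w) \<in> space M \<rightarrow> topspace C01"
  using restrict01_in_C01 eq by auto
 fix U assume "U \<in> {U. openin C01 U}"
 then have "openin euclidean {x \<in> topspace euclidean. restrict01 x \<in> U}"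
  using openin_continuous_map_preimage[OF continuous_map_restrict01] by blast
 then have "open (restrict01 -` U)" by (simp add: vimage_def)
 then have "(%w. path_bc (%t. X t w)) -` (restrict01 -` U) \<inter> space M \<in> sets M"
  by (intro measurable_sets[OF path_bc_measurable[OF m c]]) auto
 moreover have "(%w. \<lambda>t\<in>{0..1}. X t w) -` U \<inter> space M = (%w. path_bc (%t. X t w)) -` (restrict01 -` U) \<inter> space M"
  using eq by auto
 ultimately show "(%w. \<lambda>t\<in>{0..1}. X t w) -` U \<inter> space M \<in> sets M" by simp
qed

text \<open>A bounded continuous functional on \<open>C01\<close> composed with
  \<open>restrict01\<close> is one on the normed type, to which the Lipschitz criterion
  applies.\<close>

lemma process_conv_C01I:
 assumes M: "prob_space M" and N: "prob_space N"
  and X: "\<forall>\<^sub>F i in F. (\<forall>t\<in>{0..1}. X i t \<in> borel_measurable M) \<and> (\<forall>w\<in>space M. continuous_on {0..1} (%t. X i t w))"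
  and Y: "\<And>t. t \<in> {0..1} ==> Y t \<in> borel_measurable N" "\<And>w. w \<in> space N ==> continuous_on {0..1} (%t. Y t w)"
  and lip: "\<And>\<phi>. bounded_lipschitz \<phi> ==>
   ((%i. \<integral>w. \<phi> (path_bc (%t. X i t w)) \<partial>M) \<longlongrightarrow> (\<integral>w. \<phi> (path_bc (%t. Y t w)) \<partial>N)) F"
 shows "process_conv_C01 M X N Y F"
 unfolding process_conv_C01_def conv_in_distribution_def
proof (intro conjI allI impI)
 show "\<forall>\<^sub>F i in F. (%w. \<lambda>t\<in>{0..1}. X i t w) \<in> measurable M (sigma (topspace C01) {U. openin C01 U})"
  using X by eventually_elim (auto intro!: restrict_path_measurable)
 show "(%w. \<lambda>t\<in>{0..1}. Y t w) \<in> measurable N (sigma (topspace C01) {U. openin C01 U})"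
  using Y by (auto intro!: restrict_path_measurable)
 fix \<phi> :: "(real => real) => real" assume \<phi>: "continuous_map C01 euclideanreal \<phi> \<and> bounded (\<phi> ` topspace C01)"
 have "continuous_map euclidean euclideanreal (\<phi> \<circ> restrict01)"
  by (rule continuous_map_compose[OF continuous_map_restrict01]) (use \<phi> in blast)
 then have cont: "continuous_on UNIV (%x. \<phi> (restrict01 x))" by (simp add: comp_def)
 obtain C where C: "\<And>f. f \<in> topspace C01 ==> \<bar>\<phi> f\<bar> \<le> C" using \<phi> unfolding bounded_iff by auto
 have mX: "\<forall>\<^sub>F i in F. (%w. path_bc (%t. X i t w)) \<in> borel_measurable M"
  using X by eventually_elim (auto intro!: path_bc_measurable)
 have mY: "(%w. path_bc (%t. Y t w)) \<in> borel_measurable N" using Y by (auto intro!: path_bc_measurable)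
 have "((%i. \<integral>w. \<phi> (restrict01 (path_bc (%t. X i t w))) \<partial>M) \<longlongrightarrow> (\<integral>w. \<phi> (restrict01 (path_bc (%t. Y t w))) \<partial>N)) F"
  by (rule weak_conv_from_lipschitz[OF M N mX mY lip cont]) (use C restrict01_in_C01 in auto)
 moreover have ev: "\<forall>\<^sub>F i in F. (\<integral>w. \<phi> (restrict01 (path_bc (%t. X i t w))) \<partial>M) = (\<integral>w. \<phi> (\<lambda>t\<in>{0..1}. X i t w) \<partial>M)"
  using X by eventually_elim (auto intro!: Bochner_Integration.integral_cong simp: restrict_eq_restrict01)
 moreover have "(\<integral>w. \<phi> (restrict01 (path_bc (%t. Y t w))) \<partial>N) = (\<integral>w. \<phi> (\<lambda>t\<in>{0..1}. Y t w) \<partial>N)"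
  using Y(2) by (auto intro!: Bochner_Integration.integral_cong simp: restrict_eq_restrict01)
 ultimately show "((%i. \<integral>w. \<phi> (\<lambda>t\<in>{0..1}. X i t w) \<partial>M) \<longlongrightarrow> (\<integral>w. \<phi> (\<lambda>t\<in>{0..1}. Y t w) \<partial>N)) F"
  using filterlim_cong[OF refl refl ev] by (simp only:)
qed

section \<open>Dyadic chaining\<close>

definition dyadic_osc :: "(real => real) => nat => real" where
 "dyadic_osc f m = Max ((%k. \<bar>f (real (Suc k) / 2 ^ m) - f (real k / 2 ^ m)\<bar>) ` {..<2 ^ m})"

lemma dyadic_osc_ge: "k < 2 ^ m ==> \<bar>f (real (Suc k) / 2 ^ m) - f (real k / 2 ^ m)\<bar> \<le> dyadic_osc f m"
 unfolding dyadic_osc_def by (rule Max_ge) auto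

lemma dyadic_osc_nonneg: "0 \<le> dyadic_osc f m"
 by (rule order_trans[OF abs_ge_zero dyadic_osc_ge[of 0]]) simp

text \<open>Kolmogorov's chaining along the dyadic approximations of t from below: each refinement
  moves by at most one cell of the next level. In extended reals the divergent case is
  trivial.\<close>

lemma dyadic_chaining:
 assumes f: "continuous_on {0..1} f"
 shows "ennreal (dist (polygon (2 ^ m) (%k. f (real k / 2 ^ m))) (path_bc f)) \<le> (\<Sum>i. ennreal (dyadic_osc f (m + i)))"
proof (cases "(\<Sum>i. ennreal (dyadic_osc f (m + i))) = \<top>")
 case False
 have sm: "summable (%i. dyadic_osc f (m + i))"
  using False by (intro summable_suminf_not_top dyadic_osc_nonneg) auto
 define S where "S = (\<Sum>i. dyadic_osc f (m + i))"
 have "(\<Sum>i. ennreal (dyadic_osc f (m + i))) = ennreal S"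
  unfolding S_def by (rule suminf_ennreal2[OF dyadic_osc_nonneg sm])
 moreover have "dist (polygon (2 ^ m) (%k. f (real k / real (2 ^ m)))) (path_bc f) \<le> S"
 proof (rule dist_polygon_path_le[OF _ f])
  fix t :: real and k assume t: "0 \<le> t" "t \<le> 1" and k: "k \<le> 2 ^ m" "\<bar>real (2 ^ m) * t - real k\<bar> < 1"
  define j where "j M = nat \<lfloor>2 ^ M * t\<rfloor>" for M :: nat
  have pt: "0 \<le> 2 ^ M * t" "2 ^ M * t \<le> 2 ^ M" for M :: nat using t by (auto intro: mult_left_le)
  have j: "real (j M) \<le> 2 ^ M * t" "2 ^ M * t < real (j M) + 1" for M using pt(1)[of M] unfolding j_def by linarith+
  have jle: "j M \<le> 2 ^ M" for M
  proof -
   have "real (j M) \<le> real (2 ^ M)" using order_trans[OF j(1)[of M] pt(2)[of M]] by simp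
   then show ?thesis by (simp only: of_nat_le_iff)
  qed
  define r where "r M = real (j M) / 2 ^ M" for M
  have step: "\<bar>f (r (Suc M)) - f (r M)\<bar> \<le> dyadic_osc f (Suc M)" for M
  proof -
   have "j (Suc M) = 2 * j M \<or> j (Suc M) = Suc (2 * j M)"
    using j(1)[of M] j(2)[of M] j(1)[of "Suc M"] j(2)[of "Suc M"] unfolding power_Suc mult.assoc by linarith
   then show ?thesis
   proof
    assume "j (Suc M) = 2 * j M"
    then have "r (Suc M) = r M" by (simp add: r_def)
    then show ?thesis using dyadic_osc_nonneg by simp
   next
    assume e: "j (Suc M) = Suc (2 * j M)"
    have "r M = real (2 * j M) / 2 ^ Suc M" "r (Suc M) = real (Suc (2 * j M)) / 2 ^ Suc M"
     using e by (simp_all add: r_def)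
    moreover have "2 * j M < 2 ^ Suc M" using e jle[of "Suc M"] by simp
    ultimately show ?thesis using dyadic_osc_ge[of "2 * j M" "Suc M" f] by (simp only:)
   qed
  qed
  have chain: "\<bar>f (r (m + i)) - f (r m)\<bar> \<le> (\<Sum>l<i. dyadic_osc f (m + Suc l))" for i
  proof (induction i)
   case (Suc i)
   then show ?case using step[of "m + i"] by simp
  qed simp
  have rlim: "(%i. r (m + i)) \<longlonglongrightarrow> t"
  proof -
   have "r \<longlonglongrightarrow> t"
   proof (rule tendsto_sandwich)
    show "\<forall>\<^sub>F M in sequentially. t - (1 / 2) ^ M \<le> r M"
    proof (rule always_eventually, rule allI)
     fix M
     have "(2 ^ M * t - 1) / 2 ^ M \<le> r M" unfolding r_def using j(2)[of M] by (intro divide_right_mono) auto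
     then show "t - (1 / 2) ^ M \<le> r M" by (simp add: diff_divide_distrib power_one_over)
    qed
    show "\<forall>\<^sub>F M in sequentially. r M \<le> t"
     using j(1) by (auto simp: r_def divide_le_eq mult.commute)
    show "(%M. t - (1 / 2) ^ M) \<longlonglongrightarrow> t"
     using tendsto_diff[OF tendsto_const[of t] LIMSEQ_power_zero[of "1 / 2 :: real"]] by simp
   qed auto
   then show ?thesis by (subst add.commute) (rule LIMSEQ_ignore_initial_segment)
  qed
  have r01: "r M \<in> {0..1}" for M
  proof -
   have "real (j M) \<le> real (2 ^ M)" using jle[of M] by (simp only: of_nat_le_iff)
   then show ?thesis by (auto simp: r_def divide_le_eq)
  qed
  have flim: "(%i. f (r (m + i))) \<longlonglongrightarrow> f t"
   using f t r01 rlim unfolding continuous_on_sequentially by (auto simp: comp_def)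
  have sm': "summable (%l. dyadic_osc f (m + Suc l))" using sm summable_Suc_iff[of "%i. dyadic_osc f (m + i)"] by simp
  have "\<bar>f t - f (r m)\<bar> \<le> (\<Sum>l. dyadic_osc f (m + Suc l))"
  proof (rule LIMSEQ_le_const2)
   show "(%i. \<bar>f (r (m + i)) - f (r m)\<bar>) \<longlonglongrightarrow> \<bar>f t - f (r m)\<bar>" by (intro tendsto_intros flim)
   show "\<exists>N. \<forall>n\<ge>N. \<bar>f (r (m + n)) - f (r m)\<bar> \<le> (\<Sum>l. dyadic_osc f (m + Suc l))"
    using order_trans[OF chain sum_le_suminf[OF sm']] dyadic_osc_nonneg by blast
  qed
  also have "(\<Sum>l. dyadic_osc f (m + Suc l)) = S - dyadic_osc f m"
   using suminf_split_head[OF sm] by (simp add: S_def)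
  finally have a: "\<bar>f t - f (r m)\<bar> \<le> S - dyadic_osc f m" .
  \<comment> \<open>The node k is one of the two around t. Passing to the left one costs the term of
    level m, which the chain, using only finer levels, has left over.\<close>
  have "k = j m \<or> k = Suc (j m)" using k(2) j(1)[of m] j(2)[of m] by simp linarith
  then have "\<bar>f (real k / 2 ^ m) - f (r m)\<bar> \<le> dyadic_osc f m"
  proof
   assume "k = Suc (j m)"
   then show ?thesis using dyadic_osc_ge[of "j m" m f] k(1) by (simp add: r_def)
  qed (simp add: r_def dyadic_osc_nonneg)
  with a show "\<bar>f (real k / real (2 ^ m)) - f t\<bar> \<le> S" by simp
 qed simp
 ultimately show ?thesis by (simp add: ennreal_leI)
qed simp

section \<open>Continuity in the parameter and the limit at zero\<close>

lemma exp_minus_gt: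
 fixes x :: real assumes "0 < x" shows "0 < exp (- x) - 1 + x"
proof (cases "x < 2")
 case True
 \<comment> \<open>The tangent at 0 alone gives only nonnegativity; squaring the tangent bound for
   exp(-x/2) yields the extra (x/2)^2.\<close>
 have "(1 - x / 2)\<^sup>2 \<le> (exp (- x / 2))\<^sup>2"
  using True exp_ge_add_one_self[of "- x / 2"] by (intro power_mono) auto
 also have "(exp (- x / 2))\<^sup>2 = exp (- x)" by (simp add: power2_eq_square flip: exp_add)
 finally have "1 - x + (x / 2)\<^sup>2 \<le> exp (- x)" by (simp add: power2_diff)
 moreover have "0 < (x / 2)\<^sup>2" using assms by simp
 ultimately show ?thesis by linarith
next
 case False
 then show ?thesis using exp_gt_zero[of "- x"] by linarith
qed

text \<open>G and q enter only through x = G q. The expression tends to 1 as x tends to 0 and grows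
  like x/2 at infinity, which are the two regimes of the limit theorems.\<close>

lemma hermite_amplitude_sq:
 assumes g: "0 < G" and q: "1 \<le> q"
 shows "(hermite_amplitude q G)\<^sup>2 * fact q = (G * real q)\<^sup>2 / (2 * (exp (- (G * real q)) - 1 + G * real q))"
  and "0 \<le> hermite_amplitude q G"
proof -
 define d where "d = exp (- G * real q) - 1 + G * real q"
 have d: "0 < d" using exp_minus_gt[of "G * real q"] g q by (simp add: d_def)
 obtain k where k: "q = Suc k" using q by (cases q) auto
 have "0 \<le> 2 ^ (q - 1) * (real q)\<^sup>2 * G ^ (q + 2) / (fact q * d)" using g d by simp
 then have "(hermite_const q G)\<^sup>2 = 2 ^ (q - 1) * (real q)\<^sup>2 * G ^ (q + 2) / (fact q * d)"
  unfolding hermite_const_def d_def by (rule real_sqrt_pow2)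
 moreover have "(sqrt (2 * G) ^ q)\<^sup>2 = (2 * G) ^ q"
  using g by (simp add: power_mult[symmetric] mult.commute[of q] power_mult)
 ultimately have "(hermite_amplitude q G)\<^sup>2 * fact q = 2 ^ (q - 1) * (real q)\<^sup>2 * G ^ (q + 2) / (fact q * d) / (2 * G) ^ q * fact q"
  by (simp add: hermite_amplitude_def power_divide)
 also have "... = (2 ^ (q - 1) * G ^ q / (2 * G) ^ q) * ((G * real q)\<^sup>2 / d)"
  by (simp add: power_add power_mult_distrib field_simps power2_eq_square)
 also have "2 ^ (q - 1) * G ^ q / (2 * G) ^ q = 1 / 2" using g unfolding k by (simp add: power_mult_distrib)
 finally show "(hermite_amplitude q G)\<^sup>2 * fact q = (G * real q)\<^sup>2 / (2 * (exp (- (G * real q)) - 1 + G * real q))"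
  by (simp add: d_def)
 show "0 \<le> hermite_amplitude q G"
  unfolding hermite_amplitude_def hermite_const_def
  using g d unfolding d_def by (intro divide_nonneg_nonneg real_sqrt_ge_zero zero_le_power) auto
qed

lemma hermite_amplitude_eq:
 assumes g: "0 < G" and q: "1 \<le> q"
 shows "hermite_amplitude q G * sqrt (fact q) = sqrt ((G * real q)\<^sup>2 / (2 * (exp (- (G * real q)) - 1 + G * real q)))"
 unfolding hermite_amplitude_sq(1)[OF g q, symmetric]
 using hermite_amplitude_sq(2)[OF g q] by (simp add: real_sqrt_mult)

lemma hermite_amplitude_continuous:
 assumes g: "0 < G" and q: "1 \<le> q" and "Gs \<longlonglongrightarrow> G"
 shows "(%k. hermite_amplitude q (Gs k)) \<longlonglongrightarrow> hermite_amplitude q G"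
proof -
 have "exp (- G * real q) - 1 + G * real q \<noteq> 0" using exp_minus_gt[of "G * real q"] g q by simp
 then show ?thesis
  unfolding hermite_amplitude_def hermite_const_def using g assms(3) by (intro tendsto_intros) auto
qed

lemma hermite_amplitude_at_0:
 assumes q: "1 \<le> q"
 shows "((%G. hermite_amplitude q G * sqrt (fact q)) \<longlongrightarrow> 1) (at_right 0)"
proof -
 have "((%x::real. x\<^sup>2 / (2 * (exp (- x) - 1 + x))) \<longlongrightarrow> 1) (at_right 0)" by real_asymp
 moreover have "filterlim (%G. G * real q) (at_right 0) (at_right 0)"
 proof -
  have "((%G. G * real q) \<longlongrightarrow> 0 * real q) (at_right 0)" by (intro tendsto_intros)
  then show ?thesis
   using q by (auto simp: filterlim_at eventually_at_filter intro!: always_eventually)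
 qed
 ultimately have "((%G. (G * real q)\<^sup>2 / (2 * (exp (- (G * real q)) - 1 + G * real q))) \<longlongrightarrow> 1) (at_right 0)"
  by (rule filterlim_compose)
 from tendsto_real_sqrt[OF this]
 have l: "((%G. sqrt ((G * real q)\<^sup>2 / (2 * (exp (- (G * real q)) - 1 + G * real q)))) \<longlongrightarrow> 1) (at_right 0)"
  by simp
 have "\<forall>\<^sub>F G in at_right 0. sqrt ((G * real q)\<^sup>2 / (2 * (exp (- (G * real q)) - 1 + G * real q))) = hermite_amplitude q G * sqrt (fact q)"
  by (auto simp: eventually_at_filter hermite_amplitude_eq[OF _ q] intro!: always_eventually)
 from Lim_transform_eventually[OF l this] show ?thesis .
qed

lemma expectation_lipschitz_diff:
 fixes X Y :: "'a => 's::metric_space"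
 assumes M: "prob_space M" and X: "X \<in> borel_measurable M" and Y: "Y \<in> borel_measurable M"
  and bd: "\<And>x. \<bar>\<phi> x\<bar> \<le> C" and L: "0 \<le> L" "\<And>x y. \<bar>\<phi> x - \<phi> y\<bar> \<le> L * dist x y"
  and \<phi>: "\<phi> \<in> borel_measurable borel"
  and D: "integrable M D" "AE w in M. dist (X w) (Y w) \<le> D w"
 shows "\<bar>(\<integral>w. \<phi> (X w) \<partial>M) - (\<integral>w. \<phi> (Y w) \<partial>M)\<bar> \<le> L * (\<integral>w. D w \<partial>M)"
proof -
 interpret prob_space M by fact
 have iX: "integrable M (%w. \<phi> (X w))" "integrable M (%w. \<phi> (Y w))"
  using measurable_compose[OF X \<phi>] measurable_compose[OF Y \<phi>] bd
  by (auto intro!: integrable_const_bound[where B=C])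
 have "\<bar>(\<integral>w. \<phi> (X w) \<partial>M) - (\<integral>w. \<phi> (Y w) \<partial>M)\<bar> = \<bar>\<integral>w. \<phi> (X w) - \<phi> (Y w) \<partial>M\<bar>"
  using iX by simp
 also have "... \<le> (\<integral>w. \<bar>\<phi> (X w) - \<phi> (Y w)\<bar> \<partial>M)"
  using integral_norm_bound[of M "%w. \<phi> (X w) - \<phi> (Y w)"] by simp
 also have "... \<le> (\<integral>w. L * D w \<partial>M)"
 proof (rule integral_mono_AE)
  show "AE w in M. \<bar>\<phi> (X w) - \<phi> (Y w)\<bar> \<le> L * D w"
   using D(2) by eventually_elim (rule order_trans[OF L(2) mult_left_mono[OF _ L(1)]])
 qed (use iX D in auto)
 finally show ?thesis by simp
qed

lemma (in prob_space) expectation_abs_le_sqrt: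
 assumes "abs_moments M X"
 shows "expectation (%w. \<bar>X w\<bar>) \<le> sqrt (expectation (%w. (X w)\<^sup>2))"
proof (rule real_le_rsqrt)
 have i: "integrable M (%w. \<bar>X w\<bar>)" "integrable M (%w. \<bar>X w\<bar>\<^sup>2)"
  using abs_moments_integrable[OF assms] abs_moments_integrable[OF abs_moments_power[OF assms, of 2]] by auto
 from variance_eq[OF i] variance_positive[of "%w. \<bar>X w\<bar>"]
 show "(expectation (%w. \<bar>X w\<bar>))\<^sup>2 \<le> expectation (%w. (X w)\<^sup>2)" by simp
qed

context brownian_motion
begin

text \<open>Dominated convergence for the primitive, with one majorant h for all parameters in
  [G/2, 2G]: the worst parameter is G/2 on the negative half-line and 2G on the unit
  interval.\<close>

lemma OU_converges_bounded:
 assumes w: "good_path w" and g: "0 < G" and lim: "Gs \<longlonglongrightarrow> G" and near: "\<And>k. G / 2 \<le> Gs k \<and> Gs k \<le> 2 * G"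
 shows "\<exists>C. \<forall>s\<in>{0..1}. (%k. OU (Gs k) s w) \<longlonglongrightarrow> OU G s w \<and> (\<forall>k. \<bar>OU (Gs k) s w\<bar> \<le> C)"
proof -
 have w': "w \<in> space M" using w by (simp add: good_path_def)
 have gs: "0 < Gs k" for k using near[of k] g by linarith
 have [measurable]: "(%x. B x w) \<in> borel_measurable borel" by (rule borel_measurable_continuous_onI[OF B_continuous[OF w']])
 obtain b where b: "\<And>s. s \<in> {0..1} ==> \<bar>B s w\<bar> \<le> b" "0 \<le> b"
 proof -
  have "compact ((%s. B s w) ` {0..1})" by (rule compact_continuous_image[OF B_continuous[OF w'] compact_Icc])
  from compact_imp_bounded[OF this] obtain b where "\<forall>y\<in>(%s. B s w) ` {0..1}. norm y \<le> b"
   unfolding bounded_iff by blast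
  then show thesis by (intro that[of "max b 0"]) (auto simp: le_max_iff_disj)
 qed
 define h where "h x = \<bar>indicator {..0} x * (exp (G / 2 * x) * B x w)\<bar> + exp (2 * G) * b * indicator {0..1} x" for x
 have i0: "integrable lborel (%x. indicator {..0} x * (exp (G / 2 * x) * B x w))"
  using w half_gt_zero[OF g] unfolding good_path_def by blast
 have hi: "integrable lborel h"
  unfolding h_def
  by (intro Bochner_Integration.integrable_add integrable_abs[OF i0] integrable_mult_right integrable_real_indicator)
    (auto simp: emeasure_lborel_Icc_eq)
 let ?K = "%g s. exp_primitive g (%x. B x w) s"
 have dom: "norm (indicator {..s} x * (exp (Gs k * x) * B x w)) \<le> h x" if s: "s \<in> {0..1}" for s x k
 proof -
  consider "x \<le> 0" | "0 < x" "x \<le> s" | "s < x" by linarith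
  then show ?thesis
  proof cases
   case 1
   have "Gs k * x \<le> G / 2 * x" by (rule mult_right_mono_neg) (use near[of k] 1 in auto)
   then have "exp (Gs k * x) \<le> exp (G / 2 * x)" by simp
   then have "\<bar>exp (Gs k * x) * B x w\<bar> \<le> \<bar>exp (G / 2 * x) * B x w\<bar>" by (simp add: abs_mult mult_right_mono)
   moreover have "0 \<le> exp (2 * G) * b * indicator {0..1} x" using b(2) by simp
   ultimately show ?thesis using 1 s by (simp add: h_def)
  next
   case 2
   have "Gs k * x \<le> (2 * G) * 1" using near[of k] 2 s g by (intro mult_mono) auto
   then have "exp (Gs k * x) * \<bar>B x w\<bar> \<le> exp (2 * G) * b" using b(1)[of x] 2 s by (intro mult_mono) auto
   then show ?thesis using 2 s by (simp add: h_def abs_mult)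
  next
   case 3
   then show ?thesis using b(2) by (simp add: h_def)
  qed
 qed
 have Klim: "(%k. ?K (Gs k) s) \<longlonglongrightarrow> ?K G s" if s: "s \<in> {0..1}" for s
  unfolding exp_primitive_def
 proof (rule integral_dominated_convergence[OF _ _ hi])
  show "AE x in lborel. (%k. indicator {..s} x * (exp (Gs k * x) * B x w)) \<longlonglongrightarrow> indicator {..s} x * (exp (G * x) * B x w)"
   by (intro AE_I2 tendsto_intros lim)
  show "\<And>k. AE x in lborel. norm (indicator {..s} x * (exp (Gs k * x) * B x w)) \<le> h x" using dom[OF s] by auto
 qed measurable
 have Kb: "\<bar>?K (Gs k) s\<bar> \<le> integral\<^sup>L lborel h" if s: "s \<in> {0..1}" for s k
 proof -
  have "\<bar>?K (Gs k) s\<bar> \<le> (\<integral>x. norm (indicator {..s} x * (exp (Gs k * x) * B x w)) \<partial>lborel)"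
   unfolding exp_primitive_def using integral_norm_bound[of lborel "%x. indicator {..s} x * (exp (Gs k * x) * B x w)"] by simp
  also have "... \<le> integral\<^sup>L lborel h"
   by (rule integral_mono[OF integrable_norm[OF good_path_integrable[OF w gs]] hi]) (rule dom[OF s])
  finally show ?thesis .
 qed
 define C where "C = sqrt (4 * G) * (b + 2 * G * integral\<^sup>L lborel h)"
 have "(%k. OU (Gs k) s w) \<longlonglongrightarrow> OU G s w" if s: "s \<in> {0..1}" for s
  unfolding OU_eq[OF w gs] OU_eq[OF w g] by (intro tendsto_intros lim Klim[OF s])
 moreover have "\<bar>OU (Gs k) s w\<bar> \<le> C" if s: "s \<in> {0..1}" for s k
 proof -
  have e1: "exp (- Gs k * s) \<le> 1" using gs[of k] s by simp
  have "Gs k * exp (- Gs k * s) \<le> (2 * G) * 1" using near[of k] g gs[of k] e1 by (intro mult_mono) auto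
  then have "Gs k * exp (- Gs k * s) * \<bar>?K (Gs k) s\<bar> \<le> 2 * G * integral\<^sup>L lborel h"
   using Kb[OF s, of k] gs[of k] g by (intro mult_mono[of _ "2 * G"]) auto
  then have i: "\<bar>B s w - Gs k * exp (- Gs k * s) * ?K (Gs k) s\<bar> \<le> b + 2 * G * integral\<^sup>L lborel h"
   using b(1)[OF s] gs[of k] abs_triangle_ineq4[of "B s w" "Gs k * exp (- Gs k * s) * ?K (Gs k) s"]
   by (simp add: abs_mult)
  have "\<bar>OU (Gs k) s w\<bar> = sqrt (2 * Gs k) * \<bar>B s w - Gs k * exp (- Gs k * s) * ?K (Gs k) s\<bar>"
   unfolding OU_eq[OF w gs] using gs[of k] by (simp add: abs_mult)
  also have "... \<le> C" unfolding C_def using near[of k] g by (intro mult_mono i) auto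
  finally show ?thesis .
 qed
 ultimately show ?thesis by blast
qed

text \<open>The integrands converge boundedly on the unit interval, hence in mean, and the mean
  distance bounds the uniform distance of the indefinite integrals.\<close>

lemma hermite_representation_converges:
 assumes w: "good_path w" and g: "0 < G" and lim: "Gs \<longlonglongrightarrow> G" and near: "\<And>k. G / 2 \<le> Gs k \<and> Gs k \<le> 2 * G"
  and q: "1 \<le> q"
 shows "(%k. path_bc (%t. hermite_amplitude q (Gs k) * time_integral 0 t (%s. hermite q (OU (Gs k) s w))))
  \<longlonglongrightarrow> path_bc (%t. hermite_amplitude q G * time_integral 0 t (%s. hermite q (OU G s w)))"
proof -
 have gs: "0 < Gs k" for k using near[of k] g by linarith
 obtain C where C: "\<And>s. s \<in> {0..1} ==> (%k. OU (Gs k) s w) \<longlonglongrightarrow> OU G s w"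
  "\<And>s k. s \<in> {0..1} ==> \<bar>OU (Gs k) s w\<bar> \<le> C"
  using OU_converges_bounded[OF w g lim near] by blast
 have cH: "continuous_on A (%s. hermite q (OU g s w))" if "0 < g" for A g
  by (intro continuous_on_hermite OU_continuous w that)
 have mH: "(%s. hermite q (OU g s w)) \<in> borel_measurable borel" if "0 < g" for g
  by (rule borel_measurable_continuous_onI[OF cH[OF that]])
 define a where "a k = hermite_amplitude q (Gs k)" for k
 define f where "f k s = a k * hermite q (OU (Gs k) s w)" for k s
 define f0 where "f0 s = hermite_amplitude q G * hermite q (OU G s w)" for s
 have alim: "a \<longlonglongrightarrow> hermite_amplitude q G" unfolding a_def by (rule hermite_amplitude_continuous[OF g q lim])
 obtain K where K: "\<And>x. \<bar>x\<bar> \<le> C ==> \<bar>hermite q x\<bar> \<le> K"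
 proof -
  have "compact (hermite q ` {-C..C})"
   by (rule compact_continuous_image[OF continuous_on_hermite[OF continuous_on_id] compact_Icc])
  then obtain K where "\<forall>y\<in>hermite q ` {-C..C}. norm y \<le> K" using compact_imp_bounded bounded_iff by blast
  then have "\<bar>hermite q x\<bar> \<le> K" if "\<bar>x\<bar> \<le> C" for x
   using that by (auto simp: abs_le_iff)
  then show thesis by (rule that)
 qed
 from convergent_imp_Bseq[OF convergentI[OF alim]] obtain A where "\<forall>k. norm (a k) \<le> A" by (rule BseqE) blast
 then have A: "\<bar>a k\<bar> \<le> A" for k by simp
 have A0: "0 \<le> A" using A[of 0] by linarith
 have fb: "\<bar>f k s\<bar> \<le> A * K" if "s \<in> {0..1}" for k s
  unfolding f_def abs_mult by (intro mult_mono A K C(2) that A0) auto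
 have fl: "(%k. f k s) \<longlonglongrightarrow> f0 s" if "s \<in> {0..1}" for s
  unfolding f_def f0_def by (intro tendsto_intros alim C(1) that)
 have f0b: "\<bar>f0 s\<bar> \<le> A * K" if "s \<in> {0..1}" for s
  by (rule LIMSEQ_le_const2[OF tendsto_rabs[OF fl[OF that]]]) (use fb[OF that] in auto)
 have mf: "f k \<in> borel_measurable borel" and mf0: "f0 \<in> borel_measurable borel" for k
  unfolding f_def f0_def using mH[OF gs] mH[OF g] by auto
 have if_: "integrable lborel (%s. indicator {0..1} s * f k s)" for k
  by (rule time_integrable_bounded[OF mf]) (use fb in auto)
 have if0: "integrable lborel (%s. indicator {0..1} s * f0 s)"
  by (rule time_integrable_bounded[OF mf0]) (use f0b in auto)
 have "(%k. time_integral 0 1 (%s. \<bar>f k s - f0 s\<bar>)) \<longlonglongrightarrow> time_integral 0 1 (%s. 0)"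
  unfolding time_integral_def
 proof (rule integral_dominated_convergence[where w="%s. 2 * A * K * indicator {0..1} s"])
  show "integrable lborel (%s::real. 2 * A * K * indicator {0..1} s)"
   by (intro integrable_mult_right integrable_real_indicator) (auto simp: emeasure_lborel_Icc_eq)
  show "AE s in lborel. (%k. indicator {0..1} s * \<bar>f k s - f0 s\<bar>) \<longlonglongrightarrow> indicator {0..1} s * 0"
  proof (rule AE_I2)
   fix s :: real
   show "(%k. indicator {0..1} s * \<bar>f k s - f0 s\<bar>) \<longlonglongrightarrow> indicator {0..1} s * 0"
   proof (cases "s \<in> {0..1}")
    case True
    have "(%k. \<bar>f k s - f0 s\<bar>) \<longlonglongrightarrow> \<bar>f0 s - f0 s\<bar>" by (intro tendsto_intros fl True)
    then show ?thesis using True by simp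
   qed simp
  qed
  show "AE s in lborel. norm (indicator {0..1} s * \<bar>f k s - f0 s\<bar>) \<le> 2 * A * K * indicator {0..1} s" for k
  proof (rule AE_I2)
   fix s :: real
   show "norm (indicator {0..1} s * \<bar>f k s - f0 s\<bar>) \<le> 2 * A * K * indicator {0..1} s"
   proof (cases "s \<in> {0..1}")
    case True
    then show ?thesis using fb[OF True, of k] f0b[OF True] by simp
   qed simp
  qed
 qed (use mf mf0 in measurable)
 then have l0: "(%k. time_integral 0 1 (%s. \<bar>f k s - f0 s\<bar>)) \<longlonglongrightarrow> 0" by simp
 have le: "dist (path_bc (%t. a k * time_integral 0 t (%s. hermite q (OU (Gs k) s w))))
   (path_bc (%t. hermite_amplitude q G * time_integral 0 t (%s. hermite q (OU G s w)))) \<le> time_integral 0 1 (%s. \<bar>f k s - f0 s\<bar>)" for k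
 proof (rule dist_path_bc_le)
  show "continuous_on {0..1} (%t. a k * time_integral 0 t (%s. hermite q (OU (Gs k) s w)))"
   "continuous_on {0..1} (%t. hermite_amplitude q G * time_integral 0 t (%s. hermite q (OU G s w)))"
   by (intro continuous_on_mult_left time_integral_hermite_continuous w g gs)+
  fix t :: real assume t: "0 \<le> t" "t \<le> 1"
  have sub: "integrable lborel (%s. indicator {0..t} s * f k s)" "integrable lborel (%s. indicator {0..t} s * f0 s)"
   using t by (auto intro: time_integrable_subinterval[OF if_] time_integrable_subinterval[OF if0])
  have ia: "integrable lborel (%s. indicator {0..1} s * \<bar>f k s - f0 s\<bar>)"
  proof -
   have "integrable lborel (%s. \<bar>indicator {0..1} s * f k s - indicator {0..1} s * f0 s\<bar>)"
    by (intro integrable_abs Bochner_Integration.integrable_diff if_ if0)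
   moreover have "\<bar>indicator {0..1} s * f k s - indicator {0..1} s * f0 s\<bar> = indicator {0..1} s * \<bar>f k s - f0 s\<bar>" for s
    by (simp add: indicator_def)
   ultimately show ?thesis by simp
  qed
  have "a k * time_integral 0 t (%s. hermite q (OU (Gs k) s w)) - hermite_amplitude q G * time_integral 0 t (%s. hermite q (OU G s w))
   = time_integral 0 t (%s. f k s - f0 s)"
   unfolding time_integral_diff[OF sub] by (simp add: f_def[abs_def] f0_def[abs_def])
  also have "\<bar>...\<bar> \<le> time_integral 0 t (%s. \<bar>f k s - f0 s\<bar>)"
   by (rule abs_time_integral_le[OF time_integrable_subinterval[OF ia]]) (use t in auto)
  also have "... \<le> time_integral 0 1 (%s. \<bar>f k s - f0 s\<bar>)"
   unfolding time_integral_def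
   by (rule integral_mono[OF time_integrable_subinterval[OF ia] ia]) (use t in \<open>auto simp: indicator_def\<close>)
  finally show "\<bar>a k * time_integral 0 t (%s. hermite q (OU (Gs k) s w)) - hermite_amplitude q G * time_integral 0 t (%s. hermite q (OU G s w))\<bar>
   \<le> time_integral 0 1 (%s. \<bar>f k s - f0 s\<bar>)" .
 qed
 show ?thesis
  unfolding a_def[symmetric]
  by (rule metric_tendsto_imp_tendsto[OF l0]) (use order_trans[OF le abs_ge_self] in \<open>auto simp: dist_real_def\<close>)
qed

lemma tempered_hermite_measurable:
 assumes "tempered_hermite_process M B q G W"
 shows "(%w. path_bc (%t. W t w)) \<in> borel_measurable M"
 using assms unfolding tempered_hermite_process_def by (intro path_bc_measurable) auto

text \<open>Almost surely the paths converge uniformly on the same space, so bounded convergence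
  gives the limit in law. Beyond an index N the parameters lie in [G/2, 2G], and only this tail is
  used.\<close>

lemma tempered_hermite_continuity:
 assumes W: "\<And>G. 0 < G ==> tempered_hermite_process M B q G (W G)" and q: "1 \<le> q"
  and g: "0 < G" and gs: "\<And>k. 0 < Gs k" and lim: "Gs \<longlonglongrightarrow> G"
 shows "process_conv_C01 M (%k. W (Gs k)) M (W G) sequentially"
proof (rule process_conv_C01I[OF prob_space_axioms prob_space_axioms])
 show "\<forall>\<^sub>F k in sequentially. (\<forall>t\<in>{0..1}. W (Gs k) t \<in> borel_measurable M) \<and> (\<forall>w\<in>space M. continuous_on {0..1} (%t. W (Gs k) t w))"
  using W[OF gs] by (auto simp: tempered_hermite_process_def)
 show "\<And>t. t \<in> {0..1} ==> W G t \<in> borel_measurable M" "\<And>w. w \<in> space M ==> continuous_on {0..1} (%t. W G t w)"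
  using W[OF g] by (auto simp: tempered_hermite_process_def)
 fix \<phi> :: "(real \<Rightarrow>\<^sub>C real) => real" assume \<phi>: "bounded_lipschitz \<phi>"
 obtain C where C: "\<And>x. \<bar>\<phi> x\<bar> \<le> C" using \<phi> unfolding bounded_lipschitz_def by blast
 have c\<phi>: "continuous_on UNIV \<phi>" by (rule bounded_lipschitz_continuous[OF \<phi>])
 have m\<phi>: "\<phi> \<in> borel_measurable borel" by (rule borel_measurable_continuous_onI[OF c\<phi>])
 have "\<forall>\<^sub>F k in sequentially. G / 2 < Gs k \<and> Gs k < 2 * G"
  using order_tendstoD(1)[OF lim, of "G / 2"] order_tendstoD(2)[OF lim, of "2 * G"] g by (auto elim: eventually_elim2)
 then obtain N where N: "\<And>k. N \<le> k ==> G / 2 < Gs k \<and> Gs k < 2 * G" by (auto simp: eventually_sequentially)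
 have lim': "(%k. Gs (k + N)) \<longlonglongrightarrow> G" by (rule LIMSEQ_ignore_initial_segment[OF lim])
 have near: "G / 2 \<le> Gs (k + N) \<and> Gs (k + N) \<le> 2 * G" for k using N[of "k + N"] by auto
 have "AE w in M. \<forall>k. \<forall>t\<in>{0..1}. W (Gs k) t w = hermite_amplitude q (Gs k) * time_integral 0 t (%s. hermite q (OU (Gs k) s w))"
  unfolding AE_all_countable by (intro allI tempered_hermite_process_representation gs W)
 with tempered_hermite_process_representation[OF g W[OF g]] AE_good_path
 have path: "AE w in M. (%k. \<phi> (path_bc (%t. W (Gs (k + N)) t w))) \<longlonglongrightarrow> \<phi> (path_bc (%t. W G t w))"
 proof eventually_elim
  case (elim w)
  have 1: "path_bc (%t. W (Gs k) t w) = path_bc (%t. hermite_amplitude q (Gs k) * time_integral 0 t (%s. hermite q (OU (Gs k) s w)))" for k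
   using elim(3) by (intro path_bc_cong) auto
  have 2: "path_bc (%t. W G t w) = path_bc (%t. hermite_amplitude q G * time_integral 0 t (%s. hermite q (OU G s w)))"
   using elim(1) by (intro path_bc_cong) auto
  have "isCont \<phi> (path_bc (%t. W G t w))" using c\<phi> by (simp add: continuous_on_eq_continuous_at)
  moreover have "(%k. path_bc (%t. W (Gs (k + N)) t w)) \<longlonglongrightarrow> path_bc (%t. W G t w)"
   unfolding 1 2 by (rule hermite_representation_converges[OF elim(2) g lim' near q])
  ultimately show ?case by (rule isCont_tendsto_compose)
 qed
 have "(%k. \<integral>w. \<phi> (path_bc (%t. W (Gs (k + N)) t w)) \<partial>M) \<longlonglongrightarrow> (\<integral>w. \<phi> (path_bc (%t. W G t w)) \<partial>M)"
  by (rule integral_dominated_convergence[where w="%_. C"])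
    (use C path measurable_compose[OF tempered_hermite_measurable[OF W[OF gs]] m\<phi>] measurable_compose[OF tempered_hermite_measurable[OF W[OF g]] m\<phi>] in auto)
 then show "(%k. \<integral>w. \<phi> (path_bc (%t. W (Gs k) t w)) \<partial>M) \<longlonglongrightarrow> (\<integral>w. \<phi> (path_bc (%t. W G t w)) \<partial>M)"
  by (rule LIMSEQ_offset)
qed

lemma hermite_combination_process:
 assumes W: "\<And>q. q \<in> {m..p} ==> tempered_hermite_process M B q G (W q)"
 shows "\<And>t. t \<in> {0..1} ==> (%w. \<Sum>q=m..p. c q * W q t w) \<in> borel_measurable M"
  and "\<And>w. w \<in> space M ==> continuous_on {0..1} (%t. \<Sum>q=m..p. c q * W q t w)"
proof -
 have "W q t \<in> borel_measurable M" if "q \<in> {m..p}" "t \<in> {0..1}" for q t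
  using W[OF that(1)] that(2) by (simp add: tempered_hermite_process_def)
 then show "(%w. \<Sum>q=m..p. c q * W q t w) \<in> borel_measurable M" if "t \<in> {0..1}" for t
  using that by (intro borel_measurable_sum borel_measurable_times borel_measurable_const)
 have "continuous_on {0..1} (%t. W q t w)" if "q \<in> {m..p}" "w \<in> space M" for q w
  using W[OF that(1)] that(2) by (simp add: tempered_hermite_process_def)
 then show "continuous_on {0..1} (%t. \<Sum>q=m..p. c q * W q t w)" if "w \<in> space M" for w
  using that by (intro continuous_on_sum continuous_on_mult_left)
qed

text \<open>With a = \<open>hermite_amplitude q G * sqrt (fact q)\<close>, Mehler gives the second
  moment a^2 + 1 - 2 a exp(-G q s), largest at s = 1. It vanishes as G tends to 0 because a tends to
  1.\<close>

lemma hermite_small_gamma_error: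
 assumes g: "0 < G" and q: "1 \<le> q" and s: "0 \<le> s" "s \<le> 1"
 shows "expectation (%w. \<bar>hermite_amplitude q G * hermite q (OU G s w) - hermite q (OU G 0 w) / sqrt (fact q)\<bar>) \<le>
  sqrt ((hermite_amplitude q G * sqrt (fact q))\<^sup>2 + 1 - 2 * (hermite_amplitude q G * sqrt (fact q)) * exp (- G) ^ q)"
proof -
 define A where "A = hermite_amplitude q G"
 have A: "0 \<le> A" unfolding A_def by (rule hermite_amplitude_sq(2)[OF g q])
 let ?H = "%s w. hermite q (OU G s w)"
 have mH: "abs_moments M (?H s)" for s by (intro abs_moments_hermite abs_moments_OU g)
 have iHH: "integrable M (%w. ?H u w * ?H r w)" for u r by (intro abs_moments_integrable abs_moments_mult mH)
 have "expectation (%w. (A * ?H s w - ?H 0 w / sqrt (fact q))\<^sup>2) =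
  expectation (%w. A\<^sup>2 * (?H s w * ?H s w) + (1 / fact q) * (?H 0 w * ?H 0 w) - (2 * A / sqrt (fact q)) * (?H 0 w * ?H s w))"
 proof (intro Bochner_Integration.integral_cong refl)
  fix w
  have "(A * x - y / sqrt (fact q))\<^sup>2 = A\<^sup>2 * (x * x) + (1 / fact q) * (y * y) - (2 * A / sqrt (fact q)) * (y * x)" for x y :: real
   unfolding power2_diff power_mult_distrib power_divide by (simp add: power2_eq_square[of x] power2_eq_square[of y])
  then show "(A * ?H s w - ?H 0 w / sqrt (fact q))\<^sup>2 =
   A\<^sup>2 * (?H s w * ?H s w) + (1 / fact q) * (?H 0 w * ?H 0 w) - (2 * A / sqrt (fact q)) * (?H 0 w * ?H s w)" .
 qed
 also have "... = A\<^sup>2 * fact q + 1 - (2 * A / sqrt (fact q)) * (fact q * exp (- G * \<bar>s\<bar>) ^ q)"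
  using iHH expectation_hermite_OU_two[OF g, of q s s] expectation_hermite_OU_two[OF g, of q 0 0] expectation_hermite_OU_two[OF g, of q 0 s]
  by simp
 also have "(2 * A / sqrt (fact q)) * (fact q * exp (- G * \<bar>s\<bar>) ^ q) = 2 * (A * sqrt (fact q)) * exp (- G * s) ^ q"
 proof -
  have "(2 * A / sqrt (fact q)) * (fact q * x) = 2 * (A * sqrt (fact q)) * x" for x
  proof -
   have r: "fact q / sqrt (fact q) = (sqrt (fact q) :: real)" by (rule real_div_sqrt) simp
   have "(2 * A / sqrt (fact q)) * (fact q * x) = 2 * (A * (fact q / sqrt (fact q))) * x" by simp
   then show ?thesis unfolding r .
  qed
  then show ?thesis using s by simp
 qed
 also have "A\<^sup>2 * fact q + 1 - 2 * (A * sqrt (fact q)) * exp (- G * s) ^ q \<le> (A * sqrt (fact q))\<^sup>2 + 1 - 2 * (A * sqrt (fact q)) * exp (- G) ^ q"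
 proof -
  have "exp (- G) ^ q \<le> exp (- G * s) ^ q" using g s by (intro power_mono) (auto simp: mult_left_le)
  then have "2 * (A * sqrt (fact q)) * exp (- G) ^ q \<le> 2 * (A * sqrt (fact q)) * exp (- G * s) ^ q"
   using A by (intro mult_left_mono) auto
  then show ?thesis by (simp add: power_mult_distrib)
 qed
 finally have "expectation (%w. (A * ?H s w - ?H 0 w / sqrt (fact q))\<^sup>2) \<le> (A * sqrt (fact q))\<^sup>2 + 1 - 2 * (A * sqrt (fact q)) * exp (- G) ^ q" .
 moreover have "abs_moments M (%w. A * ?H s w - ?H 0 w / sqrt (fact q))"
  using abs_moments_cmult[OF mH[of 0], of "1 / sqrt (fact q)"] by (intro abs_moments_diff abs_moments_cmult mH) auto
 ultimately show ?thesis
  unfolding A_def[symmetric] using expectation_abs_le_sqrt real_sqrt_le_mono order_trans by blast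
qed

lemma tempered_hermite_small_gamma:
 fixes N :: "'c measure" and Z :: "'c => real"
 assumes W: "\<And>q G. 1 \<le> q ==> 0 < G ==> tempered_hermite_process M B q G (W q G)" and m: "1 \<le> m"
  and N: "prob_space N" and Z: "distributed N lborel Z std_normal_density"
 shows "process_conv_C01 M (%G t w. \<Sum>q=m..p. c q * W q G t w)
       N (%t w. t * (\<Sum>q=m..p. c q * hermite q (Z w) / sqrt (fact q))) (at_right 0)"
proof -
 interpret N: prob_space N by fact
 have Zm[measurable]: "Z \<in> borel_measurable N" using distributed_measurable[OF Z] by simp
 have W': "tempered_hermite_process M B q G (W q G)" if "q \<in> {m..p}" "0 < G" for q G using W that m by auto
 have pos: "\<forall>\<^sub>F G::real in at_right 0. 0 < G" by (auto simp: eventually_at_filter)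
 show ?thesis
 proof (rule process_conv_C01I[OF prob_space_axioms N])
  show "\<forall>\<^sub>F G in at_right 0. (\<forall>t\<in>{0..1}. (%w. \<Sum>q=m..p. c q * W q G t w) \<in> borel_measurable M) \<and>
    (\<forall>w\<in>space M. continuous_on {0..1} (%t. \<Sum>q=m..p. c q * W q G t w))"
   using pos by eventually_elim (use hermite_combination_process[of m p, OF W'] in blast)
  show "\<And>t. t \<in> {0..1} ==> (%w. t * (\<Sum>q=m..p. c q * hermite q (Z w) / sqrt (fact q))) \<in> borel_measurable N" by measurable
  show "\<And>w. w \<in> space N ==> continuous_on {0..1} (%t. t * (\<Sum>q=m..p. c q * hermite q (Z w) / sqrt (fact q)))"
   by (intro continuous_intros)
  fix \<phi> :: "(real \<Rightarrow>\<^sub>C real) => real" assume \<phi>: "bounded_lipschitz \<phi>"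
  obtain C L where C: "\<And>x. \<bar>\<phi> x\<bar> \<le> C" and L: "0 \<le> L" "\<And>x y. \<bar>\<phi> x - \<phi> y\<bar> \<le> L * dist x y"
   using \<phi> unfolding bounded_lipschitz_def by blast
  have m\<phi>: "\<phi> \<in> borel_measurable borel" by (rule borel_measurable_continuous_onI[OF bounded_lipschitz_continuous[OF \<phi>]])
  define h where "h z = (\<Sum>q=m..p. c q * hermite q z / sqrt (fact q))" for z
  define \<Phi> where "\<Phi> z = \<phi> (path_bc (%t. t * h z))" for z
  have pm: "(%z. path_bc (%t. t * h z)) \<in> borel_measurable borel"
   by (rule path_bc_measurable) (auto simp: h_def intro!: continuous_intros borel_measurable_times borel_measurable_sum)
  have \<Phi>m: "\<Phi> \<in> borel_measurable borel" unfolding \<Phi>_def by (rule measurable_compose[OF pm m\<phi>])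
  have lawN: "(\<integral>w. \<Phi> (Z w) \<partial>N) = (\<integral>x. std_normal_density x * \<Phi> x \<partial>lborel)"
   by (rule distributed_integral[OF Z, symmetric]) (use \<Phi>m in auto)
  define e where "e G = (\<Sum>q=m..p. \<bar>c q\<bar> * sqrt ((hermite_amplitude q G * sqrt (fact q))\<^sup>2 + 1 - 2 * (hermite_amplitude q G * sqrt (fact q)) * exp (- G) ^ q))" for G
  have "(e \<longlongrightarrow> (\<Sum>q=m..p. \<bar>c q\<bar> * sqrt (1\<^sup>2 + 1 - 2 * 1 * exp (- 0) ^ q))) (at_right 0)"
   unfolding e_def using m by (intro tendsto_intros hermite_amplitude_at_0) auto
  then have elim: "((%G. L * e G) \<longlongrightarrow> 0) (at_right 0)" using tendsto_mult_right_zero by fastforce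
  have bound: "\<bar>(\<integral>w. \<phi> (path_bc (%t. \<Sum>q=m..p. c q * W q G t w)) \<partial>M) - (\<integral>w. \<Phi> (Z w) \<partial>N)\<bar> \<le> L * e G" if g: "0 < G" for G
  proof -
   let ?Y = "%q s w. \<bar>hermite_amplitude q G * hermite q (OU G s w) - hermite q (OU G 0 w) / sqrt (fact q)\<bar>"
   define D where "D w = (\<Sum>q=m..p. \<bar>c q\<bar> * time_integral 0 1 (%s. ?Y q s w))" for w
   have Ym: "(%(s, w). ?Y q s w) \<in> borel_measurable (lborel \<Otimes>\<^sub>M M)" for q by measurable
   have Yu: "unif_moments M {0..1} (?Y q)" for q
   proof (rule unif_moments_abs)
    have "unif_moments M {0..1} (%s w. hermite_amplitude q G * hermite q (OU G s w) + (- 1 / sqrt (fact q)) * hermite q (OU G 0 w))"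
     by (intro unif_moments_add unif_moments_cmult unif_moments_hermite_OU unif_moments_const abs_moments_hermite abs_moments_OU g)
    then show "unif_moments M {0..1} (%s w. hermite_amplitude q G * hermite q (OU G s w) - hermite q (OU G 0 w) / sqrt (fact q))"
     by simp
   qed
   have Di: "integrable M D" unfolding D_def
    by (intro Bochner_Integration.integrable_sum integrable_mult_right time_integral_integrable[OF Ym Yu])
   have ED: "expectation D \<le> e G"
   proof -
    have "expectation D = (\<Sum>q=m..p. \<bar>c q\<bar> * time_integral 0 1 (%s. expectation (?Y q s)))"
     unfolding D_def
     by (subst Bochner_Integration.integral_sum)
       (auto intro!: integrable_mult_right time_integral_integrable[OF Ym Yu] simp: expectation_time_integral[OF Ym Yu])
    also have "... \<le> e G"
     unfolding e_def
    proof (intro sum_mono mult_left_mono)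
     fix q assume "q \<in> {m..p}"
     then have q: "1 \<le> q" using m by auto
     have "\<bar>time_integral 0 1 (%s. expectation (?Y q s))\<bar> \<le>
       sqrt ((hermite_amplitude q G * sqrt (fact q))\<^sup>2 + 1 - 2 * (hermite_amplitude q G * sqrt (fact q)) * exp (- G) ^ q) * (1 - 0)"
      by (rule abs_time_integral_le_const) (use hermite_small_gamma_error[OF g q] in auto)
     then show "time_integral 0 1 (%s. expectation (?Y q s)) \<le>
       sqrt ((hermite_amplitude q G * sqrt (fact q))\<^sup>2 + 1 - 2 * (hermite_amplitude q G * sqrt (fact q)) * exp (- G) ^ q)" by simp
    qed auto
    finally show ?thesis .
   qed
   have law: "(\<integral>w. \<Phi> (Z w) \<partial>N) = (\<integral>w. \<Phi> (OU G 0 w) \<partial>M)"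
    unfolding lawN by (rule expectation_OU[OF g \<Phi>m, symmetric])
   have "AE w in M. \<forall>q\<in>{m..p}. \<forall>t\<in>{0..1}. W q G t w = hermite_amplitude q G * time_integral 0 t (%s. hermite q (OU G s w))"
    by (subst AE_ball_countable) (auto intro!: tempered_hermite_process_representation[OF g] W' g)
   with AE_good_path have dist: "AE w in M. dist (path_bc (%t. \<Sum>q=m..p. c q * W q G t w)) (path_bc (%t. t * h (OU G 0 w))) \<le> D w"
    using AE_space
   proof eventually_elim
    case (elim w)
    have cH: "continuous_on A (%s. hermite q (OU G s w))" for A q
     by (intro continuous_on_hermite OU_continuous elim(1) g)
    show ?case
    proof (rule dist_path_bc_le)
     show "continuous_on {0..1} (%t. \<Sum>q=m..p. c q * W q G t w)"
      using hermite_combination_process(2)[of m p G "%q. W q G", OF W' elim(3)] g by simp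
     show "continuous_on {0..1} (%t. t * h (OU G 0 w))" by (intro continuous_intros)
     fix t :: real assume t: "0 \<le> t" "t \<le> 1"
     have eq: "(\<Sum>q=m..p. c q * W q G t w) - t * h (OU G 0 w) =
      (\<Sum>q=m..p. c q * time_integral 0 t (%s. hermite_amplitude q G * hermite q (OU G s w) - hermite q (OU G 0 w) / sqrt (fact q)))"
      unfolding h_def sum_distrib_left sum_subtractf[symmetric]
     proof (intro sum.cong refl)
      fix q assume q: "q \<in> {m..p}"
      have "time_integral 0 t (%s. hermite_amplitude q G * hermite q (OU G s w) - hermite q (OU G 0 w) / sqrt (fact q))
       = hermite_amplitude q G * time_integral 0 t (%s. hermite q (OU G s w)) - hermite q (OU G 0 w) / sqrt (fact q) * t"
       using t by (subst time_integral_diff) (auto intro!: lborel_integral_Icc_eq_integral(2) continuous_intros cH)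
      then show "c q * W q G t w - t * (c q * hermite q (OU G 0 w) / sqrt (fact q)) =
       c q * time_integral 0 t (%s. hermite_amplitude q G * hermite q (OU G s w) - hermite q (OU G 0 w) / sqrt (fact q))"
       using elim(2) q t by (simp add: right_diff_distrib)
     qed
     show "\<bar>(\<Sum>q=m..p. c q * W q G t w) - t * h (OU G 0 w)\<bar> \<le> D w"
      unfolding eq D_def
     proof (rule order_trans[OF sum_abs], rule sum_mono)
      fix q
      have ci: "integrable lborel (%s. indicator {0..1} s * ?Y q s w)"
       by (intro lborel_integral_Icc_eq_integral(2) continuous_intros cH)
      have "\<bar>time_integral 0 t (%s. hermite_amplitude q G * hermite q (OU G s w) - hermite q (OU G 0 w) / sqrt (fact q))\<bar>
       \<le> time_integral 0 t (%s. ?Y q s w)"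
       by (rule abs_time_integral_le[OF time_integrable_subinterval[OF ci]]) (use t in auto)
      also have "... \<le> time_integral 0 1 (%s. ?Y q s w)"
       unfolding time_integral_def
       by (rule integral_mono[OF time_integrable_subinterval[OF ci] ci]) (use t in \<open>auto simp: indicator_def\<close>)
      finally show "\<bar>c q * time_integral 0 t (%s. hermite_amplitude q G * hermite q (OU G s w) - hermite q (OU G 0 w) / sqrt (fact q))\<bar>
       \<le> \<bar>c q\<bar> * time_integral 0 1 (%s. ?Y q s w)" by (simp add: abs_mult mult_left_mono)
     qed
    qed
   qed
   have "\<bar>(\<integral>w. \<phi> (path_bc (%t. \<Sum>q=m..p. c q * W q G t w)) \<partial>M) - (\<integral>w. \<phi> (path_bc (%t. t * h (OU G 0 w))) \<partial>M)\<bar> \<le> L * expectation D"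
   proof (rule expectation_lipschitz_diff[OF prob_space_axioms _ _ C L m\<phi> Di dist])
    show "(%w. path_bc (%t. \<Sum>q=m..p. c q * W q G t w)) \<in> borel_measurable M"
     using hermite_combination_process[of m p G "%q. W q G", OF W'] g by (intro path_bc_measurable) auto
    show "(%w. path_bc (%t. t * h (OU G 0 w))) \<in> borel_measurable M"
     by (rule measurable_compose[OF OU_measurable pm])
   qed
   also have "... \<le> L * e G" by (rule mult_left_mono[OF ED L(1)])
   finally show ?thesis unfolding law unfolding \<Phi>_def .
  qed
  have "((%G. (\<integral>w. \<phi> (path_bc (%t. \<Sum>q=m..p. c q * W q G t w)) \<partial>M) - (\<integral>w. \<Phi> (Z w) \<partial>N)) \<longlongrightarrow> 0) (at_right 0)"
   by (rule Lim_null_comparison[OF _ elim]) (use pos in \<open>eventually_elim, use bound in auto\<close>)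
  then have "((%G. \<integral>w. \<phi> (path_bc (%t. \<Sum>q=m..p. c q * W q G t w)) \<partial>M) \<longlongrightarrow> (\<integral>w. \<Phi> (Z w) \<partial>N)) (at_right 0)"
   by (rule LIM_zero_cancel)
  then show "((%G. \<integral>w. \<phi> (path_bc (%t. \<Sum>q=m..p. c q * W q G t w)) \<partial>M) \<longlongrightarrow>
   (\<integral>w. \<phi> (path_bc (%t. t * (\<Sum>q=m..p. c q * hermite q (Z w) / sqrt (fact q)))) \<partial>N)) (at_right 0)"
   by (simp add: \<Phi>_def h_def)
 qed
qed

end

section \<open>Moments of the fluctuations\<close>

text \<open>Fixes one choice of linearisation coefficients; integrating against the normal density
  isolates the coefficient of H_0.\<close>

lemma hermite_products:
 "\<exists>a N. \<forall>k q x. hermite k x * hermite q x = (\<Sum>l\<le>N k q. a k q l * hermite l x) \<and> a k q 0 = (if k = q then fact k else 0)"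
proof -
 have "\<exists>a N. (\<forall>x. hermite k x * hermite q x = (\<Sum>l\<le>N. a l * hermite l x)) \<and> a 0 = (if k = q then fact k else 0)" for k q
 proof -
  obtain a N where a: "\<And>x. hermite k x * hermite q x = (\<Sum>l\<le>N. a l * hermite l x)"
   using hermite_product_expansion by blast
  have i: "integrable lborel (%x. std_normal_density x * hermite l x)" for l
   using integrable_std_normal_poly[of "hermite_poly l"] by simp
  have "(\<integral>x. std_normal_density x * (hermite k x * hermite q x) \<partial>lborel) = (\<integral>x. (\<Sum>l\<le>N. a l * (std_normal_density x * hermite l x)) \<partial>lborel)"
   by (simp add: a sum_distrib_left mult.left_commute)
  also have "... = (\<Sum>l\<le>N. a l * (\<integral>x. std_normal_density x * hermite l x \<partial>lborel))"
   using i by (subst Bochner_Integration.integral_sum) auto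
  also have "... = (\<Sum>l\<le>N. if l = 0 then a 0 else 0)"
   using std_normal_hermite_orthogonal[of _ 0] by (intro sum.cong refl) simp
  finally have "a 0 = (if k = q then fact k else 0)"
   using std_normal_hermite_orthogonal[of k q] by simp
  then show ?thesis using a by blast
 qed
 then show ?thesis by metis
qed

text \<open>For k >= 1 the decay factor has total mass at most 1/G, which takes the place of the
  interval length.\<close>

lemma time_integral_power_exp_le:
 assumes sr: "s \<le> r" and g: "0 < G" and k: "1 \<le> k" and b: "\<And>u. s \<le> u ==> u \<le> r ==> \<bar>f u\<bar> \<le> C"
 shows "\<bar>time_integral s r (%u. exp (- G * (r - u)) ^ k * f u)\<bar> \<le> C / G"
proof -
 have C: "0 \<le> C" using b[of s] sr by linarith
 have ci: "continuous_on {s..r} (%u. (C / G) * (G * exp (- G * (r - u))))" by (intro continuous_intros)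
 have "\<bar>time_integral s r (%u. exp (- G * (r - u)) ^ k * f u)\<bar> \<le> time_integral s r (%u. (C / G) * (G * exp (- G * (r - u))))"
 proof (rule abs_time_integral_le)
  show "integrable lborel (%u. indicator {s..r} u * (C / G * (G * exp (- G * (r - u)))))"
   by (rule lborel_integral_Icc_eq_integral(2)[OF ci])
  fix u assume u: "s \<le> u" "u \<le> r"
  have "exp (- G * (r - u)) ^ k \<le> exp (- G * (r - u)) ^ 1"
   using k g u by (intro power_decreasing) auto
  then have "exp (- G * (r - u)) ^ k * \<bar>f u\<bar> \<le> exp (- G * (r - u)) * C" using b[OF u] by (intro mult_mono) auto
  then show "\<bar>exp (- G * (r - u)) ^ k * f u\<bar> \<le> C / G * (G * exp (- G * (r - u)))"
   using g by (simp add: abs_mult mult.commute)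
 qed
 also have "... = (C / G) * integral {s..r} (%u. G * exp (- G * (r - u)))"
  by (subst time_integral_eq_integral[OF ci]) simp
 also have "... = (C / G) * (1 - exp (- G * (r - s)))" unfolding integral_gexp[OF sr] by simp
 also have "... \<le> (C / G) * 1" using C g by (intro mult_left_mono) auto
 finally show ?thesis by simp
qed

text \<open>The test functions allowed in the moment calculus: composing with them preserves uniform
  moment bounds. Powers and cosines are the instances used.\<close>

definition (in prob_space) tame :: "(real => real) => bool" where
 "tame f \<longleftrightarrow> continuous_on UNIV f \<and>
   (\<forall>(S :: real set) Y. unif_moments M S Y --> unif_moments M S (%s w. f (Y s w)))"

context prob_space
begin

lemma tame_power: "tame (%x. x ^ n)"
 unfolding tame_def by (auto intro!: continuous_intros unif_moments_power)

lemma tame_cmult: "tame f ==> tame (%x. c * f x)"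
 unfolding tame_def by (auto intro!: continuous_intros unif_moments_cmult)

lemma tame_cos: "tame (%x. cos (\<theta> * x + \<alpha>))"
 unfolding tame_def
proof (intro conjI allI impI)
 show "continuous_on UNIV (%x. cos (\<theta> * x + \<alpha>))" by (intro continuous_intros)
 fix S :: "real set" and Y assume Y: "unif_moments M S Y"
 show "unif_moments M S (%s w. cos (\<theta> * Y s w + \<alpha>))"
  by (rule unif_moments_mono[OF unif_moments_const[of M "%_. 1"]])
    (auto dest!: unif_moments_D[OF Y] abs_moments_measurable)
qed

lemma tame_measurable[measurable_dest]: "tame f ==> f \<in> borel_measurable borel"
 unfolding tame_def by (auto intro: borel_measurable_continuous_onI)

lemma tame_unif_moments: "tame f ==> unif_moments M S Y ==> unif_moments M S (%s w. f (Y s w))" for S :: "real set"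
 unfolding tame_def by blast

end

locale hermite_combination = brownian_motion +
 fixes c :: "nat => real" and m p :: nat
 assumes m_pos: "1 \<le> m" and c_norm: "(\<Sum>q=m..p. (c q)\<^sup>2) = 1"
begin

definition coef :: "real => nat => real" where
 "coef G q = c q * hermite_amplitude q G"

definition drift :: "real => real => real" where
 "drift G x = (\<Sum>q=m..p. coef G q * hermite q x)"

definition fluct :: "real => real => real => 'a => real" where
 "fluct G s r w = time_integral s r (%u. drift G (OU G u w))"

text \<open>The unknowns of the hierarchy: U is a weight from the past, f tests the increment, and k
  records the correlation with the current value of the process.\<close>

definition mixed_moment :: "('a => real) => (real => real) => nat => real => real => real => real" where
 "mixed_moment U f k G s r = expectation (%w. U w * f (fluct G s r w) * hermite k (OU G r w))"

lemma drift_measurable[measurable]: "drift G \<in> borel_measurable borel"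
 unfolding drift_def by measurable

lemma drift_OU_joint: "(%(u, w). drift G (OU G u w)) \<in> borel_measurable (lborel \<Otimes>\<^sub>M M)"
 by measurable

lemma unif_moments_drift: "0 < G ==> unif_moments M S (%u w. drift G (OU G u w))"
 unfolding drift_def by (intro unif_moments_sum unif_moments_cmult unif_moments_hermite_OU)

lemma continuous_on_drift: "good_path w ==> 0 < G ==> continuous_on A (%u. drift G (OU G u w))"
 unfolding drift_def by (intro continuous_intros OU_continuous)

lemma fluct_joint[measurable]: "(%(u, w). fluct G s u w) \<in> borel_measurable (lborel \<Otimes>\<^sub>M M)"
 unfolding fluct_def by (rule time_integral_joint_measurable[OF drift_OU_joint])

lemma fluct_measurable[measurable]: "fluct G s r \<in> borel_measurable M"
 unfolding fluct_def by (rule time_integral_measurable[OF drift_OU_joint])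

text \<open>Stopping the integrand at r leaves it unchanged on the interval of integration and makes
  it jointly measurable for the past.\<close>

lemma fluct_past: "fluct G s r \<in> borel_measurable (past r)"
proof -
 have j: "(%(t, w). OU G (min t r) w) \<in> borel_measurable (lborel \<Otimes>\<^sub>M past r)"
  using OU_past_joint[of G r] by (simp cong: measurable_cong_sets sets_pair_measure_cong)
 have "(%w. time_integral s r (%u. drift G (OU G (min u r) w))) \<in> borel_measurable (past r)"
  using measurable_compose[OF j drift_measurable[of G]] by (intro time_integral_measurable) (simp add: case_prod_beta)
 moreover have "fluct G s r w = time_integral s r (%u. drift G (OU G (min u r) w))" for w
  unfolding fluct_def by (rule time_integral_cong) (simp add: min_def)
 ultimately show ?thesis by presburger
qed

lemma unif_moments_fluct: "0 < G ==> unif_moments M {s..r} (%u. fluct G s u)"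
 unfolding fluct_def by (rule unif_moments_time_integral[OF drift_OU_joint unif_moments_drift])

lemma fluct_self[simp]: "fluct G s s w = 0"
 by (simp add: fluct_def)

lemma fluct_derivative:
 assumes w: "good_path w" and g: "0 < G" and u: "u \<in> {s..r}"
 shows "((%v. fluct G s v w) has_vector_derivative drift G (OU G u w)) (at u within {s..r})"
proof -
 note c = continuous_on_drift[OF w g]
 have "((%v. integral {s..v} (%u. drift G (OU G u w))) has_vector_derivative drift G (OU G u w)) (at u within {s..r})"
  by (rule integral_has_vector_derivative[OF c u])
 then show ?thesis unfolding fluct_def time_integral_eq_integral[OF c] .
qed

lemma fluct_chain_rule:
 assumes w: "good_path w" and g: "0 < G" and sr: "s \<le> r"
  and f: "\<And>x. (f has_real_derivative f' x) (at x)" and f': "continuous_on UNIV f'"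
 shows "f (fluct G s r w) = f 0 + time_integral s r (%u. f' (fluct G s u w) * drift G (OU G u w))"
proof -
 have d: "((%v. f (fluct G s v w)) has_vector_derivative f' (fluct G s u w) * drift G (OU G u w)) (at u within {s..r})"
  if u: "u \<in> {s..r}" for u
  using field_vector_diff_chain_within[OF fluct_derivative[OF w g u] has_field_derivative_at_within[OF f]]
  by (simp add: o_def mult.commute)
 have cf: "continuous_on {s..r} (%v. fluct G s v w)"
  unfolding continuous_on_eq_continuous_within by (blast intro: has_vector_derivative_continuous fluct_derivative[OF w g])
 have "continuous_on {s..r} (%u. f' (fluct G s u w) * drift G (OU G u w))"
  using continuous_on_compose2[OF f' cf] by (intro continuous_intros continuous_on_drift w g) auto
 from time_integral_eq_integral[OF this] fundamental_theorem_of_calculus[OF sr d] show ?thesis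
  by (simp add: integral_unique)
qed

lemma abs_moments_fluct: "0 < G ==> abs_moments M (fluct G s r)"
proof (cases "s \<le> r")
 case True
 then show "0 < G ==> ?thesis" using unif_moments_D[OF unif_moments_fluct, of G r s r] by simp
next
 case False
 then have "fluct G s r = (%_. 0)" by (simp add: fluct_def time_integral_def fun_eq_iff)
 then show ?thesis by simp
qed

lemma abs_moments_tame_fluct: "0 < G ==> tame f ==> abs_moments M (%w. f (fluct G s r w))"
 using unif_moments_D[OF tame_unif_moments[OF _ unif_moments_const[OF abs_moments_fluct]], of f G r "{r}" s r] by simp

text \<open>Variation of constants: the chain rule writes f of the increment as f 0 plus a time
  integral of f' times the drift, and Mehler carries H_k from r back to s in the first term and back
  to u under the integral.\<close>

lemma mixed_moment_duhamel:
 assumes g: "0 < G" and sr: "s \<le> r" and U: "U \<in> borel_measurable (past s)" "abs_moments M U"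
  and f: "\<And>x. (f has_real_derivative f' x) (at x)" "tame f" "tame f'"
 shows "mixed_moment U f k G s r = f 0 * exp (- G * (r - s)) ^ k * expectation (%w. U w * hermite k (OU G s w))
  + time_integral s r (%u. exp (- G * (r - u)) ^ k *
    expectation (%w. U w * f' (fluct G s u w) * drift G (OU G u w) * hermite k (OU G u w)))"
proof -
 have [measurable]: "f \<in> borel_measurable borel" "f' \<in> borel_measurable borel" "U \<in> borel_measurable M"
  using f(2,3) U(2) by (auto dest: tame_measurable abs_moments_measurable)
 let ?Y = "%u w. f' (fluct G s u w) * drift G (OU G u w)"
 let ?V = "%w. U w * hermite k (OU G r w)"
 have Ym: "(%(u, w). ?Y u w) \<in> borel_measurable (lborel \<Otimes>\<^sub>M M)" by measurable
 have Yu: "unif_moments M {s..r} ?Y"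
  by (intro unif_moments_mult tame_unif_moments[OF f(3)] unif_moments_fluct unif_moments_drift g)
 have V: "abs_moments M ?V" by (intro abs_moments_mult U abs_moments_hermite abs_moments_OU g)
 have mT: "abs_moments M (%w. time_integral s r (%u. ?Y u w))"
  using unif_moments_D[OF unif_moments_time_integral[OF Ym Yu], of r] sr by simp
 have "mixed_moment U f k G s r = expectation (%w. f 0 * ?V w + ?V w * time_integral s r (%u. ?Y u w))"
  unfolding mixed_moment_def
 proof (rule integral_cong_AE)
  show "AE w in M. U w * f (fluct G s r w) * hermite k (OU G r w) = f 0 * ?V w + ?V w * time_integral s r (%u. ?Y u w)"
   using AE_good_path
  proof eventually_elim
   case (elim w)
   have "f (fluct G s r w) = f 0 + time_integral s r (%u. ?Y u w)"
    by (rule fluct_chain_rule[OF elim g sr f(1)]) (use f(3) in \<open>simp add: tame_def\<close>)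
   then show ?case by (simp only: distrib_left distrib_right mult.commute mult.left_commute)
  qed
  show "(%w. f 0 * ?V w + ?V w * time_integral s r (%u. ?Y u w)) \<in> borel_measurable M"
   by (intro borel_measurable_add borel_measurable_times borel_measurable_const abs_moments_measurable[OF V] abs_moments_measurable[OF mT])
 qed measurable
 also have "... = f 0 * expectation ?V + expectation (%w. ?V w * time_integral s r (%u. ?Y u w))"
  using abs_moments_integrable[OF V] abs_moments_integrable[OF abs_moments_mult[OF V mT]] by simp
 also have "expectation ?V = exp (- G * (r - s)) ^ k * expectation (%w. U w * hermite k (OU G s w))"
  by (rule expectation_hermite_OU_past[OF g sr U])
 also have "expectation (%w. ?V w * time_integral s r (%u. ?Y u w)) = time_integral s r (%u. expectation (%w. ?V w * ?Y u w))"
  by (rule expectation_time_integral_mult[OF Ym Yu V])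
 also have "... = time_integral s r (%u. exp (- G * (r - u)) ^ k *
    expectation (%w. U w * f' (fluct G s u w) * drift G (OU G u w) * hermite k (OU G u w)))"
 proof (rule time_integral_cong)
  fix u assume u: "s \<le> u" "u \<le> r"
  have Up: "(%w. U w * ?Y u w) \<in> borel_measurable (past u)"
   using measurable_past_mono[OF u(1) U(1)] measurable_compose[OF fluct_past, of f' borel G s u] measurable_compose[OF OU_past_measurable, of u u "drift G" borel G]
   by (intro borel_measurable_times) auto
  have Um: "abs_moments M (%w. U w * ?Y u w)"
   by (rule abs_moments_mult[OF U(2) unif_moments_D[OF Yu]]) (use u in auto)
  have "expectation (%w. ?V w * ?Y u w) = expectation (%w. (U w * ?Y u w) * hermite k (OU G r w))"
   by (intro Bochner_Integration.integral_cong refl) (simp add: mult.commute mult.left_commute)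
  also have "... = exp (- G * (r - u)) ^ k * expectation (%w. (U w * ?Y u w) * hermite k (OU G u w))"
   by (rule expectation_hermite_OU_past[OF g u(2) Up Um])
  finally show "expectation (%w. ?V w * ?Y u w) = exp (- G * (r - u)) ^ k *
    expectation (%w. U w * f' (fluct G s u w) * drift G (OU G u w) * hermite k (OU G u w))"
   by (simp only: mult.assoc)
 qed
 finally show ?thesis by (simp add: mult.assoc)
qed

text \<open>Linearising H_q H_k expresses the drift term through mixed moments again. Applied to the
  derivative, it turns Duhamel's formula for f into a hierarchy over all Hermite orders.\<close>

lemma mixed_moment_drift:
 assumes g: "0 < G" and U: "abs_moments M U" and f: "tame f"
  and a: "\<And>q x. hermite q x * hermite k x = (\<Sum>l\<le>N q. a q l * hermite l x)"
 shows "expectation (%w. U w * f (fluct G s u w) * drift G (OU G u w) * hermite k (OU G u w))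
  = (\<Sum>q=m..p. coef G q * (\<Sum>l\<le>N q. a q l * mixed_moment U f l G s u))"
proof -
 have i: "integrable M (%w. U w * f (fluct G s u w) * hermite l (OU G u w))" for l
  by (intro abs_moments_integrable abs_moments_mult U abs_moments_tame_fluct g f abs_moments_hermite abs_moments_OU)
 have "U w * f (fluct G s u w) * drift G (OU G u w) * hermite k (OU G u w) =
  (\<Sum>q=m..p. coef G q * (\<Sum>l\<le>N q. a q l * (U w * f (fluct G s u w) * hermite l (OU G u w))))" for w
 proof -
  let ?v = "U w * f (fluct G s u w)" and ?x = "OU G u w"
  have "?v * drift G ?x * hermite k ?x = (\<Sum>q=m..p. coef G q * (?v * (hermite q ?x * hermite k ?x)))"
   unfolding drift_def by (simp add: sum_distrib_left sum_distrib_right mult.assoc mult.left_commute)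
  then show ?thesis unfolding a sum_distrib_left by (simp only: mult.left_commute)
 qed
 then show ?thesis unfolding mixed_moment_def using i by simp
qed

text \<open>The constant may depend on the order k but is uniform in G >= 1 and over windows of
  length at most 1; \<open>\<beta>\<close> carries the dependence on G and on the length.\<close>

definition moment_bound :: "nat set => (real => real) => (real => real => real) => bool" where
 "moment_bound I f \<beta> \<longleftrightarrow> (\<forall>k\<in>I. \<exists>C\<ge>0. \<forall>G s r. 1 \<le> G --> s \<le> r --> r \<le> s + 1 -->
   \<bar>mixed_moment (%_. 1) f k G s r\<bar> \<le> C * \<beta> G (r - s))"

lemma moment_bound_Un: "moment_bound I f \<beta> ==> moment_bound J f \<beta> ==> moment_bound (I \<union> J) f \<beta>"
 unfolding moment_bound_def by blast

lemma moment_bound_cmult: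
 assumes "moment_bound I f \<beta>" shows "moment_bound I (%x. a * f x) \<beta>"
 unfolding moment_bound_def
proof
 fix k assume "k \<in> I"
 then obtain C where C: "0 \<le> C" "\<And>G s r. 1 \<le> G ==> s \<le> r ==> r \<le> s + 1 ==> \<bar>mixed_moment (%_. 1) f k G s r\<bar> \<le> C * \<beta> G (r - s)"
  using assms unfolding moment_bound_def by blast
 have "mixed_moment (%_. 1) (%x. a * f x) k G s r = a * mixed_moment (%_. 1) f k G s r" for G s r
  by (simp add: mixed_moment_def mult.assoc)
 then have "\<bar>mixed_moment (%_. 1) (%x. a * f x) k G s r\<bar> \<le> (\<bar>a\<bar> * C) * \<beta> G (r - s)" if "1 \<le> G" "s \<le> r" "r \<le> s + 1" for G s r
  using C(2)[OF that] by (simp add: abs_mult mult.assoc mult_left_mono)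
 then show "\<exists>C\<ge>0. \<forall>G s r. 1 \<le> G --> s \<le> r --> r \<le> s + 1 -->
   \<bar>mixed_moment (%_. 1) (%x. a * f x) k G s r\<bar> \<le> C * \<beta> G (r - s)"
  using C(1) by (intro exI[of _ "\<bar>a\<bar> * C"]) auto
qed

text \<open>With x = G q >= 1 the denominator \<open>exp (- x) - 1 + x\<close> is at least x
  exp(-2)/2, by cases at x = 2; so the squared amplitude is at most exp(2) q G.\<close>

lemma coef_bound: "\<exists>K\<ge>0. \<forall>G\<ge>1. \<forall>q\<in>{m..p}. \<bar>coef G q\<bar> \<le> K * sqrt G"
proof -
 define K where "K = (\<Sum>q=m..p. \<bar>c q\<bar> * sqrt (exp 2 * real q))"
 have "\<bar>coef G q\<bar> \<le> K * sqrt G" if g: "1 \<le> G" and q: "q \<in> {m..p}" for G q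
 proof -
  have q1: "1 \<le> q" using q m_pos by auto
  define x where "x = G * real q"
  have x: "1 \<le> x" using mult_mono[of 1 G 1 "real q"] g q1 by (simp add: x_def)
  have d: "x * exp (- 2) / 2 \<le> exp (- x) - 1 + x"
  proof (cases "x \<le> 2")
   case True
   have "x * exp (- 2) / 2 \<le> 2 * exp (- x) / 2" using True x by (intro divide_right_mono mult_mono) auto
   then show ?thesis using x by simp
  next
   case False
   have "x * exp (- 2) \<le> x * 1" using x by (intro mult_left_mono) auto
   then show ?thesis using False exp_gt_zero[of "- x"] by linarith
  qed
  have "(hermite_amplitude q G)\<^sup>2 * 1 \<le> (hermite_amplitude q G)\<^sup>2 * fact q" by (intro mult_left_mono fact_ge_1) auto
  also have "... = x\<^sup>2 / (2 * (exp (- x) - 1 + x))"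
   unfolding x_def using g by (intro hermite_amplitude_sq(1) q1) auto
  also have "... \<le> x\<^sup>2 / (2 * (x * exp (- 2) / 2))" using d x exp_minus_gt[of x] by (intro divide_left_mono mult_left_mono mult_pos_pos) auto
  also have "... = exp 2 * real q * G" using x by (simp add: power2_eq_square exp_minus x_def field_simps)
  finally have "(hermite_amplitude q G)\<^sup>2 \<le> exp 2 * real q * G" by simp
  from real_sqrt_le_mono[OF this] have h: "\<bar>hermite_amplitude q G\<bar> \<le> sqrt (exp 2 * real q) * sqrt G" by (simp only: real_sqrt_abs real_sqrt_mult)
  have "\<bar>coef G q\<bar> \<le> (\<bar>c q\<bar> * sqrt (exp 2 * real q)) * sqrt G"
   unfolding coef_def abs_mult mult.assoc by (rule mult_left_mono[OF h]) simp
  also have "... \<le> K * sqrt G"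
   unfolding K_def using g q by (intro mult_right_mono member_le_sum) auto
  finally show ?thesis .
 qed
 moreover have "0 \<le> K" unfolding K_def by (intro sum_nonneg mult_nonneg_nonneg) auto
 ultimately show ?thesis by blast
qed

text \<open>The drift costs a factor sqrt(G). For k = 0 it is already a combination of the orders m
  to p, all positive, so bounds on positive orders are enough.\<close>

lemma moment_bound_drift:
 assumes f: "tame f" and \<beta>: "moment_bound I f \<beta>" and k: "I = UNIV \<or> I = {1..} \<and> k = 0"
 shows "\<exists>C\<ge>0. \<forall>G s u. 1 \<le> G --> s \<le> u --> u \<le> s + 1 -->
   \<bar>expectation (%w. 1 * f (fluct G s u w) * drift G (OU G u w) * hermite k (OU G u w))\<bar> \<le> C * (sqrt G * \<beta> G (u - s))"
proof -
 obtain K where K: "0 \<le> K" "\<And>G q. 1 \<le> G ==> q \<in> {m..p} ==> \<bar>coef G q\<bar> \<le> K * sqrt G" using coef_bound by blast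
 obtain a :: "nat => nat => real" and N where a: "\<And>q x. hermite q x * hermite k x = (\<Sum>l\<le>N q. a q l * hermite l x)"
  and aI: "\<And>q l. q \<in> {m..p} ==> l \<notin> I ==> a q l = 0"
 proof (cases "I = UNIV")
  case True
  obtain a :: "nat => nat => nat => real" and N where "\<And>k q x. hermite k x * hermite q x = (\<Sum>l\<le>N k q. a k q l * hermite l x)"
   using hermite_products by metis
  then show ?thesis using that[of "%q. a q k" "%q. N q k"] True by blast
 next
  case False
  then have "I = {1..}" "k = 0" using k by auto
  then show ?thesis
   using that[of "%q l. if l = q then 1 else 0" "%q. q"] m_pos by (auto simp: if_distrib[of "%x. x * _"] cong: if_cong)
 qed
 have "\<exists>C. \<forall>l\<in>I. 0 \<le> C l \<and> (\<forall>G s r. 1 \<le> G --> s \<le> r --> r \<le> s + 1 -->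
   \<bar>mixed_moment (%_. 1) f l G s r\<bar> \<le> C l * \<beta> G (r - s))"
  using \<beta> unfolding moment_bound_def by (intro bchoice) blast
 then obtain C where C: "\<And>l. l \<in> I ==> 0 \<le> C l" "\<And>l G s r. l \<in> I ==> 1 \<le> G ==> s \<le> r ==> r \<le> s + 1 ==>
   \<bar>mixed_moment (%_. 1) f l G s r\<bar> \<le> C l * \<beta> G (r - s)" by blast
 define D where "D = (\<Sum>q=m..p. K * (\<Sum>l\<le>N q. \<bar>a q l\<bar> * C l))"
 show ?thesis
 proof (intro exI[of _ D] conjI allI impI)
  have nn: "0 \<le> \<bar>a q l\<bar> * C l" if "q \<in> {m..p}" for q l using C(1)[of l] aI[OF that, of l] by (cases "l \<in> I") auto
  show "0 \<le> D" unfolding D_def by (intro sum_nonneg mult_nonneg_nonneg K(1) nn)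
  fix G s u :: real assume g: "1 \<le> G" and su: "s \<le> u" "u \<le> s + 1"
  have "\<bar>\<Sum>q=m..p. coef G q * (\<Sum>l\<le>N q. a q l * mixed_moment (%_. 1) f l G s u)\<bar>
   \<le> (\<Sum>q=m..p. (K * sqrt G) * (\<Sum>l\<le>N q. (\<bar>a q l\<bar> * C l) * \<beta> G (u - s)))"
  proof (rule order_trans[OF sum_abs], intro sum_mono)
   fix q assume q: "q \<in> {m..p}"
   have "\<bar>\<Sum>l\<le>N q. a q l * mixed_moment (%_. 1) f l G s u\<bar> \<le> (\<Sum>l\<le>N q. (\<bar>a q l\<bar> * C l) * \<beta> G (u - s))"
   proof (rule order_trans[OF sum_abs], intro sum_mono)
    fix l
    show "\<bar>a q l * mixed_moment (%_. 1) f l G s u\<bar> \<le> (\<bar>a q l\<bar> * C l) * \<beta> G (u - s)"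
    proof (cases "l \<in> I")
     case True
     show ?thesis unfolding abs_mult mult.assoc by (rule mult_left_mono[OF C(2)[OF True g su]]) simp
    qed (simp add: aI[OF q])
   qed
   then show "\<bar>coef G q * (\<Sum>l\<le>N q. a q l * mixed_moment (%_. 1) f l G s u)\<bar> \<le> (K * sqrt G) * (\<Sum>l\<le>N q. (\<bar>a q l\<bar> * C l) * \<beta> G (u - s))"
    unfolding abs_mult using K(1) g by (intro mult_mono K(2)[OF g q]) auto
  qed
  also have "... = (\<Sum>q=m..p. (K * (\<Sum>l\<le>N q. \<bar>a q l\<bar> * C l)) * (sqrt G * \<beta> G (u - s)))"
   by (intro sum.cong refl, subst sum_distrib_right[symmetric], simp)
  also have "... = D * (sqrt G * \<beta> G (u - s))" unfolding D_def sum_distrib_right[of _ "{m..p}"] ..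
  finally show "\<bar>expectation (%w. 1 * f (fluct G s u w) * drift G (OU G u w) * hermite k (OU G u w))\<bar> \<le> D * (sqrt G * \<beta> G (u - s))"
   using g by (subst mixed_moment_drift[OF _ _ f a]) auto
 qed
qed

text \<open>Since f 0 = 0, Duhamel's formula leaves only the integral. The drift contributes
  sqrt(G); time integration contributes the length d in general and 1/G when k >= 1. The second rule
  compensates the growth of the amplitude.\<close>

lemma moment_bound_step:
 assumes f: "\<And>x. (f has_real_derivative f' x) (at x)" "tame f" "tame f'" "f 0 = 0"
  and \<beta>: "moment_bound I f' \<beta>" and k: "I = UNIV \<or> I = {1..} \<and> k = 0"
  and mono: "\<And>G x y. 1 \<le> G ==> 0 \<le> x ==> x \<le> y ==> \<beta> G x \<le> \<beta> G y"
 shows "moment_bound {k} f (%G d. sqrt G * d * \<beta> G d)"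
  and "1 \<le> k ==> moment_bound {k} f (%G d. \<beta> G d / sqrt G)"
proof -
 obtain C where C: "0 \<le> C" "\<And>G s u. 1 \<le> G ==> s \<le> u ==> u \<le> s + 1 ==>
   \<bar>expectation (%w. 1 * f' (fluct G s u w) * drift G (OU G u w) * hermite k (OU G u w))\<bar> \<le> C * (sqrt G * \<beta> G (u - s))"
  using moment_bound_drift[OF f(3) \<beta> k] by blast
 define E where "E G s u = expectation (%w. 1 * f' (fluct G s u w) * drift G (OU G u w) * hermite k (OU G u w))" for G s u :: real
 have E: "\<bar>E G s u\<bar> \<le> C * (sqrt G * \<beta> G (r - s))" if "1 \<le> G" "s \<le> u" "u \<le> r" "r \<le> s + 1" for G s u r
  unfolding E_def using that C(1) by (intro order_trans[OF C(2)] mult_left_mono mono) auto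
 have d: "mixed_moment (%_. 1) f k G s r = time_integral s r (%u. exp (- G * (r - u)) ^ k * E G s u)" if "1 \<le> G" "s \<le> r" for G s r
  unfolding E_def using that by (subst mixed_moment_duhamel[OF _ _ _ _ f(1-3)]) (auto simp: f(4))
 show "moment_bound {k} f (%G d. sqrt G * d * \<beta> G d)"
  unfolding moment_bound_def
 proof (intro ballI exI[of _ C] conjI allI impI C(1))
  fix j and G s r :: real assume j: "j \<in> {k}" and g: "1 \<le> G" and sr: "s \<le> r" "r \<le> s + 1"
  have "\<bar>time_integral s r (%u. exp (- G * (r - u)) ^ k * E G s u)\<bar> \<le> C * (sqrt G * \<beta> G (r - s)) * (r - s)"
  proof (rule abs_time_integral_le_const[OF sr(1)])
   fix u assume u: "s \<le> u" "u \<le> r"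
   have "\<bar>exp (- G * (r - u)) ^ k\<bar> \<le> 1" using g u by (simp add: power_le_one)
   then have "\<bar>exp (- G * (r - u)) ^ k\<bar> * \<bar>E G s u\<bar> \<le> 1 * (C * (sqrt G * \<beta> G (r - s)))"
    by (intro mult_mono E[OF g u sr(2)]) auto
   then show "\<bar>exp (- G * (r - u)) ^ k * E G s u\<bar> \<le> C * (sqrt G * \<beta> G (r - s))" by (simp add: abs_mult)
  qed
  then show "\<bar>mixed_moment (%_. 1) f j G s r\<bar> \<le> C * (sqrt G * (r - s) * \<beta> G (r - s))"
   using j d[OF g sr(1)] by (simp add: mult.assoc mult.left_commute mult.commute)
 qed
 show "moment_bound {k} f (%G d. \<beta> G d / sqrt G)" if k1: "1 \<le> k"
  unfolding moment_bound_def
 proof (intro ballI exI[of _ C] conjI allI impI C(1))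
  fix j and G s r :: real assume j: "j \<in> {k}" and g: "1 \<le> G" and sr: "s \<le> r" "r \<le> s + 1"
  have "\<bar>time_integral s r (%u. exp (- G * (r - u)) ^ k * E G s u)\<bar> \<le> C * (sqrt G * \<beta> G (r - s)) / G"
   by (rule time_integral_power_exp_le[OF sr(1) _ k1 E[OF g _ _ sr(2)]]) (use g in auto)
  also have "... = C * (\<beta> G (r - s) * (sqrt G / G))" by simp
  also have "sqrt G / G = 1 / sqrt G" using g real_div_sqrt[of G] by (simp add: field_simps)
  finally show "\<bar>mixed_moment (%_. 1) f j G s r\<bar> \<le> C * (\<beta> G (r - s) / sqrt G)"
   using j d[OF g sr(1)] by simp
 qed
qed

lemma moment_bound_UN: "(\<And>k. k \<in> I ==> moment_bound {k} f \<beta>) ==> moment_bound I f \<beta>"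
 unfolding moment_bound_def by blast

lemma moment_bound_weaken:
 assumes "moment_bound I f \<beta>" "\<And>G d. 1 \<le> G ==> 0 \<le> d ==> \<beta> G d \<le> \<beta>' G d"
 shows "moment_bound I f \<beta>'"
 unfolding moment_bound_def
proof
 fix k assume "k \<in> I"
 then obtain C where C: "0 \<le> C" "\<And>G s r. 1 \<le> G ==> s \<le> r ==> r \<le> s + 1 ==> \<bar>mixed_moment (%_. 1) f k G s r\<bar> \<le> C * \<beta> G (r - s)"
  using assms(1) unfolding moment_bound_def by blast
 show "\<exists>C\<ge>0. \<forall>G s r. 1 \<le> G --> s \<le> r --> r \<le> s + 1 --> \<bar>mixed_moment (%_. 1) f k G s r\<bar> \<le> C * \<beta>' G (r - s)"
  by (intro exI[of _ C] conjI allI impI C(1) order_trans[OF C(2) mult_left_mono[OF assms(2) C(1)]]) auto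
qed

lemma power_step:
 "\<And>x. ((%x. x ^ Suc n) has_real_derivative real (Suc n) * x ^ n) (at x)"
 "tame (%x. x ^ Suc n)" "tame (%x. real (Suc n) * x ^ n)" "(0::real) ^ Suc n = 0"
 by (auto intro!: tame_power tame_cmult derivative_eq_intros simp del: power_Suc)

lemma mixed_moment_1:
 assumes g: "0 < G"
 shows "mixed_moment (%_. 1) (%_. 1) k G s r = (if k = 0 then 1 else 0)"
 using expectation_hermite_OU[OF g, of k r 0] by (simp add: mixed_moment_def)

text \<open>Powers are raised one at a time, with d the window length. Power 1 is O(1/sqrt G) in all
  orders; power 2 is O(d), and O(1/G) in positive orders; power 3 is O(d/sqrt G), its order 0 using
  the sharper bound on power 2; power 4 is O(d^2).\<close>

lemma fluct_moments:
 "\<exists>C\<ge>0. \<forall>G s r. 1 \<le> G --> s \<le> r --> r \<le> s + 1 --> expectation (%w. (fluct G s r w)\<^sup>2) \<le> C * (r - s)"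
 "\<exists>C\<ge>0. \<forall>G s r. 1 \<le> G --> s \<le> r --> r \<le> s + 1 --> expectation (%w. fluct G s r w ^ 4) \<le> C * (r - s)\<^sup>2"
proof -
 have split: "(UNIV :: nat set) = {1..} \<union> {0}" by auto
 have b0: "moment_bound UNIV (%x. x ^ 0) (%_ _. 1)"
  unfolding moment_bound_def by (intro ballI exI[of _ 1]) (auto simp: mixed_moment_1)
 have b0': "moment_bound {1..} (%x. x ^ 0) (%_ _. 0)"
  unfolding moment_bound_def by (intro ballI exI[of _ 1]) (auto simp: mixed_moment_1)
 note step = moment_bound_step[OF power_step moment_bound_cmult]
 have "moment_bound {1..} (%x. x ^ Suc 0) (%G d. 1 / sqrt G)"
  by (rule moment_bound_UN, rule step(2)[OF b0]) auto
 moreover have "moment_bound {0} (%x. x ^ Suc 0) (%G d. 1 / sqrt G)"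
  by (rule moment_bound_weaken[OF step(1)[OF b0']]) auto
 ultimately have b1: "moment_bound UNIV (%x. x ^ Suc 0) (%G d. 1 / sqrt G)"
  unfolding split by (rule moment_bound_Un)
 have b2: "moment_bound UNIV (%x. x ^ Suc (Suc 0)) (%G d. d)"
  by (rule moment_bound_UN, rule moment_bound_weaken[OF step(1)[OF b1]]) auto
 have b2': "moment_bound {1..} (%x. x ^ Suc (Suc 0)) (%G d. 1 / G)"
  by (rule moment_bound_UN, rule moment_bound_weaken[OF step(2)[OF b1]]) auto
 have "moment_bound {1..} (%x. x ^ Suc (Suc (Suc 0))) (%G d. d / sqrt G)"
  by (rule moment_bound_UN, rule step(2)[OF b2]) auto
 moreover have "moment_bound {0} (%x. x ^ Suc (Suc (Suc 0))) (%G d. d / sqrt G)"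
 proof (rule moment_bound_weaken[OF step(1)[OF b2']])
  fix G d :: real assume "1 \<le> G"
  then have "sqrt G / G = 1 / sqrt G" using real_div_sqrt[of G] by (simp add: field_simps)
  then have "d * (sqrt G / G) = d * (1 / sqrt G)" by simp
  then show "sqrt G * d * (1 / G) \<le> d / sqrt G" by (simp add: mult.commute)
 qed auto
 ultimately have b3: "moment_bound UNIV (%x. x ^ Suc (Suc (Suc 0))) (%G d. d / sqrt G)"
  unfolding split by (rule moment_bound_Un)
 have "moment_bound UNIV (%x. x ^ Suc (Suc (Suc (Suc 0)))) (%G d. d\<^sup>2)"
  by (rule moment_bound_UN, rule moment_bound_weaken[OF step(1)[OF b3]]) (auto simp: divide_right_mono power2_eq_square)
 then obtain C where C: "0 \<le> C" "\<And>G s r. 1 \<le> G ==> s \<le> r ==> r \<le> s + 1 ==> \<bar>mixed_moment (%_. 1) (%x. x ^ Suc (Suc (Suc (Suc 0)))) 0 G s r\<bar> \<le> C * (r - s)\<^sup>2"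
  unfolding moment_bound_def by blast
 show "\<exists>C\<ge>0. \<forall>G s r. 1 \<le> G --> s \<le> r --> r \<le> s + 1 --> expectation (%w. fluct G s r w ^ 4) \<le> C * (r - s)\<^sup>2"
  using C by (intro exI[of _ C]) (auto simp: mixed_moment_def abs_le_iff eval_nat_numeral)
 from b2 obtain C where C: "0 \<le> C" "\<And>G s r. 1 \<le> G ==> s \<le> r ==> r \<le> s + 1 ==> \<bar>mixed_moment (%_. 1) (%x. x ^ Suc (Suc 0)) 0 G s r\<bar> \<le> C * (r - s)"
  unfolding moment_bound_def by blast
 show "\<exists>C\<ge>0. \<forall>G s r. 1 \<le> G --> s \<le> r --> r \<le> s + 1 --> expectation (%w. (fluct G s r w)\<^sup>2) \<le> C * (r - s)"
  using C by (intro exI[of _ C]) (auto simp: mixed_moment_def abs_le_iff eval_nat_numeral)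
qed

end

section \<open>Characteristic functions of the fluctuations\<close>

lemma time_integrable_mult_continuous:
 fixes f h :: "real => real"
 assumes f: "integrable lborel (%u. indicator {a..b} u * f u)" and h: "continuous_on {a..b} h"
 shows "integrable lborel (%u. indicator {a..b} u * (h u * f u))"
proof -
 have "compact (h ` {a..b})" by (rule compact_continuous_image[OF h compact_Icc])
 then obtain K where K: "\<forall>y\<in>h ` {a..b}. norm y \<le> K" using compact_imp_bounded bounded_iff by blast
 have K': "\<bar>h u\<bar> \<le> \<bar>K\<bar>" if "a \<le> u" "u \<le> b" for u using K that by force
 have eq: "indicator {a..b} u * (h u * f u) = (indicator {a..b} u * h u) * (indicator {a..b} u * f u)" for u
  by (simp add: indicator_def)
 show ?thesis
 proof (rule Bochner_Integration.integrable_bound[OF integrable_mult_right[OF f, of K]])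
  show "(%u. indicator {a..b} u * (h u * f u)) \<in> borel_measurable lborel"
   unfolding eq by (intro borel_measurable_times borel_measurable_integrable[OF f] borel_measurable_integrable[OF lborel_integral_Icc_eq_integral(2)[OF h]])
  show "AE u in lborel. norm (indicator {a..b} u * (h u * f u)) \<le> norm (K * (indicator {a..b} u * f u))"
   using K' by (intro AE_I2) (auto simp: indicator_def abs_mult intro!: mult_right_mono)
 qed
qed

lemma time_integral_continuous:
 assumes f: "integrable lborel (%u. indicator {a..b} u * f u)"
 shows "continuous_on {a..b} (%r. time_integral a r f)"
proof -
 have si: "set_integrable lborel {a..r} f" if "r \<le> b" for r
  using time_integrable_subinterval[OF f order_refl that] by (simp add: set_integrable_def)
 have eq: "time_integral a r f = integral {a..r} f" if "r \<le> b" for r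
  using set_borel_integral_eq_integral(2)[OF si[OF that]] by (simp add: time_integral_def set_lebesgue_integral_def)
 have "continuous_on {a..b} (%r. integral {a..r} f)"
  by (rule indefinite_integral_continuous_1[OF set_borel_integral_eq_integral(1)[OF si]]) simp
 then show ?thesis by (rule continuous_on_eq) (simp add: eq)
qed

text \<open>Stability of v = x - \<open>\<kappa>\<close> times its integral, whose solution is
  exponential. Windows of length at most 1 keep the constant independent of r.\<close>

lemma linear_integral_equation:
 fixes v :: "real => real"
 assumes v: "continuous_on {s..t} v" and k: "0 \<le> \<kappa>" and t: "s \<le> r" "r \<le> t" "r \<le> s + 1"
  and eq: "\<And>u. u \<in> {s..r} ==> \<bar>v u - (x - \<kappa> * integral {s..u} v)\<bar> \<le> e"
 shows "\<bar>v r - x * exp (- \<kappa> * (r - s))\<bar> \<le> (\<kappa> * exp \<kappa> + 1) * e"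
proof -
 define V where "V u = integral {s..u} v" for u
 \<comment> \<open>An integrating factor: Q starts at 0, is identically 0 for the exact solution,
   and has as derivative the error of the equation times a bounded factor.\<close>
 define Q where "Q u = \<kappa> * (exp (\<kappa> * (u - s)) * V u) - x * (exp (\<kappa> * (u - s)) - 1)" for u
 have v': "continuous_on {s..r} v" by (rule continuous_on_subset[OF v]) (use t in auto)
 have e: "0 \<le> e" using eq[of s] t by force
 have dV: "(V has_real_derivative v u) (at u within {s..r})" if "u \<in> {s..r}" for u
  unfolding V_def[abs_def] has_real_derivative_iff_has_vector_derivative by (rule integral_has_vector_derivative[OF v' that])
 have "(Q has_real_derivative \<kappa> * (exp (\<kappa> * (u - s)) * (v u - (x - \<kappa> * V u)))) (at u within {s..r})" if "u \<in> {s..r}" for u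
  unfolding Q_def[abs_def]
  by (rule dV[OF that] derivative_eq_intros refl | simp add: algebra_simps)+
 moreover have "norm (\<kappa> * (exp (\<kappa> * (u - s)) * (v u - (x - \<kappa> * V u)))) \<le> \<kappa> * (exp \<kappa> * e)" if "u \<in> {s..r}" for u
 proof -
  have "\<kappa> * (u - s) \<le> \<kappa> * 1" using that t k by (intro mult_left_mono) auto
  then have "exp (\<kappa> * (u - s)) * \<bar>v u - (x - \<kappa> * V u)\<bar> \<le> exp \<kappa> * e"
   unfolding V_def by (intro mult_mono eq[OF that]) auto
  then show ?thesis using k by (simp add: abs_mult mult_left_mono)
 qed
 ultimately have "norm (Q r - Q s) \<le> \<kappa> * (exp \<kappa> * e) * norm (r - s)"
  using t by (intro field_differentiable_bound[of "{s..r}"]) auto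
 also have "... \<le> \<kappa> * (exp \<kappa> * e) * 1" using t k e by (intro mult_left_mono) auto
 finally have Q: "\<bar>Q r\<bar> \<le> \<kappa> * (exp \<kappa> * e)" by (simp add: Q_def V_def)
 have "exp (- \<kappa> * (r - s)) * Q r = \<kappa> * V r - x * (1 - exp (- \<kappa> * (r - s)))"
  unfolding Q_def by (simp add: algebra_simps flip: exp_add)
 then have "v r - x * exp (- \<kappa> * (r - s)) = (v r - (x - \<kappa> * V r)) - exp (- \<kappa> * (r - s)) * Q r" by (simp add: algebra_simps)
 also have "\<bar>...\<bar> \<le> e + 1 * (\<kappa> * (exp \<kappa> * e))"
 proof (rule order_trans[OF abs_triangle_ineq4 add_mono])
  show "\<bar>v r - (x - \<kappa> * V r)\<bar> \<le> e" unfolding V_def using t by (intro eq) auto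
  have "exp (- \<kappa> * (r - s)) \<le> 1" using k t by simp
  then show "\<bar>exp (- \<kappa> * (r - s)) * Q r\<bar> \<le> 1 * (\<kappa> * (exp \<kappa> * e))"
   unfolding abs_mult by (intro mult_mono Q) auto
 qed
 finally show ?thesis by (simp add: algebra_simps)
qed

context hermite_combination
begin

text \<open>The free phase \<open>\<alpha>\<close> keeps everything real: a derivative adds pi/2 to
  it, and the phases 0 and -pi/2 yield the real and imaginary parts of a characteristic
  function.\<close>

abbreviation cos_moment :: "('a => real) => real => real => nat => real => real => real => real" where
 "cos_moment U \<theta> \<alpha> \<equiv> mixed_moment U (%x. cos (\<theta> * x + \<alpha>))"

definition cos_drift :: "('a => real) => real => real => nat => real => real => real => real" where
 "cos_drift U \<theta> \<alpha> k G s u =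
  expectation (%w. U w * cos (\<theta> * fluct G s u w + \<alpha>) * drift G (OU G u w) * hermite k (OU G u w))"

lemma cos_moment_bound:
 assumes g: "0 < G" and U: "U \<in> borel_measurable M" "\<And>w. w \<in> space M ==> \<bar>U w\<bar> \<le> 1"
 shows "\<bar>cos_moment U \<theta> \<alpha> k G s r\<bar> \<le> sqrt (fact k)"
proof -
 have H: "abs_moments M (%w. hermite k (OU G r w))" by (intro abs_moments_hermite abs_moments_OU g)
 have le: "\<bar>U w * cos (\<theta> * fluct G s r w + \<alpha>) * hermite k (OU G r w)\<bar> \<le> \<bar>hermite k (OU G r w)\<bar>" if "w \<in> space M" for w
 proof -
  have "\<bar>U w * cos (\<theta> * fluct G s r w + \<alpha>)\<bar> \<le> 1 * 1" unfolding abs_mult by (intro mult_mono U(2) that) auto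
  then show ?thesis unfolding abs_mult[of _ "hermite k (OU G r w)"] by (intro mult_left_le_one_le) auto
 qed
 have i: "integrable M (%w. U w * cos (\<theta> * fluct G s r w + \<alpha>) * hermite k (OU G r w))"
  by (rule Bochner_Integration.integrable_bound[OF abs_moments_integrable[OF H]]) (use le U(1) in auto)
 have "\<bar>cos_moment U \<theta> \<alpha> k G s r\<bar> \<le> expectation (%w. \<bar>U w * cos (\<theta> * fluct G s r w + \<alpha>) * hermite k (OU G r w)\<bar>)"
  unfolding mixed_moment_def using integral_norm_bound[of M "%w. U w * cos (\<theta> * fluct G s r w + \<alpha>) * hermite k (OU G r w)"] by simp
 also have "... \<le> expectation (%w. \<bar>hermite k (OU G r w)\<bar>)"
  by (rule integral_mono[OF integrable_abs[OF i] integrable_abs[OF abs_moments_integrable[OF H]] le])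
 also have "... \<le> sqrt (expectation (%w. (hermite k (OU G r w))\<^sup>2))" by (rule expectation_abs_le_sqrt[OF H])
 also have "expectation (%w. (hermite k (OU G r w))\<^sup>2) = fact k"
  using expectation_hermite_OU[OF g, of k r k] by (simp add: power2_eq_square)
 finally show ?thesis .
qed

lemma cos_step:
 "\<And>x. ((%x. cos (\<theta> * x + \<alpha>)) has_real_derivative \<theta> * cos (\<theta> * x + (\<alpha> + pi / 2))) (at x)"
 "tame (%x. cos (\<theta> * x + \<alpha>))" "tame (%x. \<theta> * cos (\<theta> * x + (\<alpha> + pi / 2)))"
proof -
 have "cos (y + pi / 2) = - sin y" for y :: real by (simp add: cos_add)
 then have "cos (\<theta> * x + (\<alpha> + pi / 2)) = - sin (\<theta> * x + \<alpha>)" for x by (metis add.assoc)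
 then show "((%x. cos (\<theta> * x + \<alpha>)) has_real_derivative \<theta> * cos (\<theta> * x + (\<alpha> + pi / 2))) (at x)" for x
  by (auto intro!: derivative_eq_intros)
qed (intro tame_cmult tame_cos)+

text \<open>Splitting exp(-G(r - u)) as exp(-G r) exp(G u) isolates r in a prefactor and in the
  upper limit, ready for continuity and differentiation.\<close>

lemma cos_moment_duhamel:
 assumes g: "0 < G" and sr: "s \<le> r" and U: "U \<in> borel_measurable (past s)" "abs_moments M U"
 shows "cos_moment U \<theta> \<alpha> k G s r = exp (- G * r) ^ k *
  (exp (G * s) ^ k * cos_moment U \<theta> \<alpha> k G s s + time_integral s r (%u. exp (G * u) ^ k * (\<theta> * cos_drift U \<theta> (\<alpha> + pi / 2) k G s u)))"
proof -
 have e: "exp (- G * (r - u)) ^ k = exp (- G * r) ^ k * exp (G * u) ^ k" for u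
  by (simp add: power_mult_distrib[symmetric] algebra_simps flip: exp_add)
 have s: "cos (\<theta> * 0 + \<alpha>) * expectation (%w. U w * hermite k (OU G s w)) = cos_moment U \<theta> \<alpha> k G s s"
  unfolding mixed_moment_def by (subst integral_mult_right_zero[symmetric], intro Bochner_Integration.integral_cong refl) simp
 have d: "expectation (%w. U w * (\<theta> * cos (\<theta> * fluct G s u w + (\<alpha> + pi / 2))) * drift G (OU G u w) * hermite k (OU G u w))
  = \<theta> * cos_drift U \<theta> (\<alpha> + pi / 2) k G s u" for u
  unfolding cos_drift_def by (subst integral_mult_right_zero[symmetric], intro Bochner_Integration.integral_cong refl) simp
 have "cos_moment U \<theta> \<alpha> k G s r = cos (\<theta> * 0 + \<alpha>) * (exp (- G * r) ^ k * exp (G * s) ^ k) * expectation (%w. U w * hermite k (OU G s w))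
  + time_integral s r (%u. exp (- G * r) ^ k * exp (G * u) ^ k * (\<theta> * cos_drift U \<theta> (\<alpha> + pi / 2) k G s u))"
  unfolding mixed_moment_duhamel[OF g sr U cos_step] e d ..
 then show ?thesis unfolding s[symmetric] mult.assoc time_integral_cmult distrib_left by (simp only: mult.left_commute)
qed

lemma cos_drift_expand:
 assumes g: "0 < G" and U: "abs_moments M U"
  and a: "\<And>q x. hermite q x * hermite k x = (\<Sum>l\<le>N q. a q l * hermite l x)"
 shows "cos_drift U \<theta> \<alpha> k G s u = (\<Sum>q=m..p. coef G q * (\<Sum>l\<le>N q. a q l * cos_moment U \<theta> \<alpha> l G s u))"
 unfolding cos_drift_def by (rule mixed_moment_drift[OF g U tame_cos a])

lemma cos_drift_integrable:
 assumes g: "0 < G" and U: "abs_moments M U"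
 shows "integrable lborel (%u. indicator {s..t} u * cos_drift U \<theta> \<alpha> k G s u)"
 unfolding cos_drift_def
proof (rule expectation_time_integrable)
 have [measurable]: "U \<in> borel_measurable M" by (rule abs_moments_measurable[OF U])
 show "(%(u, w). U w * cos (\<theta> * fluct G s u w + \<alpha>) * drift G (OU G u w) * hermite k (OU G u w)) \<in> borel_measurable (lborel \<Otimes>\<^sub>M M)"
  by measurable
 show "unif_moments M {s..t} (%u w. U w * cos (\<theta> * fluct G s u w + \<alpha>) * drift G (OU G u w) * hermite k (OU G u w))"
  by (intro unif_moments_mult unif_moments_const[OF U] tame_unif_moments[OF tame_cos] unif_moments_fluct unif_moments_drift unif_moments_hermite_OU g)
qed

text \<open>Regularity is gained in steps: Fubini makes the drift moment integrable, Duhamel then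
  makes this moment continuous, and the drift moment becomes continuous as a finite combination of
  such moments.\<close>

lemma cos_moment_continuous:
 assumes g: "0 < G" and U: "U \<in> borel_measurable (past s)" "abs_moments M U"
 shows "continuous_on {s..t} (%r. cos_moment U \<theta> \<alpha> k G s r)"
proof -
 have "integrable lborel (%u. indicator {s..t} u * (exp (G * u) ^ k * (\<theta> * cos_drift U \<theta> (\<alpha> + pi / 2) k G s u)))"
  using time_integrable_mult_continuous[OF cos_drift_integrable[OF g U(2)], of s t "%u. exp (G * u) ^ k * \<theta>" \<theta> "\<alpha> + pi / 2" k]
  by (simp add: mult.assoc continuous_intros)
 from time_integral_continuous[OF this]
 have "continuous_on {s..t} (%r. exp (- G * r) ^ k *
  (exp (G * s) ^ k * cos_moment U \<theta> \<alpha> k G s s + time_integral s r (%u. exp (G * u) ^ k * (\<theta> * cos_drift U \<theta> (\<alpha> + pi / 2) k G s u))))"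
  by (intro continuous_intros)
 then show ?thesis by (rule continuous_on_eq) (rule cos_moment_duhamel[OF g _ U, symmetric], simp)
qed

lemma cos_drift_continuous:
 assumes g: "0 < G" and U: "U \<in> borel_measurable (past s)" "abs_moments M U"
 shows "continuous_on {s..t} (%r. cos_drift U \<theta> \<alpha> k G s r)"
proof -
 obtain a :: "nat => nat => nat => real" and N where a: "\<And>k q x. hermite k x * hermite q x = (\<Sum>l\<le>N k q. a k q l * hermite l x)"
  using hermite_products by metis
 have "continuous_on {s..t} (%u. \<Sum>q=m..p. coef G q * (\<Sum>l\<le>N q k. a q k l * cos_moment U \<theta> \<alpha> l G s u))"
  by (intro continuous_intros cos_moment_continuous g U)
 then show ?thesis by (rule continuous_on_eq) (simp add: cos_drift_expand[OF g U(2) a])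
qed

text \<open>Duhamel's formula differentiated and integrated again: the decay of order k becomes a
  friction term G k times the time integral.\<close>

lemma cos_moment_equation:
 assumes g: "0 < G" and sr: "s \<le> r" and U: "U \<in> borel_measurable (past s)" "abs_moments M U"
 shows "cos_moment U \<theta> \<alpha> k G s r = cos_moment U \<theta> \<alpha> k G s s - G * real k * time_integral s r (cos_moment U \<theta> \<alpha> k G s)
  + \<theta> * time_integral s r (cos_drift U \<theta> (\<alpha> + pi / 2) k G s)"
proof -
 let ?v = "cos_moment U \<theta> \<alpha> k G s" and ?g = "%u. \<theta> * cos_drift U \<theta> (\<alpha> + pi / 2) k G s u"
 have cg: "continuous_on {s..r} ?g" by (intro continuous_on_mult_left cos_drift_continuous g U)
 have cv: "continuous_on {s..r} ?v" by (rule cos_moment_continuous[OF g U])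
 have ch: "continuous_on {s..u} (%u. exp (G * u) ^ k * ?g u)" for u
  by (intro continuous_intros cos_drift_continuous g U)
 define F where "F u = exp (- G * u) ^ k * (exp (G * s) ^ k * ?v s + integral {s..u} (%u. exp (G * u) ^ k * ?g u))" for u
 have vF: "?v u = F u" if "s \<le> u" for u
  unfolding F_def cos_moment_duhamel[OF g that U] time_integral_eq_integral[OF ch] ..
 have ex: "exp (- G * u) ^ k = exp (- G * real k * u)" "exp (G * u) ^ k = exp (G * real k * u)" for u
  by (simp_all add: exp_of_nat_mult[symmetric] mult.left_commute mult.commute)
 have dF: "(F has_vector_derivative - (G * real k) * F u + ?g u) (at u within {s..r})" if u: "u \<in> {s..r}" for u
 proof -
  have dI: "((%u. integral {s..u} (%u. exp (G * u) ^ k * ?g u)) has_real_derivative exp (G * u) ^ k * ?g u) (at u within {s..r})"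
   unfolding has_real_derivative_iff_has_vector_derivative by (rule integral_has_vector_derivative[OF ch u])
  have dG: "((%u. exp (- G * u) ^ k) has_real_derivative - (G * real k) * exp (- G * u) ^ k) (at u within {s..r})"
   unfolding ex by (auto intro!: derivative_eq_intros)
  have e1: "exp (G * u) ^ k * y * exp (- G * u) ^ k = y" for y
  proof -
   have "exp (G * u) ^ k * exp (- G * u) ^ k = 1" unfolding ex by (simp flip: exp_add)
   then show ?thesis by (metis mult.commute mult.left_commute mult.right_neutral)
  qed
  have "(F has_real_derivative - (G * real k) * exp (- G * u) ^ k * (exp (G * s) ^ k * ?v s + integral {s..u} (%u. exp (G * u) ^ k * ?g u))
    + (0 + exp (G * u) ^ k * ?g u) * exp (- G * u) ^ k) (at u within {s..r})"
   unfolding F_def[abs_def] by (rule DERIV_mult[OF dG DERIV_add[OF DERIV_const dI]])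
  then have "(F has_real_derivative - (G * real k) * F u + ?g u) (at u within {s..r})"
   unfolding add_0 e1 unfolding F_def mult.assoc .
  then show ?thesis by (simp add: has_real_derivative_iff_has_vector_derivative)
 qed
 from fundamental_theorem_of_calculus[OF sr dF]
 have "((%u. - (G * real k) * ?v u + ?g u) has_integral F r - F s) {s..r}"
  by (rule has_integral_eq[rotated]) (auto simp only: vF atLeastAtMost_iff)
 then have "F r - F s = integral {s..r} (%u. - (G * real k) * ?v u + ?g u)" by (rule integral_unique[symmetric])
 also have "... = time_integral s r (%u. - (G * real k) * ?v u + ?g u)"
  by (rule time_integral_eq_integral[symmetric]) (intro continuous_on_add continuous_on_mult_left cv cg)
 also have "... = time_integral s r (%u. - (G * real k) * ?v u) + time_integral s r ?g"
  by (intro time_integral_add lborel_integral_Icc_eq_integral(2) continuous_on_mult_left cv cg)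
 also have "... = - (G * real k) * time_integral s r ?v + \<theta> * time_integral s r (cos_drift U \<theta> (\<alpha> + pi / 2) k G s)"
  unfolding time_integral_cmult ..
 finally show ?thesis using vF[of r] vF[of s] sr by simp
qed

text \<open>For \<open>k \<ge> 1\<close> the equation above bounds the time average of the moment by its drift divided by \<open>G k\<close>.\<close>
lemma cos_average_bound:
 assumes k: "1 \<le> k"
 shows "\<exists>C\<ge>0. \<forall>G s r U \<alpha>. 1 \<le> G --> s \<le> r --> r \<le> s + 1 --> U \<in> borel_measurable (past s) --> (\<forall>w\<in>space M. \<bar>U w\<bar> \<le> 1) -->
   \<bar>time_integral s r (cos_moment U \<theta> \<alpha> k G s)\<bar> \<le> C / sqrt G"
proof -
 obtain K where K: "0 \<le> K" "\<And>G q. 1 \<le> G ==> q \<in> {m..p} ==> \<bar>coef G q\<bar> \<le> K * sqrt G" using coef_bound by blast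
 obtain a :: "nat => nat => nat => real" and N where a: "\<And>k q x. hermite k x * hermite q x = (\<Sum>l\<le>N k q. a k q l * hermite l x)"
  using hermite_products by metis
 define D where "D = (\<Sum>q=m..p. K * (\<Sum>l\<le>N q k. \<bar>a q k l\<bar> * sqrt (fact l)))"
 have D0: "0 \<le> D" unfolding D_def by (intro sum_nonneg mult_nonneg_nonneg K(1)) auto
 define C where "C = 2 * sqrt (fact k) + \<bar>\<theta>\<bar> * D"
 have "\<bar>time_integral s r (cos_moment U \<theta> \<alpha> k G s)\<bar> \<le> C / sqrt G"
  if g: "1 \<le> G" and sr: "s \<le> r" "r \<le> s + 1" and U: "U \<in> borel_measurable (past s)" "\<forall>w\<in>space M. \<bar>U w\<bar> \<le> 1" for G s r U \<alpha>
 proof -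
  have g0: "0 < G" using g by simp
  have UM: "U \<in> borel_measurable M" by (rule measurable_past_M[OF U(1)])
  have mU: "abs_moments M U" using abs_moments_bounded[OF UM] U(2) by blast
  have b: "\<bar>cos_moment U \<theta> \<beta> l G s u\<bar> \<le> sqrt (fact l)" for \<beta> l u using cos_moment_bound[OF g0 UM] U(2) by blast
  have "\<bar>cos_drift U \<theta> \<beta> k G s u\<bar> \<le> D * sqrt G" for \<beta> u
  proof -
   have "\<bar>cos_drift U \<theta> \<beta> k G s u\<bar> \<le> (\<Sum>q=m..p. (K * sqrt G) * (\<Sum>l\<le>N q k. \<bar>a q k l\<bar> * sqrt (fact l)))"
    unfolding cos_drift_expand[OF g0 mU a]
   proof (rule order_trans[OF sum_abs], intro sum_mono)
    fix q assume q: "q \<in> {m..p}"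
    have "\<bar>\<Sum>l\<le>N q k. a q k l * cos_moment U \<theta> \<beta> l G s u\<bar> \<le> (\<Sum>l\<le>N q k. \<bar>a q k l\<bar> * sqrt (fact l))"
     by (rule order_trans[OF sum_abs], intro sum_mono) (auto simp: abs_mult intro!: mult_left_mono b)
    then show "\<bar>coef G q * (\<Sum>l\<le>N q k. a q k l * cos_moment U \<theta> \<beta> l G s u)\<bar> \<le> (K * sqrt G) * (\<Sum>l\<le>N q k. \<bar>a q k l\<bar> * sqrt (fact l))"
     unfolding abs_mult using K(1) g by (intro mult_mono K(2)[OF g q]) auto
   qed
   also have "... = (\<Sum>q=m..p. (K * (\<Sum>l\<le>N q k. \<bar>a q k l\<bar> * sqrt (fact l))) * sqrt G)" by (intro sum.cong refl) simp
   also have "... = D * sqrt G" unfolding D_def sum_distrib_right ..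
   finally show ?thesis .
  qed
  then have "\<bar>time_integral s r (cos_drift U \<theta> (\<alpha> + pi / 2) k G s)\<bar> \<le> D * sqrt G * (r - s)"
   by (intro abs_time_integral_le_const sr) auto
  also have "... \<le> D * sqrt G * 1" using sr D0 g by (intro mult_left_mono) auto
  finally have td: "\<bar>\<theta> * time_integral s r (cos_drift U \<theta> (\<alpha> + pi / 2) k G s)\<bar> \<le> \<bar>\<theta>\<bar> * (D * sqrt G)"
   by (simp add: abs_mult mult_left_mono)
  let ?T = "time_integral s r (cos_moment U \<theta> \<alpha> k G s)"
  have "G * \<bar>?T\<bar> \<le> G * real k * \<bar>?T\<bar>" using k g by (intro mult_right_mono) (auto simp: mult_le_cancel_left1)
  also have "... = \<bar>G * real k * ?T\<bar>" using g by (simp add: abs_mult)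
  also have "... \<le> sqrt (fact k) + sqrt (fact k) + \<bar>\<theta>\<bar> * (D * sqrt G)"
   using cos_moment_equation[OF g0 sr(1) U(1) mU, of \<theta> \<alpha> k] b[of \<alpha> k s] b[of \<alpha> k r] td by linarith
  also have "... \<le> C * sqrt G"
  proof -
   have "2 * sqrt (fact k) * 1 \<le> 2 * sqrt (fact k) * sqrt G" using g by (intro mult_left_mono) auto
   then show ?thesis by (simp add: C_def distrib_right mult.assoc)
  qed
  finally have "\<bar>?T\<bar> \<le> C * sqrt G / G" using g0 by (simp add: field_simps)
  also have "... = C / sqrt G" using g0 real_div_sqrt[of G] by (simp add: field_simps)
  finally show ?thesis .
 qed
 moreover have "0 \<le> C" unfolding C_def using D0 by simp
 ultimately show ?thesis by blast
qed

text \<open>What averaging leaves: each order q contributes its squared coefficient times q!, the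
  H_0 part of H_q H_q, divided by its relaxation rate G q.\<close>

definition effective_variance :: "real => real" where
 "effective_variance G = (\<Sum>q=m..p. (coef G q)\<^sup>2 * fact q / (G * real q))"

text \<open>With x = G q each term is \<open>(c q)\<^sup>2\<close> times x / (2(exp(-x) - 1 + x)),
  which tends to half of \<open>(c q)\<^sup>2\<close>; the normalisation of c gives the sum.\<close>

lemma effective_variance_tendsto: "(effective_variance \<longlongrightarrow> 1 / 2) at_top"
proof -
 have l: "((%x::real. x / (2 * (exp (- x) - 1 + x))) \<longlongrightarrow> 1 / 2) at_top" by real_asymp
 have "((%G. (coef G q)\<^sup>2 * fact q / (G * real q)) \<longlongrightarrow> (c q)\<^sup>2 * (1 / 2)) at_top" if q: "q \<in> {m..p}" for q
 proof -
  have q1: "1 \<le> q" using q m_pos by auto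
  have "filterlim (%G. G * real q) at_top at_top"
   using q1 by (intro filterlim_at_top_mult_tendsto_pos[OF tendsto_const _ filterlim_ident, of "real q", simplified mult.commute]) auto
  from tendsto_mult[OF tendsto_const filterlim_compose[OF l this], of "(c q)\<^sup>2"]
  show ?thesis
  proof (rule Lim_transform_eventually)
   show "\<forall>\<^sub>F G in at_top. (c q)\<^sup>2 * (G * real q / (2 * (exp (- (G * real q)) - 1 + G * real q))) = (coef G q)\<^sup>2 * fact q / (G * real q)"
    using eventually_gt_at_top[of 0]
   proof eventually_elim
    case (elim G)
    have nz: "G * real q \<noteq> 0" using elim q1 by simp
    have "(coef G q)\<^sup>2 * fact q / (G * real q) = (c q)\<^sup>2 * ((hermite_amplitude q G)\<^sup>2 * fact q) / (G * real q)"
     by (simp add: coef_def power_mult_distrib)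
    also have "... = (c q)\<^sup>2 * ((G * real q)\<^sup>2 / (2 * (exp (- (G * real q)) - 1 + G * real q))) / (G * real q)"
     unfolding hermite_amplitude_sq(1)[OF elim q1] ..
    also have "... = (c q)\<^sup>2 * (G * real q / (2 * (exp (- (G * real q)) - 1 + G * real q)))"
     using nz by (simp add: power2_eq_square)
    finally show ?case ..
   qed
  qed
 qed
 then have "(effective_variance \<longlongrightarrow> (\<Sum>q=m..p. (c q)\<^sup>2 * (1 / 2))) at_top"
  unfolding effective_variance_def[abs_def] by (rule tendsto_sum)
 moreover have "(\<Sum>q=m..p. (c q)\<^sup>2 * (1 / 2)) = 1 / 2" unfolding sum_distrib_right[symmetric] c_norm by simp
 ultimately show ?thesis by (simp only:)
qed

text \<open>The moment equation is used twice. At order 0 it involves the time averages of orders q;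
  solved for these, it returns order 0 through the H_0 part of H_q H_q, with the phase shifted by pi
  in total, hence with a minus sign. All other averages are O(1/sqrt G).\<close>

lemma cos_moment_self_consistent:
 "\<exists>C\<ge>0. \<forall>G s r U. 1 \<le> G --> s \<le> r --> r \<le> s + 1 --> U \<in> borel_measurable (past s) --> (\<forall>w\<in>space M. \<bar>U w\<bar> \<le> 1) -->
   \<bar>cos_moment U \<theta> \<alpha> 0 G s r - (expectation U * cos \<alpha> - \<theta>\<^sup>2 * effective_variance G * time_integral s r (cos_moment U \<theta> \<alpha> 0 G s))\<bar> \<le> C / sqrt G"
proof -
 obtain K where K: "0 \<le> K" "\<And>G q. 1 \<le> G ==> q \<in> {m..p} ==> \<bar>coef G q\<bar> \<le> K * sqrt G" using coef_bound by blast
 obtain a :: "nat => nat => nat => real" and N where a: "\<And>k q x. hermite k x * hermite q x = (\<Sum>l\<le>N k q. a k q l * hermite l x)"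
  and a0: "\<And>k q. a k q 0 = (if k = q then fact k else 0)"
  using hermite_products by metis
 \<comment> \<open>Packaged as a predicate so that one constant can be chosen for every order
   l.\<close>
 define P where "P l C \<longleftrightarrow> 0 \<le> C \<and> (\<forall>G s r U \<alpha>. 1 \<le> G --> s \<le> r --> r \<le> s + 1 --> U \<in> borel_measurable (past s) --> (\<forall>w\<in>space M. \<bar>U w\<bar> \<le> 1) -->
   \<bar>time_integral s r (cos_moment U \<theta> \<alpha> l G s)\<bar> \<le> C / sqrt G)" for l C
 have "\<exists>C. P l C" if "1 \<le> l" for l unfolding P_def by (rule cos_average_bound[OF that])
 then obtain L where L': "\<And>l. 1 \<le> l ==> P l (L l)" by metis
 have L: "0 \<le> L l" if "1 \<le> l" for l using L'[OF that] by (simp add: P_def)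
 have L2: "\<bar>time_integral s r (cos_moment U \<theta> \<alpha> l G s)\<bar> \<le> L l / sqrt G"
  if "1 \<le> l" "1 \<le> G" "s \<le> r" "r \<le> s + 1" "U \<in> borel_measurable (past s)" "\<forall>w\<in>space M. \<bar>U w\<bar> \<le> 1" for l G s r U \<alpha>
  using L'[OF that(1)] that(2-) by (simp add: P_def)
 define D where "D q = (\<Sum>j=m..p. K * (\<Sum>l=1..N j q. \<bar>a j q l\<bar> * L l))" for q
 have D0: "0 \<le> D q" for q unfolding D_def using L K(1) by (intro sum_nonneg mult_nonneg_nonneg) auto
 define C where "C = (\<Sum>q=m..p. \<bar>\<theta>\<bar> * (K * (2 * sqrt (fact q) + \<bar>\<theta>\<bar> * D q)))"
 have "\<bar>cos_moment U \<theta> \<alpha> 0 G s r - (expectation U * cos \<alpha> - \<theta>\<^sup>2 * effective_variance G * time_integral s r (cos_moment U \<theta> \<alpha> 0 G s))\<bar> \<le> C / sqrt G"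
  if g: "1 \<le> G" and sr: "s \<le> r" "r \<le> s + 1" and U: "U \<in> borel_measurable (past s)" "\<forall>w\<in>space M. \<bar>U w\<bar> \<le> 1" for G s r U
 proof -
  have g0: "0 < G" using g by simp
  have UM: "U \<in> borel_measurable M" by (rule measurable_past_M[OF U(1)])
  have mU: "abs_moments M U" using abs_moments_bounded[OF UM] U(2) by blast
  have b: "\<bar>cos_moment U \<theta> \<beta> l G s u\<bar> \<le> sqrt (fact l)" for \<beta> l u using cos_moment_bound[OF g0 UM] U(2) by blast
  have cv: "continuous_on {s..r} (cos_moment U \<theta> \<beta> l G s)" for \<beta> l by (rule cos_moment_continuous[OF g0 U(1) mU])
  note ci = lborel_integral_Icc_eq_integral(2)[OF cv]
  let ?T = "%\<beta> l. time_integral s r (cos_moment U \<theta> \<beta> l G s)"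
  let ?E = "%\<beta> q. time_integral s r (cos_drift U \<theta> \<beta> q G s)"
  have E: "?E \<beta> q = (\<Sum>j=m..p. coef G j * (\<Sum>l\<le>N j q. a j q l * ?T \<beta> l))" for \<beta> q
  proof -
   have "?E \<beta> q = time_integral s r (%u. \<Sum>j=m..p. coef G j * (\<Sum>l\<le>N j q. a j q l * cos_moment U \<theta> \<beta> l G s u))"
    by (rule time_integral_cong) (rule cos_drift_expand[OF g0 mU a])
   also have "... = (\<Sum>j=m..p. time_integral s r (%u. coef G j * (\<Sum>l\<le>N j q. a j q l * cos_moment U \<theta> \<beta> l G s u)))"
    by (intro time_integral_sum lborel_integral_Icc_eq_integral(2) continuous_on_mult_left continuous_on_sum cv)
   also have "... = (\<Sum>j=m..p. coef G j * (\<Sum>l\<le>N j q. time_integral s r (%u. a j q l * cos_moment U \<theta> \<beta> l G s u)))"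
    unfolding time_integral_cmult[of s r "coef G _"]
    by (intro sum.cong refl arg_cong2[where f="(*)"] time_integral_sum lborel_integral_Icc_eq_integral(2) continuous_on_mult_left cv)
   finally show ?thesis by simp
  qed
  have T0: "?T (\<alpha> + pi / 2 + pi / 2) 0 = - ?T \<alpha> 0"
  proof -
   have eq: "cos_moment U \<theta> (\<alpha> + pi / 2 + pi / 2) 0 G s = (%u. (- 1) * cos_moment U \<theta> \<alpha> 0 G s u)"
   proof
    fix u
    have "cos (\<theta> * x + (\<alpha> + pi / 2 + pi / 2)) = - cos (\<theta> * x + \<alpha>)" for x
     using cos_periodic_pi[of "\<theta> * x + \<alpha>"] by (simp add: add.assoc)
    then show "cos_moment U \<theta> (\<alpha> + pi / 2 + pi / 2) 0 G s u = (- 1) * cos_moment U \<theta> \<alpha> 0 G s u" by (simp add: mixed_moment_def)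
   qed
   show ?thesis unfolding eq time_integral_cmult by simp
  qed
  \<comment> \<open>Order 0 occurs only for j = q and is split off. In the rest, sqrt(G) from a
    coefficient meets 1/sqrt(G) from an average.\<close>
  have Eq: "\<bar>?E (\<alpha> + pi / 2 + pi / 2) q + coef G q * fact q * ?T \<alpha> 0\<bar> \<le> D q" if q: "q \<in> {m..p}" for q
  proof -
   have "?E (\<alpha> + pi / 2 + pi / 2) q = (\<Sum>j=m..p. coef G j * (a j q 0 * - ?T \<alpha> 0) + coef G j * (\<Sum>l=1..N j q. a j q l * ?T (\<alpha> + pi / 2 + pi / 2) l))"
    unfolding E T0[symmetric] by (simp add: atMost_atLeast0 sum.atLeast_Suc_atMost distrib_left)
   also have "... = (\<Sum>j=m..p. if j = q then - (coef G q * fact q * ?T \<alpha> 0) else 0) + (\<Sum>j=m..p. coef G j * (\<Sum>l=1..N j q. a j q l * ?T (\<alpha> + pi / 2 + pi / 2) l))"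
    unfolding sum.distrib by (intro arg_cong2[where f="(+)"] sum.cong refl) (simp add: a0)
   also have "(\<Sum>j=m..p. if j = q then - (coef G q * fact q * ?T \<alpha> 0) else 0) = - (coef G q * fact q * ?T \<alpha> 0)" using q by simp
   finally have "?E (\<alpha> + pi / 2 + pi / 2) q + coef G q * fact q * ?T \<alpha> 0 = (\<Sum>j=m..p. coef G j * (\<Sum>l=1..N j q. a j q l * ?T (\<alpha> + pi / 2 + pi / 2) l))" by simp
   also have "\<bar>...\<bar> \<le> D q"
    unfolding D_def
   proof (rule order_trans[OF sum_abs], intro sum_mono)
    fix j assume j: "j \<in> {m..p}"
    have "\<bar>\<Sum>l=1..N j q. a j q l * ?T (\<alpha> + pi / 2 + pi / 2) l\<bar> \<le> (\<Sum>l=1..N j q. \<bar>a j q l\<bar> * L l) / sqrt G"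
     unfolding sum_divide_distrib
    proof (rule order_trans[OF sum_abs], intro sum_mono)
     fix l assume "l \<in> {1..N j q}"
     then have "\<bar>?T (\<alpha> + pi / 2 + pi / 2) l\<bar> \<le> L l / sqrt G" by (intro L2 g sr U) auto
     from mult_left_mono[OF this abs_ge_zero[of "a j q l"]]
     show "\<bar>a j q l * ?T (\<alpha> + pi / 2 + pi / 2) l\<bar> \<le> \<bar>a j q l\<bar> * L l / sqrt G" by (simp add: abs_mult)
    qed
    then have "\<bar>coef G j * (\<Sum>l=1..N j q. a j q l * ?T (\<alpha> + pi / 2 + pi / 2) l)\<bar> \<le> (K * sqrt G) * ((\<Sum>l=1..N j q. \<bar>a j q l\<bar> * L l) / sqrt G)"
     unfolding abs_mult using K(1) g by (intro mult_mono K(2)[OF g j]) auto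
    then show "\<bar>coef G j * (\<Sum>l=1..N j q. a j q l * ?T (\<alpha> + pi / 2 + pi / 2) l)\<bar> \<le> K * (\<Sum>l=1..N j q. \<bar>a j q l\<bar> * L l)"
     using g0 by simp
   qed
   finally show ?thesis .
  qed
  have v0: "cos_moment U \<theta> \<alpha> 0 G s r = expectation U * cos \<alpha> + \<theta> * (\<Sum>q=m..p. coef G q * ?T (\<alpha> + pi / 2) q)"
  proof -
   have "?E (\<alpha> + pi / 2) 0 = (\<Sum>q=m..p. coef G q * ?T (\<alpha> + pi / 2) q)"
   proof -
    have "?E (\<alpha> + pi / 2) 0 = time_integral s r (%u. \<Sum>q=m..p. coef G q * cos_moment U \<theta> (\<alpha> + pi / 2) q G s u)"
     using cos_drift_expand[OF g0 mU, of 0 "%q l. if l = q then 1 else 0" "%q. q"]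
     by (intro time_integral_cong) (simp add: if_distrib[of "%x. x * _"] cong: if_cong)
    also have "... = (\<Sum>q=m..p. time_integral s r (%u. coef G q * cos_moment U \<theta> (\<alpha> + pi / 2) q G s u))"
     by (intro time_integral_sum lborel_integral_Icc_eq_integral(2) continuous_on_mult_left cv)
    finally show ?thesis by simp
   qed
   moreover have "cos_moment U \<theta> \<alpha> 0 G s s = expectation U * cos \<alpha>" by (simp add: mixed_moment_def)
   ultimately show ?thesis using cos_moment_equation[OF g0 sr(1) U(1) mU, of \<theta> \<alpha> 0] by simp
  qed
  have Tq: "\<bar>\<theta> * (coef G q * ?T (\<alpha> + pi / 2) q) + \<theta>\<^sup>2 * ((coef G q)\<^sup>2 * fact q / (G * real q)) * ?T \<alpha> 0\<bar>
    \<le> \<bar>\<theta>\<bar> * (K * (2 * sqrt (fact q) + \<bar>\<theta>\<bar> * D q)) / sqrt G" if q: "q \<in> {m..p}" for q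
  proof -
   have q1: "1 \<le> q" using q m_pos by auto
   \<comment> \<open>Boundary values and remainder, bounded uniformly in G; a coefficient of size
     sqrt(G) and the division by G q turn this into O(1/sqrt G).\<close>
   define R where "R = cos_moment U \<theta> (\<alpha> + pi / 2) q G s s - cos_moment U \<theta> (\<alpha> + pi / 2) q G s r
    + \<theta> * (?E (\<alpha> + pi / 2 + pi / 2) q + coef G q * fact q * ?T \<alpha> 0)"
   have "\<bar>\<theta> * (?E (\<alpha> + pi / 2 + pi / 2) q + coef G q * fact q * ?T \<alpha> 0)\<bar> \<le> \<bar>\<theta>\<bar> * D q"
    unfolding abs_mult by (rule mult_left_mono[OF Eq[OF q]]) simp
   then have R: "\<bar>R\<bar> \<le> 2 * sqrt (fact q) + \<bar>\<theta>\<bar> * D q"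
    unfolding R_def using b[of "\<alpha> + pi / 2" q s] b[of "\<alpha> + pi / 2" q r] by linarith
   have "G * real q * ?T (\<alpha> + pi / 2) q = R - \<theta> * (coef G q * fact q * ?T \<alpha> 0)"
    unfolding R_def using cos_moment_equation[OF g0 sr(1) U(1) mU, of \<theta> "\<alpha> + pi / 2" q] by (simp add: distrib_left)
   then have "?T (\<alpha> + pi / 2) q = (R - \<theta> * (coef G q * fact q * ?T \<alpha> 0)) / (G * real q)"
    using g0 q1 by (simp add: field_simps)
   then have "\<theta> * (coef G q * ?T (\<alpha> + pi / 2) q) + \<theta>\<^sup>2 * ((coef G q)\<^sup>2 * fact q / (G * real q)) * ?T \<alpha> 0 = \<theta> * (coef G q * R) / (G * real q)"
    by (simp add: diff_divide_distrib power2_eq_square right_diff_distrib)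
   also have "\<bar>...\<bar> \<le> \<bar>\<theta>\<bar> * ((K * sqrt G) * (2 * sqrt (fact q) + \<bar>\<theta>\<bar> * D q)) / G"
   proof -
    have "\<bar>coef G q\<bar> * \<bar>R\<bar> \<le> (K * sqrt G) * (2 * sqrt (fact q) + \<bar>\<theta>\<bar> * D q)"
     using K(1) g0 by (intro mult_mono K(2)[OF g q] R) auto
    moreover have "G \<le> G * real q" using g0 q1 by simp
    ultimately show ?thesis
     using g0 q1 K(1) order_trans[OF abs_ge_zero R] unfolding abs_divide abs_mult
     by (intro frac_le mult_left_mono mult_nonneg_nonneg) (auto intro!: order_trans[OF _ \<open>_ \<le> (K * sqrt G) * _\<close>] mult_nonneg_nonneg)
   qed
   also have "... = \<bar>\<theta>\<bar> * (K * (2 * sqrt (fact q) + \<bar>\<theta>\<bar> * D q)) * (sqrt G / G)" by simp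
   also have "sqrt G / G = 1 / sqrt G" using g0 real_div_sqrt[of G] by (simp add: field_simps)
   finally show ?thesis by simp
  qed
  have "cos_moment U \<theta> \<alpha> 0 G s r - (expectation U * cos \<alpha> - \<theta>\<^sup>2 * effective_variance G * ?T \<alpha> 0)
   = (\<Sum>q=m..p. \<theta> * (coef G q * ?T (\<alpha> + pi / 2) q) + \<theta>\<^sup>2 * ((coef G q)\<^sup>2 * fact q / (G * real q)) * ?T \<alpha> 0)"
   unfolding v0 effective_variance_def sum.distrib sum_distrib_left[symmetric] sum_distrib_right[symmetric] by simp
  also have "\<bar>...\<bar> \<le> C / sqrt G"
   unfolding C_def sum_divide_distrib by (rule order_trans[OF sum_abs], intro sum_mono Tq)
  finally show ?thesis .
 qed
 moreover have "0 \<le> C" unfolding C_def using K(1) D0 by (intro sum_nonneg mult_nonneg_nonneg add_nonneg_nonneg) auto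
 ultimately show ?thesis by blast
qed

text \<open>Replacing the effective variance by its limit 1/2 gives the linear integral equation
  with \<open>\<kappa>\<close> = \<open>\<theta>\<^sup>2 / 2\<close>. The error is uniform in the
  window and in U, so U may later vary with the parameter.\<close>

lemma cos_moment_limit:
 "\<exists>\<epsilon>. (\<epsilon> \<longlongrightarrow> 0) at_top \<and> (\<forall>G s r U. 1 \<le> G --> s \<le> r --> r \<le> s + 1 --> U \<in> borel_measurable (past s) --> (\<forall>w\<in>space M. \<bar>U w\<bar> \<le> 1) -->
   \<bar>expectation (%w. U w * cos (\<theta> * fluct G s r w + \<alpha>)) - expectation U * cos \<alpha> * exp (- (\<theta>\<^sup>2 / 2) * (r - s))\<bar> \<le> \<epsilon> G)"
proof -
 obtain C where C: "0 \<le> C" "\<And>G s r U. 1 \<le> G ==> s \<le> r ==> r \<le> s + 1 ==> U \<in> borel_measurable (past s) ==> \<forall>w\<in>space M. \<bar>U w\<bar> \<le> 1 ==>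
   \<bar>cos_moment U \<theta> \<alpha> 0 G s r - (expectation U * cos \<alpha> - \<theta>\<^sup>2 * effective_variance G * time_integral s r (cos_moment U \<theta> \<alpha> 0 G s))\<bar> \<le> C / sqrt G"
  using cos_moment_self_consistent[of \<theta> \<alpha>] by blast
 define \<delta> where "\<delta> G = C / sqrt G + \<theta>\<^sup>2 * \<bar>effective_variance G - 1 / 2\<bar>" for G
 define K where "K = \<theta>\<^sup>2 / 2 * exp (\<theta>\<^sup>2 / 2) + 1"
 show ?thesis
 proof (intro exI[of _ "%G. K * \<delta> G"] conjI allI impI)
  have "((%G::real. C / sqrt G) \<longlongrightarrow> 0) at_top" by real_asymp
  then have "(\<delta> \<longlongrightarrow> 0 + \<theta>\<^sup>2 * \<bar>1 / 2 - 1 / 2\<bar>) at_top"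
   unfolding \<delta>_def by (intro tendsto_intros effective_variance_tendsto)
  then show "((%G. K * \<delta> G) \<longlongrightarrow> 0) at_top" using tendsto_mult_right_zero by fastforce
  fix G s r :: real and U :: "'a => real" assume g: "1 \<le> G" and sr: "s \<le> r" "r \<le> s + 1" and U: "U \<in> borel_measurable (past s)" "\<forall>w\<in>space M. \<bar>U w\<bar> \<le> 1"
  have g0: "0 < G" using g by simp
  have UM: "U \<in> borel_measurable M" by (rule measurable_past_M[OF U(1)])
  have mU: "abs_moments M U" using abs_moments_bounded[OF UM] U(2) by blast
  let ?v = "cos_moment U \<theta> \<alpha> 0 G s"
  have b: "\<bar>?v u\<bar> \<le> 1" for u using cos_moment_bound[OF g0 UM, of \<theta> \<alpha> 0] U(2) by simp
  have cv: "continuous_on {s..u} ?v" for u by (rule cos_moment_continuous[OF g0 U(1) mU])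
  have "\<bar>?v r - expectation U * cos \<alpha> * exp (- (\<theta>\<^sup>2 / 2) * (r - s))\<bar> \<le> (\<theta>\<^sup>2 / 2 * exp (\<theta>\<^sup>2 / 2) + 1) * \<delta> G"
  proof (rule linear_integral_equation[OF cv _ sr(1) order_refl sr(2)])
   fix u assume u: "u \<in> {s..r}"
   have us: "s \<le> u" "u \<le> s + 1" using u sr by auto
   have "\<bar>time_integral s u ?v\<bar> \<le> 1 * (u - s)" by (rule abs_time_integral_le_const[OF us(1) b])
   then have T: "\<bar>time_integral s u ?v\<bar> \<le> 1" by (rule order_trans) (use us in simp)
   have "\<bar>\<theta>\<^sup>2 * (effective_variance G - 1 / 2) * time_integral s u ?v\<bar> \<le> \<theta>\<^sup>2 * \<bar>effective_variance G - 1 / 2\<bar> * 1"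
    unfolding abs_mult by (intro mult_mono T) auto
   moreover have "\<theta>\<^sup>2 * (effective_variance G - 1 / 2) * time_integral s u ?v =
    \<theta>\<^sup>2 * effective_variance G * time_integral s u ?v - \<theta>\<^sup>2 / 2 * integral {s..u} ?v"
    unfolding time_integral_eq_integral[OF cv] by (simp add: algebra_simps)
   ultimately show "\<bar>?v u - (expectation U * cos \<alpha> - \<theta>\<^sup>2 / 2 * integral {s..u} ?v)\<bar> \<le> \<delta> G"
    unfolding \<delta>_def using C(2)[OF g us U] by linarith
  qed simp
  then show "\<bar>expectation (%w. U w * cos (\<theta> * fluct G s r w + \<alpha>)) - expectation U * cos \<alpha> * exp (- (\<theta>\<^sup>2 / 2) * (r - s))\<bar> \<le> K * \<delta> G"
   by (simp add: K_def mixed_moment_def)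
 qed
qed

end

section \<open>Finite-dimensional limits\<close>

lemma tendsto_uniform_approx:
 fixes f :: "nat => real"
 assumes "\<And>e. 0 < e ==> \<exists>g l. g \<longlonglongrightarrow> l \<and> (\<forall>\<^sub>F i in sequentially. \<bar>f i - g i\<bar> \<le> e) \<and> \<bar>L - l\<bar> \<le> e"
 shows "f \<longlonglongrightarrow> L"
proof (rule tendstoI)
 fix e :: real assume e: "0 < e"
 then obtain g l where g: "g \<longlonglongrightarrow> l" and fg: "\<forall>\<^sub>F i in sequentially. \<bar>f i - g i\<bar> \<le> e / 4" and l: "\<bar>L - l\<bar> \<le> e / 4"
  using assms[of "e / 4"] by auto
 have "\<forall>\<^sub>F i in sequentially. dist (g i) l < e / 4" using tendstoD[OF g, of "e / 4"] e by simp
 with fg show "\<forall>\<^sub>F i in sequentially. dist (f i) L < e"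
  by eventually_elim (use l e in \<open>unfold dist_real_def, linarith\<close>)
qed

context hermite_combination
begin

lemma cos_limit:
 assumes gs: "filterlim Gs at_top sequentially" and sr: "s \<le> r" "r \<le> s + 1"
  and U: "\<And>n. U n \<in> borel_measurable (past s)" "\<And>n w. w \<in> space M ==> 0 \<le> U n w \<and> U n w \<le> 1"
  and lim: "(%n. expectation (U n)) \<longlonglongrightarrow> u"
 shows "(%n. expectation (%w. U n w * cos (\<theta> * fluct (Gs n) s r w + \<alpha>))) \<longlonglongrightarrow> u * cos \<alpha> * exp (- (\<theta>\<^sup>2 / 2) * (r - s))"
proof -
 obtain \<epsilon> where \<epsilon>: "(\<epsilon> \<longlongrightarrow> 0) at_top" and b: "\<And>G U. 1 \<le> G ==> U \<in> borel_measurable (past s) ==> \<forall>w\<in>space M. \<bar>U w\<bar> \<le> 1 ==>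
   \<bar>expectation (%w. U w * cos (\<theta> * fluct G s r w + \<alpha>)) - expectation U * cos \<alpha> * exp (- (\<theta>\<^sup>2 / 2) * (r - s))\<bar> \<le> \<epsilon> G"
  using cos_moment_limit[of \<theta> \<alpha>] sr by blast
 let ?d = "%n. expectation (%w. U n w * cos (\<theta> * fluct (Gs n) s r w + \<alpha>)) - expectation (U n) * cos \<alpha> * exp (- (\<theta>\<^sup>2 / 2) * (r - s))"
 have U1: "\<forall>w\<in>space M. \<bar>U n w\<bar> \<le> 1" for n using U(2)[of _ n] by fastforce
 have "\<forall>\<^sub>F n in sequentially. 1 \<le> Gs n" using gs by (simp add: filterlim_at_top)
 then have "\<forall>\<^sub>F n in sequentially. norm (?d n) \<le> \<epsilon> (Gs n)"
  by eventually_elim (use b[OF _ U(1) U1] in simp)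
 then have "?d \<longlonglongrightarrow> 0" by (rule Lim_null_comparison[OF _ filterlim_compose[OF \<epsilon> gs]])
 from tendsto_add[OF this tendsto_mult_right[OF tendsto_mult_right[OF lim, of "cos \<alpha>"], of "exp (- (\<theta>\<^sup>2 / 2) * (r - s))"]]
 show ?thesis by simp
qed

text \<open>A past event is incorporated by reweighting the measure, which reduces the conditional limit theorem to Levy's theorem.\<close>
lemma tilted_limit:
 assumes gs: "filterlim Gs at_top sequentially" and sr: "s < r" "r \<le> s + 1"
  and U: "\<And>n. U n \<in> borel_measurable (past s)" "\<And>n w. w \<in> space M ==> 0 \<le> U n w \<and> U n w \<le> 1"
  and lim: "(%n. expectation (U n)) \<longlonglongrightarrow> u"
 shows "(%n. expectation (%w. U n w * indicator {a<..b} (fluct (Gs n) s r w) :: real)) \<longlonglongrightarrow> u * expectation (%w. indicator {a<..b} (B r w - B s w))"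
proof -
 have UM[measurable]: "U n \<in> borel_measurable M" for n by (rule measurable_past_M[OF U(1)])
 have iU: "integrable M (U n)" for n by (rule abs_moments_integrable[OF abs_moments_bounded[OF UM, where C=1]]) (use U(2) in auto)
 have le: "0 \<le> expectation (U n)" for n by (rule integral_nonneg_AE) (use U(2) in auto)
 have u0: "0 \<le> u" by (rule LIMSEQ_le_const[OF lim]) (use le in auto)
 \<comment> \<open>A vanishing limit mass u rules out normalisation, but then the expectations are
   squeezed between 0 and those of U n.\<close>
 consider "b \<le> a" | "a < b" "u = 0" | "a < b" "0 < u" using u0 by linarith
 then show ?thesis
 proof cases
  case 1
  then show ?thesis by simp
 next
  case 2
  have "(%n. expectation (%w. U n w * indicator {a<..b} (fluct (Gs n) s r w))) \<longlonglongrightarrow> 0"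
  proof (rule tendsto_sandwich[OF _ _ tendsto_const lim[unfolded 2]])
   show "\<forall>\<^sub>F n in sequentially. 0 \<le> expectation (%w. U n w * indicator {a<..b} (fluct (Gs n) s r w))"
    by (intro always_eventually allI integral_nonneg_AE AE_I2) (use U(2) in auto)
   show "\<forall>\<^sub>F n in sequentially. expectation (%w. U n w * indicator {a<..b} (fluct (Gs n) s r w)) \<le> expectation (U n)"
    by (intro always_eventually allI integral_mono iU integrable_const_bound[where B=1] AE_I2)
      (use U(2) in \<open>auto simp: indicator_def\<close>)
  qed
  then show ?thesis using 2 by simp
 next
  case 3
  define Q where "Q = distr M borel (%w. B r w - B s w)"
  have Q: "real_distribution Q" unfolding Q_def by (rule real_distribution_distr) simp
  interpret Q: real_distribution Q by fact
  have charQ: "char Q t = complex_of_real (exp (- (t\<^sup>2 / 2) * (r - s)))" for t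
  proof -
   have "char Q t = (CLINT w|M. iexp (t * (B r w - B s w)))"
    unfolding char_def Q_def by (subst integral_distr) auto
   also have "... = complex_of_real (exp (- ((t * sqrt (r - s))\<^sup>2) / 2))"
    by (rule expectation_iexp_normal[OF B_increment[OF sr(1)]]) (use sr in simp)
   finally show ?thesis using sr by (simp add: power_mult_distrib)
  qed
  \<comment> \<open>The limit law has no atoms, so distribution functions converge at both endpoints
    of the box.\<close>
  have pQ: "measure Q {x} = 0" for x
  proof -
   have "Q = density lborel (normal_density 0 (sqrt (r - s)))"
    using distributed_distr_eq_density[OF B_increment[OF sr(1)]] unfolding Q_def by (simp cong: distr_cong)
   then have "emeasure Q {x} = (\<integral>\<^sup>+y. ennreal (normal_density 0 (sqrt (r - s)) y) * indicator {x} y \<partial>lborel)"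
    by (simp add: emeasure_density)
   also have "... = (\<integral>\<^sup>+(y::real). 0 \<partial>lborel)" by (rule nn_integral_cong_AE[OF eventually_mono[OF AE_lborel_singleton[of x]]]) auto
   finally show ?thesis by (simp add: measure_def)
  qed
  let ?F = "%n. fluct (Gs n) s r"
  let ?w = "%n w. U n w / expectation (U n)"
  \<comment> \<open>Reweighting requires positive mass, which is guaranteed only eventually; the
    default Q makes every member of the sequence a distribution.\<close>
  define \<nu> where "\<nu> n = (if 0 < expectation (U n) then distr (density M (%w. ennreal (?w n w))) borel (?F n) else Q)" for n
  have pr: "prob_space (density M (%w. ennreal (?w n w)))" if "0 < expectation (U n)" for n
  proof (rule prob_spaceI)
   have "emeasure (density M (%w. ennreal (?w n w))) (space M) = (\<integral>\<^sup>+w. ennreal (?w n w) \<partial>M)"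
    by (subst emeasure_density) (auto intro!: nn_integral_cong)
   also have "... = ennreal (expectation (?w n))"
    by (rule nn_integral_eq_integral) (use iU U(2) that in \<open>auto intro!: divide_nonneg_pos\<close>)
   also have "expectation (?w n) = 1" using that by simp
   finally show "emeasure (density M (%w. ennreal (?w n w))) (space (density M (%w. ennreal (?w n w)))) = 1" by simp
  qed
  have \<nu>: "real_distribution (\<nu> n)" for n
   unfolding \<nu>_def using Q by (auto intro!: prob_space.real_distribution_distr pr)
  have int: "(\<integral>x. f x \<partial>\<nu> n) = (\<integral>w. ?w n w *\<^sub>R f (?F n w) \<partial>M)"
   if "0 < expectation (U n)" "f \<in> borel_measurable borel" for n and f :: "real => 'z::{banach, second_countable_topology}"
   unfolding \<nu>_def using that U(2)
   by (simp add: integral_distr integral_density measurable_compose[OF fluct_measurable] divide_nonneg_pos)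
  have ev: "\<forall>\<^sub>F n in sequentially. 0 < expectation (U n)" using order_tendstoD(1)[OF lim 3(2)] .
  have "(%n. char (\<nu> n) t) \<longlonglongrightarrow> char Q t" for t
  proof (rule Lim_transform_eventually)
   let ?c = "%\<alpha> n. expectation (%w. U n w * cos (t * ?F n w + \<alpha>)) / expectation (U n)"
   have "(%n. complex_of_real (?c 0 n) + \<i> * complex_of_real (?c (- pi / 2) n)) \<longlonglongrightarrow>
     complex_of_real (u * cos 0 * exp (- (t\<^sup>2 / 2) * (r - s)) / u) + \<i> * complex_of_real (u * cos (- pi / 2) * exp (- (t\<^sup>2 / 2) * (r - s)) / u)"
    using 3 sr by (intro tendsto_intros cos_limit[OF gs _ _ U lim] lim) auto
   then show "(%n. complex_of_real (?c 0 n) + \<i> * complex_of_real (?c (- pi / 2) n)) \<longlonglongrightarrow> char Q t"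
    using 3 by (simp add: charQ)
   show "\<forall>\<^sub>F n in sequentially. complex_of_real (?c 0 n) + \<i> * complex_of_real (?c (- pi / 2) n) = char (\<nu> n) t"
    using ev
   proof eventually_elim
    case (elim n)
    have i: "integrable M (%w. U n w * cos (t * ?F n w + \<alpha>) / expectation (U n))" for \<alpha>
    proof -
     have "integrable M (%w. U n w * cos (t * ?F n w + \<alpha>))"
     proof (rule Bochner_Integration.integrable_bound[OF iU[of n]])
      show "AE w in M. norm (U n w * cos (t * ?F n w + \<alpha>)) \<le> norm (U n w)"
       by (intro AE_I2) (simp add: abs_mult mult_left_le)
     qed measurable
     then show ?thesis by simp
    qed
    have "cos (x - pi / 2) = sin x" for x :: real by (simp add: cos_diff)
    then have eq: "?w n w *\<^sub>R iexp (t * ?F n w) =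
     complex_of_real (U n w * cos (t * ?F n w + 0) / expectation (U n)) + \<i> * complex_of_real (U n w * cos (t * ?F n w + - pi / 2) / expectation (U n))" for w
     by (simp add: complex_eq_iff Re_exp Im_exp)
    have "char (\<nu> n) t = (CLINT w|M. ?w n w *\<^sub>R iexp (t * ?F n w))"
     unfolding char_def by (rule int[OF elim]) simp
    also have "... = complex_of_real (expectation (%w. U n w * cos (t * ?F n w + 0) / expectation (U n)))
     + \<i> * complex_of_real (expectation (%w. U n w * cos (t * ?F n w + - pi / 2) / expectation (U n)))"
     unfolding eq using i[of 0] i[of "- pi / 2"]
     by (subst Bochner_Integration.integral_add) (auto intro!: integrable_mult_right simp del: of_real_divide of_real_mult)
    finally show ?case by simp
   qed
  qed
  from levy_continuity[OF \<nu> Q this]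
  have "(%n. cdf (\<nu> n) x) \<longlonglongrightarrow> cdf Q x" for x
   using pQ Q.isCont_cdf by (simp add: weak_conv_m_def weak_conv_def)
  from tendsto_mult[OF lim tendsto_diff[OF this[of b] this[of a]]]
  have "(%n. expectation (U n) * (cdf (\<nu> n) b - cdf (\<nu> n) a)) \<longlonglongrightarrow> u * (cdf Q b - cdf Q a)" .
  moreover have "\<forall>\<^sub>F n in sequentially. expectation (U n) * (cdf (\<nu> n) b - cdf (\<nu> n) a) = expectation (%w. U n w * indicator {a<..b} (?F n w))"
   using ev
  proof eventually_elim
   case (elim n)
   interpret \<nu>: real_distribution "\<nu> n" by (rule \<nu>)
   have "cdf (\<nu> n) b - cdf (\<nu> n) a = (\<integral>x. indicator {a<..b} x \<partial>\<nu> n)"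
    unfolding \<nu>.cdf_diff_eq[OF 3(1)] by simp
   also have "... = expectation (%w. ?w n w *\<^sub>R indicator {a<..b} (?F n w))" by (rule int[OF elim]) simp
   also have "... = expectation (%w. U n w * indicator {a<..b} (?F n w)) / expectation (U n)" by simp
   finally show ?case using elim by simp
  qed
  moreover have "cdf Q b - cdf Q a = expectation (%w. indicator {a<..b} (B r w - B s w))"
  proof -
   have "cdf Q b - cdf Q a = (\<integral>x. indicator {a<..b} x \<partial>Q)" unfolding Q.cdf_diff_eq[OF 3(1)] by simp
   also have "... = expectation (%w. indicator {a<..b} (B r w - B s w))" unfolding Q_def by (subst integral_distr) auto
   finally show ?thesis .
  qed
  ultimately show ?thesis using Lim_transform_eventually by fastforce
 qed
qed

text \<open>The indicators of the first k increments form a weight from the past of the next one,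
  with known limit mass; the conditional limit then adds one more increment.\<close>

lemma box_limit:
 assumes gs: "filterlim Gs at_top sequentially" and n: "0 < n"
 shows "(%i. expectation (%w. \<Prod>j<k. indicator {a j<..b j} (fluct (Gs i) (real j / real n) (real (Suc j) / real n) w) :: real))
  \<longlonglongrightarrow> (\<Prod>j<k. expectation (%w. indicator {a j<..b j} (B (real (Suc j) / real n) w - B (real j / real n) w)))"
proof (induction k)
 case 0
 then show ?case by (simp add: prob_space)
next
 case (Suc k)
 let ?s = "real k / real n" and ?r = "real (Suc k) / real n"
 have "(%i. expectation (%w. (\<Prod>j<k. indicator {a j<..b j} (fluct (Gs i) (real j / real n) (real (Suc j) / real n) w)) * indicator {a k<..b k} (fluct (Gs i) ?s ?r w) :: real))
  \<longlonglongrightarrow> (\<Prod>j<k. expectation (%w. indicator {a j<..b j} (B (real (Suc j) / real n) w - B (real j / real n) w))) * expectation (%w. indicator {a k<..b k} (B ?r w - B ?s w))"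
 proof (rule tilted_limit[OF gs _ _ _ _ Suc.IH])
  show "?s < ?r" using n by (simp add: divide_strict_right_mono)
  show "?r \<le> ?s + 1" using n by (simp add: field_simps)
  show "(%w. \<Prod>j<k. indicator {a j<..b j} (fluct (Gs i) (real j / real n) (real (Suc j) / real n) w) :: real) \<in> borel_measurable (past ?s)" for i
  proof (rule borel_measurable_prod)
   fix j assume "j \<in> {..<k}"
   then have "real (Suc j) / real n \<le> ?s" by (intro divide_right_mono) auto
   from measurable_past_mono[OF this fluct_past]
   show "(%w. indicator {a j<..b j} (fluct (Gs i) (real j / real n) (real (Suc j) / real n) w) :: real) \<in> borel_measurable (past ?s)"
    by (rule measurable_compose) simp
  qed
  show "\<And>i w. 0 \<le> (\<Prod>j<k. indicator {a j<..b j} (fluct (Gs i) (real j / real n) (real (Suc j) / real n) w) :: real) \<and>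
   (\<Prod>j<k. indicator {a j<..b j} (fluct (Gs i) (real j / real n) (real (Suc j) / real n) w) :: real) \<le> 1"
   by (auto intro!: prod_nonneg prod_le_1 simp: indicator_le_1)
 qed
 then show ?case by simp
qed

end

text \<open>Cells of side 1/m fill the cube with coordinates in (-m, m]. Inside it the Lipschitz
  bound costs L n / m; outside, the bound K is charged to the sum of squares over m^2, which is at
  least 1 there.\<close>

lemma cell_approximation:
 fixes F :: "(nat => real) => real" and x :: "nat => real"
 assumes bd: "\<And>x. \<bar>F x\<bar> \<le> K" and lip: "\<And>x y. \<bar>F x - F y\<bar> \<le> L * (\<Sum>j<n. \<bar>x j - y j\<bar>)" and L: "0 \<le> L" and m: "1 \<le> (m :: nat)"
 defines "I \<equiv> {..<n} \<rightarrow>\<^sub>E {- (int m)\<^sup>2..<(int m)\<^sup>2}"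
 shows "\<bar>F x - (\<Sum>\<kappa>\<in>I. F (%j. real_of_int (\<kappa> j) / real m) *
   (\<Prod>j<n. indicator {real_of_int (\<kappa> j) / real m<..real_of_int (\<kappa> j + 1) / real m} (x j)))\<bar>
  \<le> L * (real n / real m) + K * (\<Sum>j<n. (x j)\<^sup>2) / (real m)\<^sup>2"
  (is "\<bar>F x - ?S\<bar> \<le> _")
proof -
 have K: "0 \<le> K" using bd[of x] by linarith
 \<comment> \<open>Cells are open on the left, hence the index ceiling(m x) - 1.\<close>
 define \<kappa>0 where "\<kappa>0 = restrict (%j. \<lceil>real m * x j\<rceil> - 1) {..<n}"
 have fin: "finite I" unfolding I_def by (intro finite_PiE) auto
 have cell: "x j \<in> {real_of_int i / real m<..real_of_int (i + 1) / real m} \<longleftrightarrow> i = \<lceil>real m * x j\<rceil> - 1" for i j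
 proof -
  have "x j \<in> {real_of_int i / real m<..real_of_int (i + 1) / real m} \<longleftrightarrow> real_of_int i < real m * x j \<and> real m * x j \<le> real_of_int (i + 1)"
   using m by (simp add: field_simps)
  also have "... \<longleftrightarrow> i = \<lceil>real m * x j\<rceil> - 1" by linarith
  finally show ?thesis .
 qed
 have prod: "(\<Prod>j<n. indicator {real_of_int (\<kappa> j) / real m<..real_of_int (\<kappa> j + 1) / real m} (x j) :: real) = (if \<kappa> = \<kappa>0 then 1 else 0)"
  if \<kappa>: "\<kappa> \<in> I" for \<kappa>
 proof (cases "\<kappa> = \<kappa>0")
  case True
  have "indicator {real_of_int (\<kappa> j) / real m<..real_of_int (\<kappa> j + 1) / real m} (x j) = (1 :: real)" if "j < n" for j
   using cell[of j "\<kappa> j"] that True by (simp add: \<kappa>0_def)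
  then show ?thesis using True by simp
 next
  case False
  moreover have "\<kappa> \<in> extensional {..<n}" "\<kappa>0 \<in> extensional {..<n}" using \<kappa> by (simp_all add: I_def \<kappa>0_def PiE_def)
  ultimately obtain j where j: "j < n" "\<kappa> j \<noteq> \<kappa>0 j" using extensionalityI[of \<kappa> "{..<n}" \<kappa>0] by auto
  then have "indicator {real_of_int (\<kappa> j) / real m<..real_of_int (\<kappa> j + 1) / real m} (x j) = (0 :: real)"
   using cell[of j "\<kappa> j"] by (simp add: \<kappa>0_def indicator_def del: greaterThanAtMost_iff)
  then have "(\<Prod>j<n. indicator {real_of_int (\<kappa> j) / real m<..real_of_int (\<kappa> j + 1) / real m} (x j) :: real) = 0"
   using j(1) by (intro prod_zero) auto
  then show ?thesis using False by simp
 qed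
 have S: "?S = (if \<kappa>0 \<in> I then F (%j. real_of_int (\<kappa>0 j) / real m) else 0)"
 proof -
  have "?S = (\<Sum>\<kappa>\<in>I. if \<kappa> = \<kappa>0 then F (%j. real_of_int (\<kappa>0 j) / real m) else 0)"
   by (intro sum.cong refl) (auto simp only: prod mult_1_right mult_zero_right split: if_splits)
  then show ?thesis using fin by simp
 qed
 have nn: "0 \<le> L * (real n / real m)" "0 \<le> K * (\<Sum>j<n. (x j)\<^sup>2) / (real m)\<^sup>2"
  using L K by (auto intro!: divide_nonneg_nonneg mult_nonneg_nonneg sum_nonneg)
 show ?thesis
 proof (cases "\<kappa>0 \<in> I")
  case True
  have "\<bar>x j - real_of_int (\<kappa>0 j) / real m\<bar> \<le> 1 / real m" if "j < n" for j
  proof -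
   have "x j \<in> {real_of_int (\<kappa>0 j) / real m<..real_of_int (\<kappa>0 j + 1) / real m}"
    unfolding cell using that by (simp add: \<kappa>0_def)
   then show ?thesis by (simp add: add_divide_distrib)
  qed
  then have "(\<Sum>j<n. \<bar>x j - real_of_int (\<kappa>0 j) / real m\<bar>) \<le> (\<Sum>j<n. 1 / real m)" by (intro sum_mono) auto
  then have "L * (\<Sum>j<n. \<bar>x j - real_of_int (\<kappa>0 j) / real m\<bar>) \<le> L * (real n / real m)" using L by (intro mult_left_mono) auto
  then have "\<bar>F x - ?S\<bar> \<le> L * (real n / real m)" using lip[of x "%j. real_of_int (\<kappa>0 j) / real m"] True S by simp
  then show ?thesis using nn by linarith
 next
  case False
  then obtain j where j: "j < n" "\<kappa>0 j \<notin> {- (int m)\<^sup>2..<(int m)\<^sup>2}"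
   unfolding I_def \<kappa>0_def by (auto simp: PiE_iff)
  have "real m \<le> \<bar>x j\<bar>"
  proof (rule ccontr)
   assume "\<not> real m \<le> \<bar>x j\<bar>"
   then have x: "- real m < x j" "x j < real m" by linarith+
   have "real m * - real m < real m * x j" "real m * x j < real m * real m" using m by (intro mult_strict_left_mono x; simp)+
   then have "real_of_int (- (int m)\<^sup>2) < real m * x j" "real m * x j \<le> real_of_int ((int m)\<^sup>2)" by (simp_all add: power2_eq_square)
   then have "- (int m)\<^sup>2 < \<lceil>real m * x j\<rceil>" "\<lceil>real m * x j\<rceil> \<le> (int m)\<^sup>2" by (simp_all only: less_ceiling_iff ceiling_le_iff)
   then show False using j by (simp add: \<kappa>0_def)
  qed
  then have "(real m)\<^sup>2 \<le> \<bar>x j\<bar>\<^sup>2" by (intro power_mono) auto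
  also have "\<bar>x j\<bar>\<^sup>2 \<le> (\<Sum>j<n. (x j)\<^sup>2)" using j(1) member_le_sum[of j "{..<n}" "%j. (x j)\<^sup>2"] by simp
  finally have "1 \<le> (\<Sum>j<n. (x j)\<^sup>2) / (real m)\<^sup>2" using m by (simp add: le_divide_eq)
  then have "K * 1 \<le> K * ((\<Sum>j<n. (x j)\<^sup>2) / (real m)\<^sup>2)" using K by (intro mult_left_mono) auto
  then show ?thesis using bd[of x] S False nn by simp
 qed
qed

lemma cell_approximation_expectation:
 fixes F :: "(nat => real) => real" and X :: "nat => 'a => real"
 assumes M: "prob_space M"
  and bd: "\<And>x. \<bar>F x\<bar> \<le> K" and lip: "\<And>x y. \<bar>F x - F y\<bar> \<le> L * (\<Sum>j<n. \<bar>x j - y j\<bar>)" and L: "0 \<le> L" and m: "1 \<le> (m :: nat)"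
  and X: "\<And>j. j < n ==> X j \<in> borel_measurable M" "\<And>j. j < n ==> integrable M (%w. (X j w)\<^sup>2)" "\<And>j. j < n ==> (\<integral>w. (X j w)\<^sup>2 \<partial>M) \<le> C"
  and F: "(%w. F (%j. X j w)) \<in> borel_measurable M"
 defines "I \<equiv> {..<n} \<rightarrow>\<^sub>E {- (int m)\<^sup>2..<(int m)\<^sup>2}"
 shows "\<bar>(\<integral>w. F (%j. X j w) \<partial>M) - (\<Sum>\<kappa>\<in>I. F (%j. real_of_int (\<kappa> j) / real m) *
   (\<integral>w. (\<Prod>j<n. indicator {real_of_int (\<kappa> j) / real m<..real_of_int (\<kappa> j + 1) / real m} (X j w)) \<partial>M))\<bar>
  \<le> L * (real n / real m) + K * (real n * C) / (real m)\<^sup>2"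
proof -
 interpret prob_space M by fact
 let ?P = "%\<kappa> w. (\<Prod>j<n. indicator {real_of_int (\<kappa> j) / real m<..real_of_int (\<kappa> j + 1) / real m} (X j w)) :: real"
 have K: "0 \<le> K" using bd[of "%_. 0"] by linarith
 have mP: "?P \<kappa> \<in> borel_measurable M" for \<kappa> using X(1) by (intro borel_measurable_prod measurable_compose[OF X(1)]) auto
 have iP: "integrable M (?P \<kappa>)" for \<kappa>
  by (rule integrable_const_bound[where B=1]) (use mP in \<open>auto intro!: AE_I2 prod_le_1 simp: indicator_le_1 abs_prod\<close>)
 have iS: "integrable M (%w. \<Sum>\<kappa>\<in>I. F (%j. real_of_int (\<kappa> j) / real m) * ?P \<kappa> w)" using iP by auto
 have iF: "integrable M (%w. F (%j. X j w))" by (rule integrable_const_bound[where B=K]) (use bd F in auto)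
 have iX: "integrable M (%w. L * (real n / real m) + K * (\<Sum>j<n. (X j w)\<^sup>2) / (real m)\<^sup>2)"
  using X(2) by (intro Bochner_Integration.integrable_add integrable_const integrable_divide_zero integrable_mult_right Bochner_Integration.integrable_sum) auto
 have "(\<Sum>\<kappa>\<in>I. F (%j. real_of_int (\<kappa> j) / real m) * expectation (?P \<kappa>)) = expectation (%w. \<Sum>\<kappa>\<in>I. F (%j. real_of_int (\<kappa> j) / real m) * ?P \<kappa> w)"
  using iP by simp
 then have "\<bar>expectation (%w. F (%j. X j w)) - (\<Sum>\<kappa>\<in>I. F (%j. real_of_int (\<kappa> j) / real m) * expectation (?P \<kappa>))\<bar>
  = \<bar>expectation (%w. F (%j. X j w) - (\<Sum>\<kappa>\<in>I. F (%j. real_of_int (\<kappa> j) / real m) * ?P \<kappa> w))\<bar>"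
  using iF iS by simp
 also have "... \<le> expectation (%w. \<bar>F (%j. X j w) - (\<Sum>\<kappa>\<in>I. F (%j. real_of_int (\<kappa> j) / real m) * ?P \<kappa> w)\<bar>)"
  using integral_norm_bound[of M "%w. F (%j. X j w) - (\<Sum>\<kappa>\<in>I. F (%j. real_of_int (\<kappa> j) / real m) * ?P \<kappa> w)"] by simp
 also have "... \<le> expectation (%w. L * (real n / real m) + K * (\<Sum>j<n. (X j w)\<^sup>2) / (real m)\<^sup>2)"
  by (rule integral_mono[OF integrable_abs[OF Bochner_Integration.integrable_diff[OF iF iS]] iX])
    (rule cell_approximation[where F=F and K=K and L=L, OF bd lip L m, folded I_def])
 also have "... = L * (real n / real m) + K * (\<Sum>j<n. expectation (%w. (X j w)\<^sup>2)) / (real m)\<^sup>2"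
 proof -
  have i: "integrable M (%w. \<Sum>j<n. (X j w)\<^sup>2)" by (rule Bochner_Integration.integrable_sum) (use X(2) in auto)
  have "expectation (%w. \<Sum>j<n. (X j w)\<^sup>2) = (\<Sum>j<n. expectation (%w. (X j w)\<^sup>2))"
   by (rule Bochner_Integration.integral_sum) (use X(2) in auto)
  moreover have "expectation (%w. L * (real n / real m) + K * (\<Sum>j<n. (X j w)\<^sup>2) / (real m)\<^sup>2) =
   expectation (%w. L * (real n / real m)) + expectation (%w. K * (\<Sum>j<n. (X j w)\<^sup>2) / (real m)\<^sup>2)"
   by (intro Bochner_Integration.integral_add integrable_const integrable_divide_zero integrable_mult_right i)
  ultimately show ?thesis by (simp add: prob_space)
 qed
 also have "... \<le> L * (real n / real m) + K * (real n * C) / (real m)\<^sup>2"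
  using K sum_bounded_above[of "{..<n}" "%j. expectation (%w. (X j w)\<^sup>2)" C] X(3)
  by (intro add_left_mono divide_right_mono mult_left_mono) auto
 finally show ?thesis .
qed

text \<open>Both expectations are replaced by the same finite combination of box probabilities; the
  common second moment bound C makes the error uniform in i.\<close>

lemma functional_convergence:
 fixes F :: "(nat => real) => real" and X :: "nat => nat => 'a => real" and Y :: "nat => 'b => real"
 assumes M: "prob_space M" and N: "prob_space N"
  and bd: "\<And>x. \<bar>F x\<bar> \<le> K" and lip: "\<And>x y. \<bar>F x - F y\<bar> \<le> L * (\<Sum>j<n. \<bar>x j - y j\<bar>)" and L: "0 \<le> L"
  and box: "\<And>a b. (%i. \<integral>w. (\<Prod>j<n. indicator {a j<..b j} (X i j w) :: real) \<partial>M) \<longlonglongrightarrow> (\<integral>w. (\<Prod>j<n. indicator {a j<..b j} (Y j w)) \<partial>N)"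
  and X: "\<And>i j. j < n ==> X i j \<in> borel_measurable M" "\<And>i j. j < n ==> integrable M (%w. (X i j w)\<^sup>2)" "\<And>i j. j < n ==> (\<integral>w. (X i j w)\<^sup>2 \<partial>M) \<le> C"
  and FX: "\<And>i. (%w. F (%j. X i j w)) \<in> borel_measurable M"
  and Y: "\<And>j. j < n ==> Y j \<in> borel_measurable N" "\<And>j. j < n ==> integrable N (%w. (Y j w)\<^sup>2)" "\<And>j. j < n ==> (\<integral>w. (Y j w)\<^sup>2 \<partial>N) \<le> C"
  and FY: "(%w. F (%j. Y j w)) \<in> borel_measurable N"
 shows "(%i. \<integral>w. F (%j. X i j w) \<partial>M) \<longlonglongrightarrow> (\<integral>w. F (%j. Y j w) \<partial>N)"
proof (rule tendsto_uniform_approx)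
 fix e :: real assume e: "0 < e"
 have "(%m. L * (real n / real m) + K * (real n * C) / (real m)\<^sup>2) \<longlonglongrightarrow> 0" by real_asymp
 then have "\<forall>\<^sub>F m in sequentially. L * (real n / real m) + K * (real n * C) / (real m)\<^sup>2 < e" using e by (rule order_tendstoD)
 then have "\<forall>\<^sub>F m in sequentially. 1 \<le> m \<and> L * (real n / real m) + K * (real n * C) / (real m)\<^sup>2 < e"
  using eventually_ge_at_top[of 1] by eventually_elim auto
 then obtain m :: nat where m: "1 \<le> m" "L * (real n / real m) + K * (real n * C) / (real m)\<^sup>2 < e"
  using eventually_happens'[OF sequentially_bot] by blast
 let ?I = "{..<n} \<rightarrow>\<^sub>E {- (int m)\<^sup>2..<(int m)\<^sup>2}"
 let ?F = "%\<kappa>. F (%j. real_of_int (\<kappa> j) / real m)"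
 let ?C = "%\<kappa> j. {real_of_int (\<kappa> j) / real m<..real_of_int (\<kappa> j + 1) / real m}"
 show "\<exists>g l. g \<longlonglongrightarrow> l \<and> (\<forall>\<^sub>F i in sequentially. \<bar>(\<integral>w. F (%j. X i j w) \<partial>M) - g i\<bar> \<le> e) \<and> \<bar>(\<integral>w. F (%j. Y j w) \<partial>N) - l\<bar> \<le> e"
 proof (intro exI conjI always_eventually allI)
  show "(%i. \<Sum>\<kappa>\<in>?I. ?F \<kappa> * (\<integral>w. (\<Prod>j<n. indicator (?C \<kappa> j) (X i j w)) \<partial>M)) \<longlonglongrightarrow> (\<Sum>\<kappa>\<in>?I. ?F \<kappa> * (\<integral>w. (\<Prod>j<n. indicator (?C \<kappa> j) (Y j w)) \<partial>N))"
   by (intro tendsto_intros box)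
  show "\<bar>(\<integral>w. F (%j. X i j w) \<partial>M) - (\<Sum>\<kappa>\<in>?I. ?F \<kappa> * (\<integral>w. (\<Prod>j<n. indicator (?C \<kappa> j) (X i j w)) \<partial>M))\<bar> \<le> e" for i
   by (rule order_trans[OF cell_approximation_expectation[OF M bd lip L m(1) X FX] less_imp_le[OF m(2)]])
  show "\<bar>(\<integral>w. F (%j. Y j w) \<partial>N) - (\<Sum>\<kappa>\<in>?I. ?F \<kappa> * (\<integral>w. (\<Prod>j<n. indicator (?C \<kappa> j) (Y j w)) \<partial>N))\<bar> \<le> e"
   by (rule order_trans[OF cell_approximation_expectation[OF N bd lip L m(1) Y FY] less_imp_le[OF m(2)]])
 qed
qed

section \<open>Tightness and the limit at infinity\<close>

lemma polygon_cong: "(\<And>k. k \<le> n ==> x k = y k) ==> polygon n x = polygon n y"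
 unfolding polygon_def by (intro sum.cong refl) simp

lemma polygon_measurable:
 assumes "\<And>k. k \<le> n ==> x k \<in> borel_measurable M"
 shows "(%w. polygon n (%k. x k w)) \<in> borel_measurable M"
proof -
 have "(%w k. if k \<le> n then x k w else 0) \<in> borel_measurable M"
 proof (rule measurable_coordinatewise_then_product)
  fix k show "(%w. if k \<le> n then x k w else 0) \<in> borel_measurable M"
   using assms by (cases "k \<le> n") auto
 qed
 from measurable_compose[OF this borel_measurable_continuous_onI[OF continuous_on_polygon[of n]]]
 have "(%w. polygon n (%k. if k \<le> n then x k w else 0)) \<in> borel_measurable M" .
 moreover have "polygon n (%k. if k \<le> n then x k w else 0) = polygon n (%k. x k w)" for w
  by (rule polygon_cong) simp
 ultimately show ?thesis by simp
qed

lemma dist_polygon_partial_sums: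
 assumes n: "0 < n"
 shows "dist (polygon n (%k. \<Sum>j<k. x j)) (polygon n (%k. \<Sum>j<k. y j)) \<le> (\<Sum>j<n. \<bar>x j - y j\<bar>)"
proof (rule dist_polygon_le[OF n])
 fix k assume "k \<le> n"
 have "\<bar>(\<Sum>j<k. x j) - (\<Sum>j<k. y j)\<bar> \<le> (\<Sum>j<k. \<bar>x j - y j\<bar>)" unfolding sum_subtractf[symmetric] by (rule sum_abs)
 also have "... \<le> (\<Sum>j<n. \<bar>x j - y j\<bar>)" using \<open>k \<le> n\<close> by (intro sum_mono2) auto
 finally show "\<bar>(\<Sum>j<k. x j) - (\<Sum>j<k. y j)\<bar> \<le> (\<Sum>j<n. \<bar>x j - y j\<bar>)" .
qed

lemma polygon_dyadic_tendsto:
 assumes f: "continuous_on {0..1} f"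
 shows "(%N. polygon (2 ^ N) (%k. f (real k / real (2 ^ N)))) \<longlonglongrightarrow> path_bc f"
proof -
 have "strict_mono (%N::nat. 2 ^ N - 1 :: nat)"
  by (auto intro!: strict_monoI diff_less_mono power_strict_increasing)
 from LIMSEQ_subseq_LIMSEQ[OF polygon_tendsto[OF f] this] show ?thesis by (simp add: o_def del: of_nat_Suc of_nat_power)
qed

text \<open>Splitting off a deterministic level d lets the maximum over many increments be
  controlled by a sum of fourth powers, whose means are known.\<close>

lemma abs_le_plus_fourth:
 fixes y d :: real assumes "0 < d" shows "\<bar>y\<bar> \<le> d + y ^ 4 / d ^ 3"
proof (cases "\<bar>y\<bar> \<le> d")
 case True
 have "0 \<le> y ^ 4 / d ^ 3" using assms by (intro divide_nonneg_pos) auto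
 then show ?thesis using True by linarith
next
 case False
 then have "d ^ 3 \<le> \<bar>y\<bar> ^ 3" using assms by (intro power_mono) auto
 then have "\<bar>y\<bar> * d ^ 3 \<le> \<bar>y\<bar> * \<bar>y\<bar> ^ 3" by (intro mult_left_mono) auto
 also have "\<bar>y\<bar> * \<bar>y\<bar> ^ 3 = \<bar>y\<bar> ^ 4" by (simp add: eval_nat_numeral)
 also have "... = y ^ 4" by simp
 finally have "\<bar>y\<bar> \<le> y ^ 4 / d ^ 3" using assms by (simp add: pos_le_divide_eq)
 then show ?thesis using assms by linarith
qed

context hermite_combination
begin

lemma fluct_diff:
 assumes w: "good_path w" and g: "0 < G" and st: "0 \<le> s" "s \<le> t"
 shows "fluct G 0 t w = fluct G 0 s w + fluct G s t w"
 unfolding fluct_def using st by (intro time_integral_combine lborel_integral_Icc_eq_integral(2) continuous_on_drift w g)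

lemma fluct_partial_sums:
 assumes w: "good_path w" and g: "0 < G"
 shows "fluct G 0 (real k / real n) w = (\<Sum>j<k. fluct G (real j / real n) (real (Suc j) / real n) w)"
proof (induction k)
 case (Suc k)
 have "fluct G 0 (real (Suc k) / real n) w = fluct G 0 (real k / real n) w + fluct G (real k / real n) (real (Suc k) / real n) w"
  by (rule fluct_diff[OF w g]) (auto intro!: divide_right_mono)
 then show ?case using Suc by simp
qed simp

text \<open>Functionals of paths require continuity everywhere, while the paths of
  \<open>fluct\<close> are known to be continuous only on good paths; a combination of the given
  processes is such a version.\<close>

definition fluct_version :: "real => (real => 'a => real) => bool" where
 "fluct_version G Y \<longleftrightarrow> (\<forall>t\<in>{0..1}. Y t \<in> borel_measurable M) \<and> (\<forall>w\<in>space M. continuous_on {0..1} (%t. Y t w)) \<and>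
   (AE w in M. \<forall>t\<in>{0..1}. Y t w = fluct G 0 t w)"

text \<open>The oscillation over a dyadic level is at most \<open>(9/10)\<^sup>i\<close> plus the fourth powers of the increments
 divided by \<open>(9/10)\<^sup>3\<^sup>i\<close>; both parts are summable over the levels.\<close>
lemma fluct_polygon_approximation:
 "\<exists>T. T \<longlonglongrightarrow> 0 \<and> (\<forall>G Y N. 1 \<le> G --> fluct_version G Y -->
   integrable M (%w. dist (polygon (2 ^ N) (%k. Y (real k / 2 ^ N) w)) (path_bc (%t. Y t w))) \<and>
   expectation (%w. dist (polygon (2 ^ N) (%k. Y (real k / 2 ^ N) w)) (path_bc (%t. Y t w))) \<le> T N)"
proof -
 obtain C where C: "0 \<le> C" "\<And>G s r. 1 \<le> G ==> s \<le> r ==> r \<le> s + 1 ==> expectation (%w. fluct G s r w ^ 4) \<le> C * (r - s)\<^sup>2"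
  using fluct_moments(2) by blast
 \<comment> \<open>500/729 is (1/2)/(9/10)^3: level i has 2^i increments with fourth moments at most
   C 4^(-i), divided by (9/10)^(3i). The factors 10 and 729/229 sum the two geometric
   series.\<close>
 define T where "T N = (9 / 10) ^ N * 10 + C * ((500 / 729) ^ N * (729 / 229))" for N :: nat
 have T: "T \<longlonglongrightarrow> 0" unfolding T_def by real_asymp
 have "integrable M (%w. dist (polygon (2 ^ N) (%k. Y (real k / 2 ^ N) w)) (path_bc (%t. Y t w))) \<and>
   expectation (%w. dist (polygon (2 ^ N) (%k. Y (real k / 2 ^ N) w)) (path_bc (%t. Y t w))) \<le> T N"
  if g: "1 \<le> G" and Y: "fluct_version G Y" for G Y N
 proof -
  have g0: "0 < G" using g by simp
  have Ym: "Y t \<in> borel_measurable M" if "0 \<le> t" "t \<le> 1" for t using Y that by (auto simp: fluct_version_def)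
  have Yc: "continuous_on {0..1} (%t. Y t w)" if "w \<in> space M" for w using Y that by (auto simp: fluct_version_def)
  have YE: "AE w in M. \<forall>t\<in>{0..1}. Y t w = fluct G 0 t w" using Y by (auto simp: fluct_version_def)
  define \<Delta> where "\<Delta> i k w = Y (real (Suc k) / 2 ^ i) w - Y (real k / 2 ^ i) w" for i k w
  define b where "b i w = (9 / 10) ^ i + (\<Sum>k<2 ^ i. \<Delta> i k w ^ 4) / ((9 / 10) ^ i) ^ 3" for i w
  have pt: "0 \<le> real k / 2 ^ i \<and> real (Suc k) / 2 ^ i \<le> 1 \<and> real k / 2 ^ i \<le> real (Suc k) / 2 ^ i" if "k < 2 ^ i" for i k
  proof -
   have "real (Suc k) \<le> real (2 ^ i)" using that by (intro of_nat_mono) simp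
   then show ?thesis by (auto intro!: divide_right_mono)
  qed
  have \<Delta>m: "\<Delta> i k \<in> borel_measurable M" if "k < 2 ^ i" for i k
   unfolding \<Delta>_def[abs_def] using pt[OF that] by (intro borel_measurable_diff Ym) linarith+
  have \<Delta>E: "AE w in M. \<Delta> i k w ^ 4 = fluct G (real k / 2 ^ i) (real (Suc k) / 2 ^ i) w ^ 4" if "k < 2 ^ i" for i k
   using YE AE_good_path
  proof eventually_elim
   case (elim w)
   have p: "0 \<le> real k / 2 ^ i" "real (Suc k) / 2 ^ i \<le> 1" "real k / 2 ^ i \<le> real (Suc k) / 2 ^ i" using pt[OF that] by auto
   have "\<Delta> i k w = fluct G 0 (real (Suc k) / 2 ^ i) w - fluct G 0 (real k / 2 ^ i) w"
    unfolding \<Delta>_def using elim(1) p order_trans[OF p(1,3)] order_trans[OF p(3,2)] by simp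
   then show ?case unfolding fluct_diff[OF elim(2) g0 p(1,3)] by simp
  qed
  have i4: "integrable M (%w. fluct G s t w ^ 4)" for s t
   by (rule abs_moments_integrable[OF abs_moments_power[OF abs_moments_fluct[OF g0]]])
  have \<Delta>i: "integrable M (%w. \<Delta> i k w ^ 4)" if "k < 2 ^ i" for i k
   using i4 integrable_cong_AE[OF borel_measurable_power[OF \<Delta>m[OF that]] borel_measurable_integrable[OF i4] \<Delta>E[OF that]] by blast
  have \<Delta>4: "expectation (%w. \<Delta> i k w ^ 4) \<le> C * (1 / 2 ^ i)\<^sup>2" if "k < 2 ^ i" for i k
  proof -
   have p: "0 \<le> real k / 2 ^ i" "real (Suc k) / 2 ^ i \<le> 1" "real k / 2 ^ i \<le> real (Suc k) / 2 ^ i" using pt[OF that] by auto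
   have "expectation (%w. \<Delta> i k w ^ 4) = expectation (%w. fluct G (real k / 2 ^ i) (real (Suc k) / 2 ^ i) w ^ 4)"
    by (rule integral_cong_AE[OF borel_measurable_power[OF \<Delta>m[OF that]] borel_measurable_integrable[OF i4] \<Delta>E[OF that]])
   also have "... \<le> C * (real (Suc k) / 2 ^ i - real k / 2 ^ i)\<^sup>2" using p by (intro C(2) g) linarith+
   also have "real (Suc k) / 2 ^ i - real k / 2 ^ i = 1 / 2 ^ i" by (simp add: add_divide_distrib)
   finally show ?thesis .
  qed
  have bi: "integrable M (b i)" for i
   unfolding b_def[abs_def]
   by (intro Bochner_Integration.integrable_add integrable_const integrable_divide_zero Bochner_Integration.integrable_sum) (auto intro: \<Delta>i)
  have b0: "0 \<le> b i w" for i w unfolding b_def by (intro add_nonneg_nonneg divide_nonneg_nonneg sum_nonneg) auto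
  have Eb: "expectation (b i) \<le> (9 / 10) ^ i + C * (500 / 729) ^ i" for i
  proof -
   have iS: "integrable M (%w. \<Sum>k<2 ^ i. \<Delta> i k w ^ 4)" by (rule Bochner_Integration.integrable_sum) (auto intro: \<Delta>i)
   have "expectation (b i) = expectation (%w. (9 / 10) ^ i) + expectation (%w. (\<Sum>k<2 ^ i. \<Delta> i k w ^ 4) / ((9 / 10) ^ i) ^ 3)"
    unfolding b_def[abs_def] by (intro Bochner_Integration.integral_add integrable_const integrable_divide_zero iS)
   also have "... = (9 / 10) ^ i + expectation (%w. \<Sum>k<2 ^ i. \<Delta> i k w ^ 4) / ((9 / 10) ^ i) ^ 3"
    by (simp add: prob_space)
   also have "expectation (%w. \<Sum>k<2 ^ i. \<Delta> i k w ^ 4) = (\<Sum>k<2 ^ i. expectation (%w. \<Delta> i k w ^ 4))"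
    by (rule Bochner_Integration.integral_sum) (auto intro: \<Delta>i)
   also have "(9 / 10) ^ i + (\<Sum>k<2 ^ i. expectation (%w. \<Delta> i k w ^ 4)) / ((9 / 10) ^ i) ^ 3
    \<le> (9 / 10) ^ i + (2 ^ i * (C * (1 / 2 ^ i)\<^sup>2)) / ((9 / 10) ^ i) ^ 3"
    using sum_bounded_above[of "{..<2 ^ i}" "%k. expectation (%w. \<Delta> i k w ^ 4)" "C * (1 / 2 ^ i)\<^sup>2"] \<Delta>4
    by (intro add_left_mono divide_right_mono) auto
   also have "(2 ^ i * (C * (1 / 2 ^ i)\<^sup>2)) / ((9 / 10) ^ i) ^ 3 = C * (500 / 729) ^ i"
   proof -
    have 1: "2 ^ i * (1 / 2 ^ i)\<^sup>2 = (1 / 2 :: real) ^ i" by (simp add: power2_eq_square power_divide)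
    have 2: "((9 / 10 :: real) ^ i) ^ 3 = (729 / 1000) ^ i"
     by (simp only: power_mult[symmetric] mult.commute[of i]) (simp only: power_mult, simp add: power3_eq_cube)
    have 3: "(1 / 2 :: real) ^ i / (729 / 1000) ^ i = (500 / 729) ^ i" by (simp only: power_divide[symmetric]) simp
    have "(2 ^ i * (C * (1 / 2 ^ i)\<^sup>2)) / ((9 / 10) ^ i) ^ 3 = C * ((2 ^ i * (1 / 2 ^ i)\<^sup>2) / ((9 / 10) ^ i) ^ 3)" by simp
    then show ?thesis unfolding 1 2 3 .
   qed
   finally show ?thesis .
  qed
  let ?D = "%w. dist (polygon (2 ^ N) (%k. Y (real k / 2 ^ N) w)) (path_bc (%t. Y t w))"
  \<comment> \<open>Bounded continuous functions on the line are not separable, so the distance of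
    two measurable maps is not automatically measurable. It is rewritten as the norm of the path of
    one real process.\<close>
  have mD: "?D \<in> borel_measurable M"
  proof -
   let ?Z = "%t w. apply_bcontfun (polygon (2 ^ N) (%k. Y (real k / 2 ^ N) w)) t - Y t w"
   have Zc: "continuous_on {0..1} (%t. ?Z t w)" if "w \<in> space M" for w
    by (intro continuous_on_diff Yc that continuous_on_apply_bcontfun)
   have "(%w. path_bc (%t. ?Z t w)) \<in> borel_measurable M"
   proof (rule path_bc_measurable[OF _ Zc])
    fix t :: real assume t: "0 \<le> t" "t \<le> 1"
    have "Y (real k / 2 ^ N) \<in> borel_measurable M" if "k \<le> 2 ^ N" for k
    proof -
     have "real k \<le> real (2 ^ N)" using that by (intro of_nat_mono)
     then show ?thesis by (intro Ym) auto
    qed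
    then show "?Z t \<in> borel_measurable M"
     unfolding apply_polygon by (intro borel_measurable_diff borel_measurable_sum borel_measurable_times borel_measurable_const Ym t) auto
   qed
   from measurable_compose[OF this borel_measurable_norm] show ?thesis
   proof (rule measurable_cong[THEN iffD1, rotated])
    fix w assume w: "w \<in> space M"
    have "path_bc (%t. ?Z t w) = polygon (2 ^ N) (%k. Y (real k / 2 ^ N) w) - path_bc (%t. Y t w)"
     by (rule bcontfun_eqI, simp only: apply_path_bc[OF Zc[OF w]] minus_bcontfun.rep_eq apply_path_bc[OF Yc[OF w]]) (simp add: apply_polygon)
    then show "norm (path_bc (%t. ?Z t w)) = ?D w" by (simp add: dist_norm)
   qed
  qed
  have le: "ennreal (?D w) \<le> (\<Sum>i. ennreal (b (N + i) w))" if w: "w \<in> space M" for w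
  proof (rule order_trans[OF dyadic_chaining[OF Yc[OF w]]], intro suminf_le ennreal_leI summableI)
   fix i
   let ?i = "N + i"
   have "\<bar>\<Delta> ?i k w\<bar> \<le> b ?i w" if k: "k < 2 ^ ?i" for k
   proof -
    have "\<bar>\<Delta> ?i k w\<bar> \<le> (9 / 10) ^ ?i + \<Delta> ?i k w ^ 4 / ((9 / 10) ^ ?i) ^ 3" by (rule abs_le_plus_fourth) simp
    also have "... \<le> b ?i w"
     unfolding b_def using k by (intro add_left_mono divide_right_mono member_le_sum) auto
    finally show ?thesis .
   qed
   then show "dyadic_osc (%t. Y t w) ?i \<le> b ?i w"
    unfolding dyadic_osc_def \<Delta>_def by (intro Max.boundedI) (auto simp: lessThan_empty_iff)
  qed
  have "(\<integral>\<^sup>+w. ennreal (?D w) \<partial>M) \<le> (\<integral>\<^sup>+w. (\<Sum>i. ennreal (b (N + i) w)) \<partial>M)" by (rule nn_integral_mono) (rule le)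
  also have "... = (\<Sum>i. \<integral>\<^sup>+w. ennreal (b (N + i) w) \<partial>M)" by (rule nn_integral_suminf) (use bi in auto)
  also have "... = (\<Sum>i. ennreal (expectation (b (N + i))))" by (simp add: nn_integral_eq_integral[OF bi] b0)
  also have "... \<le> (\<Sum>i. ennreal ((9 / 10) ^ (N + i) + C * (500 / 729) ^ (N + i)))"
   by (intro suminf_le ennreal_leI Eb summableI)
  also have "... = ennreal (T N)"
  proof (rule suminf_ennreal_eq)
   have "(%i. (9 / 10) ^ N * (9 / 10) ^ i + C * ((500 / 729) ^ N * (500 / 729) ^ i)) sums ((9 / 10) ^ N * (1 / (1 - 9 / 10)) + C * ((500 / 729) ^ N * (1 / (1 - 500 / 729))) :: real)"
    by (intro sums_add sums_mult geometric_sums) auto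
   then show "(%i. (9 / 10) ^ (N + i) + C * (500 / 729) ^ (N + i)) sums T N" by (simp add: T_def power_add)
  qed (use C(1) in auto)
  finally have nn: "(\<integral>\<^sup>+w. ennreal (?D w) \<partial>M) \<le> ennreal (T N)" .
  have T0: "0 \<le> T N" unfolding T_def using C(1) by simp
  have i: "integrable M ?D"
   by (rule integrableI_bounded[OF mD]) (use le_less_trans[OF nn] in simp)
  have "ennreal (expectation ?D) \<le> ennreal (T N)" using nn nn_integral_eq_integral[OF i] by simp
  then show ?thesis using i T0 by simp
 qed
 then show ?thesis using T by blast
qed

text \<open>Both increments have the same normal density, so expectations on N, where only the unit
  interval is available, can be moved to M.\<close>

lemma brownian_increment_transfer:
 assumes b: "standard_brownian_motion N {0..1} b" and st: "0 \<le> s" "s < t" "t \<le> 1" and f: "f \<in> borel_measurable borel"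
 shows "(\<integral>w. f (b t w - b s w) \<partial>N) = expectation (%w. f (B t w - B s w) :: real)"
  and "integrable N (%w. f (b t w - b s w)) \<longleftrightarrow> integrable M (%w. f (B t w - B s w))"
proof -
 have D: "distributed N lborel (%w. b t w - b s w) (normal_density 0 (sqrt (t - s)))"
  using b st unfolding standard_brownian_motion_def by auto
 have f': "f \<in> borel_measurable lborel" using f by simp
 show "(\<integral>w. f (b t w - b s w) \<partial>N) = expectation (%w. f (B t w - B s w))"
  using distributed_integral[OF D f'] distributed_integral[OF B_increment[OF st(2)] f'] by simp
 show "integrable N (%w. f (b t w - b s w)) \<longleftrightarrow> integrable M (%w. f (B t w - B s w))"
  using distributed_integrable[OF D f'] distributed_integrable[OF B_increment[OF st(2)] f'] by simp
qed

lemma brownian_box_probability: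
 fixes N :: "'b measure"
 assumes b: "standard_brownian_motion N {0..1} b" and n: "0 < n"
 shows "(\<integral>w. (\<Prod>j<n. indicator {u j<..v j} (b (real (Suc j) / real n) w - b (real j / real n) w)) \<partial>N)
  = (\<Prod>j<n. expectation (%w. indicator {u j<..v j} (B (real (Suc j) / real n) w - B (real j / real n) w) :: real))"
proof -
 interpret N: prob_space N using b by (simp add: standard_brownian_motion_def)
 have "strict_mono_on {..n} (%j. real j / real n)" using n by (auto intro!: strict_mono_onI divide_strict_right_mono)
 moreover have "(%j. real j / real n) ` {..n} \<subseteq> {0..1}" using n by auto
 ultimately have "N.indep_vars (%_. borel) (%j w. b (real (Suc j) / real n) w - b (real j / real n) w) {..<n}"
  using b unfolding standard_brownian_motion_def by blast
 then have ind: "N.indep_vars (%_. borel) (%j w. indicator {u j<..v j} (b (real (Suc j) / real n) w - b (real j / real n) w) :: real) {..<n}"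
  by (rule N.indep_vars_compose2) simp
 have pt: "0 \<le> real j / real n" "real j / real n < real (Suc j) / real n" "real (Suc j) / real n \<le> 1" if "j < n" for j
  using that by (auto simp: divide_strict_right_mono)
 have "integrable N (%w. indicator {u j<..v j} (b (real (Suc j) / real n) w - b (real j / real n) w) :: real)" if "j < n" for j
 proof -
  have im: "(indicator {u j<..v j} :: real => real) \<in> borel_measurable borel" by simp
  show ?thesis
   unfolding brownian_increment_transfer(2)[OF b pt[OF that] im]
   by (rule integrable_const_bound[where B=1]) (auto simp: indicator_def)
 qed
 then have "(\<integral>w. (\<Prod>j<n. indicator {u j<..v j} (b (real (Suc j) / real n) w - b (real j / real n) w)) \<partial>N)
  = (\<Prod>j<n. \<integral>w. indicator {u j<..v j} (b (real (Suc j) / real n) w - b (real j / real n) w) \<partial>N :: real)"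
  by (intro N.indep_vars_lebesgue_integral[OF _ ind]) auto
 also have "... = (\<Prod>j<n. expectation (%w. indicator {u j<..v j} (B (real (Suc j) / real n) w - B (real j / real n) w)))"
  by (intro prod.cong refl brownian_increment_transfer(1)[OF b] pt) auto
 finally show ?thesis .
qed

text \<open>For fixed n the polygon is a Lipschitz function of the n increments over the grid, so
  box probabilities and second moments decide.\<close>

lemma polygon_limit:
 fixes N :: "'b measure"
 assumes gs: "filterlim Gs at_top sequentially" "\<And>i. 1 \<le> Gs i" and Y: "\<And>i. fluct_version (Gs i) (Y i)"
  and b: "standard_brownian_motion N {0..1} b" and n: "0 < n" and \<phi>: "bounded_lipschitz \<phi>"
 shows "(%i. expectation (%w. \<phi> (polygon n (%k. Y i (real k / real n) w)))) \<longlonglongrightarrow> (\<integral>w. \<phi> (polygon n (%k. b (real k / real n) w)) \<partial>N)"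
proof -
 have N: "prob_space N" using b by (simp add: standard_brownian_motion_def)
 obtain K L where K: "\<And>x. \<bar>\<phi> x\<bar> \<le> K" and L: "0 \<le> L" "\<And>x y. \<bar>\<phi> x - \<phi> y\<bar> \<le> L * dist x y"
  using \<phi> unfolding bounded_lipschitz_def by blast
 have m\<phi>: "\<phi> \<in> borel_measurable borel" by (rule borel_measurable_continuous_onI[OF bounded_lipschitz_continuous[OF \<phi>]])
 obtain C where C: "0 \<le> C" "\<And>G s r. 1 \<le> G ==> s \<le> r ==> r \<le> s + 1 ==> expectation (%w. (fluct G s r w)\<^sup>2) \<le> C * (r - s)"
  using fluct_moments(1) by blast
 define F where "F d = \<phi> (polygon n (%k. \<Sum>j<k. d j))" for d :: "nat => real"
 have Fm: "(%w. F (%j. X j w)) \<in> borel_measurable P" if "\<And>j. j < n ==> X j \<in> borel_measurable P" for P :: "'c measure" and X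
  unfolding F_def by (rule measurable_compose[OF polygon_measurable m\<phi>]) (auto intro!: borel_measurable_sum that)
 have pt: "0 \<le> real j / real n" "real j / real n < real (Suc j) / real n" "real (Suc j) / real n \<le> 1" if "j < n" for j
  using that by (auto simp: divide_strict_right_mono)
 have pk: "real k / real n \<in> {0..1}" if "k \<le> n" for k using that n by auto
 have bm: "b (real k / real n) \<in> borel_measurable N" if "k \<le> n" for k
  using b pk[OF that] unfolding standard_brownian_motion_def by blast
 let ?X = "%i j. fluct (Gs i) (real j / real n) (real (Suc j) / real n)"
 let ?Z = "%j w. b (real (Suc j) / real n) w - b (real j / real n) w"
 have Zm: "?Z j \<in> borel_measurable N" if "j < n" for j using that by (intro borel_measurable_diff bm) auto
 have g0: "0 < Gs i" for i using gs(2)[of i] by linarith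
 have iB: "integrable M (%w. (B t w - B s w)\<^sup>2)" for s t
  by (rule abs_moments_integrable[OF abs_moments_power[OF abs_moments_increment]])
 have lim: "(%i. expectation (%w. F (%j. ?X i j w))) \<longlonglongrightarrow> (\<integral>w. F (%j. ?Z j w) \<partial>N)"
 proof (rule functional_convergence[where F=F and K=K and L=L and n=n and X="?X" and Y="?Z" and C="max C 1", OF prob_space_axioms N])
  show "\<And>x. \<bar>F x\<bar> \<le> K" unfolding F_def by (rule K)
  show "\<bar>F x - F y\<bar> \<le> L * (\<Sum>j<n. \<bar>x j - y j\<bar>)" for x y
   unfolding F_def by (rule order_trans[OF L(2) mult_left_mono[OF dist_polygon_partial_sums[OF n] L(1)]])
  show "0 \<le> L" by (rule L(1))
  show "(%i. expectation (%w. \<Prod>j<n. indicator {u j<..v j} (?X i j w) :: real)) \<longlonglongrightarrow> (\<integral>w. (\<Prod>j<n. indicator {u j<..v j} (?Z j w)) \<partial>N)" for u v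
   unfolding brownian_box_probability[OF b n] by (rule box_limit[OF gs(1) n])
  show "\<And>i j. ?X i j \<in> borel_measurable M" by simp
  show "\<And>i j. integrable M (%w. (?X i j w)\<^sup>2)"
   by (intro abs_moments_integrable[OF abs_moments_power[OF abs_moments_fluct]] g0)
  show "expectation (%w. (?X i j w)\<^sup>2) \<le> max C 1" if "j < n" for i j
  proof -
   have p: "real j / real n \<le> real (Suc j) / real n" "real (Suc j) / real n \<le> real j / real n + 1" using pt[OF that] by linarith+
   have "expectation (%w. (?X i j w)\<^sup>2) \<le> C * (real (Suc j) / real n - real j / real n)" by (rule C(2)[OF gs(2) p])
   also have "... \<le> C * 1" using p C(1) by (intro mult_left_mono) auto
   finally show ?thesis by simp
  qed
  show "(%w. F (%j. ?X i j w)) \<in> borel_measurable M" for i by (rule Fm) simp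
  show "\<And>j. j < n ==> ?Z j \<in> borel_measurable N" by (rule Zm)
  show "integrable N (%w. (?Z j w)\<^sup>2)" if "j < n" for j
   using brownian_increment_transfer(2)[OF b pt[OF that], of "%x. x\<^sup>2"] iB by simp
  show "(\<integral>w. (?Z j w)\<^sup>2 \<partial>N) \<le> max C 1" if "j < n" for j
  proof -
   have "(\<integral>w. (?Z j w)\<^sup>2 \<partial>N) = \<bar>real (Suc j) / real n - real j / real n\<bar>"
    using brownian_increment_transfer(1)[OF b pt[OF that], of "%x. x\<^sup>2"] expectation_increment_sq by simp
   also have "... \<le> 1" using pt[OF that] by linarith
   finally show ?thesis by simp
  qed
  show "(%w. F (%j. ?Z j w)) \<in> borel_measurable N" by (rule Fm) (rule Zm)
 qed
 have X: "expectation (%w. \<phi> (polygon n (%k. Y i (real k / real n) w))) = expectation (%w. F (%j. ?X i j w))" for i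
 proof (rule integral_cong_AE)
  show "(%w. \<phi> (polygon n (%k. Y i (real k / real n) w))) \<in> borel_measurable M"
   using Y[of i] pk by (intro measurable_compose[OF polygon_measurable m\<phi>]) (auto simp: fluct_version_def)
  show "(%w. F (%j. ?X i j w)) \<in> borel_measurable M" by (rule Fm) simp
  have "AE w in M. \<forall>t\<in>{0..1}. Y i t w = fluct (Gs i) 0 t w" using Y[of i] by (simp add: fluct_version_def)
  with AE_good_path show "AE w in M. \<phi> (polygon n (%k. Y i (real k / real n) w)) = F (%j. ?X i j w)"
  proof eventually_elim
   case (elim w)
   have "polygon n (%k. Y i (real k / real n) w) = polygon n (%k. \<Sum>j<k. ?X i j w)"
    by (rule polygon_cong) (use elim(2) pk fluct_partial_sums[OF elim(1) g0] in simp)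
   then show ?case by (simp add: F_def)
  qed
 qed
 have Z: "(\<integral>w. F (%j. ?Z j w) \<partial>N) = (\<integral>w. \<phi> (polygon n (%k. b (real k / real n) w)) \<partial>N)"
 proof (rule integral_cong_AE)
  show "(%w. F (%j. ?Z j w)) \<in> borel_measurable N" by (rule Fm) (rule Zm)
  show "(%w. \<phi> (polygon n (%k. b (real k / real n) w))) \<in> borel_measurable N"
   by (rule measurable_compose[OF polygon_measurable m\<phi>]) (rule bm)
  \<comment> \<open>Increments determine the polygon once the starting value is 0, which is known
    almost surely.\<close>
  have "AE w in N. b 0 w = 0" using b by (simp add: standard_brownian_motion_def)
  then show "AE w in N. F (%j. ?Z j w) = \<phi> (polygon n (%k. b (real k / real n) w))"
  proof eventually_elim
   case (elim w)
   have "(\<Sum>j<k. ?Z j w) = b (real k / real n) w" for k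
    using sum_lessThan_telescope[of "%j. b (real j / real n) w" k] elim by simp
   then show ?case by (simp add: F_def)
  qed
 qed
 show ?thesis using lim unfolding X Z .
qed

text \<open>Interchange of limits: the polygon error is small uniformly in i by chaining, and small
  for the Brownian path by continuity; at one mesh good for both, the polygons converge.\<close>

lemma fluct_weak_limit:
 fixes N :: "'b measure"
 assumes gs: "filterlim Gs at_top sequentially" "\<And>i. 1 \<le> Gs i" and Y: "\<And>i. fluct_version (Gs i) (Y i)"
  and b: "standard_brownian_motion N {0..1} b" and \<phi>: "bounded_lipschitz \<phi>"
 shows "(%i. expectation (%w. \<phi> (path_bc (%t. Y i t w)))) \<longlonglongrightarrow> (\<integral>w. \<phi> (path_bc (%t. b t w)) \<partial>N)"
proof (rule tendsto_uniform_approx)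
 fix e :: real assume e: "0 < e"
 interpret N: prob_space N using b by (simp add: standard_brownian_motion_def)
 obtain K L where K: "\<And>x. \<bar>\<phi> x\<bar> \<le> K" and L: "0 \<le> L" "\<And>x y. \<bar>\<phi> x - \<phi> y\<bar> \<le> L * dist x y"
  using \<phi> unfolding bounded_lipschitz_def by blast
 have m\<phi>: "\<phi> \<in> borel_measurable borel" by (rule borel_measurable_continuous_onI[OF bounded_lipschitz_continuous[OF \<phi>]])
 obtain T where T: "T \<longlonglongrightarrow> 0" and Ti: "\<And>G Y N. 1 \<le> G ==> fluct_version G Y ==>
   integrable M (%w. dist (polygon (2 ^ N) (%k. Y (real k / 2 ^ N) w)) (path_bc (%t. Y t w)))"
  "\<And>G Y N. 1 \<le> G ==> fluct_version G Y ==>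
   expectation (%w. dist (polygon (2 ^ N) (%k. Y (real k / 2 ^ N) w)) (path_bc (%t. Y t w))) \<le> T N"
  using fluct_polygon_approximation by blast
 have bm: "b t \<in> borel_measurable N" if "0 \<le> t" "t \<le> 1" for t using b that unfolding standard_brownian_motion_def by auto
 have bc: "continuous_on {0..1} (%t. b t w)" if "w \<in> space N" for w using b that unfolding standard_brownian_motion_def by auto
 have pk: "0 \<le> real k / real (2 ^ j)" "real k / real (2 ^ j) \<le> 1" if "k \<le> 2 ^ j" for k j
 proof -
  have "real k \<le> real (2 ^ j)" using that by (intro of_nat_mono)
  then show "0 \<le> real k / real (2 ^ j)" "real k / real (2 ^ j) \<le> 1" by auto
 qed
 let ?P = "%j Y w. polygon (2 ^ j) (%k. Y (real k / real (2 ^ j)) w)"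
 have bP: "?P j b \<in> borel_measurable N" for j by (intro polygon_measurable bm pk)
 have "(%j. \<integral>w. \<phi> (?P j b w) \<partial>N) \<longlonglongrightarrow> (\<integral>w. \<phi> (path_bc (%t. b t w)) \<partial>N)"
 proof (rule integral_dominated_convergence)
  show "integrable N (%_. K)" by simp
  show "AE w in N. (%j. \<phi> (?P j b w)) \<longlonglongrightarrow> \<phi> (path_bc (%t. b t w))"
   by (intro AE_I2 continuous_on_tendsto_compose[OF bounded_lipschitz_continuous[OF \<phi>] polygon_dyadic_tendsto] bc) auto
  show "AE w in N. norm (\<phi> (?P j b w)) \<le> K" for j using K by simp
  show "(%w. \<phi> (path_bc (%t. b t w))) \<in> borel_measurable N"
   by (rule measurable_compose[OF path_bc_measurable[OF bm bc] m\<phi>])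
  show "(%w. \<phi> (?P j b w)) \<in> borel_measurable N" for j by (rule measurable_compose[OF bP m\<phi>])
 qed
 then have "\<forall>\<^sub>F j in sequentially. dist (\<integral>w. \<phi> (?P j b w) \<partial>N) (\<integral>w. \<phi> (path_bc (%t. b t w)) \<partial>N) < e"
  using e by (rule tendstoD)
 moreover have "\<forall>\<^sub>F j in sequentially. L * T j < e"
  using tendsto_mult_right_zero[OF T, of L] e by (rule order_tendstoD)
 ultimately have "\<forall>\<^sub>F j in sequentially. dist (\<integral>w. \<phi> (?P j b w) \<partial>N) (\<integral>w. \<phi> (path_bc (%t. b t w)) \<partial>N) < e \<and> L * T j < e"
  by (rule eventually_conj)
 then obtain j where j: "dist (\<integral>w. \<phi> (?P j b w) \<partial>N) (\<integral>w. \<phi> (path_bc (%t. b t w)) \<partial>N) < e" "L * T j < e"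
  using eventually_happens'[OF sequentially_bot] by blast
 show "\<exists>g l. g \<longlonglongrightarrow> l \<and> (\<forall>\<^sub>F i in sequentially. \<bar>expectation (%w. \<phi> (path_bc (%t. Y i t w))) - g i\<bar> \<le> e)
  \<and> \<bar>(\<integral>w. \<phi> (path_bc (%t. b t w)) \<partial>N) - l\<bar> \<le> e"
 proof (intro exI conjI always_eventually allI)
  show "(%i. expectation (%w. \<phi> (?P j (Y i) w))) \<longlonglongrightarrow> (\<integral>w. \<phi> (?P j b w) \<partial>N)"
   by (rule polygon_limit[OF gs Y b _ \<phi>]) simp
  show "\<bar>(\<integral>w. \<phi> (path_bc (%t. b t w)) \<partial>N) - (\<integral>w. \<phi> (?P j b w) \<partial>N)\<bar> \<le> e"
   using j(1) by (simp add: dist_real_def abs_minus_commute)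
  fix i
  have Ym: "Y i t \<in> borel_measurable M" if "0 \<le> t" "t \<le> 1" for t using Y[of i] that by (auto simp: fluct_version_def)
  have Yc: "continuous_on {0..1} (%t. Y i t w)" if "w \<in> space M" for w using Y[of i] that by (auto simp: fluct_version_def)
  have "\<bar>expectation (%w. \<phi> (?P j (Y i) w)) - expectation (%w. \<phi> (path_bc (%t. Y i t w)))\<bar>
   \<le> L * expectation (%w. dist (?P j (Y i) w) (path_bc (%t. Y i t w)))"
  proof (rule expectation_lipschitz_diff[OF prob_space_axioms _ _ K L m\<phi>])
   show "?P j (Y i) \<in> borel_measurable M" by (intro polygon_measurable Ym pk)
   show "(%w. path_bc (%t. Y i t w)) \<in> borel_measurable M" by (rule path_bc_measurable[OF Ym Yc])
   show "integrable M (%w. dist (?P j (Y i) w) (path_bc (%t. Y i t w)))" using Ti(1)[OF gs(2) Y, of j i] by simp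
  qed simp
  also have "... \<le> L * T j" using Ti(2)[OF gs(2) Y, of j i] L(1) by (intro mult_left_mono) auto
  finally show "\<bar>expectation (%w. \<phi> (path_bc (%t. Y i t w))) - expectation (%w. \<phi> (?P j (Y i) w))\<bar> \<le> e"
   using j(2) by (simp add: abs_minus_commute)
 qed
qed

lemma fluct_version_hermite_combination:
 assumes W: "\<And>q. q \<in> {m..p} ==> tempered_hermite_process M B q G (W q)" and g: "0 < G"
 shows "fluct_version G (%t w. \<Sum>q=m..p. c q * W q t w)"
 unfolding fluct_version_def
proof (intro conjI ballI)
 show "\<And>t. t \<in> {0..1} ==> (%w. \<Sum>q=m..p. c q * W q t w) \<in> borel_measurable M"
  "\<And>w. w \<in> space M ==> continuous_on {0..1} (%t. \<Sum>q=m..p. c q * W q t w)"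
  using hermite_combination_process[where c=c and m=m and p=p and G=G and W=W, OF W] by auto
 have "AE w in M. \<forall>q\<in>{m..p}. \<forall>t\<in>{0..1}. W q t w = hermite_amplitude q G * time_integral 0 t (%s. hermite q (OU G s w))"
  by (subst AE_ball_countable) (auto intro!: tempered_hermite_process_representation[OF g] W)
 with AE_good_path show "AE w in M. \<forall>t\<in>{0..1}. (\<Sum>q=m..p. c q * W q t w) = fluct G 0 t w"
 proof eventually_elim
  case (elim w)
  show ?case
  proof
   fix t :: real assume t: "t \<in> {0..1}"
   have "fluct G 0 t w = (\<Sum>q=m..p. time_integral 0 t (%u. coef G q * hermite q (OU G u w)))"
    unfolding fluct_def drift_def
    by (intro time_integral_sum lborel_integral_Icc_eq_integral(2) continuous_intros OU_continuous elim(1) g)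
   then show "(\<Sum>q=m..p. c q * W q t w) = fluct G 0 t w" using elim(2) t by (simp add: coef_def mult.assoc)
  qed
 qed
qed

lemma tempered_hermite_large_gamma:
 fixes N :: "'b measure"
 assumes W: "\<And>q G. 1 \<le> q ==> 0 < G ==> tempered_hermite_process M B q G (W q G)"
  and b: "standard_brownian_motion N {0..1} b"
 shows "process_conv_C01 M (%G t w. \<Sum>q=m..p. c q * W q G t w) N b at_top"
proof (rule process_conv_C01I[OF prob_space_axioms])
 let ?S = "%G t w. \<Sum>q=m..p. c q * W q G t w"
 have v: "fluct_version G (?S G)" if "0 < G" for G
  using m_pos that by (intro fluct_version_hermite_combination W) auto
 show "prob_space N" using b by (simp add: standard_brownian_motion_def)
 show "\<forall>\<^sub>F G in at_top. (\<forall>t\<in>{0..1}. ?S G t \<in> borel_measurable M) \<and> (\<forall>w\<in>space M. continuous_on {0..1} (%t. ?S G t w))"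
  using eventually_gt_at_top[of 0] by eventually_elim (use v in \<open>simp add: fluct_version_def\<close>)
 show "\<And>t. t \<in> {0..1} ==> b t \<in> borel_measurable N" "\<And>w. w \<in> space N ==> continuous_on {0..1} (%t. b t w)"
  using b unfolding standard_brownian_motion_def by auto
 fix \<phi> :: "(real \<Rightarrow>\<^sub>C real) => real" assume \<phi>: "bounded_lipschitz \<phi>"
 let ?f = "%G. expectation (%w. \<phi> (path_bc (%t. ?S G t w)))"
 \<comment> \<open>The bounds are for G >= 1. The maximum with 1 admits arbitrary sequences tending
   to infinity and eventually changes nothing.\<close>
 have "((%G. ?f (max 1 G)) \<longlongrightarrow> (\<integral>w. \<phi> (path_bc (%t. b t w)) \<partial>N)) at_top"
 proof (rule tendsto_at_topI_sequentially)
  fix Gs :: "nat => real" assume "filterlim Gs at_top sequentially"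
  then have "filterlim (%i. max 1 (Gs i)) at_top sequentially"
   by (rule filterlim_at_top_mono) simp
  then show "(%i. ?f (max 1 (Gs i))) \<longlonglongrightarrow> (\<integral>w. \<phi> (path_bc (%t. b t w)) \<partial>N)"
   by (rule fluct_weak_limit[OF _ _ v b \<phi>]) (auto simp: less_max_iff_disj)
 qed
 moreover have "\<forall>\<^sub>F G::real in at_top. ?f (max 1 G) = ?f G"
  using eventually_ge_at_top[of 1] by eventually_elim (simp add: max_absorb2)
 ultimately show "(?f \<longlongrightarrow> (\<integral>w. \<phi> (path_bc (%t. b t w)) \<partial>N)) at_top" by (rule Lim_transform_eventually)
qed

end

theorem theorem6p1:
  fixes M :: "'a measure" and B :: "real \<Rightarrow> 'a \<Rightarrow> real"
    and W :: "nat \<Rightarrow> real \<Rightarrow> real \<Rightarrow> 'a \<Rightarrow> real"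
  assumes B: "standard_brownian_motion M UNIV B"
    and W: "\<And>q \<gamma>. 1 \<le> q \<Longrightarrow> 0 < \<gamma> \<Longrightarrow> tempered_hermite_process M B q \<gamma> (W q \<gamma>)"
  shows
    "(\<forall>q\<ge>1. \<forall>\<gamma>>0. \<forall>\<gamma>s :: nat \<Rightarrow> real. (\<forall>k. 0 < \<gamma>s k) \<and> \<gamma>s \<longlonglongrightarrow> \<gamma> \<longrightarrow>
        process_conv_C01 M (\<lambda>k. W q (\<gamma>s k)) M (W q \<gamma>) sequentially) \<and>
     (\<forall>m p. \<forall>c :: nat \<Rightarrow> real.
        1 \<le> m \<and> m \<le> p \<and> (\<forall>q\<in>{m..p}. 0 \<le> c q) \<and> (\<Sum>q=m..p. (c q)\<^sup>2) = 1 \<longrightarrow>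
        (\<forall>(N :: 'b measure) b. standard_brownian_motion N {0..1} b \<longrightarrow>
           process_conv_C01 M (\<lambda>\<gamma> t \<omega>. \<Sum>q=m..p. c q * W q \<gamma> t \<omega>) N b at_top) \<and>
        (\<forall>(N :: 'c measure) Z. prob_space N \<and> distributed N lborel Z std_normal_density \<longrightarrow>
           process_conv_C01 M (\<lambda>\<gamma> t \<omega>. \<Sum>q=m..p. c q * W q \<gamma> t \<omega>)
             N (\<lambda>t \<omega>. t * (\<Sum>q=m..p. c q * hermite q (Z \<omega>) / sqrt (fact q))) (at_right 0)))"
proof -
 interpret brownian_motion M B by unfold_locales (rule B)
 show ?thesis
 proof (intro conjI allI impI)
  fix q :: nat and \<gamma> :: real and \<gamma>s :: "nat \<Rightarrow> real"
  assume q: "1 \<le> q" and g: "0 < \<gamma>" and gs: "(\<forall>k. 0 < \<gamma>s k) \<and> \<gamma>s \<longlonglongrightarrow> \<gamma>"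
  show "process_conv_C01 M (\<lambda>k. W q (\<gamma>s k)) M (W q \<gamma>) sequentially"
   by (rule tempered_hermite_continuity[where W="W q", OF W[OF q] q g]) (use gs in auto)
 next
  fix m p :: nat and c :: "nat \<Rightarrow> real" and N :: "'b measure" and b
  assume c: "1 \<le> m \<and> m \<le> p \<and> (\<forall>q\<in>{m..p}. 0 \<le> c q) \<and> (\<Sum>q=m..p. (c q)\<^sup>2) = 1"
   and b: "standard_brownian_motion N {0..1} b"
  interpret hermite_combination M B c m p by unfold_locales (use c in auto)
  show "process_conv_C01 M (\<lambda>\<gamma> t \<omega>. \<Sum>q=m..p. c q * W q \<gamma> t \<omega>) N b at_top"
   by (rule tempered_hermite_large_gamma[OF W b])
 next
  fix m p :: nat and c :: "nat \<Rightarrow> real" and N :: "'c measure" and Z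
  assume c: "1 \<le> m \<and> m \<le> p \<and> (\<forall>q\<in>{m..p}. 0 \<le> c q) \<and> (\<Sum>q=m..p. (c q)\<^sup>2) = 1"
   and N: "prob_space N \<and> distributed N lborel Z std_normal_density"
  show "process_conv_C01 M (\<lambda>\<gamma> t \<omega>. \<Sum>q=m..p. c q * W q \<gamma> t \<omega>)
    N (\<lambda>t \<omega>. t * (\<Sum>q=m..p. c q * hermite q (Z \<omega>) / sqrt (fact q))) (at_right 0)"
   by (rule tempered_hermite_small_gamma[where W=W, OF W]) (use c N in auto)
 qed
qed

end
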